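(* Let $X=\mathbf{R}/\mathbf{Z}$ be the standard circle, $K$ its group of isometries and $K^+\simeq\mathrm{SO}(2)$ its group of orientation-preserving isometries. Fix $H\in\{K,K^+\}$. Consider a faithful continuous action of $H$ on $X$ whose image $G$ is contained in $\mathrm{PC}^0_{\mathbf{Proj}}(X)$. Then: (1) $G$ preserves a unique compatible projective structure $\pi$ on $X$. (2) $\pi$ is $\mathcal{C}^1$-compatible if $G$ consists of $\mathcal{C}^1$-diffeomorphisms. (3) The projectively modeled curve $(X,\pi)$ is isomorphic to $\Omega_r$ for some $r>0$, or to $\Theta_t$ for some $t\ge 1$. (4) The conjugacy class of $G$ among subgroups of $\mathrm{PC}^0_{\mathbf{Proj}}(X)$ is characterized by the isomorphism type of the projectively modeled curve $(X,\pi)$, thus by either the case $\Theta_t$ for $t\ge1$ ("affine case") or $\Omega_r$ for $r>0$ ("metaelliptic case"); one then says that $G$ is of type $\Theta_t$, or of type $\Omega_r$. That is, two such images $G_1,G_2$ (for the same $H$), with invariant compatible structures $\pi_1,\pi_2$, are conjugate in $\mathrm{PC}^0_{\mathbf{Proj}}(X)$ if and only if $(X,\pi_1)$ and $(X,\pi_2)$ are isomorphic. This also characterizes $G$ modulo conjugation by $\mathrm{PC}^{0,+}_{\mathbf{Proj}}(X)$. (5) If $G\subset\mathrm{PC}^1_{\mathbf{Proj}}(X)$, then (among such $G$) this also characterizes the conjugacy class of $G$ modulo the conjugation action of $\mathrm{PC}^1_{\mathbf{Proj}}(X)$, or also of $\mathrm{PC}^{1,+}_{\mathbf{Proj}}(X)$.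 (6) $G$ preserves an affine structure on $X$ if and only if it is of type $\Theta_1$, or if $H=K^+$ and $G$ is of type $\Theta_t$ for some $t>1$. (7) For the corresponding conjugacy classification of the actions of $H$ themselves (rather than of their images), the classification is the same when considered modulo conjugation by $\mathrm{PC}^0_{\mathbf{Proj}}(X)$, or by $\mathrm{PC}^1_{\mathbf{Proj}}(X)$ in the $\mathcal{C}^1$-case: two such actions of $H$ are conjugate by an element of $\mathrm{PC}^0_{\mathbf{Proj}}(X)$ (resp., when their images lie in $\mathrm{PC}^1_{\mathbf{Proj}}(X)$, by an element of $\mathrm{PC}^1_{\mathbf{Proj}}(X)$) if and only if the associated projectively modeled curves $(X,\pi)$ are isomorphic.
   Context: A projective structure on a 1-manifold is given by an atlas of charts valued in open intervals of $\mathbf{P}^1_{\mathbf{R}}$ with changes of charts that are locally restrictions of elements of $\mathrm{PGL}_2(\mathbf{R})$; a projectively modeled curve is a curve endowed with such a structure, and isomorphisms of projectively modeled curves are homeomorphisms that are locally projective in charts. An affine structure is defined likewise with charts in $\mathbf{R}$ and changes of charts locally of the form $x\mapsto ax+b$. The standard projective structure $\pi_0$ on $X=\mathbf{R}/\mathbf{Z}$ has local inverses of $\mathbf{R}\to\mathbf{R}/\mathbf{Z}$ as charts. A homeomorphism between projectively modeled curves is piecewise projective if it is locally projective outside a finite subset. A projective structure $\pi$ on $X$ is compatible if the identity map $(X,\pi_0)\to(X,\pi)$ is piecewise projective, and $\mathcal{C}^1$-compatible if in addition this identity map is of class $\mathcal{C}^1$. $\mathrm{PC}^0_{\mathbf{Proj}}(X)$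 is the group of piecewise projective self-homeomorphisms of $(X,\pi_0)$, $\mathrm{PC}^1_{\mathbf{Proj}}(X)$ is its subgroup of $\mathcal{C}^1$-diffeomorphisms, and the superscript $+$ denotes the subgroups of orientation-preserving elements. A faithful continuous action of $H$ on $X$ is an injective continuous homomorphism $H\to\mathrm{Homeo}(X)$. Model curves: $\Theta_1=\mathbf{R}/\mathbf{Z}$ with its standard structure; for $t>1$, $\Theta_t=\mathbf{R}_{>0}/\langle x\mapsto tx\rangle$. Let $\Sigma_\infty$ be the universal covering of $\mathbf{P}^1_{\mathbf{R}}$, and $(\xi_r)_{r\in\mathbf{R}}$ the one-parameter group of automorphisms of $\Sigma_\infty$ lifting the rotation group $\mathrm{PSO}(2)$, parametrized so that $\xi_1$ generates the deck transformation group of $\Sigma_\infty\to\mathbf{P}^1_{\mathbf{R}}$; for $r>0$, $\Omega_r=\Sigma_\infty/\langle\xi_r\rangle$ (so $\Omega_n$, for a positive integer $n$, is the connected $n$-fold covering of $\mathbf{P}^1_{\mathbf{R}}$).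
   Formalization: In (6), "affine structure" is required to have underlying projective structure compatible with the standard one; without this (6) is false, since every such G is topologically conjugate to isometries and so preserves a pulled-back affine structure, even for type Ω_r. *)

theory Defs
  imports "HOL-Analysis.Analysis" "HOL-Algebra.Bij"
begin

section \<open>Quotients of topological spaces\<close>

definition quotient_topology :: "'a topology \<Rightarrow> ('a \<Rightarrow> 'b) \<Rightarrow> 'b topology" where
  "quotient_topology S q =
     topology (\<lambda>V. V \<subseteq> q ` topspace S \<and> openin S {x \<in> topspace S. q x \<in> V})"

lemma openin_quotient_topology:
  "openin (quotient_topology S q) V \<longleftrightarrow>
     V \<subseteq> q ` topspace S \<and> openin S {x \<in> topspace S. q x \<in> V}"
proof -
  have "istopology (\<lambda>V. V \<subseteq> q ` topspace S \<and> openin S {x \<in> topspace S. q x \<in> V})"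
    unfolding istopology_def
  proof (intro conjI allI impI)
    fix V W
    assume V: "V \<subseteq> q ` topspace S \<and> openin S {x \<in> topspace S. q x \<in> V}"
      and W: "W \<subseteq> q ` topspace S \<and> openin S {x \<in> topspace S. q x \<in> W}"
    have "{x \<in> topspace S. q x \<in> V \<inter> W} =
        {x \<in> topspace S. q x \<in> V} \<inter> {x \<in> topspace S. q x \<in> W}" by auto
    then show "openin S {x \<in> topspace S. q x \<in> V \<inter> W}" using V W by auto
    show "V \<inter> W \<subseteq> q ` topspace S" using V by auto
  next
    fix \<V>
    assume \<V>: "\<forall>V\<in>\<V>. V \<subseteq> q ` topspace S \<and> openin S {x \<in> topspace S. q x \<in> V}"
    have "{x \<in> topspace S. q x \<in> \<Union>\<V>} = (\<Union>V\<in>\<V>. {x \<in> topspace S. q x \<in> V})" by auto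
    then show "openin S {x \<in> topspace S. q x \<in> \<Union>\<V>}" using \<V> by auto
    show "\<Union>\<V> \<subseteq> q ` topspace S" using \<V> by auto
  qed
  then show ?thesis by (simp add: quotient_topology_def)
qed

lemma topspace_quotient_topology: "topspace (quotient_topology S q) = q ` topspace S"
proof (rule subset_antisym)
  show "topspace (quotient_topology S q) \<subseteq> q ` topspace S"
    using openin_quotient_topology openin_topspace by metis
  have "{x \<in> topspace S. q x \<in> q ` topspace S} = topspace S" by auto
  then have "openin (quotient_topology S q) (q ` topspace S)"
    by (simp add: openin_quotient_topology)
  then show "q ` topspace S \<subseteq> topspace (quotient_topology S q)"
    by (rule openin_subset)
qed

lemma quotient_map_quotient_topology: "quotient_map S (quotient_topology S q) q"
  by (auto simp: quotient_map_def topspace_quotient_topology openin_quotient_topology)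

text \<open>The orbit of \<open>x\<close> under the cyclic group generated by the bijection \<open>f\<close>.\<close>

definition cyclic_orbit :: "('a \<Rightarrow> 'a) \<Rightarrow> 'a \<Rightarrow> 'a set" where
  "cyclic_orbit f x = {y. \<exists>n::nat. (f ^^ n) x = y \<or> (f ^^ n) y = x}"


section \<open>Geometric structures on curves\<close>

text \<open>A geometry is a one-dimensional model space together with a group of self-maps of it.
  Charts are made extensional, so that two charts with the same domain and the same values are
  equal; a structure is then a maximal atlas.\<close>

type_synonym 'm geometry = "'m topology \<times> ('m \<Rightarrow> 'm) set"
type_synonym ('a, 'm) chart = "'a set \<times> ('a \<Rightarrow> 'm)"
type_synonym ('a, 'm) curve = "'a topology \<times> ('a, 'm) chart set"

definition open_interval_in :: "'m topology \<Rightarrow> 'm set \<Rightarrow> bool" where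
  "open_interval_in M I \<longleftrightarrow> openin M I \<and> subtopology M I homeomorphic_space euclideanreal"

definition is_chart :: "'m geometry \<Rightarrow> 'a topology \<Rightarrow> ('a, 'm) chart \<Rightarrow> bool" where
  "is_chart \<G> T = (\<lambda>(U, \<phi>). openin T U \<and> \<phi> \<in> extensional U \<and>
     open_interval_in (fst \<G>) (\<phi> ` U) \<and>
     homeomorphic_map (subtopology T U) (subtopology (fst \<G>) (\<phi> ` U)) \<phi>)"

definition chart_change ::
  "'m geometry \<Rightarrow> 'a topology \<Rightarrow> ('a, 'm) chart \<Rightarrow> ('a, 'm) chart \<Rightarrow> bool" where
  "chart_change \<G> T = (\<lambda>(U, \<phi>) (V, \<psi>). \<forall>x \<in> U \<inter> V. \<exists>W. openin T W \<and> x \<in> W \<and> W \<subseteq> U \<inter> V \<and>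
     (\<exists>g \<in> snd \<G>. \<forall>y \<in> W. \<psi> y = g (\<phi> y)))"

definition is_atlas :: "'m geometry \<Rightarrow> 'a topology \<Rightarrow> ('a, 'm) chart set \<Rightarrow> bool" where
  "is_atlas \<G> T A \<longleftrightarrow> (\<forall>c \<in> A. is_chart \<G> T c) \<and> \<Union> (fst ` A) = topspace T \<and>
     (\<forall>c \<in> A. \<forall>c' \<in> A. chart_change \<G> T c c')"

definition structure_of :: "'m geometry \<Rightarrow> 'a topology \<Rightarrow> ('a, 'm) chart set \<Rightarrow> ('a, 'm) chart set" where
  "structure_of \<G> T A = {c. is_chart \<G> T c \<and> (\<forall>c' \<in> A. chart_change \<G> T c c')}"

definition is_structure :: "'m geometry \<Rightarrow> 'a topology \<Rightarrow> ('a, 'm) chart set \<Rightarrow> bool" where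
  "is_structure \<G> T A \<longleftrightarrow> is_atlas \<G> T A \<and> structure_of \<G> T A = A"

definition locally_modeled_at ::
  "'m geometry \<Rightarrow> ('a, 'm) curve \<Rightarrow> ('b, 'm) curve \<Rightarrow> ('a \<Rightarrow> 'b) \<Rightarrow> 'a \<Rightarrow> bool" where
  "locally_modeled_at \<G> = (\<lambda>(T, A) (T', A') f x.
     \<exists>(U, \<phi>) \<in> A. \<exists>(V, \<psi>) \<in> A'. \<exists>W. openin T W \<and> x \<in> W \<and> W \<subseteq> U \<and> f ` W \<subseteq> V \<and>
       (\<exists>g \<in> snd \<G>. \<forall>y \<in> W. \<psi> (f y) = g (\<phi> y)))"

definition curve_iso ::
  "'m geometry \<Rightarrow> ('a, 'm) curve \<Rightarrow> ('b, 'm) curve \<Rightarrow> ('a \<Rightarrow> 'b) \<Rightarrow> bool" where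
  "curve_iso \<G> C C' f \<longleftrightarrow> homeomorphic_map (fst C) (fst C') f \<and>
     (\<forall>x \<in> topspace (fst C). locally_modeled_at \<G> C C' f x)"

definition piecewise_iso ::
  "'m geometry \<Rightarrow> ('a, 'm) curve \<Rightarrow> ('b, 'm) curve \<Rightarrow> ('a \<Rightarrow> 'b) \<Rightarrow> bool" where
  "piecewise_iso \<G> C C' f \<longleftrightarrow> homeomorphic_map (fst C) (fst C') f \<and>
     (\<exists>F. finite F \<and> (\<forall>x \<in> topspace (fst C) - F. locally_modeled_at \<G> C C' f x))"

text \<open>Charts on a quotient of \<open>S\<close>: local inverses of the projection \<open>q\<close>, followed by a local
  homeomorphism \<open>d\<close> from \<open>S\<close> to the model space.\<close>

definition quotient_charts :: "'s topology \<Rightarrow> ('s \<Rightarrow> 'a) \<Rightarrow> ('s \<Rightarrow> 'm) \<Rightarrow> ('a, 'm) chart set" where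
  "quotient_charts S q d =
     {(q ` J, restrict (\<lambda>y. d (the_inv_into J q y)) (q ` J)) | J.
        openin S J \<and> connectedin S J \<and> J \<noteq> {} \<and> inj_on q J \<and> inj_on d J}"

definition quotient_curve ::
  "'m geometry \<Rightarrow> 's topology \<Rightarrow> ('s \<Rightarrow> 'a) \<Rightarrow> ('s \<Rightarrow> 'm) \<Rightarrow> ('a, 'm) curve" where
  "quotient_curve \<G> S q d =
     (quotient_topology S q, structure_of \<G> (quotient_topology S q) (quotient_charts S q d))"


section \<open>Projective and affine geometry\<close>

type_synonym p1 = "(real^2) set"

text \<open>Points of the projective line are the one-dimensional subspaces of the plane.\<close>

definition proj_line :: "p1 topology" where
  "proj_line = quotient_topology (top_of_set (- {0})) (\<lambda>v. span {v})"

definition PGL2 :: "(p1 \<Rightarrow> p1) set" where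
  "PGL2 = {(\<lambda>L. ((*v) A) ` L) | A :: real^2^2. invertible A}"

definition proj_geom :: "p1 geometry" where
  "proj_geom = (proj_line, PGL2)"

definition affine_geom :: "real geometry" where
  "affine_geom = (euclideanreal, {(\<lambda>x. a * x + b) | a b. a \<noteq> 0})"

definition affine_embed :: "real \<Rightarrow> p1" where
  "affine_embed x = span {vector [x, 1]}"

text \<open>The projective structure underlying an affine structure.\<close>

definition proj_of_affine :: "'a topology \<Rightarrow> ('a, real) chart set \<Rightarrow> ('a, p1) chart set" where
  "proj_of_affine T A = structure_of proj_geom T
     {(U, restrict (\<lambda>y. affine_embed (\<phi> y)) U) | U \<phi>. (U, \<phi>) \<in> A}"

text \<open>Class \<open>C\<^sup>1\<close> is tested in projective charts that avoid the point at infinity, read as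
  real-valued charts through \<^const>\<open>affine_embed\<close>; every point has such charts, because
  structures are maximal and \<open>PGL\<^sub>2\<close> is transitive on the projective line.\<close>

definition C1_map :: "('a, p1) curve \<Rightarrow> ('b, p1) curve \<Rightarrow> ('a \<Rightarrow> 'b) \<Rightarrow> bool" where
  "C1_map = (\<lambda>(T, A) (T', A') f. \<forall>x \<in> topspace T. \<exists>(U, \<phi>) \<in> A. \<exists>(V, \<psi>) \<in> A'.
     x \<in> U \<and> f ` U \<subseteq> V \<and> \<phi> ` U \<subseteq> range affine_embed \<and> \<psi> ` V \<subseteq> range affine_embed \<and>
     (\<lambda>s. the_inv affine_embed (\<psi> (f (the_inv_into U \<phi> (affine_embed s)))))
       C1_differentiable_on (affine_embed -` (\<phi> ` U)))"


section \<open>Model curves\<close>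

definition circle_proj :: "real \<Rightarrow> real set" where
  "circle_proj = cyclic_orbit (\<lambda>x. x + 1)"

definition Theta :: "real \<Rightarrow> (real set, p1) curve" where
  "Theta t = (if t = 1 then quotient_curve proj_geom euclideanreal circle_proj affine_embed
     else quotient_curve proj_geom (top_of_set {0<..}) (cyclic_orbit (\<lambda>x. t * x)) affine_embed)"

text \<open>The universal covering of the projective line is realized on the real line, by the map
  \<open>x \<mapsto> [cos \<pi>x : sin \<pi>x]\<close>. Translation by \<open>r\<close> lifts the rotation of angle \<open>\<pi>r\<close>, and translation
  by \<open>1\<close> generates the deck transformation group.\<close>

definition universal_cover :: "real \<Rightarrow> p1" where
  "universal_cover x = span {vector [cos (pi * x), sin (pi * x)]}"

definition xi :: "real \<Rightarrow> real \<Rightarrow> real" where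
  "xi r x = x + r"

lemma universal_cover_xi:
  "universal_cover (xi r x) =
     ((*v) (vector [vector [cos (pi * r), - sin (pi * r)],
                    vector [sin (pi * r), cos (pi * r)]] :: real^2^2)) ` universal_cover x"
proof -
  let ?R = "vector [vector [cos (pi * r), - sin (pi * r)],
                    vector [sin (pi * r), cos (pi * r)]] :: real^2^2"
  have "?R *v vector [cos (pi * x), sin (pi * x)] =
      (vector [cos (pi * xi r x), sin (pi * xi r x)] :: real^2)"
    by (simp add: vec_eq_iff forall_2 matrix_vector_mult_def sum_2 xi_def distrib_left
        cos_add sin_add)
  then show ?thesis
    unfolding universal_cover_def
    by (simp add: linear_span_image[OF matrix_vector_mul_linear, symmetric])
qed

lemma universal_cover_eq_iff: "universal_cover x = universal_cover y \<longleftrightarrow> x - y \<in> \<int>"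
proof
  assume eq: "universal_cover x = universal_cover y"
  have "(vector [cos (pi * x), sin (pi * x)] :: real^2) \<in> universal_cover y"
    unfolding eq[symmetric] by (simp add: universal_cover_def span_base)
  then obtain k where k: "vector [cos (pi * x), sin (pi * x)] =
      k *\<^sub>R (vector [cos (pi * y), sin (pi * y)] :: real^2)"
    unfolding universal_cover_def span_singleton by auto
  then have "cos (pi * x) = k * cos (pi * y)" "sin (pi * x) = k * sin (pi * y)"
    by (simp_all add: vec_eq_iff forall_2)
  then have "sin (pi * (x - y)) = 0"
    by (simp add: right_diff_distrib sin_diff)
  then show "x - y \<in> \<int>"
    by (auto simp: sin_zero_iff_int2 Ints_def)
next
  assume "x - y \<in> \<int>"
  then obtain n :: int where n: "x = y + n"
    by (metis Ints_cases add.commute diff_add_cancel)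
  have "cos (pi * x) = (if even n then 1 else - 1) * cos (pi * y)"
      "sin (pi * x) = (if even n then 1 else - 1) * sin (pi * y)"
    by (simp_all add: n distrib_left cos_add sin_add cos_npi_int sin_npi_int)
  then have "vector [cos (pi * x), sin (pi * x)] =
        (vector [cos (pi * y), sin (pi * y)] :: real^2) \<or>
      vector [cos (pi * x), sin (pi * x)] =
        - (vector [cos (pi * y), sin (pi * y)] :: real^2)"
    by (cases "even n") (simp_all add: vec_eq_iff forall_2)
  moreover have "span {- v} = span {v}" for v :: "real^2"
    unfolding span_singleton by (auto intro: range_eqI[of _ _ "- _"])
  ultimately show "universal_cover x = universal_cover y"
    unfolding universal_cover_def by auto
qed

definition Omega :: "real \<Rightarrow> (real set, p1) curve" where
  "Omega r = quotient_curve proj_geom euclideanreal (cyclic_orbit (xi r)) universal_cover"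


section \<open>The circle and its transformation groups\<close>

definition circle :: "real set topology" where
  "circle = quotient_topology euclideanreal circle_proj"

text \<open>The standard projective structure.\<close>

definition pi0 :: "(real set, p1) chart set" where
  "pi0 = structure_of proj_geom circle (quotient_charts euclideanreal circle_proj affine_embed)"

definition homeo_group :: "(real set \<Rightarrow> real set) monoid" where
  "homeo_group = BijGroup (topspace circle)
     \<lparr>carrier := {f \<in> Bij (topspace circle). homeomorphic_map circle circle f}\<rparr>"

text \<open>The compact-open topology.\<close>

definition homeo_topology :: "(real set \<Rightarrow> real set) topology" where
  "homeo_topology = topology_generated_by
     {{f \<in> carrier homeo_group. f ` C \<subseteq> U} | C U. compactin circle C \<and> openin circle U}"

definition orientation_preserving :: "(real set \<Rightarrow> real set) \<Rightarrow> bool" where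
  "orientation_preserving f \<longleftrightarrow>
     (\<exists>F :: real \<Rightarrow> real. continuous_on UNIV F \<and> strict_mono F \<and>
        (\<forall>x. f (circle_proj x) = circle_proj (F x)))"

text \<open>The quotient metric on the circle is the distance of cosets, i.e. \<^const>\<open>setdist\<close>.\<close>

definition isometries :: "(real set \<Rightarrow> real set) set" where
  "isometries = {f \<in> Bij (topspace circle).
     \<forall>x \<in> topspace circle. \<forall>y \<in> topspace circle. setdist (f x) (f y) = setdist x y}"

definition isometries_plus :: "(real set \<Rightarrow> real set) set" where
  "isometries_plus = {f \<in> isometries. orientation_preserving f}"

definition C1_diffeo :: "(real set \<Rightarrow> real set) \<Rightarrow> bool" where
  "C1_diffeo f \<longleftrightarrow> f \<in> carrier homeo_group \<and> C1_map (circle, pi0) (circle, pi0) f \<and>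
     C1_map (circle, pi0) (circle, pi0) (inv\<^bsub>homeo_group\<^esub> f)"

definition PC0 :: "(real set \<Rightarrow> real set) set" where
  "PC0 = {f \<in> carrier homeo_group. piecewise_iso proj_geom (circle, pi0) (circle, pi0) f}"

definition PC0_plus :: "(real set \<Rightarrow> real set) set" where
  "PC0_plus = {f \<in> PC0. orientation_preserving f}"

definition PC1 :: "(real set \<Rightarrow> real set) set" where
  "PC1 = {f \<in> PC0. C1_diffeo f}"

definition PC1_plus :: "(real set \<Rightarrow> real set) set" where
  "PC1_plus = {f \<in> PC1. orientation_preserving f}"

definition faithful_continuous_action ::
  "(real set \<Rightarrow> real set) set \<Rightarrow> ((real set \<Rightarrow> real set) \<Rightarrow> (real set \<Rightarrow> real set)) \<Rightarrow> bool" where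
  "faithful_continuous_action H \<rho> \<longleftrightarrow>
     \<rho> \<in> hom (homeo_group\<lparr>carrier := H\<rparr>) homeo_group \<and> inj_on \<rho> H \<and>
     continuous_map (subtopology homeo_topology H) homeo_topology \<rho>"

definition conjugate_subsets ::
  "(real set \<Rightarrow> real set) set \<Rightarrow> (real set \<Rightarrow> real set) set \<Rightarrow> (real set \<Rightarrow> real set) set \<Rightarrow> bool" where
  "conjugate_subsets P G1 G2 \<longleftrightarrow>
     (\<exists>f \<in> P. G2 = (\<lambda>g. f \<otimes>\<^bsub>homeo_group\<^esub> g \<otimes>\<^bsub>homeo_group\<^esub> inv\<^bsub>homeo_group\<^esub> f) ` G1)"

definition conjugate_actions ::
  "(real set \<Rightarrow> real set) set \<Rightarrow> (real set \<Rightarrow> real set) set \<Rightarrow>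
   ((real set \<Rightarrow> real set) \<Rightarrow> (real set \<Rightarrow> real set)) \<Rightarrow>
   ((real set \<Rightarrow> real set) \<Rightarrow> (real set \<Rightarrow> real set)) \<Rightarrow> bool" where
  "conjugate_actions P H \<rho>1 \<rho>2 \<longleftrightarrow>
     (\<exists>f \<in> P. \<forall>h \<in> H.
        \<rho>2 h = f \<otimes>\<^bsub>homeo_group\<^esub> \<rho>1 h \<otimes>\<^bsub>homeo_group\<^esub> inv\<^bsub>homeo_group\<^esub> f)"


section \<open>Compatible and invariant structures on the circle\<close>

definition compatible :: "(real set, p1) chart set \<Rightarrow> bool" where
  "compatible \<pi> \<longleftrightarrow> is_structure proj_geom circle \<pi> \<and>
     piecewise_iso proj_geom (circle, pi0) (circle, \<pi>) (\<lambda>x. x)"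

definition C1_compatible :: "(real set, p1) chart set \<Rightarrow> bool" where
  "C1_compatible \<pi> \<longleftrightarrow> compatible \<pi> \<and> C1_map (circle, pi0) (circle, \<pi>) (\<lambda>x. x)"

definition preserves ::
  "'m geometry \<Rightarrow> (real set \<Rightarrow> real set) set \<Rightarrow> (real set, 'm) chart set \<Rightarrow> bool" where
  "preserves \<G> G \<pi> \<longleftrightarrow> (\<forall>g \<in> G. curve_iso \<G> (circle, \<pi>) (circle, \<pi>) g)"

definition invariant_compatible ::
  "(real set \<Rightarrow> real set) set \<Rightarrow> (real set, p1) chart set \<Rightarrow> bool" where
  "invariant_compatible G \<pi> \<longleftrightarrow> compatible \<pi> \<and> preserves proj_geom G \<pi>"

text \<open>As in the projective case, the affine structure has to be related to the standard structure
  of the circle: transporting the standard affine structure by a topological conjugacy with the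
  rotations would give an invariant affine structure for every circle action.\<close>

definition preserves_affine_structure :: "(real set \<Rightarrow> real set) set \<Rightarrow> bool" where
  "preserves_affine_structure G \<longleftrightarrow>
     (\<exists>\<alpha>. is_structure affine_geom circle \<alpha> \<and> compatible (proj_of_affine circle \<alpha>) \<and>
        preserves affine_geom G \<alpha>)"

definition isomorphic_curves :: "('a, p1) curve \<Rightarrow> ('b, p1) curve \<Rightarrow> bool" where
  "isomorphic_curves C C' \<longleftrightarrow> (\<exists>f. curve_iso proj_geom C C' f)"

end

theory Submission
  imports Defs
begin

text \<open>The orbit map of a point of the circle is a homeomorphism \<open>F\<close> conjugating the standard action of \<open>H\<close> to the
  given one. Call two points equivalent if the rotation between them, read through \<open>F\<close>, is projective at the first
  one. Every rotation respects this relation up to finitely many points, so there is a cofinite class; spreading a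
  projective chart from that class along the orbit gives the invariant structure, whose developing map \<open>D\<close> satisfies
  \<open>D (x + t) = A t (D x)\<close> with \<open>A t\<close> projective. Such local one-parameter families are generated by one traceless
  matrix \<open>N\<close>, and according to the sign of \<open>det N\<close> the map \<open>D\<close> is projectively equivalent to \<open>x\<close>, to \<open>exp (c * x)\<close>
  or to the universal covering at \<open>r * x\<close>. These normal forms are pairwise distinct and are the models \<open>\<Theta>\<close> and
  \<open>\<Omega>\<close>; two actions with the same normal form are conjugate by \<open>F2 \<circ> F1\<inverse>\<close>.\<close>

section \<open>Curves modeled on a geometry\<close>

text \<open>The projective maps A t come as pointwise choices: nothing makes them depend
  continuously on t, and the finite exceptional set of a rotation may grow without bound as the
  rotation varies. Continuity is used only for coordinate functions on one small interval, and the
  algebra rests on two facts: three points determine a projective map, and an invertible matrix that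
  commutes up to a scalar with one of nonzero trace commutes with it. Exceptional points disappear
  for another reason: rotations are automorphisms and move any given point off a finite set. This
  yields uniqueness of the structure and turns a conjugation in \<open>PC0\<close> into an
  isomorphism. The map F itself need not be piecewise projective for the standard structure, so it
  enters as part of the covering map, while D is normalized to one fixed function per type;
  isomorphism of structures then becomes equality of functions. Every normal form is carried to
  itself by x -> -x up to a projective map. Hence the reflections in K preserve what the rotations
  determine, and the orientation of a conjugator can be corrected.\<close>

definition change_at :: "'m geometry \<Rightarrow> 'a topology \<Rightarrow> ('a, 'm) chart \<Rightarrow> ('a, 'm) chart \<Rightarrow> 'a \<Rightarrow> bool" where
  "change_at \<G> T c c' x \<longleftrightarrow> (\<exists>W. openin T W \<and> x \<in> W \<and> W \<subseteq> fst c \<inter> fst c' \<and>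
     (\<exists>g \<in> snd \<G>. \<forall>y \<in> W. snd c' y = g (snd c y)))"

lemma chart_change_iff: "chart_change \<G> T c c' \<longleftrightarrow> (\<forall>x \<in> fst c \<inter> fst c'. change_at \<G> T c c' x)"
  by (cases c; cases c') (simp add: chart_change_def change_at_def)

lemma change_atI:
  assumes "openin T W" "x \<in> W" "W \<subseteq> fst c" "W \<subseteq> fst c'" "g \<in> snd \<G>" "\<And>y. y \<in> W \<Longrightarrow> snd c' y = g (snd c y)"
  shows "change_at \<G> T c c' x"
  using assms unfolding change_at_def by (intro exI[of _ W] conjI bexI[of _ g] ballI) auto

lemma change_atE:
  assumes "change_at \<G> T c c' x"
  obtains W g where "openin T W" "x \<in> W" "W \<subseteq> fst c" "W \<subseteq> fst c'" "g \<in> snd \<G>" "\<And>y. y \<in> W \<Longrightarrow> snd c' y = g (snd c y)"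
  using assms unfolding change_at_def by auto

lemma atlas_change_at:
  assumes "is_atlas \<G> T A" "c \<in> A" "c' \<in> A" "x \<in> fst c" "x \<in> fst c'"
  shows "change_at \<G> T c c' x"
  using assms unfolding is_atlas_def chart_change_iff by blast

lemma locally_modeled_atI:
  assumes "(U, \<phi>) \<in> A" "(V, \<psi>) \<in> A'" "openin T W" "x \<in> W" "W \<subseteq> U" "f ` W \<subseteq> V"
    "g \<in> snd \<G>" "\<And>y. y \<in> W \<Longrightarrow> \<psi> (f y) = g (\<phi> y)"
  shows "locally_modeled_at \<G> (T, A) (T', A') f x"
  unfolding locally_modeled_at_def prod.case
  apply (rule bexI[OF _ assms(1)], unfold prod.case, rule bexI[OF _ assms(2)], unfold prod.case)
  by (intro exI[of _ W] conjI bexI[of _ g] ballI assms)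

lemma locally_modeled_atE:
  assumes "locally_modeled_at \<G> (T, A) (T', A') f x"
  obtains U \<phi> V \<psi> W g where "(U, \<phi>) \<in> A" "(V, \<psi>) \<in> A'" "openin T W" "x \<in> W" "W \<subseteq> U" "f ` W \<subseteq> V"
    "g \<in> snd \<G>" "\<And>y. y \<in> W \<Longrightarrow> \<psi> (f y) = g (\<phi> y)"
  using assms unfolding locally_modeled_at_def by auto

text \<open>Inverses are required at all elements of the type, not only at points of the model
  space. For \<open>PGL2\<close> this costs nothing, since a matrix acts on arbitrary sets of
  vectors; it lets a change of charts be inverted without tracking where its values lie.\<close>

locale geometry_group =
  fixes \<G> :: "'m geometry"
  assumes id_mem: "(\<lambda>x. x) \<in> snd \<G>"
    and comp_mem: "g \<in> snd \<G> \<Longrightarrow> h \<in> snd \<G> \<Longrightarrow> (\<lambda>x. g (h x)) \<in> snd \<G>"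
    and inv_mem: "g \<in> snd \<G> \<Longrightarrow> \<exists>h \<in> snd \<G>. (\<forall>x. h (g x) = x) \<and> (\<forall>x. g (h x) = x)"
begin

lemma change_at_sym:
  assumes "change_at \<G> T c c' x"
  shows "change_at \<G> T c' c x"
proof -
  obtain W g where W: "openin T W" "x \<in> W" "W \<subseteq> fst c" "W \<subseteq> fst c'" "g \<in> snd \<G>" "\<And>y. y\<in>W \<Longrightarrow> snd c' y = g (snd c y)"
    using assms by (rule change_atE) blast
  then obtain h where h: "h \<in> snd \<G>" "\<forall>x. h (g x) = x" using inv_mem by blast
  show ?thesis by (rule change_atI[OF W(1,2,4,3) h(1)]) (simp add: W(6) h(2))
qed

lemma change_at_trans:
  assumes "change_at \<G> T c1 c2 x" "change_at \<G> T c2 c3 x"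
  shows "change_at \<G> T c1 c3 x"
proof -
  obtain W g where W: "openin T W" "x \<in> W" "W \<subseteq> fst c1" "W \<subseteq> fst c2" "g \<in> snd \<G>" "\<And>y. y\<in>W \<Longrightarrow> snd c2 y = g (snd c1 y)"
    using assms(1) by (rule change_atE) blast
  obtain W' g' where W': "openin T W'" "x \<in> W'" "W' \<subseteq> fst c2" "W' \<subseteq> fst c3" "g' \<in> snd \<G>" "\<And>y. y\<in>W' \<Longrightarrow> snd c3 y = g' (snd c2 y)"
    using assms(2) by (rule change_atE) blast
  show ?thesis
    by (rule change_atI[of T "W \<inter> W'" _ _ _ "\<lambda>x. g' (g x)"]) (use W W' comp_mem in auto)
qed

lemma atlas_chart_at:
  assumes "is_atlas \<G> T A" "x \<in> topspace T"
  obtains U \<phi> where "(U, \<phi>) \<in> A" "x \<in> U" "openin T U"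
proof -
  have "x \<in> \<Union> (fst ` A)" using assms by (simp add: is_atlas_def)
  then obtain c where "c \<in> A" "x \<in> fst c" by auto
  moreover have "is_chart \<G> T c" using assms \<open>c \<in> A\<close> by (simp add: is_atlas_def)
  ultimately show ?thesis using that by (cases c) (auto simp: is_chart_def)
qed

lemma chart_openin: "is_chart \<G> T c \<Longrightarrow> openin T (fst c)"
  by (cases c) (simp add: is_chart_def)

lemma structure_of_change:
  assumes A: "is_atlas \<G> T A" and c: "c \<in> structure_of \<G> T A" "c' \<in> structure_of \<G> T A"
  shows "chart_change \<G> T c c'"
  unfolding chart_change_iff
proof
  fix x assume x: "x \<in> fst c \<inter> fst c'"
  have "is_chart \<G> T c" using c by (simp add: structure_of_def)
  then have "x \<in> topspace T" using chart_openin openin_subset x by blast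
  then obtain U \<phi> where U: "(U, \<phi>) \<in> A" "x \<in> U" by (rule atlas_chart_at[OF A])
  have "chart_change \<G> T c (U, \<phi>)" "chart_change \<G> T c' (U, \<phi>)"
    using c U(1) by (simp_all add: structure_of_def)
  then have "change_at \<G> T c (U, \<phi>) x" "change_at \<G> T c' (U, \<phi>) x"
    using U(2) x unfolding chart_change_iff by simp_all
  then show "change_at \<G> T c c' x"
    by (rule change_at_trans[OF _ change_at_sym])
qed

lemma atlas_subset_structure_of: "is_atlas \<G> T A \<Longrightarrow> A \<subseteq> structure_of \<G> T A"
  by (auto simp: is_atlas_def structure_of_def)

lemma is_atlas_structure_of:
  assumes A: "is_atlas \<G> T A"
  shows "is_atlas \<G> T (structure_of \<G> T A)"
  unfolding is_atlas_def
proof (intro conjI ballI)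
  fix c assume "c \<in> structure_of \<G> T A" then show "is_chart \<G> T c" by (simp add: structure_of_def)
next
  have "fst c \<subseteq> topspace T" if "c \<in> structure_of \<G> T A" for c
    using openin_subset[OF chart_openin[of T c]] that by (simp add: structure_of_def)
  then have "\<Union> (fst ` structure_of \<G> T A) \<subseteq> topspace T" by blast
  moreover have "\<Union> (fst ` A) = topspace T" using A by (simp add: is_atlas_def)
  then have "topspace T \<subseteq> \<Union> (fst ` structure_of \<G> T A)"
    using atlas_subset_structure_of[OF A] by blast
  ultimately show "\<Union> (fst ` structure_of \<G> T A) = topspace T" by blast
next
  fix c c' assume "c \<in> structure_of \<G> T A" "c' \<in> structure_of \<G> T A"
  then show "chart_change \<G> T c c'" by (rule structure_of_change[OF A])
qed

lemma is_structure_structure_of: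
  assumes A: "is_atlas \<G> T A"
  shows "is_structure \<G> T (structure_of \<G> T A)"
proof -
  have "structure_of \<G> T (structure_of \<G> T A) = structure_of \<G> T A"
    using structure_of_change[OF A] atlas_subset_structure_of[OF A]
    by (auto simp: structure_of_def)
  then show ?thesis using is_atlas_structure_of[OF A] by (simp add: is_structure_def)
qed

text \<open>The definition grants one pair of charts only. Changes of charts near x and near f x,
  composed on either side, carry the local form to the prescribed pair.\<close>

lemma locally_modeled_at_any_chart:
  assumes A: "is_atlas \<G> T A" and A': "is_atlas \<G> T' A'" and f: "continuous_map T T' f"
    and lm: "locally_modeled_at \<G> (T, A) (T', A') f x"
    and U: "(U, \<phi>) \<in> A" "x \<in> U" and V: "(V, \<psi>) \<in> A'" "f x \<in> V"
  obtains W g where "openin T W" "x \<in> W" "W \<subseteq> U" "f ` W \<subseteq> V" "g \<in> snd \<G>" "\<And>y. y \<in> W \<Longrightarrow> \<psi> (f y) = g (\<phi> y)"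
proof -
  obtain U0 \<phi>0 V0 \<psi>0 W0 g0 where 0: "(U0, \<phi>0) \<in> A" "(V0, \<psi>0) \<in> A'" "openin T W0" "x \<in> W0" "W0 \<subseteq> U0" "f ` W0 \<subseteq> V0"
      "g0 \<in> snd \<G>" "\<And>y. y\<in>W0 \<Longrightarrow> \<psi>0 (f y) = g0 (\<phi>0 y)"
    using lm by (rule locally_modeled_atE) blast
  have "change_at \<G> T (U, \<phi>) (U0, \<phi>0) x"
    by (rule atlas_change_at[OF A U(1) 0(1)]) (use U 0 in auto)
  then obtain W1 g1 where 1: "openin T W1" "x \<in> W1" "W1 \<subseteq> U" "W1 \<subseteq> U0" "g1 \<in> snd \<G>" "\<And>y. y\<in>W1 \<Longrightarrow> \<phi>0 y = g1 (\<phi> y)"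
    by (rule change_atE) simp
  have "change_at \<G> T' (V0, \<psi>0) (V, \<psi>) (f x)"
    by (rule atlas_change_at[OF A' 0(2) V(1)]) (use V 0 in auto)
  then obtain W2 g2 where 2: "openin T' W2" "f x \<in> W2" "W2 \<subseteq> V0" "W2 \<subseteq> V" "g2 \<in> snd \<G>" "\<And>y. y\<in>W2 \<Longrightarrow> \<psi> y = g2 (\<psi>0 y)"
    by (rule change_atE) simp
  let ?W = "W0 \<inter> W1 \<inter> {y \<in> topspace T. f y \<in> W2}"
  have W: "openin T ?W"
    by (intro openin_Int 0 1 openin_continuous_map_preimage[OF f] 2)
  have gm: "(\<lambda>m. g2 (g0 (g1 m))) \<in> snd \<G>" by (rule comp_mem[OF comp_mem[OF 2(5) 0(7)] 1(5)])
  show ?thesis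
  proof (rule that[OF W _ _ _ gm])
    show "x \<in> ?W" using 0(4) 1(2) 2(2) openin_subset[OF 0(3)] by auto
    show "?W \<subseteq> U" "f ` ?W \<subseteq> V" using 1 2 by auto
    show "\<psi> (f y) = g2 (g0 (g1 (\<phi> y)))" if "y \<in> ?W" for y
      using that by (simp add: 0(8) 1(6) 2(6) flip: 0(8) 1(6))
  qed
qed

lemma locally_modeled_at_comp:
  assumes A': "is_atlas \<G> T' A'" and f: "continuous_map T T' f"
    and lm: "locally_modeled_at \<G> (T, A) (T', A') f x"
    and lm': "locally_modeled_at \<G> (T', A') (T'', A'') f' (f x)"
  shows "locally_modeled_at \<G> (T, A) (T'', A'') (\<lambda>y. f' (f y)) x"
proof -
  obtain U \<phi> V \<psi> W g where 0: "(U, \<phi>) \<in> A" "(V, \<psi>) \<in> A'" "openin T W" "x \<in> W" "W \<subseteq> U" "f ` W \<subseteq> V"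
      "g \<in> snd \<G>" "\<And>y. y\<in>W \<Longrightarrow> \<psi> (f y) = g (\<phi> y)"
    using lm by (rule locally_modeled_atE) blast
  obtain U1 \<phi>1 V1 \<psi>1 W1 g1 where 1: "(U1, \<phi>1) \<in> A'" "(V1, \<psi>1) \<in> A''" "openin T' W1" "f x \<in> W1" "W1 \<subseteq> U1" "f' ` W1 \<subseteq> V1"
      "g1 \<in> snd \<G>" "\<And>y. y\<in>W1 \<Longrightarrow> \<psi>1 (f' y) = g1 (\<phi>1 y)"
    using lm' by (rule locally_modeled_atE) blast
  \<comment> \<open>The chart in which f arrives and the chart in which f' starts may differ; their
    change at f x links the two local forms.\<close>
  have "change_at \<G> T' (V, \<psi>) (U1, \<phi>1) (f x)"
    by (rule atlas_change_at[OF A' 0(2) 1(1)]) (use 0 1 in auto)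
  then obtain W2 g2 where 2: "openin T' W2" "f x \<in> W2" "W2 \<subseteq> V" "W2 \<subseteq> U1" "g2 \<in> snd \<G>" "\<And>y. y\<in>W2 \<Longrightarrow> \<phi>1 y = g2 (\<psi> y)"
    by (rule change_atE) simp
  let ?W = "W \<inter> {y \<in> topspace T. f y \<in> W1 \<inter> W2}"
  show ?thesis
  proof (rule locally_modeled_atI[OF 0(1) 1(2)])
    show "openin T ?W"
      by (intro openin_Int[OF 0(3)] openin_continuous_map_preimage[OF f] openin_Int 1 2)
    show "x \<in> ?W" using 0(4) 1(4) 2(2) openin_subset[OF 0(3)] by auto
    show "?W \<subseteq> U" using 0 by blast
    show "(\<lambda>y. f' (f y)) ` ?W \<subseteq> V1" using 1(6) by blast
    show "(\<lambda>m. g1 (g2 (g m))) \<in> snd \<G>" by (rule comp_mem[OF comp_mem[OF 1(7) 2(5)] 0(7)])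
    show "\<psi>1 (f' (f y)) = g1 (g2 (g (\<phi> y)))" if "y \<in> ?W" for y
      using that by (simp add: 1(8) 2(6) flip: 0(8))
  qed
qed

lemma locally_modeled_at_inv:
  assumes f: "homeomorphic_map T T' f" and h: "\<And>y. y \<in> topspace T \<Longrightarrow> h (f y) = y"
    and lm: "locally_modeled_at \<G> (T, A) (T', A') f x"
  shows "locally_modeled_at \<G> (T', A') (T, A) h (f x)"
proof -
  obtain U \<phi> V \<psi> W g where 0: "(U, \<phi>) \<in> A" "(V, \<psi>) \<in> A'" "openin T W" "x \<in> W" "W \<subseteq> U" "f ` W \<subseteq> V"
      "g \<in> snd \<G>" "\<And>y. y\<in>W \<Longrightarrow> \<psi> (f y) = g (\<phi> y)"
    using lm by (rule locally_modeled_atE) blast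
  obtain g' where g': "g' \<in> snd \<G>" "\<forall>x. g' (g x) = x" using inv_mem 0 by blast
  have hW: "h (f y) = y" if "y \<in> W" for y using that h openin_subset[OF 0(3)] by blast
  show ?thesis
  proof (rule locally_modeled_atI[OF 0(2,1)])
    show "openin T' (f ` W)"
      using homeomorphic_imp_open_map[OF f] 0(3) by (simp add: open_map_def)
    show "f x \<in> f ` W" using 0 by blast
    show "h ` f ` W \<subseteq> U" using hW 0(5) by auto
    show "\<phi> (h z) = g' (\<psi> z)" if "z \<in> f ` W" for z using that hW by (auto simp: 0(8) g')
  qed (use 0 g' in auto)
qed

lemma locally_modeled_at_cong:
  assumes "\<And>y. y \<in> topspace T \<Longrightarrow> f y = f' y" "locally_modeled_at \<G> (T, A) (T', A') f x"
  shows "locally_modeled_at \<G> (T, A) (T', A') f' x"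
proof -
  obtain U \<phi> V \<psi> W g where 0: "(U, \<phi>) \<in> A" "(V, \<psi>) \<in> A'" "openin T W" "x \<in> W" "W \<subseteq> U" "f ` W \<subseteq> V"
      "g \<in> snd \<G>" "\<And>y. y\<in>W \<Longrightarrow> \<psi> (f y) = g (\<phi> y)"
    using assms(2) by (rule locally_modeled_atE) blast
  have W: "f' y = f y" if "y \<in> W" for y using that assms(1) openin_subset[OF 0(3)] by auto
  show ?thesis
    by (rule locally_modeled_atI[OF 0(1-5) _ 0(7)]) (use W 0 in auto)
qed

lemma curve_iso_comp:
  assumes "is_atlas \<G> T' A'" "curve_iso \<G> (T, A) (T', A') f" "curve_iso \<G> (T', A') (T'', A'') f'"
  shows "curve_iso \<G> (T, A) (T'', A'') (\<lambda>y. f' (f y))"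
  unfolding curve_iso_def
proof (intro conjI ballI)
  show "homeomorphic_map (fst (T, A)) (fst (T'', A'')) (\<lambda>y. f' (f y))"
    using assms homeomorphic_map_compose[of T T' f T'' f'] by (simp add: curve_iso_def o_def)
  fix x assume "x \<in> topspace (fst (T, A))"
  then have x: "x \<in> topspace T" by simp
  have f: "homeomorphic_map T T' f" using assms(2) by (simp add: curve_iso_def)
  then have "f x \<in> topspace T'" using x homeomorphic_imp_surjective_map by blast
  then have "locally_modeled_at \<G> (T, A) (T', A') f x" "locally_modeled_at \<G> (T', A') (T'', A'') f' (f x)"
    using assms(2,3) x unfolding curve_iso_def by simp_all
  from locally_modeled_at_comp[OF assms(1) homeomorphic_imp_continuous_map[OF f] this]
  show "locally_modeled_at \<G> (T, A) (T'', A'') (\<lambda>y. f' (f y)) x" .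
qed

lemma curve_iso_inv:
  assumes f: "curve_iso \<G> (T, A) (T', A') f" and h: "\<And>y. y \<in> topspace T \<Longrightarrow> h (f y) = y"
  shows "curve_iso \<G> (T', A') (T, A) h"
proof -
  have hf: "homeomorphic_map T T' f" using f by (simp add: curve_iso_def)
  then have im: "f ` topspace T = topspace T'" by (rule homeomorphic_imp_surjective_map)
  obtain k where k: "homeomorphic_maps T T' f k" using hf homeomorphic_map_maps by blast
  then have "homeomorphic_map T' T k" by (meson homeomorphic_maps_map)
  moreover have "k y = h y" if "y \<in> topspace T'" for y
    using that k h im by (metis homeomorphic_maps_def imageE)
  ultimately have "homeomorphic_map T' T h" using homeomorphic_map_eq by blast
  moreover have "locally_modeled_at \<G> (T', A') (T, A) h y" if y: "y \<in> topspace T'" for y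
  proof -
    obtain x where "x \<in> topspace T" "y = f x" using y im by (metis imageE)
    then show ?thesis using locally_modeled_at_inv[OF hf h] f by (auto simp: curve_iso_def)
  qed
  ultimately show ?thesis by (simp add: curve_iso_def)
qed

text \<open>Local agreement through the identity makes every chart of one atlas compatible with
  every chart of the other; both being maximal, each contains the other.\<close>

lemma structure_eqI:
  assumes A: "is_structure \<G> T A" and A': "is_structure \<G> T A'"
    and lm: "\<And>x. x \<in> topspace T \<Longrightarrow> locally_modeled_at \<G> (T, A) (T, A') (\<lambda>x. x) x"
  shows "A = A'"
proof -
  have at: "is_atlas \<G> T A" "is_atlas \<G> T A'" using A A' by (auto simp: is_structure_def)
  have ch: "chart_change \<G> T c c'" if c: "c \<in> A" and c': "c' \<in> A'" for c c'
    unfolding chart_change_iff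
  proof
    fix x assume x: "x \<in> fst c \<inter> fst c'"
    obtain U \<phi> V \<psi> where UV: "c = (U, \<phi>)" "c' = (V, \<psi>)" by (metis surj_pair)
    have "x \<in> topspace T" using x c at chart_openin openin_subset by (fastforce simp: is_atlas_def)
    then obtain W g where W: "openin T W" "x \<in> W" "W \<subseteq> U" "(\<lambda>x. x) ` W \<subseteq> V" "g \<in> snd \<G>" "\<And>y. y\<in>W \<Longrightarrow> \<psi> y = g (\<phi> y)"
      using locally_modeled_at_any_chart[OF at _ lm, of x U \<phi> V \<psi>] x c c' UV by auto
    show "change_at \<G> T c c' x" unfolding UV by (rule change_atI[OF W(1,2) _ _ W(5)]) (use W in auto)
  qed
  have ch': "chart_change \<G> T c' c" if "c \<in> A" "c' \<in> A'" for c c'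
    using ch[OF that] unfolding chart_change_iff by (auto intro: change_at_sym)
  have "A = structure_of \<G> T A" "A' = structure_of \<G> T A'" "\<forall>c \<in> A. is_chart \<G> T c" "\<forall>c \<in> A'. is_chart \<G> T c"
    using A A' at unfolding is_structure_def is_atlas_def by auto
  then show ?thesis using ch ch' unfolding structure_of_def by blast
qed

text \<open>Writing f as g' o f o g with automorphisms g and g' transports the local form of f from
  g x to x. A good point among the images of x is thus enough, which is how finite exceptional sets
  are later removed.\<close>

lemma curve_iso_intertwining:
  assumes A: "is_atlas \<G> T A" and A': "is_atlas \<G> T' A'"
    and f: "homeomorphic_map T T' f"
    and tr: "\<And>x. x \<in> topspace T \<Longrightarrow> \<exists>g g'. curve_iso \<G> (T, A) (T, A) g \<and> curve_iso \<G> (T', A') (T', A') g' \<and>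
          locally_modeled_at \<G> (T, A) (T', A') f (g x) \<and> (\<forall>y \<in> topspace T. f y = g' (f (g y)))"
  shows "curve_iso \<G> (T, A) (T', A') f"
  unfolding curve_iso_def
proof (intro conjI ballI)
  show "homeomorphic_map (fst (T, A)) (fst (T', A')) f" using f by simp
  fix x assume "x \<in> topspace (fst (T, A))"
  then have x: "x \<in> topspace T" by simp
  then obtain g g' where g: "curve_iso \<G> (T, A) (T, A) g" "curve_iso \<G> (T', A') (T', A') g'"
          "locally_modeled_at \<G> (T, A) (T', A') f (g x)" "\<forall>y \<in> topspace T. f y = g' (f (g y))"
    using tr by blast
  have cg: "continuous_map T T g" "continuous_map T T' f"
    using g f by (auto simp: curve_iso_def homeomorphic_imp_continuous_map)
  have gx: "g x \<in> topspace T" "f (g x) \<in> topspace T'"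
    using cg x by (metis continuous_map_funspace Pi_iff)+
  have 1: "locally_modeled_at \<G> (T, A) (T', A') (\<lambda>y. f (g y)) x"
    using locally_modeled_at_comp[OF A cg(1) _ g(3)] g(1) x by (auto simp: curve_iso_def)
  have "locally_modeled_at \<G> (T, A) (T', A') (\<lambda>y. g' (f (g y))) x"
    using locally_modeled_at_comp[OF A' _ 1] continuous_map_compose[OF cg] g(2) gx
    by (auto simp: curve_iso_def o_def)
  then show "locally_modeled_at \<G> (T, A) (T', A') f x"
    by (rule locally_modeled_at_cong[rotated]) (simp add: g(4)[rule_format, symmetric])
qed

end

section \<open>Quotient curves\<close>

text \<open>Applying \<open>arctan\<close> first makes J bounded, so that \<open>Inf\<close> and
  \<open>Sup\<close> exist and all unbounded cases merge into one open interval.\<close>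

lemma open_connected_real_homeomorphic:
  fixes J :: "real set"
  assumes "open J" "connected J" "J \<noteq> {}"
  shows "J homeomorphic (UNIV :: real set)"
proof -
  let ?K = "arctan ` J"
  have inj: "inj_on arctan J" by (rule inj_onI) (use arctan_eq_iff in blast)
  have J: "J homeomorphic ?K"
    by (rule invariance_of_domain_homeomorphic) (use assms inj in \<open>auto intro: continuous_intros\<close>)
  have op: "open ?K"
    by (rule injective_into_1d_imp_open_map_UNIV) (use assms inj in \<open>auto intro: continuous_intros\<close>)
  have "connected ?K"
    by (rule connected_continuous_image) (use assms in \<open>auto intro: continuous_intros\<close>)
  then have iv: "is_interval ?K" using is_interval_connected_1 by blast
  have K: "?K \<noteq> {}" "bdd_below ?K" "bdd_above ?K"
    using assms by (auto intro!: bdd_belowI2[of _ "-(pi/2)"] bdd_aboveI2[of _ _ "pi/2"] less_imp_le[OF arctan_lbound] less_imp_le[OF arctan_ubound])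
  have sub: "Inf ?K < y \<and> y < Sup ?K" if y: "y \<in> ?K" for y
  proof -
    obtain e where e: "e > 0" "ball y e \<subseteq> ?K" using op y open_contains_ball by blast
    then have "y - e/2 \<in> ?K" "y + e/2 \<in> ?K" by (auto simp: dist_real_def subset_iff)
    then show ?thesis using cInf_lower[OF _ K(2)] cSup_upper[OF _ K(3)] e(1) by fastforce
  qed
  have "y \<in> ?K" if y: "Inf ?K < y" "y < Sup ?K" for y
  proof -
    obtain a b where "a \<in> ?K" "a < y" "b \<in> ?K" "y < b"
      using cInf_lessD[OF K(1) y(1)] less_cSupD[OF K(1) y(2)] by blast
    then show ?thesis using iv unfolding is_interval_1 by (meson less_imp_le)
  qed
  then have "?K = {Inf ?K<..<Sup ?K}" using sub by auto
  moreover have "Inf ?K < Sup ?K" using sub K(1) by (metis all_not_in_conv order_less_trans)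
  ultimately have "?K homeomorphic (UNIV :: real set)" using homeomorphic_open_interval_UNIV by metis
  then show ?thesis using J homeomorphic_trans by blast
qed

text \<open>\<open>fibre\<close> is the deck transformation from x to y: it is defined on all of S,
  and d turns it into one element of the group. The first half makes q open, the second makes the
  inverse branches of q compatible charts.\<close>

locale quotient_data = geometry_group \<G> for \<G> :: "'m geometry" +
  fixes S :: "real set" and q :: "real \<Rightarrow> 'a" and d :: "real \<Rightarrow> 'm"
  assumes open_S: "open S"
    and d_cont: "continuous_map (top_of_set S) (fst \<G>) d"
    and d_open: "\<And>U. open U \<Longrightarrow> U \<subseteq> S \<Longrightarrow> openin (fst \<G>) (d ` U)"
    and d_inj: "\<And>x. x \<in> S \<Longrightarrow> \<exists>e>0. inj_on d (ball x e \<inter> S)"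
    and q_inj: "\<And>x. x \<in> S \<Longrightarrow> \<exists>e>0. inj_on q (ball x e \<inter> S)"
    and fibre: "\<And>x y. x \<in> S \<Longrightarrow> y \<in> S \<Longrightarrow> q x = q y \<Longrightarrow>
      \<exists>\<sigma>. continuous_on S \<sigma> \<and> \<sigma> \<in> S \<rightarrow> S \<and> \<sigma> x = y \<and> (\<forall>z\<in>S. q (\<sigma> z) = q z) \<and> (\<exists>g\<in>snd \<G>. \<forall>z\<in>S. d (\<sigma> z) = g (d z))"
begin

abbreviation "T \<equiv> quotient_topology (top_of_set S) q"
abbreviation "charts \<equiv> quotient_charts (top_of_set S) q d"
abbreviation "struct \<equiv> structure_of \<G> T charts"

lemma topspace_T: "topspace T = q ` S"
  by (simp add: topspace_quotient_topology)

lemma q_continuous: "continuous_map (top_of_set S) T q"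
  by (simp add: quotient_imp_continuous_map quotient_map_quotient_topology)

text \<open>The saturation of U is open because around each of its points it contains the preimage
  of U under a deck transformation.\<close>

lemma q_open:
  assumes "open U" "U \<subseteq> S"
  shows "openin T (q ` U)"
proof -
  have "open {x \<in> S. q x \<in> q ` U}"
  proof (subst open_subopen, clarify)
    fix x u assume x: "x \<in> S" "q x = q u" "u \<in> U"
    then obtain \<sigma> where \<sigma>: "continuous_on S \<sigma>" "\<sigma> \<in> S \<rightarrow> S" "\<sigma> x = u" "\<forall>z\<in>S. q (\<sigma> z) = q z"
      using fibre[of x u] assms by blast
    have "open (S \<inter> \<sigma> -` U)"
      using \<sigma>(1) open_S assms by (simp add: continuous_on_open_vimage Int_commute)
    moreover have "S \<inter> \<sigma> -` U \<subseteq> {x \<in> S. q x \<in> q ` U}" using \<sigma>(4) by (auto simp: image_iff) metis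
    ultimately show "\<exists>V. open V \<and> x \<in> V \<and> V \<subseteq> {x \<in> S. q x \<in> q ` U}"
      using x \<sigma> by (intro exI[of _ "S \<inter> \<sigma> -` U"]) auto
  qed
  then show ?thesis using assms open_S
    by (auto simp: openin_quotient_topology openin_open_eq intro!: image_mono)
qed

lemma chartsI:
  assumes "open J" "J \<subseteq> S" "connected J" "J \<noteq> {}" "inj_on q J" "inj_on d J"
  shows "(q ` J, restrict (\<lambda>y. d (the_inv_into J q y)) (q ` J)) \<in> charts"
proof -
  have "openin (top_of_set S) J \<and> connectedin (top_of_set S) J"
    using assms open_S by (simp add: openin_open_eq connectedin_subtopology)
  then show ?thesis using assms unfolding quotient_charts_def by blast
qed

lemma chartsE:
  assumes "c \<in> charts"
  obtains J where "open J" "J \<subseteq> S" "connected J" "J \<noteq> {}" "inj_on q J" "inj_on d J"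
    "c = (q ` J, restrict (\<lambda>y. d (the_inv_into J q y)) (q ` J))"
proof -
  obtain J where "openin (top_of_set S) J" "connectedin (top_of_set S) J" "J \<noteq> {}" "inj_on q J" "inj_on d J"
    "c = (q ` J, restrict (\<lambda>y. d (the_inv_into J q y)) (q ` J))"
    using assms unfolding quotient_charts_def by blast
  moreover then have "open J" "J \<subseteq> S" "connected J"
    using open_S by (simp_all add: openin_open_eq connectedin_subtopology)
  ultimately show ?thesis using that by blast
qed

lemma small_interval:
  assumes "x \<in> S" "open U" "x \<in> U"
  obtains e where "e > 0" "ball x e \<subseteq> S \<inter> U" "inj_on q (ball x e)" "inj_on d (ball x e)"
proof -
  obtain e1 where e1: "e1 > 0" "inj_on d (ball x e1 \<inter> S)" using d_inj assms by blast
  obtain e2 where e2: "e2 > 0" "inj_on q (ball x e2 \<inter> S)" using q_inj assms by blast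
  obtain e3 where e3: "e3 > 0" "ball x e3 \<subseteq> S \<inter> U"
    using open_S assms by (metis IntI open_Int open_contains_ball)
  let ?e = "min e1 (min e2 e3)"
  have "ball x ?e \<subseteq> ball x e1 \<inter> S" "ball x ?e \<subseteq> ball x e2 \<inter> S" "ball x ?e \<subseteq> S \<inter> U"
    using e3 by auto
  then show ?thesis using that[of ?e] e1 e2 e3 by (meson inj_on_subset min_less_iff_conj)
qed

lemma restrict_chart_eq:
  assumes "inj_on q J" "z \<in> J"
  shows "restrict (\<lambda>y. d (the_inv_into J q y)) (q ` J) (q z) = d z"
  using assms by (simp add: the_inv_into_f_f)

lemma is_chart_charts:
  assumes J: "open J" "J \<subseteq> S" "connected J" "J \<noteq> {}" "inj_on q J" "inj_on d J"
  shows "is_chart \<G> T (q ` J, restrict (\<lambda>y. d (the_inv_into J q y)) (q ` J))"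
proof -
  let ?\<phi> = "restrict (\<lambda>y. d (the_inv_into J q y)) (q ` J)"
  have im: "?\<phi> ` q ` J = d ` J" using restrict_chart_eq[OF J(5)] by (force simp: image_image)
  have sub: "subtopology (top_of_set S) J = top_of_set J"
    using J by (simp add: subtopology_subtopology Int_absorb1)
  have opJ: "openin (top_of_set J) U \<longleftrightarrow> open U \<and> U \<subseteq> J" for U
    using J by (auto simp: openin_open_eq)
  have dtop: "d ` J \<subseteq> topspace (fst \<G>)" using d_open[OF J(1,2)] openin_subset by blast
  have qtop: "q ` J \<subseteq> topspace T" using J topspace_T by auto
  have hd: "homeomorphic_map (top_of_set J) (subtopology (fst \<G>) (d ` J)) d"
  proof (rule bijective_open_imp_homeomorphic_map)
    show "continuous_map (top_of_set J) (subtopology (fst \<G>) (d ` J)) d"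
      using continuous_map_from_subtopology[OF d_cont, of J] sub by (auto simp: continuous_map_in_subtopology)
    show "open_map (top_of_set J) (subtopology (fst \<G>) (d ` J)) d"
      unfolding open_map_def opJ using J d_open[OF J(1,2)]
      by (auto simp: openin_open_subtopology intro!: d_open)
    show "d ` topspace (top_of_set J) = topspace (subtopology (fst \<G>) (d ` J))"
      using dtop by auto
  qed (use J in auto)
  have hq: "homeomorphic_map (top_of_set J) (subtopology T (q ` J)) q"
  proof (rule bijective_open_imp_homeomorphic_map)
    show "continuous_map (top_of_set J) (subtopology T (q ` J)) q"
      using continuous_map_from_subtopology[OF q_continuous, of J] sub by (auto simp: continuous_map_in_subtopology)
    show "open_map (top_of_set J) (subtopology T (q ` J)) q"
      unfolding open_map_def opJ using J q_open[OF J(1,2)]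
      by (auto simp: openin_open_subtopology intro!: q_open)
    show "q ` topspace (top_of_set J) = topspace (subtopology T (q ` J))"
      using qtop by auto
  qed (use J in auto)
  have "homeomorphic_map (subtopology T (q ` J)) (top_of_set J) (the_inv_into J q)"
  proof -
    obtain k where k: "homeomorphic_maps (top_of_set J) (subtopology T (q ` J)) q k"
      using hq homeomorphic_map_maps by blast
    then have "homeomorphic_map (subtopology T (q ` J)) (top_of_set J) k" by (meson homeomorphic_maps_map)
    moreover have "k y = the_inv_into J q y" if y: "y \<in> topspace (subtopology T (q ` J))" for y
    proof -
      obtain z where "z \<in> J" "y = q z" using y by (force simp: topspace_quotient_topology)
      moreover then have "k (q z) = z" using k by (auto simp: homeomorphic_maps_def)
      ultimately show ?thesis using J by (simp add: the_inv_into_f_f)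
    qed
    ultimately show ?thesis using homeomorphic_map_eq by blast
  qed
  from homeomorphic_map_compose[OF this hd]
  have "homeomorphic_map (subtopology T (q ` J)) (subtopology (fst \<G>) (d ` J)) ?\<phi>"
    by (rule homeomorphic_map_eq) (use qtop in \<open>auto simp: Int_absorb1\<close>)
  moreover have "open_interval_in (fst \<G>) (d ` J)"
  proof -
    obtain a b where "homeomorphism J (UNIV :: real set) a b"
      using open_connected_real_homeomorphic[OF J(1,3,4)] homeomorphic_def by blast
    then have "top_of_set J homeomorphic_space euclideanreal"
      unfolding homeomorphic_space_def homeomorphic_maps_def homeomorphism_def
      by (intro exI[of _ a] exI[of _ b]) (auto simp: continuous_map_in_subtopology image_subset_iff)
    moreover have "subtopology (fst \<G>) (d ` J) homeomorphic_space top_of_set J"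
      using hd homeomorphic_map_imp_homeomorphic_space homeomorphic_space_sym by blast
    ultimately show ?thesis unfolding open_interval_in_def
      using d_open[OF J(1,2)] homeomorphic_space_trans by blast
  qed
  ultimately show ?thesis unfolding is_chart_def using im q_open[OF J(1,2)] by simp
qed

lemma is_atlas_charts: "is_atlas \<G> T charts"
  unfolding is_atlas_def
proof (intro conjI ballI)
  fix c assume "c \<in> charts"
  then show "is_chart \<G> T c" by (elim chartsE) (simp add: is_chart_charts)
next
  have "\<Union> (fst ` charts) \<subseteq> q ` S" by (force elim: chartsE)
  moreover have "q x \<in> \<Union> (fst ` charts)" if x: "x \<in> S" for x
  proof -
    obtain e where e: "e > 0" "ball x e \<subseteq> S \<inter> UNIV" "inj_on q (ball x e)" "inj_on d (ball x e)"
      by (rule small_interval[OF x open_UNIV UNIV_I])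
    then have "(q ` ball x e, restrict (\<lambda>y. d (the_inv_into (ball x e) q y)) (q ` ball x e)) \<in> charts"
      by (intro chartsI) auto
    then show ?thesis using e by force
  qed
  ultimately show "\<Union> (fst ` charts) = topspace T" using topspace_T by auto
next
  fix c c' assume "c \<in> charts" "c' \<in> charts"
  then obtain J J' where J: "open J" "J \<subseteq> S" "connected J" "J \<noteq> {}" "inj_on q J" "inj_on d J"
    "c = (q ` J, restrict (\<lambda>y. d (the_inv_into J q y)) (q ` J))"
   and J': "open J'" "J' \<subseteq> S" "connected J'" "J' \<noteq> {}" "inj_on q J'" "inj_on d J'"
    "c' = (q ` J', restrict (\<lambda>y. d (the_inv_into J' q y)) (q ` J'))"
    by (elim chartsE) blast
  show "chart_change \<G> T c c'" unfolding chart_change_iff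
  proof
    fix p assume "p \<in> fst c \<inter> fst c'"
    then obtain x y where xy: "x \<in> J" "y \<in> J'" "p = q x" "q x = q y" using J J' by auto
    then obtain \<sigma> g where \<sigma>: "continuous_on S \<sigma>" "\<sigma> \<in> S \<rightarrow> S" "\<sigma> x = y" "\<forall>z\<in>S. q (\<sigma> z) = q z"
        "g \<in> snd \<G>" "\<forall>z\<in>S. d (\<sigma> z) = g (d z)"
      using fibre[of x y] J J' by blast
    have op: "open (S \<inter> \<sigma> -` J')"
      using \<sigma>(1) open_S J' by (simp add: continuous_on_open_vimage Int_commute)
    \<comment> \<open>On this set \<sigma> maps into J', so the second chart reads
      \<open>q z\<close> at \<open>\<sigma> z\<close>, which differs from the reading of the first
      chart by g.\<close>
    let ?N = "J \<inter> (S \<inter> \<sigma> -` J')"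
    have N: "open ?N" "?N \<subseteq> S" "x \<in> ?N" using op J xy \<sigma> by auto
    have "snd c' (q z) = g (snd c (q z))" "q z \<in> fst c'" if z: "z \<in> ?N" for z
    proof -
      have "q z = q (\<sigma> z)" "\<sigma> z \<in> J'" "z \<in> J" "z \<in> S" using z \<sigma> J by auto
      then show "snd c' (q z) = g (snd c (q z))" "q z \<in> fst c'"
        using restrict_chart_eq[OF J(5) \<open>z \<in> J\<close>] restrict_chart_eq[OF J'(5) \<open>\<sigma> z \<in> J'\<close>] \<sigma>(6) J J' 
        by auto
    qed
    moreover have "q ` ?N \<subseteq> fst c" using J by auto
    ultimately show "change_at \<G> T c c' p" unfolding change_at_def
      using q_open[OF N(1,2)] N(3) xy(3) \<sigma>(5)
      by (intro exI[of _ "q ` ?N"]) blast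
  qed
qed

lemma is_structure_struct: "is_structure \<G> T struct"
  by (rule is_structure_structure_of[OF is_atlas_charts])

lemma is_atlas_struct: "is_atlas \<G> T struct"
  by (rule is_atlas_structure_of[OF is_atlas_charts])

lemma struct_chart:
  assumes "open J" "J \<subseteq> S" "connected J" "J \<noteq> {}" "inj_on q J" "inj_on d J"
  shows "(q ` J, restrict (\<lambda>y. d (the_inv_into J q y)) (q ` J)) \<in> struct"
  using chartsI[OF assms] atlas_subset_structure_of[OF is_atlas_charts] by blast

lemma quotient_curve_eq: "quotient_curve \<G> (top_of_set S) q d = (T, struct)"
  by (simp add: quotient_curve_def)

end

section \<open>Maps between quotients, read through a lift\<close>

lemma quotient_map_lift_continuous:
  assumes F: "continuous_map X Y F" and f: "\<And>x. x \<in> topspace X \<Longrightarrow> f (p x) = p' (F x)"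
  shows "continuous_map (quotient_topology X p) (quotient_topology Y p') f"
proof -
  have "continuous_map X (quotient_topology Y p') (p' \<circ> F)"
    using F by (rule continuous_map_compose) (simp add: quotient_imp_continuous_map quotient_map_quotient_topology)
  then have "continuous_map X (quotient_topology Y p') (f \<circ> p)"
    by (rule continuous_map_eq) (simp add: f)
  then show ?thesis
    by (rule continuous_compose_quotient_map[OF quotient_map_quotient_topology])
qed

lemma quotient_map_lift_homeomorphic:
  assumes F: "homeomorphic_map X Y F" and f: "\<And>x. x \<in> topspace X \<Longrightarrow> f (p x) = p' (F x)"
    and eq: "\<And>x y. x \<in> topspace X \<Longrightarrow> y \<in> topspace X \<Longrightarrow> p x = p y \<longleftrightarrow> p' (F x) = p' (F y)"
  shows "homeomorphic_map (quotient_topology X p) (quotient_topology Y p') f"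
proof -
  have "quotient_map X (quotient_topology Y p') (p' \<circ> F)"
    using F quotient_map_compose quotient_map_quotient_topology homeomorphic_map_def by blast
  then have qm: "quotient_map X (quotient_topology Y p') (f \<circ> p)"
    by (rule quotient_map_eq) (simp add: f)
  have c: "continuous_map (quotient_topology X p) (quotient_topology Y p') f"
    using homeomorphic_imp_continuous_map[OF F] f by (rule quotient_map_lift_continuous)
  have "quotient_map (quotient_topology X p) (quotient_topology Y p') f"
    using quotient_map_from_composition[OF _ c qm] quotient_map_quotient_topology quotient_imp_continuous_map by blast
  moreover have "inj_on f (topspace (quotient_topology X p))"
    unfolding topspace_quotient_topology inj_on_def using f eq by auto
  ultimately show ?thesis by (simp add: homeomorphic_map_def)
qed

locale quotient_pair = q1: quotient_data \<G> S1 q1 d1 + q2: quotient_data \<G> S2 q2 d2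
  for \<G> :: "'m geometry" and S1 S2 and q1 :: "real \<Rightarrow> 'a" and q2 :: "real \<Rightarrow> 'b" and d1 d2 +
  fixes F :: "real \<Rightarrow> real" and f :: "'a \<Rightarrow> 'b"
  assumes F_cont: "continuous_on S1 F" and F_maps: "F \<in> S1 \<rightarrow> S2"
    and f_lift: "\<And>x. x \<in> S1 \<Longrightarrow> f (q1 x) = q2 (F x)"
begin

lemma f_continuous: "continuous_map q1.T q2.T f"
  by (rule quotient_map_lift_continuous[of _ _ F]) (use F_cont F_maps f_lift in auto)

text \<open>Small balls around x and F x serve as charts, where the inverse branches of q1 and q2
  cancel; what remains is an identity between d2 composed with F and d1. From here on the geometry
  is done on the real line.\<close>

lemma locally_modeled_at_lift:
  assumes x: "x \<in> S1"
  shows "locally_modeled_at \<G> (q1.T, q1.struct) (q2.T, q2.struct) f (q1 x) \<longleftrightarrow>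
    (\<exists>g \<in> snd \<G>. \<exists>e>0. \<forall>y \<in> ball x e \<inter> S1. d2 (F y) = g (d1 y))"  (is "?L \<longleftrightarrow> ?R")
proof -
  have Fx: "F x \<in> S2" using F_maps x by auto
  obtain e1 where e1: "e1 > 0" "ball x e1 \<subseteq> S1 \<inter> UNIV" "inj_on q1 (ball x e1)" "inj_on d1 (ball x e1)"
    by (rule q1.small_interval[OF x open_UNIV UNIV_I])
  obtain e2 where e2: "e2 > 0" "ball (F x) e2 \<subseteq> S2 \<inter> UNIV" "inj_on q2 (ball (F x) e2)" "inj_on d2 (ball (F x) e2)"
    by (rule q2.small_interval[OF Fx open_UNIV UNIV_I])
  let ?J1 = "ball x e1" and ?J2 = "ball (F x) e2"
  let ?\<phi> = "restrict (\<lambda>y. d1 (the_inv_into ?J1 q1 y)) (q1 ` ?J1)"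
  let ?\<psi> = "restrict (\<lambda>y. d2 (the_inv_into ?J2 q2 y)) (q2 ` ?J2)"
  have c: "(q1 ` ?J1, ?\<phi>) \<in> q1.struct" "(q2 ` ?J2, ?\<psi>) \<in> q2.struct"
    using e1 e2 by (auto intro!: q1.struct_chart q2.struct_chart)
  have opF: "open (S1 \<inter> F -` ?J2)"
    using F_cont q1.open_S by (simp add: continuous_on_open_vimage Int_commute)
  show ?thesis
  proof
    assume ?L
    from q1.locally_modeled_at_any_chart[OF q1.is_atlas_struct q2.is_atlas_struct f_continuous this c(1) _ c(2)]
    obtain W g where W: "openin q1.T W" "q1 x \<in> W" "W \<subseteq> q1 ` ?J1" "f ` W \<subseteq> q2 ` ?J2" "g \<in> snd \<G>" "\<And>y. y\<in>W \<Longrightarrow> ?\<psi> (f y) = g (?\<phi> y)"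
      using e1(1) e2(1) f_lift[OF x] by auto
    have "openin (top_of_set S1) {y \<in> topspace (top_of_set S1). q1 y \<in> W}"
      using openin_continuous_map_preimage[OF q1.q_continuous W(1)] .
    then have "open {y \<in> S1. q1 y \<in> W}" using q1.open_S by (auto simp: openin_open_eq)
    then have "open ({y \<in> S1. q1 y \<in> W} \<inter> (S1 \<inter> F -` ?J2) \<inter> ?J1)" (is "open ?N") using opF by auto
    moreover have "x \<in> ?N" using x W e1 e2 by auto
    ultimately obtain e where e: "e > 0" "ball x e \<subseteq> ?N" using open_contains_ball by blast
    have "d2 (F y) = g (d1 y)" if y: "y \<in> ball x e \<inter> S1" for y
    proof -
      have N: "q1 y \<in> W" "F y \<in> ?J2" "y \<in> ?J1" "y \<in> S1" using e y by auto
      then show ?thesis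
        using W(6)[OF N(1)] q1.restrict_chart_eq[OF e1(3) N(3)] q2.restrict_chart_eq[OF e2(3) N(2)]
          f_lift[OF N(4)] by simp
    qed
    then show ?R using W(5) e(1) by blast
  next
    assume ?R
    then obtain g e where g: "g \<in> snd \<G>" "e > 0" "\<forall>y \<in> ball x e \<inter> S1. d2 (F y) = g (d1 y)" by blast
    let ?N = "?J1 \<inter> ball x e \<inter> (S1 \<inter> F -` ?J2)"
    have N: "open ?N" "?N \<subseteq> S1" "x \<in> ?N" using opF g e1 e2 x by auto
    have *: "?\<psi> (f (q1 z)) = g (?\<phi> (q1 z))" "f (q1 z) \<in> q2 ` ?J2" if z: "z \<in> ?N" for z
    proof -
      have "z \<in> ?J1" "F z \<in> ?J2" "z \<in> S1" "z \<in> ball x e" using z by auto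
      then show "?\<psi> (f (q1 z)) = g (?\<phi> (q1 z))" "f (q1 z) \<in> q2 ` ?J2"
        using q1.restrict_chart_eq[OF e1(3), of z] q2.restrict_chart_eq[OF e2(3), of "F z"]
          f_lift[of z] g(3) by auto
    qed
    show ?L
    proof (rule locally_modeled_atI[OF c])
      show "openin q1.T (q1 ` ?N)" by (rule q1.q_open[OF N(1,2)])
    qed (use N(3) g(1) * in blast)+
  qed
qed

end

section \<open>The projective line\<close>

definition mob :: "real^2^2 \<Rightarrow> p1 \<Rightarrow> p1" where
  "mob A L = ((*v) A) ` L"

definition mat2 :: "real \<Rightarrow> real \<Rightarrow> real \<Rightarrow> real \<Rightarrow> real^2^2" where
  "mat2 a b c d = vector [vector [a, b], vector [c, d]]"

lemma mat2_nth [simp]: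
  "mat2 a b c d $ 1 $ 1 = a" "mat2 a b c d $ 1 $ 2 = b" "mat2 a b c d $ 2 $ 1 = c" "mat2 a b c d $ 2 $ 2 = d"
  by (simp_all add: mat2_def)

lemma mat2_eta: "A = mat2 (A $ 1 $ 1) (A $ 1 $ 2) (A $ 2 $ 1) (A $ 2 $ 2)"
  by (simp add: vec_eq_iff forall_2)

lemma mat2_mult_vector: "mat2 a b c d *v vector [x, y] = vector [a * x + b * y, c * x + d * y]"
  by (simp add: vec_eq_iff forall_2 matrix_vector_mult_def sum_2)

lemma mat2_mult: "mat2 a b c d ** mat2 a' b' c' d' =
    mat2 (a * a' + b * c') (a * b' + b * d') (c * a' + d * c') (c * b' + d * d')"
  by (simp add: vec_eq_iff forall_2 matrix_matrix_mult_def sum_2)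

lemma invertible_mat2: "invertible (mat2 a b c d) \<longleftrightarrow> a * d - b * c \<noteq> 0"
  by (simp add: invertible_det_nz det_2)

lemma vector2_eq_0_iff: "(vector [x, y] :: real^2) = 0 \<longleftrightarrow> x = 0 \<and> y = 0"
  by (simp add: vec_eq_iff forall_2)

lemma PGL2_iff: "g \<in> PGL2 \<longleftrightarrow> (\<exists>A. invertible A \<and> g = mob A)"
  by (auto simp: PGL2_def mob_def fun_eq_iff)

lemma mob_in_PGL2: "invertible A \<Longrightarrow> mob A \<in> PGL2"
  using PGL2_iff by blast

lemma mob_span: "mob A (span {v}) = span {A *v v}"
  by (simp add: mob_def linear_span_image[OF matrix_vector_mul_linear, symmetric])

lemma mob_mob: "mob A (mob B L) = mob (A ** B) L"
  by (simp add: mob_def image_image matrix_vector_mul_assoc)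

lemma geometry_group_proj: "geometry_group proj_geom"
proof
  show "(\<lambda>x. x) \<in> snd proj_geom"
    unfolding proj_geom_def snd_conv PGL2_iff
    by (intro exI[of _ "mat 1"]) (auto simp: fun_eq_iff mob_def invertible_def intro!: exI[of _ "mat 1"])
next
  fix g h assume "g \<in> snd proj_geom" "h \<in> snd proj_geom"
  then obtain A B where "invertible A" "g = mob A" "invertible B" "h = mob B"
    by (auto simp: proj_geom_def PGL2_iff)
  then show "(\<lambda>x. g (h x)) \<in> snd proj_geom"
    unfolding proj_geom_def snd_conv PGL2_iff
    by (intro exI[of _ "A ** B"]) (auto simp: mob_mob invertible_mult)
next
  fix g assume "g \<in> snd proj_geom"
  then obtain A where A: "invertible A" "g = mob A" by (auto simp: proj_geom_def PGL2_iff)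
  then obtain B where B: "A ** B = mat 1" "B ** A = mat 1" by (auto simp: invertible_def)
  then have "mob B \<in> snd proj_geom" using A
    by (auto simp: proj_geom_def invertible_def intro!: mob_in_PGL2)
  moreover have "mob (mat 1) L = L" for L by (simp add: mob_def)
  ultimately show "\<exists>h\<in>snd proj_geom. (\<forall>x. h (g x) = x) \<and> (\<forall>x. g (h x) = x)"
    using A B by (intro bexI[of _ "mob B"]) (auto simp: mob_mob)
qed

interpretation proj: geometry_group proj_geom by (rule geometry_group_proj)

lemma proj_geom_sel [simp]: "fst proj_geom = proj_line" "snd proj_geom = PGL2"
  by (simp_all add: proj_geom_def)

lemmas PGL2_id = proj.id_mem[simplified] and PGL2_comp = proj.comp_mem[simplified]
  and PGL2_inv = proj.inv_mem[simplified]

lemma topspace_proj_line: "topspace proj_line = (\<lambda>v. span {v}) ` (- {0})"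
  by (simp add: proj_line_def topspace_quotient_topology)

lemma openin_proj_line:
  "openin proj_line V \<longleftrightarrow> V \<subseteq> topspace proj_line \<and> open {v. v \<noteq> 0 \<and> span {v} \<in> V}"
proof -
  have "{x. x \<noteq> 0 \<and> span {x} \<in> V} = {x \<in> - {0}. span {x} \<in> V}" by auto
  moreover have "openin (top_of_set (- {0::real^2})) W \<longleftrightarrow> open W \<and> W \<subseteq> - {0}" for W
    by (rule openin_open_eq) auto
  ultimately show ?thesis
    unfolding topspace_proj_line by (auto simp: proj_line_def openin_quotient_topology)
qed

lemma span_singleton_scaleR:
  fixes v :: "real^2"
  assumes "k \<noteq> 0"
  shows "span {k *\<^sub>R v} = span {v}"
proof -
  have "c *\<^sub>R k *\<^sub>R v = (c * k) *\<^sub>R v" "c *\<^sub>R v = (c / k) *\<^sub>R k *\<^sub>R v" for c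
    using assms by simp_all
  then show ?thesis unfolding span_singleton by (metis (no_types, lifting) image_cong order_antisym image_subsetI rangeI)
qed

lemma span_vector_eq_iff:
  assumes "(a, b) \<noteq> (0, 0)" "(c, d) \<noteq> (0, 0)"
  shows "span {vector [a, b] :: real^2} = span {vector [c, d]} \<longleftrightarrow> a * d = b * c"
proof
  assume "span {vector [a, b] :: real^2} = span {vector [c, d]}"
  then have "vector [a, b] \<in> span {vector [c, d] :: real^2}" by (metis insertI1 span_base)
  then obtain k where "vector [a, b] = k *\<^sub>R (vector [c, d] :: real^2)"
    unfolding span_singleton by auto
  then show "a * d = b * c" by (simp add: vec_eq_iff forall_2)
next
  assume eq: "a * d = b * c"
  have "\<exists>k. k \<noteq> 0 \<and> vector [a, b] = k *\<^sub>R (vector [c, d] :: real^2)"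
  proof (cases "c = 0")
    case True
    then have "d \<noteq> 0" "a = 0" using assms eq by auto
    then show ?thesis using assms True by (intro exI[of _ "b / d"]) (auto simp: vec_eq_iff forall_2)
  next
    case False
    then have "a \<noteq> 0" using assms eq by auto
    then show ?thesis using False eq by (intro exI[of _ "a / c"]) (auto simp: vec_eq_iff forall_2 field_simps)
  qed
  then show "span {vector [a, b] :: real^2} = span {vector [c, d]}" using span_singleton_scaleR by metis
qed

lemma affine_embed_eq_iff [simp]: "affine_embed x = affine_embed y \<longleftrightarrow> x = y"
  by (simp add: affine_embed_def span_vector_eq_iff)

lemma inj_affine_embed: "inj affine_embed" by (simp add: inj_def)

lemma the_inv_affine_embed [simp]: "the_inv affine_embed (affine_embed x) = x"
  by (simp add: the_inv_f_f inj_affine_embed)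

lemma span_vector_affine: "b \<noteq> 0 \<Longrightarrow> span {vector [a, b] :: real^2} = affine_embed (a / b)"
  unfolding affine_embed_def by (subst span_vector_eq_iff) auto

lemma vector2_eta: "v = vector [v $ 1, v $ 2]" for v :: "real^2"
  by (simp add: vec_eq_iff forall_2)

definition point_at_infinity :: p1 where "point_at_infinity = span {vector [1, 0]}"

lemma affine_embed_neq_infinity [simp]: "affine_embed x \<noteq> point_at_infinity" "point_at_infinity \<noteq> affine_embed x"
  by (simp_all add: affine_embed_def point_at_infinity_def span_vector_eq_iff)

lemma span_vector_infinity: "a \<noteq> 0 \<Longrightarrow> span {vector [a, 0] :: real^2} = point_at_infinity"
  unfolding point_at_infinity_def by (subst span_vector_eq_iff) auto

lemma topspace_proj_line_eq: "topspace proj_line = insert point_at_infinity (range affine_embed)"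
proof -
  have "span {v} \<in> insert point_at_infinity (range affine_embed)" if "v \<noteq> 0" for v :: "real^2"
  proof -
    obtain a b where v: "v = vector [a, b]" using vector2_eta[of v] by blast
    show ?thesis
    proof (cases "b = 0")
      case True
      moreover have "a \<noteq> 0" using True that by (simp add: v vector2_eq_0_iff)
      ultimately show ?thesis by (simp add: v span_vector_infinity)
    qed (simp add: v span_vector_affine)
  qed
  moreover have "point_at_infinity \<in> topspace proj_line"
    unfolding topspace_proj_line point_at_infinity_def by (rule imageI) (simp add: vector2_eq_0_iff)
  moreover have "affine_embed x \<in> topspace proj_line" for x
    unfolding topspace_proj_line affine_embed_def by (rule imageI) (simp add: vector2_eq_0_iff)
  ultimately show ?thesis unfolding topspace_proj_line by auto
qed

lemma mob_affine_embed:
  "c * x + d \<noteq> 0 \<Longrightarrow> mob (mat2 a b c d) (affine_embed x) = affine_embed ((a * x + b) / (c * x + d))"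
  using span_vector_affine[of "c * x + d" "a * x + b"]
  by (simp add: affine_embed_def[of x] mob_span mat2_mult_vector)

lemma continuous_map_span:
  assumes "continuous_on S v" "\<And>x. x \<in> S \<Longrightarrow> v x \<noteq> 0"
  shows "continuous_map (top_of_set S) proj_line (\<lambda>x. span {v x})"
proof -
  have "continuous_map (top_of_set (-{0})) proj_line (\<lambda>v. span {v})"
    unfolding proj_line_def by (rule quotient_imp_continuous_map[OF quotient_map_quotient_topology])
  moreover have "continuous_map (top_of_set S) (top_of_set (-{0})) v" using assms by auto
  ultimately show ?thesis using continuous_map_compose[of "top_of_set S" "top_of_set (-{0})" v proj_line "\<lambda>v. span {v}"] by (simp add: o_def)
qed

lemma continuous_on_vector2:
  assumes "continuous_on S f" "continuous_on S g"
  shows "continuous_on S (\<lambda>x. vector [f x, g x] :: real^2)"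
proof -
  have "(\<lambda>x. vector [f x, g x] :: real^2) = (\<lambda>x. f x *\<^sub>R vector [1, 0] + g x *\<^sub>R vector [0, 1])"
    by (auto simp: vec_eq_iff forall_2)
  then show ?thesis using assms by (simp only:) (intro continuous_intros)
qed

lemma continuous_affine_embed: "continuous_map euclideanreal proj_line affine_embed"
proof -
  have "continuous_map (top_of_set UNIV) proj_line (\<lambda>x. span {vector [x, 1] :: real^2})"
    by (rule continuous_map_span) (auto intro!: continuous_on_vector2 continuous_intros simp: vector2_eq_0_iff)
  then show ?thesis by (simp add: affine_embed_def[abs_def])
qed

lemma open_affine_embed:
  assumes "open U"
  shows "openin proj_line (affine_embed ` U)"
proof -
  have "{v. v \<noteq> 0 \<and> span {v} \<in> affine_embed ` U} = {v::real^2. v $ 2 \<noteq> 0} \<inter> (\<lambda>v. v $ 1 / v $ 2) -` U"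
  proof -
    \<comment> \<open>The quotient of the coordinates inverts \<open>affine_embed\<close> off the
      axis where the second coordinate vanishes, and on that axis only the point at infinity
      occurs.\<close>
    have "(v \<noteq> 0 \<and> span {v} \<in> affine_embed ` U) \<longleftrightarrow> (v $ 2 \<noteq> 0 \<and> v $ 1 / v $ 2 \<in> U)" for v :: "real^2"
    proof (cases "v $ 2 = 0")
      case True
      have v: "v = vector [v $ 1, 0]" using True by (simp add: vec_eq_iff forall_2)
      show ?thesis
      proof (cases "v $ 1 = 0")
        case True
        then show ?thesis using v by (auto simp: vec_eq_iff forall_2)
      next
        case False
        then have "span {v} = point_at_infinity" using v span_vector_infinity by metis
        then show ?thesis using True by auto
      qed
    next
      case False
      have "v = vector [v $ 1, v $ 2]" by (simp add: vec_eq_iff forall_2)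
      then have "span {v} = affine_embed (v $ 1 / v $ 2)" using False span_vector_affine by metis
      then show ?thesis using False by (auto simp: image_iff)
    qed
    then show ?thesis by auto
  qed
  moreover have "open {v::real^2. v $ 2 \<noteq> 0}"
    by (intro open_Collect_neq continuous_intros)
  moreover have "continuous_on {v::real^2. v $ 2 \<noteq> 0} (\<lambda>v. v $ 1 / v $ 2)"
    by (intro continuous_intros) auto
  ultimately have "open {v. v \<noteq> 0 \<and> span {v} \<in> affine_embed ` U}"
    using assms by (simp add: continuous_on_open_vimage Int_commute)
  then show ?thesis unfolding openin_proj_line topspace_proj_line_eq by auto
qed

lemma PGL2_topspace: "g \<in> PGL2 \<Longrightarrow> p \<in> topspace proj_line \<Longrightarrow> g p \<in> topspace proj_line"
proof -
  assume g: "g \<in> PGL2" "p \<in> topspace proj_line"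
  then obtain A v where A: "invertible A" "g = mob A" "v \<noteq> 0" "p = span {v}" by (auto simp: PGL2_iff topspace_proj_line)
  then have "A *v v \<noteq> 0" by (metis inj_matrix_vector_mult injD matrix_vector_mult_0_right)
  then show ?thesis using A by (auto simp: mob_span topspace_proj_line)
qed

lemma PGL2_continuous:
  assumes "g \<in> PGL2"
  shows "continuous_map proj_line proj_line g"
proof -
  obtain A where A: "invertible A" "g = mob A" using assms by (auto simp: PGL2_iff)
  have "continuous_map (top_of_set (-{0})) proj_line (\<lambda>v. span {A *v v})"
    by (rule continuous_map_span)
      (auto intro!: linear_continuous_on matrix_vector_mul_bounded_linear, metis A(1) inj_matrix_vector_mult injD matrix_vector_mult_0_right)
  then have "continuous_map (top_of_set (-{0})) proj_line (g \<circ> (\<lambda>v. span {v}))"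
    by (simp add: o_def A mob_span)
  then show ?thesis unfolding proj_line_def
    by (rule continuous_compose_quotient_map[OF quotient_map_quotient_topology])
qed

lemma PGL2_openin:
  assumes g: "g \<in> PGL2" and V: "openin proj_line V"
  shows "openin proj_line (g ` V)"
proof -
  obtain h where h: "h \<in> PGL2" "\<forall>x. h (g x) = x" "\<forall>x. g (h x) = x" using PGL2_inv[OF g] by blast
  have "g ` V = {x \<in> topspace proj_line. h x \<in> V}"
    using h PGL2_topspace[OF g] openin_subset[OF V] by (auto simp: image_iff) (metis)
  then show ?thesis using openin_continuous_map_preimage[OF PGL2_continuous[OF h(1)] V] by simp
qed

lemma PGL2_inj: "g \<in> PGL2 \<Longrightarrow> g p = g p' \<longleftrightarrow> p = p'"
  using PGL2_inv by metis

lemma affine_embed_topspace [simp]: "affine_embed x \<in> topspace proj_line"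
  by (simp add: topspace_proj_line_eq)

subsection \<open>Projective maps are determined by three points\<close>

lemma quadratic_three_roots:
  fixes a b c :: real
  assumes "x \<noteq> y" "y \<noteq> z" "x \<noteq> z"
    "a * x^2 + b * x + c = 0" "a * y^2 + b * y + c = 0" "a * z^2 + b * z + c = 0"
  shows "a = 0 \<and> b = 0 \<and> c = 0"
proof -
  have "(x - y) * (a * (x + y) + b) = 0" "(x - z) * (a * (x + z) + b) = 0"
    using assms(4-6) by algebra+
  then have 1: "a * (x + y) + b = 0" "a * (x + z) + b = 0" using assms(1-3) by auto
  then have "a * (y - z) = 0" by algebra
  then have "a = 0" using assms(2) by simp
  then show ?thesis using 1 assms(4) by auto
qed

text \<open>Equality of the two images of t is a polynomial equation in t of degree at most two.
  Three solutions make its coefficients vanish, which says that the adjugate of B times A is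
  scalar.\<close>

lemma mat2_proportional:
  assumes A: "invertible A" and B: "invertible B" and w: "x \<noteq> y" "y \<noteq> z" "x \<noteq> z"
    and eq: "mob A (affine_embed x) = mob B (affine_embed x)" "mob A (affine_embed y) = mob B (affine_embed y)"
      "mob A (affine_embed z) = mob B (affine_embed z)"
  shows "\<exists>k. k \<noteq> 0 \<and> A = k *\<^sub>R B"
proof -
  obtain a b c d where A': "A = mat2 a b c d" using mat2_eta by blast
  obtain a' b' c' d' where B': "B = mat2 a' b' c' d'" using mat2_eta by blast
  have det: "a * d - b * c \<noteq> 0" "a' * d' - b' * c' \<noteq> 0" using A B by (auto simp: A' B' invertible_mat2)
  have q: "(a * c' - c * a') * t^2 + (a * d' + b * c' - c * b' - d * a') * t + (b * d' - d * b') = 0"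
    if "mob A (affine_embed t) = mob B (affine_embed t)" for t
  proof -
    have "(a * t + b, c * t + d) \<noteq> (0, 0)" "(a' * t + b', c' * t + d') \<noteq> (0, 0)"
      using det by (auto, algebra+)
    moreover have "span {vector [a * t + b, c * t + d] :: real^2} = span {vector [a' * t + b', c' * t + d']}"
      using that by (simp add: A' B' affine_embed_def mob_span mat2_mult_vector)
    ultimately have "(a * t + b) * (c' * t + d') = (c * t + d) * (a' * t + b')"
      by (simp add: span_vector_eq_iff)
    then show ?thesis by algebra
  qed
  have z: "a * c' - c * a' = 0 \<and> a * d' + b * c' - c * b' - d * a' = 0 \<and> b * d' - d * b' = 0"
    by (rule quadratic_three_roots[OF w q[OF eq(1)] q[OF eq(2)] q[OF eq(3)]])
  \<comment> \<open>The scalar is a diagonal entry of the inverse of B times A.\<close>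
  define k where "k = (d' * a - b' * c) / (a' * d' - b' * c')"
  have "a = k * a'" "b = k * b'" "c = k * c'" "d = k * d'"
    unfolding k_def using z det(2) by (simp_all add: field_simps; algebra)+
  moreover from this have "k \<noteq> 0" using det by auto
  ultimately show ?thesis unfolding A' B' by (intro exI[of _ k]) (simp add: vec_eq_iff forall_2)
qed

lemma mob_scaleR:
  assumes "k \<noteq> 0" "p \<in> topspace proj_line"
  shows "mob (k *\<^sub>R B) p = mob B p"
proof -
  obtain v where "p = span {v}" using assms by (auto simp: topspace_proj_line)
  then show ?thesis using span_singleton_scaleR[OF assms(1)]
    by (simp add: mob_span scaleR_matrix_vector_assoc[symmetric])
qed

lemma PGL2_eq_three_points:
  assumes "g \<in> PGL2" "h \<in> PGL2" "x \<noteq> y" "y \<noteq> z" "x \<noteq> z"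
    "g (affine_embed x) = h (affine_embed x)" "g (affine_embed y) = h (affine_embed y)"
    "g (affine_embed z) = h (affine_embed z)" "p \<in> topspace proj_line"
  shows "g p = h p"
proof -
  obtain A B where AB: "invertible A" "g = mob A" "invertible B" "h = mob B" using assms(1,2) by (auto simp: PGL2_iff)
  then obtain k where "k \<noteq> 0" "A = k *\<^sub>R B" using mat2_proportional[OF AB(1,3) assms(3-5)] assms(6-8) by auto
  then show ?thesis using AB mob_scaleR assms(9) by simp
qed

subsection \<open>Developing maps\<close>

text \<open>The local coordinate \<theta> is asked to be a C1 diffeomorphism onto its image, not a
  mere homeomorphism, because the regularity of conjugacies is later read off from it. The factor k
  keeps the coordinate finite where d meets the point at infinity.\<close>

definition developing :: "(real \<Rightarrow> p1) \<Rightarrow> bool" where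
  "developing d \<longleftrightarrow> (\<forall>z. \<exists>k\<in>PGL2. \<exists>e>0. \<exists>\<theta> \<theta>'. inj_on \<theta> (ball z e) \<and> continuous_on (ball z e) \<theta>' \<and>
     (\<forall>y\<in>ball z e. d y = k (affine_embed (\<theta> y)) \<and> (\<theta> has_real_derivative \<theta>' y) (at y) \<and> \<theta>' y \<noteq> 0))"

lemma developingE:
  assumes "developing d"
  obtains k e \<theta> \<theta>' where "k \<in> PGL2" "e > 0" "inj_on \<theta> (ball z e)" "continuous_on (ball z e) \<theta>'"
    "\<And>y. y \<in> ball z e \<Longrightarrow> d y = k (affine_embed (\<theta> y))"
    "\<And>y. y \<in> ball z e \<Longrightarrow> (\<theta> has_real_derivative \<theta>' y) (at y)" "\<And>y. y \<in> ball z e \<Longrightarrow> \<theta>' y \<noteq> 0"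
    "continuous_on (ball z e) \<theta>"
proof -
  obtain k e \<theta> \<theta>' where *: "k \<in> PGL2" "e > 0" "inj_on \<theta> (ball z e)" "continuous_on (ball z e) \<theta>'"
    "\<And>y. y \<in> ball z e \<Longrightarrow> d y = k (affine_embed (\<theta> y))"
    "\<And>y. y \<in> ball z e \<Longrightarrow> (\<theta> has_real_derivative \<theta>' y) (at y)" "\<And>y. y \<in> ball z e \<Longrightarrow> \<theta>' y \<noteq> 0"
    using assms unfolding developing_def by (elim allE[of _ z]) blast
  moreover have "continuous_on (ball z e) \<theta>"
    using *(6) by (meson DERIV_isCont continuous_at_imp_continuous_on)
  ultimately show ?thesis using that by blast
qed

lemma developing_inj:
  assumes "developing d"
  shows "\<exists>e>0. inj_on d (ball z e)"
proof -
  obtain k e \<theta> \<theta>' where *: "k \<in> PGL2" "e > 0" "inj_on \<theta> (ball z e)" "continuous_on (ball z e) \<theta>'"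
    "\<And>y. y \<in> ball z e \<Longrightarrow> d y = k (affine_embed (\<theta> y))"
    "\<And>y. y \<in> ball z e \<Longrightarrow> (\<theta> has_real_derivative \<theta>' y) (at y)" "\<And>y. y \<in> ball z e \<Longrightarrow> \<theta>' y \<noteq> 0"
    "continuous_on (ball z e) \<theta>" by (rule developingE[OF assms, of z]) blast
  have "inj_on d (ball z e)"
    by (rule inj_onI) (use * PGL2_inj in \<open>simp add: inj_on_eq_iff\<close>)
  then show ?thesis using * by blast
qed

lemma developing_topspace: "developing d \<Longrightarrow> d z \<in> topspace proj_line"
  by (erule developingE[where z = z]) (simp add: PGL2_topspace)

lemma developing_open:
  assumes d: "developing d" and U: "open U"
  shows "openin proj_line (d ` U)"
proof (subst openin_subopen, clarify)
  fix z assume z: "z \<in> U"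
  obtain k e \<theta> \<theta>' where *: "k \<in> PGL2" "e > 0" "inj_on \<theta> (ball z e)" "continuous_on (ball z e) \<theta>'"
    "\<And>y. y \<in> ball z e \<Longrightarrow> d y = k (affine_embed (\<theta> y))" 
    "\<And>y. y \<in> ball z e \<Longrightarrow> (\<theta> has_real_derivative \<theta>' y) (at y)" "\<And>y. y \<in> ball z e \<Longrightarrow> \<theta>' y \<noteq> 0"
    "continuous_on (ball z e) \<theta>" by (rule developingE[OF d, of z]) blast
  let ?N = "ball z e \<inter> U"
  have "open (\<theta> ` ?N)"
    by (rule injective_into_1d_imp_open_map_UNIV[of _ "ball z e"]) (use * U in auto)
  then have "openin proj_line (k ` affine_embed ` \<theta> ` ?N)"
    using PGL2_openin[OF *(1)] open_affine_embed by blast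
  moreover have "k ` affine_embed ` \<theta> ` ?N = d ` ?N"
    unfolding image_image using *(5) by (intro image_cong) auto
  ultimately show "\<exists>T. openin proj_line T \<and> d z \<in> T \<and> T \<subseteq> d ` U"
    using z *(2) by (intro exI[of _ "d ` ?N"]) auto
qed

lemma developing_continuous:
  assumes d: "developing d"
  shows "continuous_map euclideanreal proj_line d"
  unfolding continuous_map_def
proof (intro conjI allI impI)
  show "d \<in> topspace euclideanreal \<rightarrow> topspace proj_line" using developing_topspace[OF d] by auto
  fix V assume V: "openin proj_line V"
  have "open {x. d x \<in> V}"
  proof (subst open_subopen, clarify)
    fix z assume z: "d z \<in> V"
    obtain k e \<theta> \<theta>' where *: "k \<in> PGL2" "e > 0" "inj_on \<theta> (ball z e)" "continuous_on (ball z e) \<theta>'"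
    "\<And>y. y \<in> ball z e \<Longrightarrow> d y = k (affine_embed (\<theta> y))" 
    "\<And>y. y \<in> ball z e \<Longrightarrow> (\<theta> has_real_derivative \<theta>' y) (at y)" "\<And>y. y \<in> ball z e \<Longrightarrow> \<theta>' y \<noteq> 0"
    "continuous_on (ball z e) \<theta>" by (rule developingE[OF d, of z]) blast
    have "continuous_map euclideanreal proj_line (k \<circ> affine_embed)"
      using continuous_affine_embed PGL2_continuous[OF *(1)] by (rule continuous_map_compose)
    then have "open {x. k (affine_embed x) \<in> V}"
      using V by (auto simp: continuous_map_def)
    then have "open (ball z e \<inter> \<theta> -` {x. k (affine_embed x) \<in> V})"
      using *(8) continuous_on_open_vimage[of "ball z e" \<theta>] by (metis Int_commute open_ball)
    then show "\<exists>T. open T \<and> z \<in> T \<and> T \<subseteq> {x. d x \<in> V}"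
      using *(2,5) z by (intro exI[of _ "ball z e \<inter> \<theta> -` {x. k (affine_embed x) \<in> V}"]) auto
  qed
  then show "openin euclideanreal {x \<in> topspace euclideanreal. d x \<in> V}" by simp
qed

text \<open>The centre and two symmetric points of a small interval have three distinct images, so
  the two projective maps agree there and hence at every p, also outside the image of d.\<close>

lemma PGL2_eq_on_developing:
  assumes d: "developing d" and g: "g \<in> PGL2" "h \<in> PGL2" and e: "e > 0"
    and eq: "\<And>y. y \<in> ball z e \<Longrightarrow> g (d y) = h (d y)" and p: "p \<in> topspace proj_line"
  shows "g p = h p"
proof -
  obtain k e' \<theta> \<theta>' where *: "k \<in> PGL2" "e' > 0" "inj_on \<theta> (ball z e')" "continuous_on (ball z e') \<theta>'"
    "\<And>y. y \<in> ball z e' \<Longrightarrow> d y = k (affine_embed (\<theta> y))"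
    "\<And>y. y \<in> ball z e' \<Longrightarrow> (\<theta> has_real_derivative \<theta>' y) (at y)" "\<And>y. y \<in> ball z e' \<Longrightarrow> \<theta>' y \<noteq> 0"
    "continuous_on (ball z e') \<theta>" by (rule developingE[OF d, of z]) blast
  obtain k' where k': "k' \<in> PGL2" "\<forall>x. k' (k x) = x" "\<forall>x. k (k' x) = x" using PGL2_inv[OF *(1)] by blast
  define r where "r = min e e' / 2"
  have r: "r > 0" "r < e" "r < e'" using e *(2) by (auto simp: r_def)
  have b: "z \<in> ball z e'" "z + r \<in> ball z e'" "z - r \<in> ball z e'" "z \<in> ball z e" "z + r \<in> ball z e" "z - r \<in> ball z e"
    using r e by (auto simp: dist_real_def)
  have ne: "\<theta> z \<noteq> \<theta> (z + r)" "\<theta> (z + r) \<noteq> \<theta> (z - r)" "\<theta> z \<noteq> \<theta> (z - r)"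
    using *(3) b r(1) by (auto simp: inj_on_eq_iff)
  have e3: "g (k (affine_embed (\<theta> y))) = h (k (affine_embed (\<theta> y)))" if "y \<in> ball z e'" "y \<in> ball z e" for y
    using eq that *(5) by metis
  have "g (k (k' p)) = h (k (k' p))"
    using PGL2_eq_three_points[OF PGL2_comp[OF g(1) *(1)] PGL2_comp[OF g(2) *(1)] ne e3[OF b(1,4)] e3[OF b(2,5)] e3[OF b(3,6)]
      PGL2_topspace[OF k'(1) p]] .
  then show ?thesis by (simp add: k')
qed

text \<open>Analytic continuation: two local projective maps that agree along d on some ball agree
  everywhere, so the points near which g0 works form an open and closed subset of the connected set
  I.\<close>

lemma developing_glue:
  assumes d: "developing d" and I: "open I" "connected I"
    and loc: "\<And>x. x \<in> I \<Longrightarrow> \<exists>g\<in>PGL2. \<exists>e>0. \<forall>y\<in>ball x e. d' y = g (d y)"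
  shows "\<exists>g\<in>PGL2. \<forall>y\<in>I. d' y = g (d y)"
proof (cases "I = {}")
  case True
  then show ?thesis using PGL2_id by blast
next
  case False
  then obtain x0 where x0: "x0 \<in> I" by blast
  obtain g0 e0 where g0: "g0 \<in> PGL2" "e0 > 0" "\<forall>y\<in>ball x0 e0. d' y = g0 (d y)" using loc[OF x0] by blast
  define Q where "Q x \<longleftrightarrow> (\<exists>e>0. \<forall>y\<in>ball x e. d' y = g0 (d y))" for x
  have op: "openin (top_of_set I) {x \<in> I. Q x}"
  proof -
    have "open {x. Q x}"
    proof (rule openI)
      fix x assume "x \<in> {x. Q x}"
      then obtain e where e: "e > 0" "\<forall>y\<in>ball x e. d' y = g0 (d y)" by (auto simp: Q_def)
      have "ball x e \<subseteq> {x. Q x}"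
      proof
        fix x' assume "x' \<in> ball x e"
        then obtain e' where "e' > 0" "ball x' e' \<subseteq> ball x e" by (meson open_ball openE)
        then show "x' \<in> {x. Q x}" using e(2) unfolding Q_def by blast
      qed
      then show "\<exists>e>0. ball x e \<subseteq> {x. Q x}" using e(1) by blast
    qed
    then show ?thesis using I(1) by (simp add: openin_open_eq Collect_conj_eq open_Int)
  qed
  have cl: "openin (top_of_set I) {x \<in> I. \<not> Q x}"
  proof (subst openin_subopen, clarify)
    fix x assume x: "x \<in> I" "\<not> Q x"
    obtain g e where g: "g \<in> PGL2" "e > 0" "\<forall>y\<in>ball x e. d' y = g (d y)" using loc[OF x(1)] by blast
    have "\<not> Q x'" if x': "x' \<in> ball x e" for x'
    proof
      assume "Q x'"
      then obtain e1 where e1: "e1 > 0" "\<forall>y\<in>ball x' e1. d' y = g0 (d y)" by (auto simp: Q_def)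
      obtain e2 where e2: "e2 > 0" "ball x' e2 \<subseteq> ball x e" using x' by (meson open_ball openE)
      have "g p = g0 p" if "p \<in> topspace proj_line" for p
      proof (rule PGL2_eq_on_developing[OF d g(1) g0(1) _ _ that])
        show "min e1 e2 > 0" using e1 e2 by simp
        fix y assume "y \<in> ball x' (min e1 e2)"
        then have "y \<in> ball x' e1" "y \<in> ball x e" using e2(2) by auto
        then show "g (d y) = g0 (d y)" using g(3) e1(2) by metis
      qed
      then have "\<forall>y\<in>ball x e. d' y = g0 (d y)" using g(3) developing_topspace[OF d] by metis
      then show False using x(2) g(2) unfolding Q_def by blast
    qed
    then show "\<exists>T. openin (top_of_set I) T \<and> x \<in> T \<and> T \<subseteq> {x \<in> I. \<not> Q x}"
      using I(1) x(1) g(2) by (intro exI[of _ "I \<inter> ball x e"]) (auto simp: openin_open_Int)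
  qed
  have "I - {x \<in> I. \<not> Q x} = {x \<in> I. Q x}" by auto
  then have "closedin (top_of_set I) {x \<in> I. Q x}"
    using openin_closedin_eq[of "top_of_set I" "{x \<in> I. \<not> Q x}"] cl by simp
  moreover have "{x \<in> I. Q x} \<noteq> {}" using x0 g0 unfolding Q_def by blast
  ultimately have "{x \<in> I. Q x} = I"
    using I(2) op unfolding connected_clopen by blast
  then have Qx: "Q x" if "x \<in> I" for x using that by blast
  have "d' x = g0 (d x)" if "x \<in> I" for x using Qx[OF that] unfolding Q_def by (metis centre_in_ball)
  then show ?thesis using g0 by blast
qed

subsection \<open>Normal forms of homogeneous developing maps\<close>

text \<open>The three cases are orbits of parabolic, hyperbolic and elliptic one-parameter groups.
  Requiring c and r positive removes the identification of a rate with its opposite, so that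
  equivalent normal forms are equal functions.\<close>

definition normal_dev :: "(real \<Rightarrow> p1) \<Rightarrow> bool" where
  "normal_dev D \<longleftrightarrow> D = affine_embed \<or> (\<exists>c>0. D = (\<lambda>x. affine_embed (exp (c * x)))) \<or>
     (\<exists>r>0. D = (\<lambda>x. universal_cover (r * x)))"

lemma normal_dev_cases [consumes 1, case_names parabolic hyperbolic elliptic]:
  assumes "normal_dev D"
  obtains "D = affine_embed" | c where "c > 0" "D = (\<lambda>x. affine_embed (exp (c * x)))"
    | r where "r > 0" "D = (\<lambda>x. universal_cover (r * x))"
  using assms unfolding normal_dev_def by blast

lemma universal_cover_translate:
  "\<exists>g\<in>PGL2. \<forall>x. universal_cover (x + r) = g (universal_cover x)"
proof -
  let ?R = "mat2 (cos (pi * r)) (- sin (pi * r)) (sin (pi * r)) (cos (pi * r))"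
  have "invertible ?R" unfolding invertible_mat2 by (simp flip: power2_eq_square)
  moreover have "universal_cover (x + r) = mob ?R (universal_cover x)" for x
    using universal_cover_xi[of r x] by (simp add: xi_def mob_def mat2_def)
  ultimately show ?thesis using mob_in_PGL2 by blast
qed

text \<open>\<open>universal_cover 0\<close> is the point at infinity. A shift by half a period
  brings it to the affine point 0, around which the coordinate is minus the tangent.\<close>

lemma universal_cover_half: "cos (pi * u) \<noteq> 0 \<Longrightarrow> universal_cover (u + 1/2) = affine_embed (- tan (pi * u))"
proof -
  assume "cos (pi * u) \<noteq> 0"
  moreover have "cos (pi * (u + 1/2)) = - sin (pi * u)" "sin (pi * (u + 1/2)) = cos (pi * u)"
    by (simp_all add: distrib_left cos_add sin_add)
  ultimately show ?thesis
    unfolding universal_cover_def by (simp add: span_vector_affine tan_def)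
qed

lemma normal_dev_translate:
  assumes "normal_dev D"
  shows "\<exists>g\<in>PGL2. \<forall>x. D (x + s) = g (D x)"
  using assms
proof (cases rule: normal_dev_cases)
  case parabolic
  have "affine_embed (x + s) = mob (mat2 1 s 0 1) (affine_embed x)" for x
    by (simp add: mob_affine_embed)
  then show ?thesis using parabolic by (intro bexI[of _ "mob (mat2 1 s 0 1)"]) (auto intro!: mob_in_PGL2 simp: invertible_mat2)
next
  case (hyperbolic c)
  have "affine_embed (exp (c * (x + s))) = mob (mat2 (exp (c * s)) 0 0 1) (affine_embed (exp (c * x)))" for x
    by (simp add: mob_affine_embed exp_add distrib_left mult.commute)
  then show ?thesis using hyperbolic by (intro bexI[of _ "mob (mat2 (exp (c * s)) 0 0 1)"]) (auto intro!: mob_in_PGL2 simp: invertible_mat2)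
next
  case (elliptic r)
  then show ?thesis using universal_cover_translate[of "r * s"] by (simp add: distrib_left) (metis)
qed

lemma universal_cover_reflect: "universal_cover (- x) = mob (mat2 1 0 0 (-1)) (universal_cover x)"
  by (simp add: universal_cover_def mob_span mat2_mult_vector)

lemma affine_exp_reflect: "affine_embed (exp (- y)) = mob (mat2 0 1 1 0) (affine_embed (exp y))"
  by (simp add: mob_affine_embed exp_minus inverse_eq_divide)

text \<open>The projective maps are x -> -x, x -> 1 / x and the reflection of the plane in its first
  axis. They exist for every normal form, which is why a structure built from the rotations is also
  preserved by the reflections.\<close>

lemma normal_dev_reflect:
  assumes "normal_dev D"
  shows "\<exists>g\<in>PGL2. \<forall>x. D (- x) = g (D x)"
  using assms
proof (cases rule: normal_dev_cases)
  case parabolic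
  have "affine_embed (- x) = mob (mat2 (-1) 0 0 1) (affine_embed x)" for x
    by (simp add: mob_affine_embed)
  then show ?thesis using parabolic by (intro bexI[of _ "mob (mat2 (-1) 0 0 1)"]) (auto intro!: mob_in_PGL2 simp: invertible_mat2)
next
  case (hyperbolic c)
  then show ?thesis using affine_exp_reflect
    by (intro bexI[of _ "mob (mat2 0 1 1 0)"]) (auto intro!: mob_in_PGL2 simp: invertible_mat2)
next
  case (elliptic r)
  then show ?thesis using universal_cover_reflect
    by (intro bexI[of _ "mob (mat2 1 0 0 (-1))"]) (auto intro!: mob_in_PGL2 simp: invertible_mat2)
qed

lemma developing_affine_embed: "developing affine_embed"
  unfolding developing_def
  by (rule allI, rule bexI[OF _ PGL2_id], rule exI[of _ 1], rule conjI, simp, rule exI[of _ "\<lambda>x. x"], rule exI[of _ "\<lambda>x. 1"]) auto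

lemma normal_dev_developing:
  assumes "normal_dev D"
  shows "developing D"
  using assms
proof (cases rule: normal_dev_cases)
  case parabolic
  then show ?thesis using developing_affine_embed by simp
next
  case (hyperbolic c)
  show ?thesis unfolding developing_def
  proof (intro allI bexI[OF _ PGL2_id] exI conjI ballI)
    fix z y :: real
    show "(1::real) > 0" by simp
    show "inj_on (\<lambda>x. exp (c * x)) (ball z 1)" using hyperbolic by (auto simp: inj_on_def)
    show "continuous_on (ball z 1) (\<lambda>x. exp (c * x) * c)" by (intro continuous_intros)
    show "D y = affine_embed (exp (c * y))" using hyperbolic by simp
    show "((\<lambda>x. exp (c * x)) has_real_derivative exp (c * y) * c) (at y)"
      by (auto intro!: derivative_eq_intros)
    show "exp (c * y) * c \<noteq> 0" using hyperbolic by simp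
  qed
next
  case (elliptic r)
  show ?thesis unfolding developing_def
  proof
    fix z
    \<comment> \<open>The shift moves the base point z to the middle of the chart by minus the
      tangent: the argument becomes \<open>r * (y - z) + 1/2\<close>.\<close>
    obtain g where g: "g \<in> PGL2" "\<And>x. universal_cover (x + (r * z - 1/2)) = g (universal_cover x)"
      using universal_cover_translate by blast
    let ?\<theta> = "\<lambda>y. - tan (pi * (r * (y - z)))"
    \<comment> \<open>With this radius the angle stays strictly between -pi/2 and pi/2, where tan is
      finite and injective.\<close>
    let ?e = "1 / (2 * r)"
    have arg: "\<bar>pi * (r * (y - z))\<bar> < pi / 2" if "y \<in> ball z ?e" for y
    proof -
      have "\<bar>y - z\<bar> < ?e" using that by (simp add: dist_real_def abs_minus_commute)
      then have "r * \<bar>y - z\<bar> < 1/2" using elliptic(1) by (simp add: field_simps)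
      then have "pi * (r * \<bar>y - z\<bar>) < pi * (1/2)" by (intro mult_strict_left_mono) auto
      then show ?thesis using elliptic(1) by (simp add: abs_mult)
    qed
    have cn: "cos (pi * (r * (y - z))) > 0" if "y \<in> ball z ?e" for y
      using arg[OF that] unfolding abs_less_iff by (intro cos_gt_zero_pi) linarith+
    have "inj_on ?\<theta> (ball z ?e)"
    proof (rule inj_onI)
      fix x y assume x: "x \<in> ball z ?e" "y \<in> ball z ?e" "?\<theta> x = ?\<theta> y"
      have "arctan (tan (pi * (r * (x - z)))) = pi * (r * (x - z))" "arctan (tan (pi * (r * (y - z)))) = pi * (r * (y - z))"
        using arg[OF x(1)] arg[OF x(2)] unfolding abs_less_iff by (intro arctan_tan; linarith)+
      moreover have "tan (pi * (r * (x - z))) = tan (pi * (r * (y - z)))"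
        using x(3) by (simp only: neg_equal_iff_equal)
      ultimately have "pi * (r * (x - z)) = pi * (r * (y - z))" by metis
      then show "x = y" using elliptic(1) pi_neq_zero by (simp only: mult_cancel_left) auto
    qed
    moreover have "continuous_on (ball z ?e) (\<lambda>y. - (inverse ((cos (pi * (r * (y - z))))\<^sup>2) * (pi * r)))"
      by (intro continuous_intros) (use cn in force)
    moreover have "D y = g (affine_embed (?\<theta> y))" if "y \<in> ball z ?e" for y
    proof -
      have "D y = universal_cover ((r * (y - z) + 1/2) + (r * z - 1/2))" by (simp add: elliptic algebra_simps)
      also have "\<dots> = g (universal_cover (r * (y - z) + 1/2))" by (rule g)
      finally show ?thesis using universal_cover_half cn[OF that] by simp
    qed
    moreover have "(?\<theta> has_real_derivative - (inverse ((cos (pi * (r * (y - z))))\<^sup>2) * (pi * r))) (at y)"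
      if "y \<in> ball z ?e" for y
      using cn[OF that] by (auto intro!: derivative_eq_intros)
    moreover have "- (inverse ((cos (pi * (r * (y - z))))\<^sup>2) * (pi * r)) \<noteq> 0" if "y \<in> ball z ?e" for y
      using cn[OF that] elliptic(1) by simp
    moreover have "?e > 0" using elliptic by simp
    ultimately show "\<exists>k\<in>PGL2. \<exists>e>0. \<exists>\<theta> \<theta>'. inj_on \<theta> (ball z e) \<and> continuous_on (ball z e) \<theta>' \<and>
       (\<forall>y\<in>ball z e. D y = k (affine_embed (\<theta> y)) \<and> (\<theta> has_real_derivative \<theta>' y) (at y) \<and> \<theta>' y \<noteq> 0)"
      using g(1) by blast
  qed
qed

section \<open>Local one-parameter families of projective maps\<close>

text \<open>A positive maximum m is impossible: for m in the left half, f doubles at 2m; for m in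
  the right half, \<open>f a = 0\<close> gives f (a - m) = - f m, whence f (2m - a) = 2 f m.\<close>

lemma local_additive_nonpos:
  fixes f :: "real \<Rightarrow> real"
  assumes a: "a > 0" and cont: "continuous_on {0..a} f" and fa: "f a = 0"
    and add: "\<And>x y. 0 \<le> x \<Longrightarrow> 0 \<le> y \<Longrightarrow> x + y \<le> a \<Longrightarrow> f (x + y) = f x + f y"
    and x: "0 \<le> x" "x \<le> a"
  shows "f x \<le> 0"
proof (rule ccontr)
  assume neg: "\<not> f x \<le> 0"
  obtain m where m: "m \<in> {0..a}" "\<And>y. y \<in> {0..a} \<Longrightarrow> f y \<le> f m"
    using continuous_attains_sup[OF compact_Icc _ cont] a by auto
  have pos: "f m > 0" using m(2)[of x] x neg by auto
  show False
  proof (cases "m \<le> a / 2")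
    case True
    then have "f (m + m) = f m + f m" using m by (intro add) auto
    then show False using m(2)[of "m + m"] m(1) True pos by auto
  next
    case False
    have "f m = f (2 * m - a) + f (a - m)" using add[of "2 * m - a" "a - m"] m False by auto
    moreover have "f a = f m + f (a - m)" using add[of m "a - m"] m by auto
    ultimately show False using m(2)[of "2 * m - a"] m(1) False pos fa by auto
  qed
qed

text \<open>The linear function with the same value at d / 2 is subtracted, and the preceding sign
  argument applies to the difference and to its negative. Negative x follow because f is
  odd.\<close>

lemma local_additive_linear:
  fixes f :: "real \<Rightarrow> real"
  assumes d: "d > 0" and cont: "continuous_on (ball 0 d) f"
    and add: "\<And>x y. \<bar>x\<bar> < d \<Longrightarrow> \<bar>y\<bar> < d \<Longrightarrow> \<bar>x + y\<bar> < d \<Longrightarrow> f (x + y) = f x + f y"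
  obtains c where "\<And>x. \<bar>x\<bar> \<le> d / 2 \<Longrightarrow> f x = c * x"
proof -
  define a where "a = d / 2"
  have a: "a > 0" "a < d" using d by (auto simp: a_def)
  obtain c where c: "f a = c * a" using a by (metis nonzero_divide_eq_eq less_irrefl)
  have ca: "continuous_on {0..a} f" using cont by (rule continuous_on_subset) (use a in \<open>auto simp: dist_real_def\<close>)
  have pos: "f x = c * x" if x: "0 \<le> x" "x \<le> a" for x
  proof -
    have "f x - c * x \<le> 0"
    proof (rule local_additive_nonpos[OF a(1), where f = "\<lambda>x. f x - c * x" and x = x])
      show "continuous_on {0..a} (\<lambda>x. f x - c * x)" by (intro continuous_intros ca)
    qed (use a x add c in \<open>auto simp: algebra_simps\<close>)
    moreover have "- (f x - c * x) \<le> 0"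
    proof (rule local_additive_nonpos[OF a(1), where f = "\<lambda>x. - (f x - c * x)" and x = x])
      show "continuous_on {0..a} (\<lambda>x. - (f x - c * x))" by (intro continuous_intros ca)
    qed (use a x add c in \<open>auto simp: algebra_simps\<close>)
    ultimately show ?thesis by simp
  qed
  have f0: "f 0 = 0" using add[of 0 0] d by simp
  have "f x = c * x" if x: "\<bar>x\<bar> \<le> d / 2" for x
  proof (cases "x \<ge> 0")
    case True then show ?thesis using pos x by (simp add: a_def)
  next
    case False
    have "f (x + - x) = f x + f (- x)" using x d by (intro add) auto
    then show ?thesis using f0 pos[of "- x"] x False by (simp add: a_def)
  qed
  then show ?thesis using that by blast
qed

lemma mob_affine_embed_eqD:
  assumes "invertible (mat2 a b c d)" "mob (mat2 a b c d) (affine_embed x) = affine_embed y"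
  shows "c * x + d \<noteq> 0" "(c * x + d) * y = a * x + b"
proof -
  have ne: "(a * x + b, c * x + d) \<noteq> (0, 0)"
    using assms(1) unfolding invertible_mat2 by (auto, algebra+)
  have "span {vector [a * x + b, c * x + d] :: real^2} = span {vector [y, 1]}"
    using assms(2) by (simp add: affine_embed_def mob_span mat2_mult_vector)
  then have eq: "a * x + b = (c * x + d) * y" using ne by (simp add: span_vector_eq_iff)
  then show "(c * x + d) * y = a * x + b" by simp
  show "c * x + d \<noteq> 0" using eq ne by auto
qed

text \<open>For k = 0, k > 0 and k < 0 the law is the addition theorem of a linear function, of the
  hyperbolic tangent and of the tangent. In the last two cases a logarithm of the Cayley transform,
  respectively arctan, makes it additive, hence linear near 0.\<close>

lemma normal_form_of_addition_law:
  fixes v :: "real \<Rightarrow> real"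
  assumes d: "d > 0" and cont: "continuous_on (ball 0 d) v" and v0: "v 0 = 0"
    and nz: "\<And>t. \<bar>t\<bar> < d \<Longrightarrow> t \<noteq> 0 \<Longrightarrow> v t \<noteq> 0"
    and law: "\<And>s t. \<bar>s\<bar> < d \<Longrightarrow> \<bar>t\<bar> < d \<Longrightarrow> \<bar>s + t\<bar> < d \<Longrightarrow> v (s + t) * (1 + k * v s * v t) = v s + v t"
  shows "\<exists>D e g. normal_dev D \<and> e > 0 \<and> g \<in> PGL2 \<and> (\<forall>t. \<bar>t\<bar> < e \<longrightarrow> affine_embed (v t) = g (D t))"
proof -
  have small: "\<exists>e>0. e \<le> d \<and> (\<forall>t. \<bar>t\<bar> < e \<longrightarrow> \<bar>v t\<bar> < b)" if b: "b > 0" for b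
  proof -
    have "isCont v 0" using cont d by (simp add: continuous_on_eq_continuous_at)
    then obtain e where e: "e > 0" "\<forall>t. dist t 0 < e \<longrightarrow> dist (v t) (v 0) < b"
      using b unfolding continuous_at_eps_delta by blast
    then show ?thesis using d v0 by (intro exI[of _ "min e d"]) (auto simp: dist_real_def)
  qed
  consider "k = 0" | "k > 0" | "k < 0" by linarith
  then show ?thesis
  proof cases
    case 1
    obtain c where c: "\<And>x. \<bar>x\<bar> \<le> d / 2 \<Longrightarrow> v x = c * x"
      by (rule local_additive_linear[OF d cont]) (use law 1 in auto)
    have "c \<noteq> 0" using c[of "d / 2"] nz[of "d / 2"] d by auto
    then have "mob (mat2 c 0 0 1) \<in> PGL2" by (intro mob_in_PGL2) (simp add: invertible_mat2)
    moreover have "affine_embed (v t) = mob (mat2 c 0 0 1) (affine_embed t)" if "\<bar>t\<bar> < d / 2" for t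
      using c that by (simp add: mob_affine_embed)
    moreover have "normal_dev affine_embed" by (simp add: normal_dev_def)
    ultimately show ?thesis using d by (intro exI[of _ affine_embed] exI[of _ "d / 2"]) auto
  next
    case 2
    define \<kappa> where "\<kappa> = sqrt k"
    have \<kappa>: "\<kappa> > 0" "\<kappa> * \<kappa> = k" using 2 by (auto simp: \<kappa>_def)
    obtain e where e: "e > 0" "e \<le> d" "\<And>t. \<bar>t\<bar> < e \<Longrightarrow> \<bar>v t\<bar> < 1 / \<kappa>"
      using small[of "1 / \<kappa>"] \<kappa> by auto
    have lt1: "\<bar>\<kappa> * v t\<bar> < 1" if "\<bar>t\<bar> < e" for t
      using e(3)[OF that] \<kappa>(1) by (simp add: abs_mult field_simps)
    \<comment> \<open>Cayley transform of \<open>\<kappa> * v\<close>: the addition theorem of the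
      hyperbolic tangent becomes multiplicativity.\<close>
    define E where "E t = (1 + \<kappa> * v t) / (1 - \<kappa> * v t)" for t
    have Epos: "E t > 0" if "\<bar>t\<bar> < e" for t
      using lt1[OF that] by (auto simp: E_def abs_less_iff)
    have Emult: "E (s + t) = E s * E t" if st: "\<bar>s\<bar> < e" "\<bar>t\<bar> < e" "\<bar>s + t\<bar> < e" for s t
    proof -
      have l: "v (s + t) * (1 + k * v s * v t) = v s + v t" using st e(2) by (intro law) auto
      have ne: "1 - \<kappa> * v s \<noteq> 0" "1 - \<kappa> * v t \<noteq> 0" "1 - \<kappa> * v (s + t) \<noteq> 0"
        using lt1 st by (force simp: abs_less_iff)+
      have "(1 + \<kappa> * v (s + t)) * ((1 - \<kappa> * v s) * (1 - \<kappa> * v t)) =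
          ((1 + \<kappa> * v s) * (1 + \<kappa> * v t)) * (1 - \<kappa> * v (s + t))"
        using l \<kappa>(2) by algebra
      then show ?thesis unfolding E_def times_divide_times_eq using ne by (subst frac_eq_eq) auto
    qed
    have "continuous_on (ball 0 e) (\<lambda>t. ln (E t))"
    proof -
      have "continuous_on (ball 0 e) v" using cont e(2) by (auto intro: continuous_on_subset)
      moreover have "1 - \<kappa> * v t \<noteq> 0" if "t \<in> ball 0 e" for t using lt1[of t] that by auto
      ultimately have "continuous_on (ball 0 e) E" unfolding E_def by (intro continuous_intros) auto
      then show ?thesis using Epos by (intro continuous_intros) (auto simp: less_imp_neq[symmetric] dest: Epos)
    qed
    then obtain c where c: "\<And>x. \<bar>x\<bar> \<le> e / 2 \<Longrightarrow> ln (E x) = c * x"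
      by (rule local_additive_linear[OF e(1)]) (use Emult Epos in \<open>auto simp: ln_mult_pos\<close>)
    have Ex: "E x = exp (c * x)" if "\<bar>x\<bar> < e / 2" for x
      using c[of x] Epos[of x] that by (metis abs_ge_zero exp_ln field_sum_of_halves less_add_same_cancel1 less_imp_le order.strict_trans1 order_less_trans)
    \<comment> \<open>The matrix inverts the Cayley transform: v = (E - 1) / (\<kappa> E +
      \<kappa>).\<close>
    have vE: "affine_embed (v t) = mob (mat2 1 (-1) \<kappa> \<kappa>) (affine_embed (exp (c * t)))" if t: "\<bar>t\<bar> < e / 2" for t
    proof -
      have "1 - \<kappa> * v t \<noteq> 0" using lt1[of t] t e(1) by auto
      then have "E t * (1 - \<kappa> * v t) = 1 + \<kappa> * v t" by (simp add: E_def)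
      then have "v t * (\<kappa> * E t + \<kappa>) = E t - 1" by algebra
      moreover have "E t > 0" using Epos[of t] t e(1) by auto
      then have "\<kappa> * E t + \<kappa> > 0" using \<kappa>(1) by (simp add: add_pos_pos)
      then have "\<kappa> * E t + \<kappa> \<noteq> 0" by simp
      ultimately show ?thesis using Ex[OF t] by (subst mob_affine_embed) (auto simp: field_simps)
    qed
    have inv: "mob (mat2 1 (-1) \<kappa> \<kappa>) \<in> PGL2" by (intro mob_in_PGL2) (use \<kappa> in \<open>simp add: invertible_mat2\<close>)
    have "c \<noteq> 0"
    proof
      assume "c = 0"
      then have "E (e / 4) = 1" using Ex[of "e / 4"] e(1) by auto
      then have "\<kappa> * v (e / 4) = 0" using lt1[of "e / 4"] e(1) by (auto simp: E_def field_simps)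
      then show False using nz[of "e / 4"] e \<kappa> by auto
    qed
    then consider "c > 0" | "c < 0" by linarith
    then show ?thesis
    proof cases
      case 1
      then have "normal_dev (\<lambda>x. affine_embed (exp (c * x)))" by (auto simp: normal_dev_def)
      then show ?thesis using vE inv e(1)
        by (intro exI[of _ "\<lambda>x. affine_embed (exp (c * x))"] exI[of _ "e / 2"] exI[of _ "mob (mat2 1 (-1) \<kappa> \<kappa>)"]) auto
    next
      \<comment> \<open>A negative rate is made positive by x -> 1 / x, at the price of one more
        projective factor.\<close>
      case 2
      then have n: "normal_dev (\<lambda>x. affine_embed (exp (- c * x)))" unfolding normal_dev_def by (intro disjI2 disjI1 exI[of _ "- c"]) auto
      have "mob (mat2 0 1 1 0) \<in> PGL2" by (intro mob_in_PGL2) (simp add: invertible_mat2)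
      then have g: "(\<lambda>p. mob (mat2 1 (-1) \<kappa> \<kappa>) (mob (mat2 0 1 1 0) p)) \<in> PGL2" (is "?g \<in> _") using inv PGL2_comp by blast
      have "affine_embed (v t) = ?g (affine_embed (exp (- c * t)))" if "\<bar>t\<bar> < e / 2" for t
        using vE[OF that] affine_exp_reflect[of "- c * t"] by simp
      then show ?thesis using n g e(1)
        by (intro exI[of _ "\<lambda>x. affine_embed (exp (- c * x))"] exI[of _ "e / 2"] exI[of _ ?g]) auto
    qed
  next
    case 3
    define \<kappa> where "\<kappa> = sqrt (- k)"
    have \<kappa>: "\<kappa> > 0" "\<kappa> * \<kappa> = - k" using 3 by (auto simp: \<kappa>_def)
    obtain e where e: "e > 0" "e \<le> d" "\<And>t. \<bar>t\<bar> < e \<Longrightarrow> \<bar>v t\<bar> < 1 / \<kappa>"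
      using small[of "1 / \<kappa>"] \<kappa> by auto
    have lt1: "\<bar>\<kappa> * v t\<bar> < 1" if "\<bar>t\<bar> < e" for t
      using e(3)[OF that] \<kappa>(1) by (simp add: abs_mult field_simps)
    have add: "arctan (\<kappa> * v (s + t)) = arctan (\<kappa> * v s) + arctan (\<kappa> * v t)"
      if st: "\<bar>s\<bar> < e" "\<bar>t\<bar> < e" "\<bar>s + t\<bar> < e" for s t
    proof -
      have l: "v (s + t) * (1 + k * v s * v t) = v s + v t" using st e(2) by (intro law) auto
      \<comment> \<open>Both factors are below 1 in absolute value, which keeps the sum of the two
        arctangents on the principal branch; no multiple of pi enters.\<close>
      have "\<bar>(\<kappa> * v s) * (\<kappa> * v t)\<bar> < 1 * 1"
        unfolding abs_mult[of "\<kappa> * v s"] by (intro mult_strict_mono lt1 st) auto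
      then have ne: "1 - (\<kappa> * v s) * (\<kappa> * v t) \<noteq> 0" by auto
      have "\<kappa> * v (s + t) * (1 - (\<kappa> * v s) * (\<kappa> * v t)) = \<kappa> * v s + \<kappa> * v t"
        using l \<kappa>(2) by algebra
      then have "\<kappa> * v (s + t) = (\<kappa> * v s + \<kappa> * v t) / (1 - (\<kappa> * v s) * (\<kappa> * v t))"
        using ne by (simp add: eq_divide_eq)
      then show ?thesis using arctan_add[of "\<kappa> * v s" "\<kappa> * v t"] lt1 st by (simp add: less_imp_le)
    qed
    have "continuous_on (ball 0 e) (\<lambda>t. arctan (\<kappa> * v t))"
      using cont e(2) by (intro continuous_intros) (auto intro: continuous_on_subset)
    then obtain c where c: "\<And>x. \<bar>x\<bar> \<le> e / 2 \<Longrightarrow> arctan (\<kappa> * v x) = c * x"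
      by (rule local_additive_linear[OF e(1)]) (use add in auto)
    \<comment> \<open>Division by pi cancels the factor in \<open>universal_cover\<close>; the
      matrix sends the direction of angle \<open>c * t\<close> to its tangent divided by
      \<kappa>.\<close>
    have vE: "affine_embed (v t) = mob (mat2 0 1 \<kappa> 0) (universal_cover (c / pi * t))" if t: "\<bar>t\<bar> < e / 2" for t
    proof -
      have ct: "arctan (\<kappa> * v t) = c * t" using c t by auto
      then have tn: "\<kappa> * v t = tan (c * t)" by (metis tan_arctan)
      have "cos (c * t) > 0" using ct arctan_lbound arctan_ubound by (metis cos_gt_zero_pi)
      then have "sin (c * t) = (\<kappa> * v t) * cos (c * t)" using tn by (simp add: tan_def)
      moreover have "(v t, 1 :: real) \<noteq> (0, 0)" "(sin (c * t), \<kappa> * cos (c * t)) \<noteq> (0, 0)" using \<open>cos (c * t) > 0\<close> \<kappa> by auto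
      ultimately show ?thesis
        by (simp add: universal_cover_def mob_span mat2_mult_vector affine_embed_def span_vector_eq_iff)
    qed
    have inv: "mob (mat2 0 1 \<kappa> 0) \<in> PGL2" by (intro mob_in_PGL2) (use \<kappa> in \<open>simp add: invertible_mat2\<close>)
    have "c \<noteq> 0"
    proof
      assume "c = 0"
      then have "arctan (\<kappa> * v (e / 4)) = 0" using c[of "e / 4"] e(1) by auto
      then show False using nz[of "e / 4"] e \<kappa> by auto
    qed
    then consider "c > 0" | "c < 0" by linarith
    then show ?thesis
    proof cases
      case 1
      then have "normal_dev (\<lambda>x. universal_cover (c / pi * x))"
        unfolding normal_dev_def by (intro disjI2 exI[of _ "c / pi"]) auto
      then show ?thesis using vE inv e(1)
        by (intro exI[of _ "\<lambda>x. universal_cover (c / pi * x)"] exI[of _ "e / 2"] exI[of _ "mob (mat2 0 1 \<kappa> 0)"]) auto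
    next
      case 2
      then have n: "normal_dev (\<lambda>x. universal_cover (- c / pi * x))"
        unfolding normal_dev_def by (intro disjI2 exI[of _ "- c / pi"]) (auto simp: divide_neg_pos)
      have "mob (mat2 1 0 0 (-1)) \<in> PGL2" by (intro mob_in_PGL2) (simp add: invertible_mat2)
      then have g: "(\<lambda>p. mob (mat2 0 1 \<kappa> 0) (mob (mat2 1 0 0 (-1)) p)) \<in> PGL2" (is "?g \<in> _") using inv PGL2_comp by blast
      have "affine_embed (v t) = ?g (universal_cover (- c / pi * t))" if "\<bar>t\<bar> < e / 2" for t
        using vE[OF that] universal_cover_reflect[of "- c / pi * t"] by simp
      then show ?thesis using n g e(1)
        by (intro exI[of _ "\<lambda>x. universal_cover (- c / pi * x)"] exI[of _ "e / 2"] exI[of _ ?g]) auto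
    qed
  qed
qed

text \<open>The translations of a chart form a commuting family of projective maps, hence lie in the algebra
  generated by one traceless matrix \<open>N = (n, q; r, - n)\<close> with \<open>N\<^sup>2 = k I\<close>. In the coordinate
  \<open>v = w / (q + n w)\<close> the family becomes the addition law of the tangent functions.\<close>

lemma local_normal_form:
  fixes w :: "real \<Rightarrow> real"
  assumes e: "e > 0" and inj: "inj_on w (ball 0 (2 * e))" and cont: "continuous_on (ball 0 (2 * e)) w" and w0: "w 0 = 0"
    and M: "\<And>s. \<bar>s\<bar> < e \<Longrightarrow> \<exists>g\<in>PGL2. \<forall>y. \<bar>y\<bar> < e \<longrightarrow> affine_embed (w (y + s)) = g (affine_embed (w y))"
  shows "\<exists>D e' g. normal_dev D \<and> e' > 0 \<and> g \<in> PGL2 \<and> (\<forall>t. \<bar>t\<bar> < e' \<longrightarrow> affine_embed (w t) = g (D t))"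
proof -
  have "\<exists>A. invertible A \<and> (\<forall>y. \<bar>y\<bar> < e \<longrightarrow> affine_embed (w (y + s)) = mob A (affine_embed (w y)))" if "\<bar>s\<bar> < e" for s
    using M[OF that] by (auto simp: PGL2_iff)
  then obtain T where T: "\<And>s. \<bar>s\<bar> < e \<Longrightarrow> invertible (T s)"
      "\<And>s y. \<bar>s\<bar> < e \<Longrightarrow> \<bar>y\<bar> < e \<Longrightarrow> mob (T s) (affine_embed (w y)) = affine_embed (w (y + s))"
    by metis
  have w_ne: "w x \<noteq> w y" if "\<bar>x\<bar> < 2 * e" "\<bar>y\<bar> < 2 * e" "x \<noteq> y" for x y
    using inj that by (auto simp: inj_on_eq_iff)
  \<comment> \<open>The parameters 0, e/4 and -e/4 supply the three points at which two matrices are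
    compared.\<close>
  have propo: "\<exists>k. k \<noteq> 0 \<and> A = k *\<^sub>R B" if "invertible A" "invertible B"
      "\<And>y. \<bar>y\<bar> < e / 2 \<Longrightarrow> mob A (affine_embed (w y)) = mob B (affine_embed (w y))" for A B
    by (rule mat2_proportional[OF that(1,2), of "w 0" "w (e / 4)" "w (- e / 4)"]) (use e w_ne that(3) in auto)
  have comp: "mob (T s ** T t) (affine_embed (w y)) = affine_embed (w (y + (s + t)))"
    if "\<bar>s\<bar> < e / 2" "\<bar>t\<bar> < e / 2" "\<bar>y\<bar> < e / 2" for s t y
    using that T(2)[of t y] T(2)[of s "y + t"] by (simp add: mob_mob[symmetric] add_ac)
  \<comment> \<open>Some small translation has nonzero trace: a traceless matrix squares to minus
    its determinant times the identity, so if the matrix at e/8 is traceless, the one at e/4 is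
    not.\<close>
  obtain p q r u s1 where A: "T s1 = mat2 p q r u" "\<bar>s1\<bar> < e / 2" "s1 \<noteq> 0" "p + u \<noteq> 0"
  proof -
    obtain a b c d where B: "T (e / 8) = mat2 a b c d" using mat2_eta by blast
    obtain a' b' c' d' where C: "T (e / 4) = mat2 a' b' c' d'" using mat2_eta by blast
    have "\<exists>k. k \<noteq> 0 \<and> T (e / 4) = k *\<^sub>R (T (e / 8) ** T (e / 8))"
      by (rule propo) (use e T comp[of "e / 8" "e / 8"] in \<open>auto intro: invertible_mult\<close>)
    then obtain k where "k \<noteq> 0" "a' = k * (a * a + b * c)" "d' = k * (c * b + d * d)"
      unfolding B C mat2_mult by (auto simp: vec_eq_iff forall_2)
    moreover have "a * d - b * c \<noteq> 0" using T(1)[of "e / 8"] e by (simp add: B invertible_mat2)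
    ultimately have "a + d \<noteq> 0 \<or> a' + d' \<noteq> 0" by algebra
    then show ?thesis
    proof
      assume "a + d \<noteq> 0" then show ?thesis using that[OF B] e by auto
    next
      assume "a' + d' \<noteq> 0" then show ?thesis using that[OF C] e by auto
    qed
  qed
  have "invertible (T s1)" "mob (T s1) (affine_embed (w 0)) = affine_embed (w s1)"
    using T(1)[of s1] T(2)[of s1 0] A(2) e by auto
  \<comment> \<open>The map sends 0 to w s1, which is not 0; so the upper right entry q cannot
    vanish and may serve as a divisor.\<close>
  from mob_affine_embed_eqD[OF this[unfolded A(1)]] have "u * w s1 = q" "u \<noteq> 0" by (auto simp: w0)
  moreover have "w s1 \<noteq> 0" using w_ne[of s1 0] A e w0 by auto
  ultimately have q: "q \<noteq> 0" by auto
  define n where "n = (p - u) / 2"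
  define k where "k = n^2 + q * r"
  have fam: "\<exists>\<alpha> \<beta>. T t = mat2 (\<alpha> + \<beta> * n) (\<beta> * q) (\<beta> * r) (\<alpha> - \<beta> * n)" if t: "\<bar>t\<bar> < e / 2" for t
  proof -
    obtain a b c d where B: "T t = mat2 a b c d" using mat2_eta by blast
    have inv: "invertible (T s1)" "invertible (T t)" using T(1) t A(2) e by auto
    have "\<exists>k. k \<noteq> 0 \<and> T s1 ** T t = k *\<^sub>R (T t ** T s1)"
    proof (rule propo)
      show "mob (T s1 ** T t) (affine_embed (w y)) = mob (T t ** T s1) (affine_embed (w y))" if "\<bar>y\<bar> < e / 2" for y
        using comp[OF A(2) t that] comp[OF t A(2) that] by (simp add: add.commute)
    qed (use inv invertible_mult in auto)
    then obtain l where l: "l \<noteq> 0" "p * a + q * c = l * (a * p + b * r)" "p * b + q * d = l * (a * q + b * u)"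
      "r * a + u * c = l * (c * p + d * r)" "r * b + u * d = l * (c * q + d * u)"
      unfolding A(1) B mat2_mult by (auto simp: vec_eq_iff forall_2)
    have det: "a * d - b * c \<noteq> 0" using T(1)[of t] t e by (simp add: B invertible_mat2)
    \<comment> \<open>So far the two matrices commute only up to a scalar l. Conjugation preserves
      the trace, which is nonzero for T s1; hence l = 1.\<close>
    have "(a * d - b * c) * (p + u) = l * ((a * d - b * c) * (p + u))"
      using l(2-5) by algebra
    then have "l = 1" using det A(4) by simp
    then have eqs: "q * c = b * r" "q * (a - d) = b * (p - u)" using l(2-5) by (auto simp: algebra_simps)
    have "a = (a + d) / 2 + (b / q) * n" "b = (b / q) * q" "c = (b / q) * r" "d = (a + d) / 2 - (b / q) * n"
      using eqs q by (simp_all add: n_def field_simps)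
    then show ?thesis unfolding B by metis
  qed
  define v where "v t = w t / (q + n * w t)" for t
  have "isCont (\<lambda>t. q + n * w t) 0"
    using cont e by (intro continuous_intros) (simp add: continuous_on_eq_continuous_at)
  then obtain e' where "e' > 0" "\<forall>t. dist t 0 < e' \<longrightarrow> dist (q + n * w t) (q + n * w 0) < \<bar>q\<bar>"
    using q unfolding continuous_at_eps_delta by (metis zero_less_abs_iff)
  then have e': "e' > 0" "\<And>t. \<bar>t\<bar> < e' \<Longrightarrow> \<bar>(q + n * w t) - q\<bar> < \<bar>q\<bar>"
    by (auto simp: dist_real_def w0)
  define d where "d = min e' (e / 2)"
  have d: "d > 0" "d \<le> e / 2" "d \<le> e'" using e' e by (auto simp: d_def)
  have den: "q + n * w t \<noteq> 0" if "\<bar>t\<bar> < d" for t using e'(2)[of t] that d by auto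
  \<comment> \<open>v t is the ratio of the coefficient of N to that of the identity in T t. Since
    the square of N is k times the identity, ratios of products obey the addition law below.\<close>
  have fam': "\<exists>\<alpha> \<beta>. \<alpha> \<noteq> 0 \<and> v t = \<beta> / \<alpha> \<and> 1 - n * v t \<noteq> 0 \<and> w t = q * v t / (1 - n * v t) \<and>
      T t = mat2 (\<alpha> + \<beta> * n) (\<beta> * q) (\<beta> * r) (\<alpha> - \<beta> * n)" if t: "\<bar>t\<bar> < d" for t
  proof -
    obtain \<alpha> \<beta> where ab: "T t = mat2 (\<alpha> + \<beta> * n) (\<beta> * q) (\<beta> * r) (\<alpha> - \<beta> * n)" using fam[of t] t d by auto
    have "invertible (T t)" "mob (T t) (affine_embed (w 0)) = affine_embed (w t)"
      using T[of t] t d e by auto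
    from mob_affine_embed_eqD[OF this[unfolded ab]]
    have 1: "\<alpha> - \<beta> * n \<noteq> 0" "(\<alpha> - \<beta> * n) * w t = \<beta> * q" by (auto simp: w0)
    have "(q + n * w t) * (\<alpha> - \<beta> * n) = q * \<alpha>" using 1(2) by algebra
    then have \<alpha>: "\<alpha> \<noteq> 0" using den[OF t] 1(1) by auto
    have "\<alpha> * w t = \<beta> * (q + n * w t)" using 1(2) by algebra
    then have v: "v t = \<beta> / \<alpha>" unfolding v_def using den[OF t] \<alpha> by (simp add: field_simps)
    have "1 - n * v t = q / (q + n * w t)" unfolding v_def using den[OF t] by (simp add: field_simps)
    moreover from this have "1 - n * v t \<noteq> 0" using q den[OF t] by simp
    moreover have "w t = q * v t / (q / (q + n * w t))" unfolding v_def using den[OF t] q by simp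
    ultimately show ?thesis using \<alpha> v ab by metis
  qed
  have law: "v (s + t) * (1 + k * v s * v t) = v s + v t" if st: "\<bar>s\<bar> < d" "\<bar>t\<bar> < d" "\<bar>s + t\<bar> < d" for s t
  proof -
    obtain \<alpha> \<beta> where ab: "\<alpha> \<noteq> 0" "v s = \<beta> / \<alpha>" "T s = mat2 (\<alpha> + \<beta> * n) (\<beta> * q) (\<beta> * r) (\<alpha> - \<beta> * n)"
      using fam'[OF st(1)] by blast
    have ne: "1 - n * v t \<noteq> 0" "1 - n * v (s + t) \<noteq> 0" 
      and weq: "w t = q * v t / (1 - n * v t)" "w (s + t) = q * v (s + t) / (1 - n * v (s + t))"
      using fam'[OF st(2)] fam'[OF st(3)] by auto
    have w: "w t * (1 - n * v t) = q * v t" "w (s + t) * (1 - n * v (s + t)) = q * v (s + t)"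
      using ne weq by simp_all
    have "invertible (T s)" "mob (T s) (affine_embed (w t)) = affine_embed (w (s + t))"
      using T(1)[of s] T(2)[of s t] st d e by (auto simp: add.commute)
    from mob_affine_embed_eqD(2)[OF this[unfolded ab]]
    have 1: "(\<beta> * r * w t + (\<alpha> - \<beta> * n)) * w (s + t) = (\<alpha> + \<beta> * n) * w t + \<beta> * q" .
    have b: "\<beta> = v s * \<alpha>" using ab by simp
    have "\<alpha> * ((v s * r * w t + (1 - v s * n)) * w (s + t)) = \<alpha> * ((1 + v s * n) * w t + v s * q)"
      using 1 unfolding b by algebra
    then have 2: "(v s * r * w t + (1 - v s * n)) * w (s + t) = (1 + v s * n) * w t + v s * q"
      using ab(1) by simp
    have "q * (v (s + t) * (1 + k * v s * v t)) = q * (v s + v t)"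
      using 2 w unfolding k_def by algebra
    then show ?thesis using q by simp
  qed
  have "continuous_on (ball 0 d) v"
  proof -
    have "continuous_on (ball 0 d) w" using cont d e by (auto intro: continuous_on_subset)
    then show ?thesis unfolding v_def using den by (intro continuous_intros) auto
  qed
  moreover have "v t \<noteq> 0" if "\<bar>t\<bar> < d" "t \<noteq> 0" for t
    using w_ne[of t 0] w0 that d e den[of t] by (auto simp: v_def)
  moreover have "v 0 = 0" by (simp add: v_def w0)
  ultimately obtain D e'' g where g: "normal_dev D" "e'' > 0" "g \<in> PGL2" "\<forall>t. \<bar>t\<bar> < e'' \<longrightarrow> affine_embed (v t) = g (D t)"
    using normal_form_of_addition_law[OF d(1) _ _ _ law] by blast
  have wv: "affine_embed (w t) = mob (mat2 q 0 (- n) 1) (affine_embed (v t))" if t: "\<bar>t\<bar> < d" for t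
    using fam'[OF t] by (auto simp: mob_affine_embed)
  have "mob (mat2 q 0 (- n) 1) \<in> PGL2" by (intro mob_in_PGL2) (simp add: invertible_mat2 q)
  then have "(\<lambda>x. mob (mat2 q 0 (- n) 1) (g x)) \<in> PGL2" using g(3) PGL2_comp by blast
  then show ?thesis using g wv d(1)
    by (intro exI[of _ D] exI[of _ "min d e''"] exI[of _ "\<lambda>x. mob (mat2 q 0 (- n) 1) (g x)"]) auto
qed

section \<open>The circle and lifts of its homeomorphisms\<close>

text \<open>\<open>cyclic_orbit\<close> applies iterates on one side only; for injective f common
  iterates cancel, and the symmetric form is the one that composes.\<close>

lemma cyclic_orbit_mem_iff:
  assumes "inj f"
  shows "y \<in> cyclic_orbit f x \<longleftrightarrow> (\<exists>m n. (f ^^ m) x = (f ^^ n) y)"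
proof
  assume "y \<in> cyclic_orbit f x"
  then obtain n where "(f ^^ n) x = y \<or> (f ^^ n) y = x" unfolding cyclic_orbit_def by blast
  then have "(f ^^ n) x = (f ^^ 0) y \<or> (f ^^ 0) x = (f ^^ n) y" by auto
  then show "\<exists>m n. (f ^^ m) x = (f ^^ n) y" by blast
next
  assume "\<exists>m n. (f ^^ m) x = (f ^^ n) y"
  then obtain m n where mn: "(f ^^ m) x = (f ^^ n) y" by blast
  have i: "inj (f ^^ k)" for k using assms by (induction k) (auto intro: inj_compose)
  show "y \<in> cyclic_orbit f x"
  proof (cases "m \<le> n")
    case True
    then have "(f ^^ m) ((f ^^ (n - m)) y) = (f ^^ m) x" using mn by (metis funpow_add le_add_diff_inverse o_apply)
    then have "(f ^^ (n - m)) y = x" using i[of m] by (simp add: inj_eq)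
    then show ?thesis unfolding cyclic_orbit_def by blast
  next
    case False
    then have "(f ^^ n) ((f ^^ (m - n)) x) = (f ^^ n) y" using mn by (metis funpow_add le_add_diff_inverse o_apply nat_le_linear)
    then have "(f ^^ (m - n)) x = y" using i[of n] by (simp add: inj_eq)
    then show ?thesis unfolding cyclic_orbit_def by blast
  qed
qed

lemma cyclic_orbit_eq_iff:
  assumes f: "inj f"
  shows "cyclic_orbit f x = cyclic_orbit f y \<longleftrightarrow> (\<exists>m n. (f ^^ m) x = (f ^^ n) y)"
proof
  assume "cyclic_orbit f x = cyclic_orbit f y"
  moreover have "y \<in> cyclic_orbit f y" unfolding cyclic_orbit_mem_iff[OF f] by blast
  ultimately show "\<exists>m n. (f ^^ m) x = (f ^^ n) y" using cyclic_orbit_mem_iff[OF f] by blast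
next
  have tr: "\<exists>m n. (f ^^ m) x = (f ^^ n) z" if a: "(f ^^ m) x = (f ^^ n) y" "(f ^^ k) y = (f ^^ l) z" for x y z m n k l
  proof -
    have "(f ^^ (k + m)) x = (f ^^ (k + n)) y" using a by (simp add: funpow_add)
    also have "\<dots> = (f ^^ (n + k)) y" by (simp add: add.commute)
    also have "\<dots> = (f ^^ (n + l)) z" using a by (simp add: funpow_add)
    finally show ?thesis by blast
  qed
  assume "\<exists>m n. (f ^^ m) x = (f ^^ n) y"
  then obtain m n where mn: "(f ^^ m) x = (f ^^ n) y" by blast
  have "z \<in> cyclic_orbit f x \<longleftrightarrow> z \<in> cyclic_orbit f y" for z
    unfolding cyclic_orbit_mem_iff[OF f] using tr[OF mn] tr[OF mn[symmetric]] by blast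
  then show "cyclic_orbit f x = cyclic_orbit f y" by blast
qed

lemma funpow_xi: "(xi r ^^ n) x = x + real n * r"
  by (induction n) (auto simp: xi_def algebra_simps)

lemma nat_diff_Ints:
  fixes a b :: real
  shows "(\<exists>m n. a + real m = b + real n) \<longleftrightarrow> a - b \<in> \<int>"
proof
  assume "\<exists>m n. a + real m = b + real n"
  then obtain m n where "a + real m = b + real n" by blast
  then have "a - b = real n - real m" by simp
  then show "a - b \<in> \<int>" by simp
next
  assume "a - b \<in> \<int>"
  then obtain k where k: "a - b = of_int k" by (auto elim: Ints_cases)
  show "\<exists>m n. a + real m = b + real n"
  proof (cases "k \<ge> 0")
    case True then show ?thesis using k by (intro exI[of _ 0] exI[of _ "nat k"]) auto
  next
    case False then show ?thesis using k by (intro exI[of _ "nat (- k)"] exI[of _ 0]) auto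
  qed
qed

lemma cyclic_orbit_xi_eq_iff:
  assumes "r \<noteq> 0"
  shows "cyclic_orbit (xi r) x = cyclic_orbit (xi r) y \<longleftrightarrow> (x - y) / r \<in> \<int>"
proof -
  have "x + real m * r = y + real n * r \<longleftrightarrow> x / r + real m = y / r + real n" for m n
    using assms by (simp add: field_simps)
  moreover have "inj (xi r)" by (simp add: inj_def xi_def)
  ultimately show ?thesis
    by (simp add: cyclic_orbit_eq_iff funpow_xi nat_diff_Ints diff_divide_distrib)
qed

lemma circle_proj_xi: "circle_proj = cyclic_orbit (xi 1)"
  by (simp add: circle_proj_def xi_def[abs_def])

lemma circle_proj_eq_iff: "circle_proj x = circle_proj y \<longleftrightarrow> x - y \<in> \<int>"
  by (simp add: circle_proj_xi cyclic_orbit_xi_eq_iff)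

lemma mem_circle_proj_iff: "y \<in> circle_proj x \<longleftrightarrow> y - x \<in> \<int>"
proof -
  have "inj (xi 1)" by (simp add: inj_def xi_def)
  then have "y \<in> circle_proj x \<longleftrightarrow> circle_proj x = circle_proj y"
    by (simp add: circle_proj_xi cyclic_orbit_mem_iff cyclic_orbit_eq_iff)
  then show ?thesis unfolding circle_proj_eq_iff using Ints_minus[of "x - y"] Ints_minus[of "y - x"] by auto
qed

lemma circle_proj_Ints [simp]: "n \<in> \<int> \<Longrightarrow> circle_proj (x + n) = circle_proj x"
  by (simp add: circle_proj_eq_iff)

lemma topspace_circle: "topspace circle = range circle_proj"
  by (simp add: circle_def topspace_quotient_topology)

lemma continuous_circle_proj: "continuous_map euclideanreal circle circle_proj"
  unfolding circle_def by (rule quotient_imp_continuous_map[OF quotient_map_quotient_topology])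

section \<open>Lifting paths through the covering of the circle\<close>

lemma integer_valued_constant:
  fixes f :: "real \<Rightarrow> real"
  assumes "continuous_on UNIV f" "\<And>x. f x \<in> \<int>"
  shows "f x = f y"
proof -
  have "f constant_on UNIV"
  proof (rule continuous_discrete_range_constant[OF connected_UNIV assms(1)])
    fix x :: real
    have "1 \<le> norm (f y - f x)" if "f y \<noteq> f x" for y
      using Ints_nonzero_abs_ge1[of "f y - f x"] assms(2) that by auto
    then show "\<exists>e>0. \<forall>y. y \<in> UNIV \<and> f y \<noteq> f x \<longrightarrow> e \<le> norm (f y - f x)" by (intro exI[of _ 1]) auto
  qed
  then obtain c where "\<forall>x\<in>UNIV. f x = c" unfolding constant_on_def by blast
  then show ?thesis by simp
qed

text \<open>The exponential embeds the circle in the complex plane; this brings separation and,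
  through continuous logarithms, the lifting of paths.\<close>

lemma circle_to_complex:
  obtains h :: "real set \<Rightarrow> complex" where "continuous_map circle euclidean h" "inj_on h (topspace circle)"
    "\<And>x. h (circle_proj x) = exp (2 * pi * \<i> * x)"
proof -
  define h where "h p = exp (2 * pi * \<i> * (SOME x. circle_proj x = p))" for p
  have eq: "exp (2 * pi * \<i> * x) = exp (2 * pi * \<i> * y) \<longleftrightarrow> x - y \<in> \<int>" for x y :: real
  proof
    assume "exp (2 * pi * \<i> * x) = exp (2 * pi * \<i> * y)"
    then obtain n :: int where "2 * pi * \<i> * x = 2 * pi * \<i> * y + of_int (2 * n) * pi * \<i>"
      unfolding exp_eq by auto
    then have "Im (2 * pi * \<i> * x) = Im (2 * pi * \<i> * y + of_int (2 * n) * pi * \<i>)" by (rule arg_cong)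
    then have "pi * (x - y) = pi * of_int n" by (simp add: algebra_simps)
    then show "x - y \<in> \<int>" by simp
  next
    assume "x - y \<in> \<int>"
    then obtain n :: int where n: "x = y + of_int n" by (metis Ints_cases add.commute diff_add_cancel)
    show "exp (2 * pi * \<i> * x) = exp (2 * pi * \<i> * y)"
      unfolding exp_eq by (intro exI[of _ n]) (simp add: n algebra_simps)
  qed
  have h: "h (circle_proj x) = exp (2 * pi * \<i> * x)" for x
  proof -
    have "circle_proj (SOME y. circle_proj y = circle_proj x) = circle_proj x" by (rule someI) simp
    then show ?thesis unfolding h_def eq circle_proj_eq_iff .
  qed
  have "continuous_map euclideanreal euclidean (h \<circ> circle_proj)"
    unfolding o_def h by (auto intro!: continuous_intros)
  then have "continuous_map circle euclidean h"
    unfolding circle_def by (rule continuous_compose_quotient_map[OF quotient_map_quotient_topology])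
  moreover have "inj_on h (topspace circle)"
    unfolding topspace_circle inj_on_def using h eq circle_proj_eq_iff by (metis imageE)
  ultimately show ?thesis using that h by blast
qed

lemma Hausdorff_circle: "Hausdorff_space circle"
proof -
  obtain h :: "real set \<Rightarrow> complex" where h: "continuous_map circle euclidean h" "inj_on h (topspace circle)"
    "\<And>x. h (circle_proj x) = exp (2 * pi * \<i> * x)" by (rule circle_to_complex) blast
  show ?thesis
    using Hausdorff_space_injective_preimage[OF Hausdorff_space_euclidean h(1,2)] .
qed

text \<open>A nowhere vanishing function on the contractible line has a continuous logarithm. As its
  values lie on the unit circle, the real part of the logarithm is 0 and the imaginary part over 2
  pi is the lift.\<close>

lemma circle_path_lift:
  assumes f: "continuous_map euclideanreal circle f"
  obtains F where "continuous_on UNIV F" "\<And>x. f x = circle_proj (F x)"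
proof -
  obtain h :: "real set \<Rightarrow> complex" where h: "continuous_map circle euclidean h" "inj_on h (topspace circle)"
    "\<And>x. h (circle_proj x) = exp (2 * pi * \<i> * x)" by (rule circle_to_complex) blast
  have ft: "f x \<in> range circle_proj" for x
    using f by (auto simp: continuous_map_def topspace_circle)
  have hf: "\<exists>y. f x = circle_proj y \<and> h (f x) = exp (2 * pi * \<i> * of_real y)" for x using ft[of x] h(3) by auto
  have "continuous_map euclideanreal euclidean (h \<circ> f)" using f h(1) by (rule continuous_map_compose)
  then have "continuous_on UNIV (\<lambda>x. h (f x))" by (simp add: o_def)
  moreover have "contractible (UNIV :: real set)" by (simp add: convex_imp_contractible)
  moreover have "h (f x) \<noteq> 0" for x using hf[of x] by auto
  ultimately obtain g where g: "continuous_on UNIV g" "\<And>x. h (f x) = exp (g x)"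
    using continuous_logarithm_on_contractible[of UNIV "\<lambda>x. h (f x)"] by auto
  define F where "F x = Im (g x) / (2 * pi)" for x
  have "f x = circle_proj (F x)" for x
  proof -
    obtain y where y: "f x = circle_proj y" "h (f x) = exp (2 * pi * \<i> * of_real y)" using hf by blast
    have "norm (h (f x)) = 1" unfolding y(2) by (simp add: norm_exp_eq_Re)
    then have "Re (g x) = 0" unfolding g(2) by (simp add: norm_exp_eq_Re)
    then have "g x = 2 * pi * \<i> * of_real (F x)" by (simp add: F_def complex_eq_iff)
    then have "h (circle_proj (F x)) = h (f x)" using g(2)[of x] h(3) by simp
    then show ?thesis using inj_onD[OF h(2)] ft[of x] unfolding topspace_circle by (metis rangeI)
  qed
  moreover have "continuous_on UNIV F" unfolding F_def using g(1) by (intro continuous_intros) auto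
  ultimately show ?thesis using that by blast
qed

text \<open>The number e is the degree, 1 or -1 according to the orientation. Self-homeomorphisms of
  the circle are exactly the maps covered by such F, so group elements are handled through
  F.\<close>

definition circle_lift :: "(real \<Rightarrow> real) \<Rightarrow> bool" where
  "circle_lift F \<longleftrightarrow> continuous_on UNIV F \<and> inj F \<and> (\<exists>e\<in>{1, -1}. \<forall>x. F (x + 1) = F x + e)"

lemma circle_liftE:
  assumes "circle_lift F"
  obtains e where "e \<in> {1, -1}" "\<And>x (n::int). F (x + of_int n) = F x + e * of_int n"
proof -
  obtain e where e: "e \<in> {1, -1}" "\<And>x. F (x + 1) = F x + e" using assms by (auto simp: circle_lift_def)
  have nat: "F (x + real n) = F x + e * real n" for x n
  proof (induction n)
    case (Suc n)
    have "F (x + real (Suc n)) = F (x + real n + 1)" by (simp add: add_ac)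
    then show ?case using Suc by (simp only: e(2)) (simp add: algebra_simps)
  qed simp
  have "F (x + of_int n) = F x + e * of_int n" for x and n :: int
  proof (cases "n \<ge> 0")
    case True then show ?thesis using nat[of x "nat n"] by simp
  next
    case False then show ?thesis using nat[of "x + of_int n" "nat (- n)"] by (simp add: algebra_simps)
  qed
  then show ?thesis using that e by blast
qed

lemma circle_lift_continuous: "circle_lift F \<Longrightarrow> continuous_on S F"
  unfolding circle_lift_def by (auto intro: continuous_on_subset)

lemma circle_lift_inj: "circle_lift F \<Longrightarrow> F x = F y \<longleftrightarrow> x = y"
  unfolding circle_lift_def by (auto simp: inj_eq)

lemma circle_lift_surj:
  assumes F: "circle_lift F"
  shows "surj F"
proof -
  obtain e where e: "e \<in> {1, -1}" "\<And>x (n::int). F (x + of_int n) = F x + e * of_int n" by (rule circle_liftE[OF F]) blast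
  have con: "connected (range F)" using circle_lift_continuous[OF F] by (rule connected_continuous_image) simp
  have mem: "F 0 + of_int n \<in> range F" for n :: int
  proof -
    have "e = 1 \<or> e = - 1" using e(1) by auto
    then have "F 0 + of_int n = F (0 + of_int n) \<or> F 0 + of_int n = F (0 + of_int (- n))"
      unfolding e(2) by auto
    then show ?thesis by auto
  qed
  have "y \<in> range F" for y
    by (rule connectedD_interval[OF con mem[of "\<lfloor>y - F 0\<rfloor>"] mem[of "\<lceil>y - F 0\<rceil>"]]) linarith+
  then show ?thesis by blast
qed

lemma circle_lift_bij: "circle_lift F \<Longrightarrow> bij F"
  using circle_lift_surj by (auto simp: bij_def circle_lift_def)

lemma circle_lift_inv_f [simp]: "circle_lift F \<Longrightarrow> inv_into UNIV F (F x) = x" "circle_lift F \<Longrightarrow> F (inv_into UNIV F x) = x"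
  using circle_lift_bij by (auto simp: bij_is_inj bij_is_surj surj_f_inv_f)

lemma circle_lift_Ints:
  assumes F: "circle_lift F"
  shows "F x - F y \<in> \<int> \<longleftrightarrow> x - y \<in> \<int>"
proof -
  obtain e where e: "e \<in> {1, -1}" "\<And>x (n::int). F (x + of_int n) = F x + e * of_int n" by (rule circle_liftE[OF F]) blast
  show ?thesis
  proof
    assume "x - y \<in> \<int>"
    then obtain n :: int where "x = y + of_int n" by (metis Ints_cases add.commute diff_add_cancel)
    then show "F x - F y \<in> \<int>" using e by auto
  next
    assume "F x - F y \<in> \<int>"
    then obtain n :: int where n: "F x = F y + of_int n" by (metis Ints_cases add.commute diff_add_cancel)
    have "e = 1 \<or> e = - 1" using e(1) by auto
    then have "F x = F (y + of_int n) \<or> F x = F (y + of_int (- n))" unfolding e(2) n by auto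
    then show "x - y \<in> \<int>" using circle_lift_inj[OF F] by auto
  qed
qed

lemma circle_lift_proj_eq_iff:
  "circle_lift F \<Longrightarrow> circle_proj (F x) = circle_proj (F y) \<longleftrightarrow> circle_proj x = circle_proj y"
  by (simp add: circle_proj_eq_iff circle_lift_Ints)

lemma circle_lift_open: "circle_lift F \<Longrightarrow> open U \<Longrightarrow> open (F ` U)"
  by (rule injective_into_1d_imp_open_map_UNIV[of _ UNIV]) (auto simp: circle_lift_def)

lemma circle_lift_homeomorphic: "circle_lift F \<Longrightarrow> homeomorphic_map euclideanreal euclideanreal F"
  using circle_lift_surj[of F] circle_lift_open[of F]
  by (intro bijective_open_imp_homeomorphic_map) (auto simp: circle_lift_def open_map_def)

lemma circle_lift_inv:
  assumes F: "circle_lift F"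
  shows "circle_lift (inv_into UNIV F)"
proof -
  obtain e where e: "e \<in> {1, -1}" "\<And>x (n::int). F (x + of_int n) = F x + e * of_int n" by (rule circle_liftE[OF F]) blast
  have ee: "e = 1 \<or> e = - 1" using e(1) by auto
  have "continuous_on UNIV (inv_into UNIV F)"
  proof -
    have "open (inv_into UNIV F -` U)" if "open U" for U
      using circle_lift_open[OF F that] bij_vimage_eq_inv_image[OF bij_imp_bij_inv[OF circle_lift_bij[OF F]]]
        inv_inv_eq[OF circle_lift_bij[OF F]] by simp
    then show ?thesis by (simp add: continuous_on_open_vimage)
  qed
  moreover have "inj (inv_into UNIV F)" using bij_imp_bij_inv[OF circle_lift_bij[OF F]] bij_is_inj by blast
  moreover have "inv_into UNIV F (x + 1) = inv_into UNIV F x + e" for x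
  proof -
    have "F (inv_into UNIV F x + e) = x + 1" using ee e(2)[of "inv_into UNIV F x" 1] e(2)[of "inv_into UNIV F x" "-1"] F by auto
    then show ?thesis by (metis circle_lift_inv_f(1)[OF F])
  qed
  ultimately show ?thesis using e(1) unfolding circle_lift_def by blast
qed

lemma circle_lift_comp:
  assumes F: "circle_lift F" and G: "circle_lift G"
  shows "circle_lift (\<lambda>x. F (G x))"
proof -
  obtain e where e: "e \<in> {1, -1}" "\<And>x (n::int). F (x + of_int n) = F x + e * of_int n" by (rule circle_liftE[OF F]) blast
  obtain e' where e': "e' \<in> {1, -1}" "\<And>x (n::int). G (x + of_int n) = G x + e' * of_int n" by (rule circle_liftE[OF G]) blast
  have 1: "F (G (x + 1)) = F (G x) + e * e'" for x
    using e'(1) e'(2)[of x 1] e(2)[of "G x" 1] e(2)[of "G x" "-1"] by auto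
  have 2: "e * e' \<in> {1, -1}" using e e' by auto
  have "continuous_on UNIV (\<lambda>x. F (G x))"
    by (rule continuous_on_compose2[OF circle_lift_continuous[OF F, of UNIV] circle_lift_continuous[OF G]]) simp
  moreover have "inj (\<lambda>x. F (G x))" by (simp add: inj_def circle_lift_inj F G)
  ultimately show ?thesis unfolding circle_lift_def using 1 2 by blast
qed

lemma circle_lift_translation [simp]: "circle_lift (\<lambda>x. x + t)"
  unfolding circle_lift_def by (auto intro!: continuous_intros simp: inj_def)

lemma circle_lift_translation' [simp]: "circle_lift (\<lambda>x. x - t)"
  using circle_lift_translation[of "- t"] by simp

lemma circle_lift_id [simp]: "circle_lift (\<lambda>x. x)"
  using circle_lift_translation[of 0] by simp

lemma circle_lift_uminus [simp]: "circle_lift uminus"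
  unfolding circle_lift_def by (auto intro!: continuous_intros simp: inj_def)

text \<open>A continuous integer-valued function is constant, so \<open>F (x + 1) - F x\<close> is
  one integer n. The hypothesis \<open>surj\<close> produces an integer k with n k = 1, which leaves
  only 1 and -1 for n.\<close>

lemma circle_liftI:
  assumes cont: "continuous_on UNIV F" and Z: "\<And>x y. F x - F y \<in> \<int> \<longleftrightarrow> x - y \<in> \<int>"
    and surj: "\<exists>x y. F x - F y = 1"
  shows "circle_lift F"
proof -
  have per: "F (x + 1) - F x = F (y + 1) - F y" for x y
  proof (rule integer_valued_constant[of "\<lambda>x. F (x + 1) - F x"])
    show "continuous_on UNIV (\<lambda>x. F (x + 1) - F x)"
      by (intro continuous_intros continuous_on_compose2[OF cont]) (auto intro!: continuous_intros cont)
  qed (simp add: Z)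
  define n where "n = F 1 - F 0"
  have n: "F (x + 1) = F x + n" for x using per[of x 0] by (simp add: n_def)
  have nat: "F (x + real k) = F x + n * real k" for x k
  proof (induction k)
    case (Suc k)
    have "F (x + real (Suc k)) = F (x + real k + 1)" by (simp add: add_ac)
    then show ?case using Suc by (simp only: n) (simp add: algebra_simps)
  qed simp
  have int: "F (x + of_int k) = F x + n * of_int k" for x and k :: int
  proof (cases "k \<ge> 0")
    case True then show ?thesis using nat[of x "nat k"] by simp
  next
    case False then show ?thesis using nat[of "x + of_int k" "nat (- k)"] by (simp add: algebra_simps)
  qed
  obtain x y where xy: "F x - F y = 1" using surj by blast
  then have "x - y \<in> \<int>" using Z[of x y] by simp
  then obtain k :: int where k: "x = y + of_int k" by (metis Ints_cases add.commute diff_add_cancel)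
  have "n \<in> \<int>" using Z[of 1 0] by (simp add: n_def)
  then obtain m :: int where m: "n = of_int m" by (auto elim: Ints_cases)
  have "n * of_int k = 1" using xy unfolding k int by simp
  then have "m * k = 1" unfolding m by (metis of_int_eq_1_iff of_int_mult)
  then have n1: "n \<in> {1, -1}" using m by (auto simp: zmult_eq_1_iff)
  have "inj F"
  proof (rule injI)
    fix x y assume "F x = F y"
    moreover then have "x - y \<in> \<int>" using Z[of x y] by simp
    then obtain k :: int where k: "x = y + of_int k" by (metis Ints_cases add.commute diff_add_cancel)
    ultimately have "n * of_int k = 0" unfolding k int by simp
    then show "x = y" using n1 k by auto
  qed
  then show ?thesis unfolding circle_lift_def using cont n n1 by blast
qed

text \<open>For a lift F any representative gives the same value. The restriction matches the
  extensional elements of \<open>homeo_group\<close>, so that maps equal on the circle are equal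
  functions.\<close>

definition circle_map :: "(real \<Rightarrow> real) \<Rightarrow> real set \<Rightarrow> real set" where
  "circle_map F = restrict (\<lambda>p. circle_proj (F (SOME x. circle_proj x = p))) (topspace circle)"

lemma circle_map_proj [simp]:
  assumes "circle_lift F"
  shows "circle_map F (circle_proj x) = circle_proj (F x)"
proof -
  have "circle_proj (SOME y. circle_proj y = circle_proj x) = circle_proj x" by (rule someI) simp
  then show ?thesis using assms by (simp add: circle_map_def topspace_circle circle_lift_proj_eq_iff)
qed

lemma circle_map_homeomorphic:
  assumes F: "circle_lift F"
  shows "homeomorphic_map circle circle (circle_map F)"
  unfolding circle_def
  by (rule quotient_map_lift_homeomorphic[OF circle_lift_homeomorphic[OF F]])
    (simp_all add: circle_lift_proj_eq_iff F)

section \<open>The homeomorphism group, described by lifts\<close>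

lemma carrier_homeo_group:
  "f \<in> carrier homeo_group \<longleftrightarrow> f \<in> extensional (topspace circle) \<and> homeomorphic_map circle circle f"
proof -
  have "bij_betw f (topspace circle) (topspace circle)" if "homeomorphic_map circle circle f"
    using that by (simp add: bij_betw_def homeomorphic_eq_everything_map)
  then show ?thesis by (auto simp: homeo_group_def Bij_def)
qed

lemma circle_map_extensional: "circle_map F \<in> extensional (topspace circle)"
  by (simp add: circle_map_def)

lemma circle_map_carrier [simp]: "circle_lift F \<Longrightarrow> circle_map F \<in> carrier homeo_group"
  by (simp add: carrier_homeo_group circle_map_homeomorphic circle_map_extensional)

lemma circle_map_eqI:
  assumes "f \<in> extensional (topspace circle)" "circle_lift F" "\<And>x. f (circle_proj x) = circle_proj (F x)"
  shows "f = circle_map F"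
proof (rule extensionalityI[OF assms(1)])
  show "circle_map F \<in> extensional (topspace circle)" by (simp add: circle_map_def)
qed (auto simp: topspace_circle assms)

lemma homeo_group_lift:
  assumes f: "f \<in> carrier homeo_group"
  obtains F where "circle_lift F" "f = circle_map F"
proof -
  have h: "homeomorphic_map circle circle f" and ext: "f \<in> extensional (topspace circle)"
    using f by (auto simp: carrier_homeo_group)
  have "continuous_map euclideanreal circle (f \<circ> circle_proj)"
    using continuous_circle_proj homeomorphic_imp_continuous_map[OF h] by (rule continuous_map_compose)
  then obtain F where F: "continuous_on UNIV F" "\<And>x. f (circle_proj x) = circle_proj (F x)"
    using circle_path_lift[of "f \<circ> circle_proj"] by auto
  have inj: "inj_on f (range circle_proj)"
    using h by (auto simp: homeomorphic_eq_everything_map topspace_circle)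
  have Z: "F x - F y \<in> \<int> \<longleftrightarrow> x - y \<in> \<int>" for x y
    using inj by (simp add: circle_proj_eq_iff[symmetric] F(2)[symmetric] inj_on_eq_iff)
  \<comment> \<open>The degree is the integer F 1 - F 0. If it is nonzero, the range contains a
    segment of length at least 1; the work is to exclude degree 0.\<close>
  have "\<exists>x y. F x - F y = 1"
  proof -
    have con: "connected (range F)" using F(1) by (rule connected_continuous_image) simp
    have "F 1 - F 0 \<in> \<int>" unfolding Z by simp
    then obtain m :: int where m: "F 1 - F 0 = of_int m" by (auto elim: Ints_cases)
    show ?thesis
    proof (cases "m = 0")
      case False
      then consider "m \<ge> 1" | "m \<le> - 1" by linarith
      then show ?thesis
      proof cases
        case 1
        have "F 0 + 1 \<in> range F" by (rule connectedD_interval[OF con, of "F 0" "F 1"]) (use m 1 in auto)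
        then show ?thesis by (metis add_diff_cancel_left' imageE)
      next
        case 2
        have "F 1 + 1 \<in> range F" by (rule connectedD_interval[OF con, of "F 1" "F 0"]) (use m 2 in auto)
        then show ?thesis by (metis add_diff_cancel_left' imageE)
      qed
    next
      \<comment> \<open>With degree 0 both halves of the unit interval connect the values F 0 and F
        (1/2). The middle value is then taken on each half, at two distinct points less than 1
        apart, against injectivity modulo 1.\<close>
      case True
      then have F01: "F 1 = F 0" using m by simp
      have inj: "inj_on F {0..1/2}" "inj_on F {1/2..1}"
      proof -
        have "x = y" if "F x = F y" "\<bar>x - y\<bar> < 1" for x y
          using Z[of x y] that Ints_nonzero_abs_less1[of "x - y"] by auto
        then show "inj_on F {0..1/2}" "inj_on F {1/2..1}" by (auto intro!: inj_onI)
      qed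
      have ne: "F (1/2) \<noteq> F 0" using inj(1) by (auto simp: inj_on_eq_iff)
      define y where "y = (F 0 + F (1/2)) / 2"
      have c: "continuous_on S F" for S using F(1) continuous_on_subset by blast
      have y: "y \<in> K" if "connected K" "F 0 \<in> K" "F (1/2) \<in> K" for K
      proof (cases "F 0 \<le> F (1/2)")
        case True
        show ?thesis by (rule connectedD_interval[OF that(1,2,3)]) (use True in \<open>auto simp: y_def\<close>)
      next
        case False
        show ?thesis by (rule connectedD_interval[OF that(1,3,2)]) (use False in \<open>auto simp: y_def\<close>)
      qed
      have "F 0 \<in> F ` {0..1/2}" "F (1/2) \<in> F ` {0..1/2}" "F 0 \<in> F ` {1/2..1}" "F (1/2) \<in> F ` {1/2..1}"
        using imageI[of 1 "{1/2..1}" F] F01 by (auto intro!: imageI)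
      then have "y \<in> F ` {0..1/2}" "y \<in> F ` {1/2..1}"
        by (auto intro!: y connected_continuous_image c)
      then obtain a b where ab: "0 \<le> a" "a \<le> 1/2" "1/2 \<le> b" "b \<le> 1" "F a = y" "F b = y" by auto
      have "y \<noteq> F 0" "y \<noteq> F (1/2)" using ne by (auto simp: y_def)
      then have "a \<noteq> 1/2" "\<not> (a = 0 \<and> b = 1)" using ab by metis+
      then have "a \<noteq> b" "\<bar>a - b\<bar> < 1" using ab by (auto simp: abs_if)
      moreover have "a - b \<in> \<int>" using Z[of a b] ab by simp
      ultimately show ?thesis using Ints_nonzero_abs_less1[of "a - b"] by auto
    qed
  qed
  then have "circle_lift F" using circle_liftI F(1) Z by blast
  then show ?thesis using that circle_map_eqI[OF ext _ F(2)] by blast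
qed

lemma circle_map_mult:
  assumes "circle_lift F" "circle_lift G"
  shows "circle_map F \<otimes>\<^bsub>homeo_group\<^esub> circle_map G = circle_map (\<lambda>x. F (G x))"
proof -
  have "circle_map F \<in> Bij (topspace circle)" "circle_map G \<in> Bij (topspace circle)"
    using assms circle_map_carrier by (auto simp: homeo_group_def)
  then have "circle_map F \<otimes>\<^bsub>homeo_group\<^esub> circle_map G = compose (topspace circle) (circle_map F) (circle_map G)"
    by (simp add: homeo_group_def BijGroup_def)
  also have "\<dots> = circle_map (\<lambda>x. F (G x))"
    by (rule circle_map_eqI[OF _ circle_lift_comp[OF assms]]) (auto simp: compose_def topspace_circle assms)
  finally show ?thesis .
qed

lemma homeo_group_one: "\<one>\<^bsub>homeo_group\<^esub> = circle_map (\<lambda>x. x)"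
  by (rule circle_map_eqI) (auto simp: homeo_group_def BijGroup_def topspace_circle)

lemma group_homeo_group: "group homeo_group"
proof (rule groupI)
  fix x y assume "x \<in> carrier homeo_group" "y \<in> carrier homeo_group"
  then obtain F G where "circle_lift F" "x = circle_map F" "circle_lift G" "y = circle_map G"
    by (metis homeo_group_lift)
  then show "x \<otimes>\<^bsub>homeo_group\<^esub> y \<in> carrier homeo_group" by (simp add: circle_map_mult circle_lift_comp)
next
  show "\<one>\<^bsub>homeo_group\<^esub> \<in> carrier homeo_group" by (simp add: homeo_group_one)
next
  fix x y z assume "x \<in> carrier homeo_group" "y \<in> carrier homeo_group" "z \<in> carrier homeo_group"
  then obtain F G E where "circle_lift F" "x = circle_map F" "circle_lift G" "y = circle_map G" "circle_lift E" "z = circle_map E"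
    by (metis homeo_group_lift)
  then show "x \<otimes>\<^bsub>homeo_group\<^esub> y \<otimes>\<^bsub>homeo_group\<^esub> z = x \<otimes>\<^bsub>homeo_group\<^esub> (y \<otimes>\<^bsub>homeo_group\<^esub> z)"
    by (simp add: circle_map_mult circle_lift_comp)
next
  fix x assume "x \<in> carrier homeo_group"
  then obtain F where F: "circle_lift F" "x = circle_map F" by (metis homeo_group_lift)
  then show "\<one>\<^bsub>homeo_group\<^esub> \<otimes>\<^bsub>homeo_group\<^esub> x = x" by (simp add: homeo_group_one circle_map_mult)
  show "\<exists>y\<in>carrier homeo_group. y \<otimes>\<^bsub>homeo_group\<^esub> x = \<one>\<^bsub>homeo_group\<^esub>"
    using F circle_lift_inv[OF F(1)]
    by (intro bexI[of _ "circle_map (inv_into UNIV F)"]) (simp_all add: homeo_group_one circle_map_mult)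
qed

interpretation homeo: group homeo_group by (rule group_homeo_group)

lemma circle_map_inv:
  assumes F: "circle_lift F"
  shows "inv\<^bsub>homeo_group\<^esub> (circle_map F) = circle_map (inv_into UNIV F)"
  by (rule homeo.inv_equality)
    (use F circle_lift_inv[OF F] in \<open>simp_all add: homeo_group_one circle_map_mult\<close>)

lemma circle_map_eq_iff:
  assumes F: "circle_lift F" and G: "circle_lift G"
  shows "circle_map F = circle_map G \<longleftrightarrow> (\<exists>n\<in>\<int>. \<forall>x. F x = G x + n)"
proof
  assume eq: "circle_map F = circle_map G"
  have Z: "F x - G x \<in> \<int>" for x
    using eq circle_map_proj[OF F, of x] circle_map_proj[OF G, of x] by (metis circle_proj_eq_iff)
  have "F x - G x = F 0 - G 0" for x
    by (rule integer_valued_constant[of "\<lambda>x. F x - G x"])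
      (use Z circle_lift_continuous[OF F] circle_lift_continuous[OF G] in \<open>auto intro: continuous_on_diff\<close>)
  then show "\<exists>n\<in>\<int>. \<forall>x. F x = G x + n" using Z[of 0]
    by (intro bexI[of _ "F 0 - G 0"]) (auto simp: algebra_simps)
next
  assume "\<exists>n\<in>\<int>. \<forall>x. F x = G x + n"
  then obtain n where n: "n \<in> \<int>" "\<And>x. F x = G x + n" by blast
  show "circle_map F = circle_map G"
    using circle_map_extensional G
  proof (rule circle_map_eqI)
    fix x show "circle_map F (circle_proj x) = circle_proj (G x)" using F n by simp
  qed
qed

lemma circle_lift_mono:
  assumes F: "circle_lift F"
  shows "strict_mono F \<or> strict_mono (\<lambda>x. F (- x))"
proof -
  have "strict_mono F \<or> strict_antimono_on UNIV F"
    using injective_eq_monotone_map[of UNIV F] F by (auto simp: circle_lift_def)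
  then show ?thesis by (auto simp: strict_mono_def monotone_on_def)
qed

lemma orientation_preserving_circle_map:
  assumes F: "circle_lift F"
  shows "orientation_preserving (circle_map F) \<longleftrightarrow> strict_mono F"
proof
  assume "strict_mono F"
  then show "orientation_preserving (circle_map F)"
    unfolding orientation_preserving_def using F circle_lift_continuous by (intro exI[of _ F]) auto
next
  assume "orientation_preserving (circle_map F)"
  then obtain G where G: "continuous_on UNIV G" "strict_mono G" "\<And>x. circle_proj (F x) = circle_proj (G x)"
    unfolding orientation_preserving_def using F by auto
  have Z: "F x - G x \<in> \<int>" for x using G(3) by (simp add: circle_proj_eq_iff)
  have "F x - G x = F 0 - G 0" for x
    by (rule integer_valued_constant[of "\<lambda>x. F x - G x"])
      (use Z circle_lift_continuous[OF F] G in \<open>auto intro: continuous_on_diff\<close>)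
  then have "F x = G x + (F 0 - G 0)" for x by (simp add: algebra_simps)
  then show "strict_mono F" using G(2) unfolding strict_mono_def by (metis add_strict_right_mono)
qed

subsection \<open>The isometry group\<close>

lemma setdist_circle_proj:
  "setdist (circle_proj x) (circle_proj y) = \<bar>(x - y) - of_int (round (x - y))\<bar>"
proof (rule antisym)
  have "x - of_int (round (x - y)) \<in> circle_proj x" "y \<in> circle_proj y" by (auto simp: mem_circle_proj_iff)
  from setdist_le_dist[OF this] show "setdist (circle_proj x) (circle_proj y) \<le> \<bar>(x - y) - of_int (round (x - y))\<bar>"
    by (simp add: dist_real_def algebra_simps)
  show "\<bar>(x - y) - of_int (round (x - y))\<bar> \<le> setdist (circle_proj x) (circle_proj y)"
  proof (rule le_setdistI)
    show "circle_proj x \<noteq> {}" "circle_proj y \<noteq> {}" using mem_circle_proj_iff[of x x] mem_circle_proj_iff[of y y] by auto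
    fix a b assume "a \<in> circle_proj x" "b \<in> circle_proj y"
    then have "(x - y) - (a - b) \<in> \<int>" unfolding mem_circle_proj_iff
      using Ints_diff[of "b - y" "a - x"] by (simp add: algebra_simps)
    then obtain k :: int where k: "(x - y) - (a - b) = of_int k" by (auto elim: Ints_cases)
    have "\<bar>(x - y) - of_int (round (x - y))\<bar> \<le> \<bar>(x - y) - of_int k\<bar>" by (rule round_diff_minimal)
    moreover have "(x - y) - of_int k = a - b" using k by linarith
    ultimately show "\<bar>(x - y) - of_int (round (x - y))\<bar> \<le> dist a b"
      by (simp add: dist_real_def)
  qed
qed

lemma setdist_circle_proj_eq_iff:
  "setdist (circle_proj x) (circle_proj y) = setdist (circle_proj x') (circle_proj y') \<longleftrightarrow>
     (x - y) - (x' - y') \<in> \<int> \<or> (x - y) + (x' - y') \<in> \<int>"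
proof -
  define u v where "u = x - y" and "v = x' - y'"
  have "\<bar>u - of_int (round u)\<bar> = \<bar>v - of_int (round v)\<bar> \<longleftrightarrow> u - v \<in> \<int> \<or> u + v \<in> \<int>"
  proof
    assume "\<bar>u - of_int (round u)\<bar> = \<bar>v - of_int (round v)\<bar>"
    then have "u - v = of_int (round u - round v) \<or> u + v = of_int (round u + round v)" by (auto simp: abs_eq_iff)
    then show "u - v \<in> \<int> \<or> u + v \<in> \<int>" by (metis Ints_of_int)
  next
    have 1: "setdist (circle_proj u) (circle_proj 0) = \<bar>u - of_int (round u)\<bar>" for u
      using setdist_circle_proj[of u 0] by simp
    have 2: "setdist (circle_proj 0) (circle_proj u) = \<bar>(- u) - of_int (round (- u))\<bar>" for u
      using setdist_circle_proj[of 0 u] by simp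
    assume "u - v \<in> \<int> \<or> u + v \<in> \<int>"
    then show "\<bar>u - of_int (round u)\<bar> = \<bar>v - of_int (round v)\<bar>"
    proof
      assume "u - v \<in> \<int>" then show ?thesis using 1 by (metis circle_proj_eq_iff)
    next
      assume "u + v \<in> \<int>"
      then have "circle_proj u = circle_proj (- v)" by (simp add: circle_proj_eq_iff)
      then show ?thesis using 1[of u] 2[of "- v"] 1[of "- v"] 1[of v] 2[of v] setdist_sym by (metis minus_minus)
    qed
  qed
  then show ?thesis unfolding setdist_circle_proj u_def v_def .
qed

abbreviation rot :: "real \<Rightarrow> real set \<Rightarrow> real set" where "rot t \<equiv> circle_map (\<lambda>x. x + t)"
abbreviation refl_circle :: "real set \<Rightarrow> real set" where "refl_circle \<equiv> circle_map uminus"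

lemma circle_lift_reflection [simp]: "circle_lift (\<lambda>x. t - x)"
  using circle_lift_comp[OF circle_lift_translation[of t] circle_lift_uminus] by simp

lemma isometries_eq: "isometries = range rot \<union> range (\<lambda>t. circle_map (\<lambda>x. t - x))"
proof
  show "range rot \<union> range (\<lambda>t. circle_map (\<lambda>x. t - x)) \<subseteq> isometries"
  proof -
    have *: "circle_map F \<in> isometries" if F: "circle_lift F" and FF: "\<And>x y. F x - F y = x - y \<or> F x - F y = y - x" for F
    proof -
      have "circle_map F \<in> Bij (topspace circle)" using circle_map_carrier[OF F] by (simp add: homeo_group_def)
      moreover have "setdist (circle_map F (circle_proj x)) (circle_map F (circle_proj y)) = setdist (circle_proj x) (circle_proj y)" for x y
        using FF[of x y] by (auto simp: F setdist_circle_proj_eq_iff)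
      ultimately show ?thesis by (auto simp: isometries_def topspace_circle)
    qed
    then show ?thesis by (auto intro!: *)
  qed
  show "isometries \<subseteq> range rot \<union> range (\<lambda>t. circle_map (\<lambda>x. t - x))"
  proof
    fix f assume f: "f \<in> isometries"
    then have bij: "f \<in> Bij (topspace circle)"
      and iso: "\<And>x y. setdist (f (circle_proj x)) (f (circle_proj y)) = setdist (circle_proj x) (circle_proj y)"
      by (auto simp: isometries_def topspace_circle)
    have "\<exists>y. f (circle_proj x) = circle_proj y" for x
      using Bij_imp_funcset[OF bij] by (auto simp: topspace_circle Pi_iff)
    then obtain g where g: "\<And>x. f (circle_proj x) = circle_proj (g x)" by metis
    have gg: "(g x - g y) - (x - y) \<in> \<int> \<or> (g x - g y) + (x - y) \<in> \<int>" for x y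
      using iso[of x y] unfolding g setdist_circle_proj_eq_iff .
    have ext: "f \<in> extensional (topspace circle)" using bij by (simp add: Bij_def)
    \<comment> \<open>For each x, g x is t + x or t - x modulo 1, with a sign that might depend on
      x. The point 1/4 fixes the sign: a point of the other sign that did not also satisfy the first
      formula would make 1/2 an integer.\<close>
    have nhalf: "(1/2::real) \<notin> \<int>" "(-1/2::real) \<notin> \<int>"
      using Ints_nonzero_abs_less1[of "1/2::real"] Ints_nonzero_abs_less1[of "-1/2::real"] by auto
    define t where "t = g 0"
    have "(g (1/4) - t) - 1/4 \<in> \<int> \<or> (g (1/4) - t) + 1/4 \<in> \<int>" using gg[of "1/4" 0] by (simp add: t_def)
    then show "f \<in> range rot \<union> range (\<lambda>t. circle_map (\<lambda>x. t - x))"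
    proof
      assume q: "(g (1/4) - t) - 1/4 \<in> \<int>"
      have "g x - (x + t) \<in> \<int>" for x
        using gg[of x 0]
      proof
        assume "g x - g 0 - (x - 0) \<in> \<int>" then show ?thesis by (simp add: t_def algebra_simps)
      next
        assume a: "g x - g 0 + (x - 0) \<in> \<int>"
        show ?thesis using gg[of x "1/4"]
        proof
          assume "g x - g (1/4) - (x - 1/4) \<in> \<int>"
          from Ints_add[OF this q] show ?thesis by (simp add: algebra_simps)
        next
          assume b: "g x - g (1/4) + (x - 1/4) \<in> \<int>"
          have "(g x - g (1/4) + (x - 1/4)) + ((g (1/4) - t) - 1/4) - (g x - g 0 + (x - 0)) \<in> \<int>"
            by (intro Ints_add Ints_diff a b q)
          then show ?thesis using nhalf by (simp add: t_def)
        qed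
      qed
      then have "f = rot t" by (intro circle_map_eqI[OF ext]) (auto simp: g circle_proj_eq_iff)
      then show ?thesis by blast
    next
      assume q: "(g (1/4) - t) + 1/4 \<in> \<int>"
      have "g x - (t - x) \<in> \<int>" for x
        using gg[of x 0]
      proof
        assume "g x - g 0 + (x - 0) \<in> \<int>" then show ?thesis by (simp add: t_def algebra_simps)
      next
        assume a: "g x - g 0 - (x - 0) \<in> \<int>"
        show ?thesis using gg[of x "1/4"]
        proof
          assume "g x - g (1/4) + (x - 1/4) \<in> \<int>"
          from Ints_add[OF this q] show ?thesis by (simp add: algebra_simps)
        next
          assume b: "g x - g (1/4) - (x - 1/4) \<in> \<int>"
          have "(g x - g (1/4) - (x - 1/4)) + ((g (1/4) - t) + 1/4) - (g x - g 0 - (x - 0)) \<in> \<int>"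
            by (intro Ints_add Ints_diff a b q)
          then show ?thesis using nhalf by (simp add: t_def)
        qed
      qed
      then have "f = circle_map (\<lambda>x. t - x)" by (intro circle_map_eqI[OF ext]) (auto simp: g circle_proj_eq_iff)
      then show ?thesis by blast
    qed
  qed
qed

lemma isometries_plus_eq: "isometries_plus = range rot"
proof -
  have "orientation_preserving (rot t)" for t
    by (simp add: orientation_preserving_circle_map strict_mono_def)
  moreover have "\<not> orientation_preserving (circle_map (\<lambda>x. t - x))" for t
  proof -
    have "\<not> strict_mono (\<lambda>x. t - x)" unfolding strict_mono_def by (simp, rule exI[of _ 0], rule exI[of _ 1], simp)
    then show ?thesis by (simp add: orientation_preserving_circle_map)
  qed
  ultimately show ?thesis unfolding isometries_plus_def isometries_eq by auto
qed

section \<open>Circle actions are topologically conjugate to the standard one\<close>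

lemma topspace_homeo_topology: "topspace homeo_topology = carrier homeo_group"
proof -
  have "carrier homeo_group \<in> {{f \<in> carrier homeo_group. f ` C \<subseteq> U} | C U. compactin circle C \<and> openin circle U}"
    by (intro CollectI exI[of _ "{}"]) auto
  then show ?thesis unfolding homeo_topology_def topology_generated_by_topspace by blast
qed

lemma openin_homeo_topology:
  "compactin circle C \<Longrightarrow> openin circle U \<Longrightarrow> openin homeo_topology {f \<in> carrier homeo_group. f ` C \<subseteq> U}"
  unfolding homeo_topology_def by (rule topology_generated_by_Basis) blast

text \<open>Only representatives in [0,1] matter, so membership in a subbasic set says that a
  compact subset of the line, translated by t, stays in an open set; this persists for nearby
  t.\<close>

lemma continuous_map_rot: "continuous_map euclideanreal homeo_topology rot"
  unfolding homeo_topology_def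
proof (rule continuous_on_generated_topo)
  fix V assume "V \<in> {{f \<in> carrier homeo_group. f ` C \<subseteq> U} | C U. compactin circle C \<and> openin circle U}"
  then obtain C U where V: "V = {f \<in> carrier homeo_group. f ` C \<subseteq> U}" "compactin circle C" "openin circle U" by blast
  define A where "A = {x. circle_proj x \<in> C}"
  define B where "B = {x. circle_proj x \<in> U}"
  have "closedin circle C" using Hausdorff_circle V(2) by (rule compactin_imp_closedin)
  then have A: "closed A" using closedin_continuous_map_preimage[OF continuous_circle_proj] by (fastforce simp: A_def)
  have B: "open B" using openin_continuous_map_preimage[OF continuous_circle_proj V(3)] by (simp add: B_def)
  have AB: "rot t \<in> V \<longleftrightarrow> (\<forall>x \<in> A \<inter> {0..1}. x + t \<in> B)" for t
  proof
    assume "rot t \<in> V"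
    then have "rot t (circle_proj x) \<in> U" if "circle_proj x \<in> C" for x using that V(1) by blast
    then show "\<forall>x \<in> A \<inter> {0..1}. x + t \<in> B" by (auto simp: A_def B_def)
  next
    assume a: "\<forall>x \<in> A \<inter> {0..1}. x + t \<in> B"
    have "rot t p \<in> U" if p: "p \<in> C" for p
    proof -
      obtain x where x: "p = circle_proj x" using p compactin_subset_topspace[OF V(2)] by (auto simp: topspace_circle)
      have eq: "circle_proj x = circle_proj (frac x)" by (simp add: circle_proj_eq_iff frac_def)
      have "frac x \<in> A \<inter> {0..1}" using p x eq frac_lt_1[of x] by (auto simp: A_def less_imp_le)
      then have "frac x + t \<in> B" using a by blast
      then show ?thesis unfolding x eq by (simp add: B_def)
    qed
    then show "rot t \<in> V" unfolding V(1) by auto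
  qed
  have "open {t. \<forall>x \<in> A \<inter> {0..1}. x + t \<in> B}"
  proof (rule openI)
    fix t assume "t \<in> {t. \<forall>x \<in> A \<inter> {0..1}. x + t \<in> B}"
    then have t: "(\<lambda>x. x + t) ` (A \<inter> {0..1}) \<subseteq> B" by auto
    have "compact (A \<inter> {0..1})" using A by (intro closed_Int_compact) auto
    then have "compact ((\<lambda>x. x + t) ` (A \<inter> {0..1}))"
      by (intro compact_continuous_image continuous_intros)
    then obtain e where e: "e > 0" "(\<Union>y\<in>(\<lambda>x. x + t) ` (A \<inter> {0..1}). ball y e) \<subseteq> B"
      using compact_subset_open_imp_ball_epsilon_subset[OF _ B t] by blast
    have "x + t' \<in> B" if "t' \<in> ball t e" "x \<in> A \<inter> {0..1}" for t' x
    proof -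
      have "x + t' \<in> ball (x + t) e" using that by (simp add: dist_real_def)
      then show ?thesis using e(2) that by blast
    qed
    then show "\<exists>e>0. ball t e \<subseteq> {t. \<forall>x \<in> A \<inter> {0..1}. x + t \<in> B}" using e(1) by blast
  qed
  moreover have "rot -` V \<inter> topspace euclideanreal = {t. \<forall>x \<in> A \<inter> {0..1}. x + t \<in> B}" using AB by auto
  ultimately show "openin euclideanreal (rot -` V \<inter> topspace euclideanreal)" by simp
next
  show "rot ` topspace euclideanreal \<subseteq> \<Union> {{f \<in> carrier homeo_group. f ` C \<subseteq> U} | C U. compactin circle C \<and> openin circle U}"
    using topspace_homeo_topology unfolding homeo_topology_def topology_generated_by_topspace by auto
qed

text \<open>A singleton is compact, so the preimage of an open set is one of the generating sets of
  the compact-open topology.\<close>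

lemma continuous_map_evaluation:
  assumes p: "p \<in> topspace circle"
  shows "continuous_map homeo_topology circle (\<lambda>f. f p)"
  unfolding continuous_map_def
proof (intro conjI allI impI)
  show "(\<lambda>f. f p) \<in> topspace homeo_topology \<rightarrow> topspace circle"
  proof
    fix f assume "f \<in> topspace homeo_topology"
    then have "f ` topspace circle = topspace circle"
      by (simp add: topspace_homeo_topology carrier_homeo_group homeomorphic_imp_surjective_map)
    then show "f p \<in> topspace circle" using p by blast
  qed
  fix U assume U: "openin circle U"
  have "{f \<in> topspace homeo_topology. f p \<in> U} = {f \<in> carrier homeo_group. f ` {p} \<subseteq> U}"
    by (simp add: topspace_homeo_topology)
  then show "openin homeo_topology {f \<in> topspace homeo_topology. f p \<in> U}"
    using openin_homeo_topology[of "{p}" U] U p by simp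
qed

text \<open>If F a = F b, the difference of a and b is a period. Every period r can be halved:
  \<open>F (x + r/2) - F x\<close> takes opposite values at 0 and r/2, and its zero spreads to all x
  by \<open>hom\<close>. Arbitrarily small periods and continuity force F to be constant.\<close>

lemma injective_or_constant:
  fixes F :: "real \<Rightarrow> real"
  assumes cont: "continuous_on UNIV F"
    and hom: "\<And>t a b. F a = F b \<Longrightarrow> F (t + a) = F (t + b)"
  shows "inj F \<or> (\<forall>x. F x = F 0)"
proof (rule disjCI)
  assume "\<not> (\<forall>x. F x = F 0)"
  then obtain z where z: "F z \<noteq> F 0" by blast
  show "inj F"
  proof (rule ccontr)
    assume "\<not> inj F"
    then obtain a b where "F a = F b" "a < b" unfolding inj_def by (metis linorder_neqE_linordered_idom)
    then have "\<exists>p>0. \<forall>x. F (x + p) = F x"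
      using hom[of a b] by (intro exI[of _ "b - a"]) (auto, metis add.commute diff_add_cancel add_diff_eq)
    then obtain p where p: "p > 0" "\<And>x. F (x + p) = F x" by blast
    have half: "\<forall>x. F (x + r / 2) = F x" if r: "r > 0" "\<forall>x. F (x + r) = F x" for r
    proof -
      define G where "G x = F (x + r / 2) - F x" for x
      have "continuous_on UNIV G" unfolding G_def
        by (intro continuous_intros continuous_on_compose2[OF cont] cont) auto
      then have con: "connected (range G)" by (rule connected_continuous_image) simp
      have "G (r / 2) = - G 0" using r(2)[rule_format, of 0] by (simp add: G_def)
      then have "0 \<in> range G"
        using connectedD_interval[OF con rangeI[of G 0] rangeI[of G "r / 2"], of 0]
          connectedD_interval[OF con rangeI[of G "r / 2"] rangeI[of G 0], of 0] by (cases "G 0 \<le> 0") auto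
      then obtain x where "F (x + r / 2) = F x" by (auto simp: G_def)
      then have "F (t + (x + r / 2)) = F (t + x)" for t by (rule hom)
      from this[of "_ - x"] show ?thesis by (simp add: algebra_simps)
    qed
    have per: "\<forall>x. F (x + p / 2 ^ n) = F x" for n
    proof (induction n)
      case (Suc n)
      have "\<forall>x. F (x + (p / 2 ^ n) / 2) = F x" by (rule half) (use Suc p in auto)
      then show ?case by (simp add: mult.commute)
    qed (use p in simp)
    have per_nat: "F (x + real k * (p / 2 ^ n)) = F x" for x k n
    proof (induction k)
      case (Suc k)
      have "F (x + real (Suc k) * (p / 2 ^ n)) = F ((x + real k * (p / 2 ^ n)) + p / 2 ^ n)"
        by (simp add: algebra_simps add_divide_distrib)
      then show ?case using per[of n] Suc by metis
    qed simp
    have per_int: "F (of_int k * (p / 2 ^ n)) = F 0" for k :: int and n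
    proof (cases "k \<ge> 0")
      case True then show ?thesis using per_nat[of 0 "nat k" n] by simp
    next
      case False then show ?thesis using per_nat[of "of_int k * (p / 2 ^ n)" "nat (- k)" n] by simp
    qed
    have "isCont F z" using cont by (simp add: continuous_on_eq_continuous_at)
    then obtain e where e: "e > 0" "\<forall>x. dist x z < e \<longrightarrow> dist (F x) (F z) < \<bar>F z - F 0\<bar>"
      unfolding continuous_at_eps_delta using z by (metis right_minus_eq zero_less_abs_iff)
    obtain n where n: "p / e < 2 ^ n" using real_arch_pow[of 2 "p / e"] by auto
    define q where "q = p / 2 ^ n"
    have q: "0 < q" "q < e" using n p(1) e(1) by (auto simp: q_def field_simps)
    define k where "k = \<lfloor>z / q\<rfloor>"
    have "of_int k \<le> z / q" "z / q < of_int k + 1" by (auto simp: k_def)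
    then have "of_int k * q \<le> z" "z < of_int k * q + q" using q(1) by (simp_all add: field_simps)
    then have "dist (of_int k * q) z < e" using q by (simp add: dist_real_def)
    then have "dist (F (of_int k * q)) (F z) < \<bar>F z - F 0\<bar>" using e(2) by blast
    then show False using per_int[of k n] by (simp add: q_def dist_real_def abs_minus_commute)
  qed
qed

lemma homeo_carrierE:
  assumes "f \<in> carrier homeo_group"
  shows "f (circle_proj x) \<in> range circle_proj" "inj_on f (range circle_proj)" "f ` range circle_proj = range circle_proj"
proof -
  show 1: "inj_on f (range circle_proj)" "f ` range circle_proj = range circle_proj"
    using assms by (auto simp: carrier_homeo_group homeomorphic_eq_everything_map topspace_circle)
  show "f (circle_proj x) \<in> range circle_proj" using 1(2) by blast
qed

lemma homeo_mult_apply: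
  assumes "f \<in> carrier homeo_group" "g \<in> carrier homeo_group"
  shows "(f \<otimes>\<^bsub>homeo_group\<^esub> g) (circle_proj x) = f (g (circle_proj x))"
proof -
  obtain F where F: "circle_lift F" "f = circle_map F" by (rule homeo_group_lift[OF assms(1)])
  obtain G where G: "circle_lift G" "g = circle_map G" by (rule homeo_group_lift[OF assms(2)])
  show ?thesis using F G circle_lift_comp by (simp add: circle_map_mult)
qed

locale circle_action =
  fixes H :: "(real set \<Rightarrow> real set) set" and \<rho> :: "(real set \<Rightarrow> real set) \<Rightarrow> (real set \<Rightarrow> real set)"
  assumes H: "H = isometries \<or> H = isometries_plus"
    and act: "faithful_continuous_action H \<rho>"
begin

lemma rot_H: "rot t \<in> H"
  using H isometries_eq isometries_plus_eq by auto

lemma rho_carrier: "h \<in> H \<Longrightarrow> \<rho> h \<in> carrier homeo_group"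
  using act unfolding faithful_continuous_action_def hom_def by auto

lemma rho_mult: "h \<in> H \<Longrightarrow> k \<in> H \<Longrightarrow> \<rho> (h \<otimes>\<^bsub>homeo_group\<^esub> k) = \<rho> h \<otimes>\<^bsub>homeo_group\<^esub> \<rho> k"
  using act unfolding faithful_continuous_action_def hom_def by auto

lemma rho_rot_add: "\<rho> (rot (s + t)) (circle_proj x) = \<rho> (rot s) (\<rho> (rot t) (circle_proj x))"
proof -
  have "rot (s + t) = rot s \<otimes>\<^bsub>homeo_group\<^esub> rot t" by (simp add: circle_map_mult add_ac)
  then show ?thesis using rho_mult[OF rot_H rot_H] homeo_mult_apply rho_carrier[OF rot_H] by simp
qed

lemma rho_inj: "h \<in> H \<Longrightarrow> k \<in> H \<Longrightarrow> \<rho> h = \<rho> k \<longleftrightarrow> h = k"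
  using act unfolding faithful_continuous_action_def by (auto simp: inj_on_eq_iff)

lemma rot_eq_iff: "rot s = rot t \<longleftrightarrow> s - t \<in> \<int>"
proof -
  have "rot s = rot t \<longleftrightarrow> (\<exists>n\<in>\<int>. s = t + n)" by (simp add: circle_map_eq_iff add_ac)
  also have "\<dots> \<longleftrightarrow> s - t \<in> \<int>" by (metis add_diff_cancel_left' diff_add_cancel add.commute)
  finally show ?thesis .
qed

lemma rho_eqI: "h \<in> H \<Longrightarrow> k \<in> H \<Longrightarrow> (\<And>x. \<rho> h (circle_proj x) = \<rho> k (circle_proj x)) \<Longrightarrow> h = k"
proof -
  assume a: "h \<in> H" "k \<in> H" "\<And>x. \<rho> h (circle_proj x) = \<rho> k (circle_proj x)"
  have "\<rho> h = \<rho> k"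
    by (rule extensionalityI[of _ "topspace circle"])
      (use rho_carrier[OF a(1)] rho_carrier[OF a(2)] a(3) in \<open>auto simp: carrier_homeo_group topspace_circle\<close>)
  then show "h = k" using a rho_inj by blast
qed

lemma rho_rot_zero: "\<rho> (rot 0) (circle_proj x) = circle_proj x"
proof -
  have "\<rho> (rot 0) (\<rho> (rot 0) (circle_proj x)) = \<rho> (rot 0) (circle_proj x)"
    using rho_rot_add[of 0 0 x] by simp
  moreover have "\<rho> (rot 0) (circle_proj x) \<in> range circle_proj" by (rule homeo_carrierE(1)[OF rho_carrier[OF rot_H]])
  ultimately show ?thesis by (rule inj_onD[OF homeo_carrierE(2)[OF rho_carrier[OF rot_H]]]) blast
qed

lemma orbit_continuous: "continuous_map euclideanreal circle (\<lambda>t. \<rho> (rot t) (circle_proj x))"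
proof -
  have "continuous_map euclideanreal (subtopology homeo_topology H) rot"
    using continuous_map_rot rot_H by (auto simp: continuous_map_in_subtopology)
  moreover have "continuous_map (subtopology homeo_topology H) homeo_topology \<rho>"
    using act by (simp add: faithful_continuous_action_def)
  moreover have "continuous_map homeo_topology circle (\<lambda>f. f (circle_proj x))"
    by (rule continuous_map_evaluation) (simp add: topspace_circle)
  ultimately have "continuous_map euclideanreal circle ((\<lambda>f. f (circle_proj x)) \<circ> \<rho> \<circ> rot)"
    by (blast intro: continuous_map_compose)
  then show ?thesis by (simp add: o_def)
qed

text \<open>With G a lift of \<open>\<rho> (rot t)\<close>, the functions F (t + s) and G (F s) of s
  cover the same curve and differ by a constant integer. So a coincidence of values of F survives
  every translation, as \<open>injective_or_constant\<close> demands.\<close>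

lemma orbit_lift:
  obtains F where "continuous_on UNIV F" "\<And>t. \<rho> (rot t) (circle_proj x) = circle_proj (F t)"
    "\<And>t a b. F a = F b \<Longrightarrow> F (t + a) = F (t + b)"
proof -
  obtain F where F: "continuous_on UNIV F" "\<And>t. \<rho> (rot t) (circle_proj x) = circle_proj (F t)"
    using circle_path_lift[OF orbit_continuous] by blast
  have "F (t + a) = F (t + b)" if ab: "F a = F b" for t a b
  proof -
    obtain G where G: "circle_lift G" "\<rho> (rot t) = circle_map G" by (rule homeo_group_lift[OF rho_carrier[OF rot_H]])
    have "circle_proj (F (t + s)) = circle_proj (G (F s))" for s
      using rho_rot_add[of t s x] unfolding F(2) G(2) circle_map_proj[OF G(1)] .
    then have Z: "F (t + s) - G (F s) \<in> \<int>" for s by (simp add: circle_proj_eq_iff)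
    have "F (t + a) - G (F a) = F (t + b) - G (F b)"
    proof (rule integer_valued_constant[of "\<lambda>s. F (t + s) - G (F s)"])
      have "continuous_on UNIV (\<lambda>s. F (t + s))"
        by (rule continuous_on_compose2[OF F(1)]) (auto intro!: continuous_intros)
      moreover have "continuous_on UNIV (\<lambda>s. G (F s))"
        by (rule continuous_on_compose2[OF circle_lift_continuous[OF G(1), of UNIV] F(1)]) simp
      ultimately show "continuous_on UNIV (\<lambda>s. F (t + s) - G (F s))" by (rule continuous_on_diff)
    qed (rule Z)
    then show ?thesis using ab by simp
  qed
  then show ?thesis using that F by blast
qed

text \<open>By faithfulness some point is moved, so the lift of its orbit is not constant, hence
  injective; a closed orbit with such a lift covers the whole circle. A rotation that fixes one
  point of this orbit then fixes all of them, so it is trivial.\<close>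

lemma simply_transitive_orbit:
  obtains F where "circle_lift F" "\<And>s t. \<rho> (rot t) (circle_proj (F s)) = circle_proj (F (t + s))"
proof -
  have "\<exists>x t. \<rho> (rot t) (circle_proj x) \<noteq> circle_proj x"
  proof (rule ccontr)
    assume "\<not> ?thesis"
    then have "\<rho> (rot (1/2)) (circle_proj x) = \<rho> (rot 0) (circle_proj x)" for x by metis
    then have "rot (1/2) = rot 0" by (rule rho_eqI[OF rot_H rot_H])
    then have "(1/2 :: real) \<in> \<int>" unfolding rot_eq_iff by simp
    then show False using Ints_nonzero_abs_less1[of "1/2::real"] by auto
  qed
  then obtain x0 t0 where x0: "\<rho> (rot t0) (circle_proj x0) \<noteq> circle_proj x0" by blast
  obtain F where F: "continuous_on UNIV F" "\<And>t. \<rho> (rot t) (circle_proj x0) = circle_proj (F t)"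
    "\<And>t a b. F a = F b \<Longrightarrow> F (t + a) = F (t + b)" by (rule orbit_lift) blast
  have "F t0 \<noteq> F 0" using x0 F(2)[of t0] F(2)[of 0] rho_rot_zero[of x0] by auto
  then have inj: "inj F" using injective_or_constant[OF F(1) F(3)] by blast
  have rho_F: "\<rho> (rot t) (circle_proj (F s)) = circle_proj (F (t + s))" for s t
    using rho_rot_add[of t s x0] by (simp add: F(2))
  have per: "circle_proj (F (s + 1)) = circle_proj (F s)" for s
  proof -
    have "rot (s + 1) = rot s" by (simp add: rot_eq_iff)
    then show ?thesis by (metis F(2))
  qed
  then have "F 1 - F 0 \<in> \<int>" using per[of 0] by (simp add: circle_proj_eq_iff)
  moreover have "F 1 - F 0 \<noteq> 0" using inj by (auto simp: inj_eq)
  ultimately have big: "\<bar>F 1 - F 0\<bar> \<ge> 1" using Ints_nonzero_abs_ge1 by blast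
  have con: "connected (range F)" using F(1) by (rule connected_continuous_image) simp
  have "\<exists>m. m \<in> range F \<and> (\<forall>y. m \<le> y \<longrightarrow> y \<le> m + 1 \<longrightarrow> y \<in> range F)"
  proof (cases "F 0 \<le> F 1")
    case True
    show ?thesis using connectedD_interval[OF con, of "F 0" "F 1"] big True by (intro exI[of _ "F 0"]) auto
  next
    case False
    show ?thesis using connectedD_interval[OF con, of "F 1" "F 0"] big False by (intro exI[of _ "F 1"]) auto
  qed
  then obtain m where m: "m \<in> range F" "\<And>y. m \<le> y \<Longrightarrow> y \<le> m + 1 \<Longrightarrow> y \<in> range F" by blast
  have surj: "\<exists>s. circle_proj z = circle_proj (F s)" for z
  proof -
    have "z + of_int \<lceil>m - z\<rceil> \<in> range F" by (rule m(2)) linarith+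
    then obtain s where "z + of_int \<lceil>m - z\<rceil> = F s" by auto
    then have "circle_proj (F s) = circle_proj z" using circle_proj_Ints[of "of_int \<lceil>m - z\<rceil>" z] by simp
    then show ?thesis by metis
  qed
  have Z: "F a - F b \<in> \<int> \<longleftrightarrow> a - b \<in> \<int>" for a b
  proof
    assume "a - b \<in> \<int>"
    then have "rot a = rot b" by (simp add: rot_eq_iff)
    then show "F a - F b \<in> \<int>" by (metis F(2) circle_proj_eq_iff)
  next
    assume "F a - F b \<in> \<int>"
    then have ab: "circle_proj (F a) = circle_proj (F b)" by (simp add: circle_proj_eq_iff)
    have "\<rho> (rot (a - b)) (circle_proj z) = \<rho> (rot 0) (circle_proj z)" for z
    proof -
      obtain s where s: "circle_proj z = circle_proj (F s)" using surj by blast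
      have "circle_proj (F ((s - b) + a)) = circle_proj (F ((s - b) + b))"
        using ab unfolding rho_F[symmetric] by simp
      then have "circle_proj (F (a - b + s)) = circle_proj (F (0 + s))" by (simp add: algebra_simps)
      then show ?thesis unfolding s rho_F .
    qed
    then have "rot (a - b) = rot 0" by (rule rho_eqI[OF rot_H rot_H])
    then show "a - b \<in> \<int>" unfolding rot_eq_iff by simp
  qed
  have "\<exists>a b. F a - F b = 1"
  proof -
    obtain b where b: "m = F b" using m(1) by auto
    obtain a where "m + 1 = F a" using m(2)[of "m + 1"] by auto
    then show ?thesis using b by (intro exI[of _ a] exI[of _ b]) simp
  qed
  then have "circle_lift F" using circle_liftI[OF F(1) Z] by blast
  then show ?thesis using that rho_F by blast
qed

text \<open>The base point of the orbit is chosen fixed by the reflection, so that the conjugacy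
  intertwines all of \<open>H\<close> and not just the rotations.\<close>

theorem conjugate_to_standard:
  obtains F where "circle_lift F"
    "\<And>h. h \<in> H \<Longrightarrow> \<rho> h = circle_map F \<otimes>\<^bsub>homeo_group\<^esub> h \<otimes>\<^bsub>homeo_group\<^esub> inv\<^bsub>homeo_group\<^esub> (circle_map F)"
proof -
  obtain F0 where F0: "circle_lift F0" "\<And>s t. \<rho> (rot t) (circle_proj (F0 s)) = circle_proj (F0 (t + s))"
    by (rule simply_transitive_orbit) blast
  have conj: "\<rho> (circle_map L) = circle_map F \<otimes>\<^bsub>homeo_group\<^esub> circle_map L \<otimes>\<^bsub>homeo_group\<^esub> inv\<^bsub>homeo_group\<^esub> (circle_map F)"
    if F: "circle_lift F" and L: "circle_lift L" "circle_map L \<in> H" and eq: "\<And>s. \<rho> (circle_map L) (circle_proj (F s)) = circle_proj (F (L s))" for F L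
  proof -
    have "\<rho> (circle_map L) = circle_map (\<lambda>x. F (L (inv_into UNIV F x)))"
    proof (rule circle_map_eqI)
      show "\<rho> (circle_map L) \<in> extensional (topspace circle)" using rho_carrier[OF L(2)] by (simp add: carrier_homeo_group)
      show "circle_lift (\<lambda>x. F (L (inv_into UNIV F x)))" using F L circle_lift_comp circle_lift_inv by blast
      show "\<rho> (circle_map L) (circle_proj x) = circle_proj (F (L (inv_into UNIV F x)))" for x
        using eq[of "inv_into UNIV F x"] F by simp
    qed
    then show ?thesis using F L circle_lift_inv[OF F] circle_lift_comp[OF F L(1)] by (simp add: circle_map_inv circle_map_mult)
  qed
  show ?thesis
  proof (cases "H = isometries_plus")
    case True
    have "\<rho> h = circle_map F0 \<otimes>\<^bsub>homeo_group\<^esub> h \<otimes>\<^bsub>homeo_group\<^esub> inv\<^bsub>homeo_group\<^esub> (circle_map F0)" if h: "h \<in> H" for h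
    proof -
      obtain t where t: "h = rot t" using h True isometries_plus_eq by auto
      have "\<rho> (rot t) (circle_proj (F0 s)) = circle_proj (F0 (s + t))" for s by (simp only: F0(2) add.commute[of s t])
      then show ?thesis unfolding t using rot_H by (intro conj[OF F0(1)]) auto
    qed
    then show ?thesis using that F0(1) by blast
  next
    case False
    then have Hi: "H = isometries" using H by blast
    have "circle_map (\<lambda>x. 0 - x) \<in> H" unfolding Hi isometries_eq by blast
    then have refl: "refl_circle \<in> H" by simp
    have "\<exists>b. \<rho> refl_circle (circle_proj (F0 0)) = circle_proj (F0 b)"
      using homeo_carrierE(1)[OF rho_carrier[OF refl], of "F0 0"] circle_lift_surj[OF F0(1)] by (metis imageE surjD)
    then obtain b where b: "\<rho> refl_circle (circle_proj (F0 0)) = circle_proj (F0 b)" by blast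
    have rF0: "\<rho> refl_circle (circle_proj (F0 s)) = circle_proj (F0 (b - s))" for s
    proof -
      have "refl_circle \<otimes>\<^bsub>homeo_group\<^esub> rot s = rot (- s) \<otimes>\<^bsub>homeo_group\<^esub> refl_circle" by (simp add: circle_map_mult)
      then have "\<rho> refl_circle \<otimes>\<^bsub>homeo_group\<^esub> \<rho> (rot s) = \<rho> (rot (- s)) \<otimes>\<^bsub>homeo_group\<^esub> \<rho> refl_circle"
        using rho_mult[OF refl rot_H] rho_mult[OF rot_H refl] by metis
      then have "\<rho> refl_circle (\<rho> (rot s) (circle_proj (F0 0))) = \<rho> (rot (- s)) (\<rho> refl_circle (circle_proj (F0 0)))"
        using homeo_mult_apply rho_carrier rot_H refl by metis
      then show ?thesis unfolding F0(2) b by simp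
    qed
    \<comment> \<open>On orbit parameters the reflection is s -> b - s, with fixed point b /
      2.\<close>
    define F where "F s = F0 (s + b / 2)" for s
    have F: "circle_lift F" unfolding F_def using circle_lift_comp[OF F0(1) circle_lift_translation] .
    have rotF: "\<rho> (rot t) (circle_proj (F s)) = circle_proj (F (s + t))" for s t
      unfolding F_def F0(2) by (simp add: add_ac)
    have reflF: "\<rho> refl_circle (circle_proj (F s)) = circle_proj (F (- s))" for s
      unfolding F_def rF0 by (simp add: algebra_simps)
    have "\<rho> h = circle_map F \<otimes>\<^bsub>homeo_group\<^esub> h \<otimes>\<^bsub>homeo_group\<^esub> inv\<^bsub>homeo_group\<^esub> (circle_map F)" if h: "h \<in> H" for h
    proof -
      consider t where "h = rot t" | t where "h = circle_map (\<lambda>x. t - x)" using h[unfolded Hi isometries_eq] by blast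
      then show ?thesis
      proof cases
        case 1
        show ?thesis unfolding 1 by (rule conj[OF F]) (use rotF rot_H in auto)
      next
        case (2 t)
        have "h = rot t \<otimes>\<^bsub>homeo_group\<^esub> refl_circle" unfolding 2 by (simp add: circle_map_mult)
        then have "\<rho> h (circle_proj (F s)) = \<rho> (rot t) (\<rho> refl_circle (circle_proj (F s)))" for s
          using rho_mult[OF rot_H refl] homeo_mult_apply rho_carrier rot_H refl by metis
        then have "\<rho> h (circle_proj (F s)) = circle_proj (F (t - s))" for s
          unfolding reflF rotF by simp
        then show ?thesis using h unfolding 2 by (intro conj[OF F]) auto
      qed
    qed
    then show ?thesis using that F by blast
  qed
qed

end

section \<open>Structures on the circle from lifts and developing maps\<close>

lemma quotient_data_translation:
  fixes q :: "real \<Rightarrow> 'a" and d :: "real \<Rightarrow> 'm"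
  assumes G: "geometry_group \<G>" and r: "r > 0"
    and q: "\<And>x y. q x = q y \<longleftrightarrow> (x - y) / r \<in> \<int>"
    and d: "continuous_map euclideanreal (fst \<G>) d" "\<And>U. open U \<Longrightarrow> openin (fst \<G>) (d ` U)" "\<And>x. \<exists>e>0. inj_on d (ball x e)"
    and tr: "\<And>s. \<exists>g\<in>snd \<G>. \<forall>x. d (x + s) = g (d x)"
  shows "quotient_data \<G> UNIV q d"
proof -
  interpret geometry_group \<G> by (rule G)
  show ?thesis
  proof
    fix x :: real
    show "\<exists>e>0. inj_on q (ball x e \<inter> UNIV)"
    proof (intro exI[of _ "r / 2"] conjI inj_onI)
      show "r / 2 > 0" using r by simp
      fix y z assume yz: "y \<in> ball x (r / 2) \<inter> UNIV" "z \<in> ball x (r / 2) \<inter> UNIV" "q y = q z"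
      then have "dist y z < r" using dist_triangle_half_l[of y x r z] by (auto simp: dist_commute)
      then have "\<bar>y - z\<bar> < r" by (simp add: dist_real_def)
      then have "\<bar>(y - z) / r\<bar> < 1" using r by simp
      then show "y = z" using yz(3) Ints_nonzero_abs_less1[of "(y - z) / r"] r unfolding q by auto
    qed
  next
    fix x y assume xy: "q x = q y"
    obtain g where "g \<in> snd \<G>" "\<forall>z. d (z + (y - x)) = g (d z)" using tr by blast
    moreover have "q (z + (y - x)) = q z" for z
    proof -
      have "- ((x - y) / r) \<in> \<int>" using xy unfolding q by (rule Ints_minus)
      then show ?thesis unfolding q by (simp add: diff_divide_distrib)
    qed
    ultimately show "\<exists>\<sigma>. continuous_on UNIV \<sigma> \<and> \<sigma> \<in> UNIV \<rightarrow> UNIV \<and> \<sigma> x = y \<and> (\<forall>z\<in>UNIV. q (\<sigma> z) = q z) \<and>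
       (\<exists>g\<in>snd \<G>. \<forall>z\<in>UNIV. d (\<sigma> z) = g (d z))"
      by (intro exI[of _ "\<lambda>z. z + (y - x)"]) (auto intro!: continuous_intros)
  qed (use d in auto)
qed

lemma quotient_data_proj_translation:
  assumes "r > 0" "\<And>x y. q x = q y \<longleftrightarrow> (x - y) / r \<in> \<int>" "normal_dev D"
  shows "quotient_data proj_geom UNIV q D"
proof (rule quotient_data_translation[OF geometry_group_proj assms(1,2)])
  have D: "developing D" using assms(3) by (rule normal_dev_developing)
  show "continuous_map euclideanreal (fst proj_geom) D" using developing_continuous[OF D] by simp
  show "openin (fst proj_geom) (D ` U)" if "open U" for U using developing_open[OF D that] by simp
  show "\<exists>e>0. inj_on D (ball x e)" for x by (rule developing_inj[OF D])
  show "\<exists>g\<in>snd proj_geom. \<forall>x. D (x + s) = g (D x)" for s using normal_dev_translate[OF assms(3)] by simp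
qed

lemma quotient_data_circle:
  assumes "circle_lift F" "normal_dev D"
  shows "quotient_data proj_geom UNIV (\<lambda>x. circle_proj (F x)) D"
  by (rule quotient_data_proj_translation[of 1]) (use assms in \<open>auto simp: circle_proj_eq_iff circle_lift_Ints\<close>)

text \<open>Precomposing the projection with a homeomorphism of the line changes no open set below.
  All structures therefore live on \<open>circle\<close> itself and can be compared by
  equality.\<close>

lemma circle_eq_quotient:
  assumes F: "circle_lift F"
  shows "quotient_topology euclideanreal (\<lambda>x. circle_proj (F x)) = circle"
proof -
  have "openin (quotient_topology euclideanreal (\<lambda>x. circle_proj (F x))) V \<longleftrightarrow> openin circle V" for V
  proof -
    have *: "{x. circle_proj (F x) \<in> V} = F -` {x. circle_proj x \<in> V}" by auto
    have "open (F -` {x. circle_proj x \<in> V}) \<longleftrightarrow> open {x. circle_proj x \<in> V}"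
    proof
      assume "open (F -` {x. circle_proj x \<in> V})"
      then have "open (F ` F -` {x. circle_proj x \<in> V})" by (rule circle_lift_open[OF F])
      then show "open {x. circle_proj x \<in> V}" by (simp only: surj_image_vimage_eq[OF circle_lift_surj[OF F]])
    next
      assume "open {x. circle_proj x \<in> V}"
      then show "open (F -` {x. circle_proj x \<in> V})"
        using circle_lift_continuous[OF F, of UNIV] by (rule open_vimage)
    qed
    then have "open {x. circle_proj (F x) \<in> V} \<longleftrightarrow> open {x. circle_proj x \<in> V}" unfolding * .
    moreover have "range (\<lambda>x. circle_proj (F x)) = range circle_proj"
      using image_image[of circle_proj F UNIV] circle_lift_surj[OF F] by simp
    ultimately show ?thesis by (simp add: circle_def openin_quotient_topology)
  qed
  then show ?thesis by (rule topology_eq[THEN iffD2, rule_format])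
qed

text \<open>The developing map of this structure is D composed with the inverse of F. Keeping F in
  the covering map rather than in D leaves D one of the explicit normal forms.\<close>

definition circle_structure :: "(real \<Rightarrow> real) \<Rightarrow> (real \<Rightarrow> p1) \<Rightarrow> (real set, p1) chart set" where
  "circle_structure F D = structure_of proj_geom circle (quotient_charts euclideanreal (\<lambda>x. circle_proj (F x)) D)"

lemma pi0_eq: "pi0 = circle_structure (\<lambda>x. x) affine_embed"
  by (simp add: pi0_def circle_structure_def)

lemma normal_dev_affine [simp]: "normal_dev affine_embed"
  by (simp add: normal_dev_def)

lemma is_structure_circle_structure:
  assumes "circle_lift F" "normal_dev D"
  shows "is_structure proj_geom circle (circle_structure F D)"
proof -
  interpret quotient_data proj_geom UNIV "\<lambda>x. circle_proj (F x)" D by (rule quotient_data_circle[OF assms])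
  show ?thesis using is_structure_struct by (simp add: circle_structure_def circle_eq_quotient assms)
qed

lemma is_atlas_circle_structure:
  "circle_lift F \<Longrightarrow> normal_dev D \<Longrightarrow> is_atlas proj_geom circle (circle_structure F D)"
  using is_structure_circle_structure by (auto simp: is_structure_def)

section \<open>Projectivity at a point, read on lifts\<close>

definition proj_at :: "(real \<Rightarrow> p1) \<Rightarrow> (real \<Rightarrow> p1) \<Rightarrow> (real \<Rightarrow> real) \<Rightarrow> real \<Rightarrow> bool" where
  "proj_at d d' \<Phi> x \<longleftrightarrow> (\<exists>g\<in>PGL2. \<exists>e>0. \<forall>y\<in>ball x e. d' (\<Phi> y) = g (d y))"

lemma locally_modeled_circle:
  assumes F: "circle_lift F1" "circle_lift F2" and D: "normal_dev D1" "normal_dev D2"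
    and \<Phi>: "continuous_on UNIV \<Phi>" and f: "\<And>x. f (circle_proj (F1 x)) = circle_proj (F2 (\<Phi> x))"
  shows "locally_modeled_at proj_geom (circle, circle_structure F1 D1) (circle, circle_structure F2 D2) f (circle_proj (F1 x)) \<longleftrightarrow>
    proj_at D1 D2 \<Phi> x"
proof -
  interpret q1: quotient_data proj_geom UNIV "\<lambda>x. circle_proj (F1 x)" D1 by (rule quotient_data_circle[OF F(1) D(1)])
  interpret q2: quotient_data proj_geom UNIV "\<lambda>x. circle_proj (F2 x)" D2 by (rule quotient_data_circle[OF F(2) D(2)])
  interpret quotient_pair proj_geom UNIV UNIV "\<lambda>x. circle_proj (F1 x)" "\<lambda>x. circle_proj (F2 x)" D1 D2 \<Phi> f
    by unfold_locales (use \<Phi> f in auto)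
  show ?thesis using locally_modeled_at_lift[of x]
    by (simp add: circle_structure_def circle_eq_quotient F proj_at_def)
qed

lemma proj_at_comp:
  assumes \<Phi>: "continuous_on UNIV \<Phi>" and 1: "proj_at d1 d2 \<Phi> x" and 2: "proj_at d2 d3 \<Psi> (\<Phi> x)"
  shows "proj_at d1 d3 (\<lambda>x. \<Psi> (\<Phi> x)) x"
proof -
  obtain g e where g: "g \<in> PGL2" "e > 0" "\<forall>y\<in>ball x e. d2 (\<Phi> y) = g (d1 y)" using 1 by (auto simp: proj_at_def)
  obtain h e' where h: "h \<in> PGL2" "e' > 0" "\<forall>y\<in>ball (\<Phi> x) e'. d3 (\<Psi> y) = h (d2 y)" using 2 by (auto simp: proj_at_def)
  have "isCont \<Phi> x" using \<Phi> by (simp add: continuous_on_eq_continuous_at)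
  then obtain e2 where e2: "e2 > 0" "\<forall>y. dist y x < e2 \<longrightarrow> dist (\<Phi> y) (\<Phi> x) < e'"
    unfolding continuous_at_eps_delta using h(2) by blast
  have "d3 (\<Psi> (\<Phi> y)) = h (g (d1 y))" if "y \<in> ball x (min e e2)" for y
  proof -
    have "y \<in> ball x e" "\<Phi> y \<in> ball (\<Phi> x) e'" using that e2(2)[rule_format, of y] by (auto simp: dist_commute)
    then show ?thesis using g(3) h(3) by simp
  qed
  then show ?thesis unfolding proj_at_def
    using PGL2_comp[OF h(1) g(1)] g(2) e2(1) by (intro bexI[of _ "\<lambda>x. h (g x)"] exI[of _ "min e e2"]) auto
qed

lemma proj_at_inv:
  assumes \<Phi>: "circle_lift \<Phi>" and 1: "proj_at d1 d2 \<Phi> x"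
  shows "proj_at d2 d1 (inv_into UNIV \<Phi>) (\<Phi> x)"
proof -
  obtain g e where g: "g \<in> PGL2" "e > 0" "\<forall>y\<in>ball x e. d2 (\<Phi> y) = g (d1 y)" using 1 by (auto simp: proj_at_def)
  obtain h where h: "h \<in> PGL2" "\<forall>p. h (g p) = p" using PGL2_inv[OF g(1)] by blast
  have "open (\<Phi> ` ball x e)" using circle_lift_open[OF \<Phi>] by simp
  moreover have "\<Phi> x \<in> \<Phi> ` ball x e" using g(2) by simp
  ultimately obtain e' where e': "e' > 0" "ball (\<Phi> x) e' \<subseteq> \<Phi> ` ball x e" using open_contains_ball by blast
  have "d1 (inv_into UNIV \<Phi> y) = h (d2 y)" if y: "y \<in> ball (\<Phi> x) e'" for y
  proof -
    obtain z where "y = \<Phi> z" "z \<in> ball x e" using y e'(2) by blast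
    then show ?thesis using g(3) h(2) \<Phi> by simp
  qed
  then show ?thesis unfolding proj_at_def using h(1) e'(1) by blast
qed

section \<open>A group of rotations by piecewise projective maps is projective in some normal form\<close>

lemma countable_of_finite_proj:
  assumes "finite (circle_proj ` A)"
  shows "countable A"
proof -
  have "countable {x. circle_proj x = p}" for p
  proof (cases "\<exists>y. circle_proj y = p")
    case True
    then obtain y where y: "p = circle_proj y" by blast
    have "{x. circle_proj x = p} \<subseteq> (\<lambda>n::int. y + of_int n) ` UNIV"
    proof
      fix x assume "x \<in> {x. circle_proj x = p}"
      then have "x - y \<in> \<int>" by (simp add: y circle_proj_eq_iff)
      then obtain n :: int where "x - y = of_int n" by (auto elim: Ints_cases)
      then show "x \<in> (\<lambda>n::int. y + of_int n) ` UNIV" by (intro image_eqI[of _ _ n]) auto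
    qed
    then show ?thesis by (rule countable_subset) simp
  qed (simp add: Collect_empty_eq[THEN iffD2])
  then have "countable (\<Union>p\<in>circle_proj ` A. {x. circle_proj x = p})"
    using assms by (intro countable_UN) (auto intro: countable_finite)
  moreover have "A \<subseteq> (\<Union>p\<in>circle_proj ` A. {x. circle_proj x = p})" by auto
  ultimately show ?thesis using countable_subset by blast
qed

text \<open>The exceptional sets for the rotations by \<open>1 / (n + 2)\<close> are discarded first: any other point is joined
  to \<open>c\<close> through one of these small rotations, so the complement \<open>D\<close> of the class of \<open>c\<close> is countable. Some
  rotation then moves \<open>D\<close> off itself, and its exceptional set contains \<open>D\<close>.\<close>

lemma cofinite_class:
  fixes E :: "real \<Rightarrow> real \<Rightarrow> bool"
  assumes E: "\<And>x y. E x y \<Longrightarrow> E y x" "\<And>x y z. E x y \<Longrightarrow> E y z \<Longrightarrow> E x z"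
    and fin: "\<And>t. finite (circle_proj ` {x. \<not> E x (x + t)})"
  shows "\<exists>c. finite (circle_proj ` {x. \<not> E c x})"
proof -
  define B where "B = (\<Union>n::nat. {x. \<not> E x (x + 1 / (n + 2))})"
  have B: "countable B" unfolding B_def by (intro countable_UN countable_of_finite_proj[OF fin]) auto
  have "\<exists>c. c \<notin> A" if "countable A" for A :: "real set"
    using that uncountable_UNIV_real by (metis UNIV_eq_I)
  then obtain c where c: "c \<notin> B" using B by blast
  have EB: "E c y" if y: "y \<notin> B" for y
  proof -
    \<comment> \<open>The steps 1 / (n + 2) lie in (0,1), so these points are distinct on the
      circle: infinitely many, hence one of them escapes the exceptional set of the rotation by y -
      c.\<close>
    let ?P = "\<lambda>n::nat. c + 1 / (real n + 2)"
    have "inj (\<lambda>n. circle_proj (?P n))"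
    proof (rule injI)
      fix m n assume "circle_proj (?P m) = circle_proj (?P n)"
      then have "1 / (real m + 2) - 1 / (real n + 2) \<in> \<int>" by (simp add: circle_proj_eq_iff)
      moreover have "0 < 1 / (real m + 2)" "1 / (real m + 2) < 1" "0 < 1 / (real n + 2)" "1 / (real n + 2) < 1" by auto
      then have "\<bar>1 / (real m + 2) - 1 / (real n + 2)\<bar> < 1" by linarith
      ultimately have "1 / (real m + 2) - 1 / (real n + 2) = 0" by (intro Ints_nonzero_abs_less1)
      then show "m = n" by simp
    qed
    then have "infinite (range (\<lambda>n. circle_proj (?P n)))" using finite_imageD infinite_UNIV_nat by blast
    then have "\<not> range (\<lambda>n. circle_proj (?P n)) \<subseteq> circle_proj ` {x. \<not> E x (x + (y - c))}"
      using fin finite_subset by blast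
    then obtain n where "E (?P n) (?P n + (y - c))" by blast
    then have "E (?P n) (y + 1 / (real n + 2))" by (simp add: add_ac)
    moreover have "E c (?P n)" "E y (y + 1 / (real n + 2))" using c y by (auto simp: B_def)
    ultimately show ?thesis using E by blast
  qed
  define D where "D = {x. \<not> E c x}"
  have "D \<subseteq> B" using EB by (auto simp: D_def)
  then have "countable D" using B countable_subset by blast
  then have "countable ((\<lambda>(x, y). y - x) ` (D \<times> D))" by (intro countable_image countable_SIGMA)
  then obtain t where t: "t \<notin> (\<lambda>(x, y). y - x) ` (D \<times> D)"
    using uncountable_UNIV_real by (metis UNIV_eq_I)
  have "D \<subseteq> {x. \<not> E x (x + t)}"
  proof
    fix x assume x: "x \<in> D"
    have "x + t \<notin> D"
    proof
      assume "x + t \<in> D"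
      then have "t \<in> (\<lambda>(x, y). y - x) ` (D \<times> D)" using x by (intro image_eqI[of _ _ "(x, x + t)"]) auto
      then show False using t by blast
    qed
    then have "E c (x + t)" "\<not> E c x" using x by (auto simp: D_def)
    then have "\<not> E x (x + t)" using E(1) E(2)[of c "x + t" x] by blast
    then show "x \<in> {x. \<not> E x (x + t)}" by simp
  qed
  then have "circle_proj ` D \<subseteq> circle_proj ` {x. \<not> E x (x + t)}" by blast
  then show ?thesis using fin[of t] finite_subset unfolding D_def by blast
qed

lemma proj_at_translate:
  assumes "normal_dev d"
  shows "proj_at d d (\<lambda>x. x + t) x"
  unfolding proj_at_def using normal_dev_translate[OF assms, of t] by (auto intro!: exI[of _ 1])

lemma circle_proj_finite_interval:
  assumes "finite (circle_proj ` A)"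
  shows "\<exists>x e. e > 0 \<and> ball x e \<inter> A = {}"
proof -
  have "inj_on circle_proj {0<..<1}"
  proof (rule inj_onI)
    fix x y :: real assume "x \<in> {0<..<1}" "y \<in> {0<..<1}" "circle_proj x = circle_proj y"
    then show "x = y" using Ints_nonzero_abs_less1[of "x - y"] by (auto simp: circle_proj_eq_iff)
  qed
  then have fin: "finite (A \<inter> {0<..<1})"
    using assms by (metis Int_lower1 Int_lower2 finite_imageD finite_subset image_mono inj_on_subset)
  have "open ({0<..<1} - A \<inter> {0<..<1})" using fin by (intro open_Diff finite_imp_closed) auto
  moreover have "infinite {0<..<1::real}" by (simp add: infinite_Ioo)
  then have "{0<..<1} - A \<inter> {0<..<1} \<noteq> {}" using fin by (metis Diff_infinite_finite finite.emptyI)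
  ultimately obtain x e where "e > 0" "ball x e \<subseteq> {0<..<1} - A \<inter> {0<..<1}"
    by (metis all_not_in_conv open_contains_ball)
  then show ?thesis by (intro exI[of _ x] exI[of _ e]) blast
qed

lemma PC0_iff:
  assumes "circle_lift \<Phi>"
  shows "circle_map \<Phi> \<in> PC0 \<longleftrightarrow> finite (circle_proj ` {x. \<not> proj_at affine_embed affine_embed \<Phi> x})"
proof -
  have lm: "locally_modeled_at proj_geom (circle, pi0) (circle, pi0) (circle_map \<Phi>) (circle_proj x) \<longleftrightarrow>
      proj_at affine_embed affine_embed \<Phi> x" for x
    unfolding pi0_eq by (rule locally_modeled_circle) (use assms circle_lift_continuous in auto)
  have "(\<exists>A. finite A \<and> (\<forall>p\<in>topspace circle - A. locally_modeled_at proj_geom (circle, pi0) (circle, pi0) (circle_map \<Phi>) p)) \<longleftrightarrow>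
      finite (circle_proj ` {x. \<not> proj_at affine_embed affine_embed \<Phi> x})" (is "?L \<longleftrightarrow> ?R")
  proof
    assume ?L
    then obtain A where "finite A" "\<And>p. p \<in> topspace circle \<Longrightarrow> p \<notin> A \<Longrightarrow> locally_modeled_at proj_geom (circle, pi0) (circle, pi0) (circle_map \<Phi>) p"
      by blast
    moreover from this have "circle_proj ` {x. \<not> proj_at affine_embed affine_embed \<Phi> x} \<subseteq> A"
      using lm by (auto simp: topspace_circle)
    ultimately show ?R using finite_subset by blast
  next
    assume ?R
    moreover have "locally_modeled_at proj_geom (circle, pi0) (circle, pi0) (circle_map \<Phi>) p"
      if "p \<in> topspace circle - circle_proj ` {x. \<not> proj_at affine_embed affine_embed \<Phi> x}" for p
      using that lm by (auto simp: topspace_circle)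
    ultimately show ?L by blast
  qed
  then show ?thesis using assms by (simp add: PC0_def piecewise_iso_def circle_map_homeomorphic)
qed

text \<open>On an interval inside the cofinite class each small rotation is projective near every
  point, hence given by a single projective map, so that \<open>local_normal_form\<close> applies
  there. The other points of the class inherit the normal form through a rotation.\<close>

theorem normal_form_of_piecewise_projective:
  assumes F: "circle_lift F"
    and PC: "\<And>t. circle_map (\<lambda>x. F (inv_into UNIV F x + t)) \<in> PC0"
  obtains D where "normal_dev D" "finite (circle_proj ` {x. \<not> proj_at D affine_embed F x})"
proof -
  let ?F' = "inv_into UNIV F"
  have F': "circle_lift ?F'" by (rule circle_lift_inv[OF F])
  define T where "T t u = F (?F' u + t)" for t u
  have T: "circle_lift (T t)" for t
    unfolding T_def using circle_lift_comp[OF F circle_lift_comp[OF circle_lift_translation F']] .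
  have TF: "T t (F x) = F (x + t)" for t x by (simp add: T_def F)
  have TT: "T s (T t u) = T (t + s) u" for s t u by (simp add: T_def F add_ac)
  have Tinv: "inv_into UNIV (T t) = T (- t)" for t
  proof (rule ext)
    fix u
    have "T t (T (- t) u) = u" by (simp add: TT) (simp add: T_def F)
    then show "inv_into UNIV (T t) u = T (- t) u" by (metis T circle_lift_inv_f(1))
  qed
  define E where "E x y \<longleftrightarrow> proj_at affine_embed affine_embed (T (y - x)) (F x)" for x y
  have E_sym: "E y x" if "E x y" for x y
    using proj_at_inv[OF T that[unfolded E_def]] unfolding E_def Tinv TF by simp
  have E_trans: "E x z" if "E x y" "E y z" for x y z
  proof -
    have "proj_at affine_embed affine_embed (T (z - y)) (T (y - x) (F x))"
      using that(2) unfolding E_def TF by simp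
    from proj_at_comp[OF circle_lift_continuous[OF T] _ this] that(1)
    show ?thesis unfolding E_def TT by simp
  qed
  have "finite (circle_proj ` {x. \<not> E x (x + t)})" for t
  proof -
    have "finite (circle_proj ` {u. \<not> proj_at affine_embed affine_embed (T t) u})"
      using PC[of t] PC0_iff[OF T] by (simp add: T_def[abs_def])
    moreover have "circle_map F ` circle_proj ` {x. \<not> E x (x + t)} \<subseteq> circle_proj ` {u. \<not> proj_at affine_embed affine_embed (T t) u}"
      by (auto simp: F E_def)
    moreover have "inj_on (circle_map F) (circle_proj ` {x. \<not> E x (x + t)})"
      using homeo_carrierE(2)[OF circle_map_carrier[OF F]] by (rule inj_on_subset) auto
    ultimately show ?thesis by (blast intro: finite_imageD[OF finite_subset])
  qed
  then obtain c where c: "finite (circle_proj ` {x. \<not> E c x})"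
    using cofinite_class[of E] E_sym E_trans by blast
  obtain x1 e0 where x1: "e0 > 0" "ball x1 e0 \<inter> {x. \<not> E c x} = {}" using circle_proj_finite_interval[OF c] by blast
  \<comment> \<open>Half the radius, so that x and x + s both stay in the good interval.\<close>
  define e where "e = e0 / 2"
  have e: "e > 0" using x1 by (simp add: e_def)
  have Ec: "E c x" if "\<bar>x - x1\<bar> < 2 * e" for x
  proof -
    have "x \<in> ball x1 e0" using that by (simp add: e_def dist_real_def abs_minus_commute)
    then show ?thesis using x1(2) by blast
  qed
  define w where "w y = F (x1 + y) - F x1" for y
  let ?tr = "mob (mat2 1 (- F x1) 0 1)" and ?tr' = "mob (mat2 1 (F x1) 0 1)"
  have tr: "?tr \<in> PGL2" "?tr' \<in> PGL2" by (auto intro!: mob_in_PGL2 simp: invertible_mat2)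
  have trw: "affine_embed (w y) = ?tr (affine_embed (F (x1 + y)))" "affine_embed (F (x1 + y)) = ?tr' (affine_embed (w y))" for y
    by (simp_all add: mob_affine_embed w_def)
  have M: "\<exists>g\<in>PGL2. \<forall>y. \<bar>y\<bar> < e \<longrightarrow> affine_embed (w (y + s)) = g (affine_embed (w y))" if s: "\<bar>s\<bar> < e" for s
  proof -
    let ?I = "F ` ball x1 e"
    have "\<exists>g\<in>PGL2. \<forall>u\<in>?I. affine_embed (T s u) = g (affine_embed u)"
    proof (rule developing_glue[OF developing_affine_embed])
      show "open ?I" by (rule circle_lift_open[OF F]) simp
      show "connected ?I" by (rule connected_continuous_image[OF circle_lift_continuous[OF F]]) simp
      fix u assume "u \<in> ?I"
      then obtain x where x: "u = F x" "\<bar>x - x1\<bar> < e" by (auto simp: dist_real_def abs_minus_commute)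
      have "E c x" "E c (x + s)" using x s e by (auto intro!: Ec)
      then have "E x (x + s)" using E_sym E_trans by blast
      then show "\<exists>g\<in>PGL2. \<exists>e>0. \<forall>y\<in>ball u e. affine_embed (T s y) = g (affine_embed y)"
        by (simp add: E_def x proj_at_def)
    qed
    then obtain g where g: "g \<in> PGL2" "\<And>u. u \<in> ?I \<Longrightarrow> affine_embed (T s u) = g (affine_embed u)" by blast
    have "affine_embed (w (y + s)) = ?tr (g (?tr' (affine_embed (w y))))" if "\<bar>y\<bar> < e" for y
    proof -
      have "x1 + y \<in> ball x1 e" using that by (simp add: dist_real_def)
      then have "affine_embed (T s (F (x1 + y))) = g (affine_embed (F (x1 + y)))" using g(2) by blast
      then show ?thesis using trw(1)[of "y + s"] trw(2)[of y] by (simp add: TF add_ac)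
    qed
    moreover have "(\<lambda>p. ?tr (g (?tr' p))) \<in> PGL2" using PGL2_comp[OF tr(1) PGL2_comp[OF g(1) tr(2)]] .
    ultimately show ?thesis by (intro bexI[of _ "\<lambda>p. ?tr (g (?tr' p))"]) auto
  qed
  have wi: "inj_on w (ball 0 (2 * e))" by (rule inj_onI) (simp add: w_def circle_lift_inj[OF F])
  have wc: "continuous_on (ball 0 (2 * e)) w" unfolding w_def
    by (intro continuous_intros continuous_on_compose2[OF circle_lift_continuous[OF F, of UNIV]]) auto
  have w0: "w 0 = 0" by (simp add: w_def)
  obtain D e' g where D: "normal_dev D" "e' > 0" "g \<in> PGL2" "\<forall>t. \<bar>t\<bar> < e' \<longrightarrow> affine_embed (w t) = g (D t)"
    using local_normal_form[OF e wi wc w0 M] by blast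
  have at1: "proj_at D affine_embed F x" if x: "E c x" for x
  proof -
    \<comment> \<open>Near x, the map F is a translation to the neighbourhood of 0, followed by F
      near x1, followed by the rotation from x1 to x. The first is projective for D by homogeneity,
      the second by the normal form, the last because x1 and x are equivalent.\<close>
    have "E x1 x" using x Ec[of x1] e E_sym E_trans by (metis abs_zero diff_self mult_pos_pos zero_less_numeral)
    then have 3: "proj_at affine_embed affine_embed (T (x - x1)) (F (0 + x1))" by (simp add: E_def)
    have 2: "proj_at D affine_embed (\<lambda>y. F (y + x1)) 0"
      unfolding proj_at_def
      using PGL2_comp[OF tr(2) D(3)] D(2,4) trw(2)
      by (intro bexI[of _ "\<lambda>p. ?tr' (g p)"] exI[of _ e']) (auto simp: add.commute)
    have c2: "continuous_on UNIV (\<lambda>y. F (y + x1))" using circle_lift_continuous[OF circle_lift_comp[OF F circle_lift_translation]] .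
    have "proj_at D affine_embed (\<lambda>y. T (x - x1) (F (y + x1))) (x + - x)"
      using proj_at_comp[OF c2 2 3] by simp
    from proj_at_comp[OF circle_lift_continuous[OF circle_lift_translation] proj_at_translate[OF D(1)] this]
    show ?thesis by (simp add: TF)
  qed
  have "circle_proj ` {x. \<not> proj_at D affine_embed F x} \<subseteq> circle_proj ` {x. \<not> E c x}" using at1 by blast
  then show ?thesis using that[OF D(1)] c finite_subset by blast
qed

section \<open>Classification of the model curves\<close>

lemma universal_cover_surj: "topspace proj_line = range universal_cover"
proof
  show "topspace proj_line \<subseteq> range universal_cover"
  proof
    fix p assume "p \<in> topspace proj_line"
    then consider "p = point_at_infinity" | y where "p = affine_embed y" by (auto simp: topspace_proj_line_eq)
    then show "p \<in> range universal_cover"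
    proof cases
      case 1
      have "universal_cover 0 = p" by (simp add: 1 universal_cover_def point_at_infinity_def)
      then show ?thesis by blast
    next
      case (2 y)
      have eq: "pi * (- arctan y / pi) = - arctan y" by simp
      have "cos (pi * (- arctan y / pi)) \<noteq> 0" unfolding eq by (simp add: cos_arctan_not_zero)
      from universal_cover_half[OF this] have "universal_cover (- arctan y / pi + 1/2) = p"
        unfolding eq 2 by (simp add: tan_arctan)
      then show ?thesis by blast
    qed
  qed
  have "developing (\<lambda>x. universal_cover (1 * x))"
    by (rule normal_dev_developing) (auto simp: normal_dev_def intro!: exI[of _ 1])
  then show "range universal_cover \<subseteq> topspace proj_line" using developing_topspace by fastforce
qed

text \<open>Commuting with integer translations up to sign keeps \<Psi> y at bounded distance from y
  or from -y, while n steps of length r1 move the value by n r2 up to sign. Comparing the growth in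
  n leaves r1 = r2.\<close>

lemma translation_number_unique:
  assumes \<Psi>: "circle_lift \<Psi>" and r: "r1 > 0" "r2 > 0" and e: "e \<in> {1, -1}"
    and tr: "\<And>y. \<Psi> (y + r1) = \<Psi> y + e * r2"
  shows "r1 = r2"
proof -
  obtain e' where e': "e' \<in> {1, -1}" "\<And>x (n::int). \<Psi> (x + of_int n) = \<Psi> x + e' * of_int n" by (rule circle_liftE[OF \<Psi>]) blast
  have "continuous_on {0..1} (\<lambda>y. \<bar>\<Psi> y - e' * y\<bar>)" by (intro continuous_intros circle_lift_continuous[OF \<Psi>])
  then obtain m where m: "m \<in> {0..1}" "\<And>y. y \<in> {0..1} \<Longrightarrow> \<bar>\<Psi> y - e' * y\<bar> \<le> \<bar>\<Psi> m - e' * m\<bar>"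
    using continuous_attains_sup[of "{0..1::real}" "\<lambda>y. \<bar>\<Psi> y - e' * y\<bar>"] by auto
  define B where "B = \<bar>\<Psi> m - e' * m\<bar>"
  have bd: "\<bar>\<Psi> y - e' * y\<bar> \<le> B" for y
  proof -
    have "\<Psi> y - e' * y = \<Psi> (frac y) - e' * frac y"
      using e'(2)[of "frac y" "\<lfloor>y\<rfloor>"] by (simp add: frac_def algebra_simps)
    then show ?thesis using m(2)[of "frac y"] frac_lt_1[of y] by (simp add: B_def less_imp_le)
  qed
  have it: "\<Psi> (real n * r1) = \<Psi> 0 + real n * (e * r2)" for n
  proof (induction n)
    case (Suc n)
    have "\<Psi> (real (Suc n) * r1) = \<Psi> (real n * r1 + r1)" by (simp add: algebra_simps)
    then show ?case by (simp only: tr Suc) (simp add: algebra_simps)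
  qed simp
  define \<delta> where "\<delta> = \<bar>e * r2 - e' * r1\<bar>"
  have bn: "real n * \<delta> \<le> B + \<bar>\<Psi> 0\<bar>" for n
  proof -
    have "real n * (e * r2 - e' * r1) = (\<Psi> (real n * r1) - e' * (real n * r1)) - \<Psi> 0"
      unfolding it by (simp add: algebra_simps)
    then have "\<bar>real n * (e * r2 - e' * r1)\<bar> \<le> B + \<bar>\<Psi> 0\<bar>" using bd[of "real n * r1"] by linarith
    then show ?thesis by (simp add: \<delta>_def abs_mult)
  qed
  have "\<delta> = 0"
  proof (rule ccontr)
    assume "\<delta> \<noteq> 0"
    then have "\<delta> > 0" by (simp add: \<delta>_def)
    then obtain n where "B + \<bar>\<Psi> 0\<bar> < real n * \<delta>" using reals_Archimedean3 by blast
    then show False using bn[of n] by simp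
  qed
  then show ?thesis using e e'(1) r by (auto simp: \<delta>_def)
qed

text \<open>One turn around the circle multiplies the source coordinate by exp c1 and the target
  coordinate by the exponential of c2 or -c2. Homotheties conjugate by g have equal or inverse
  ratios, and positivity of the rates leaves c1 = c2.\<close>

lemma hyperbolic_rate_unique:
  assumes \<Phi>: "circle_lift \<Phi>" and c: "c1 > 0" "c2 > 0" and g: "g \<in> PGL2"
    and eq: "\<And>x. affine_embed (exp (c2 * \<Phi> x)) = g (affine_embed (exp (c1 * x)))"
  shows "c1 = c2"
proof -
  obtain e where e: "e \<in> {1, -1}" "\<And>x (n::int). \<Phi> (x + of_int n) = \<Phi> x + e * of_int n" by (rule circle_liftE[OF \<Phi>]) blast
  obtain A where A: "invertible A" "g = mob A" using g by (auto simp: PGL2_iff)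
  obtain a b c' d where abcd: "A = mat2 a b c' d" using mat2_eta by blast
  define \<mu> where "\<mu> = exp (c2 * e)"
  define \<nu> where "\<nu> = exp c1"
  have pos: "\<mu> > 0" "\<nu> > 0" by (auto simp: \<mu>_def \<nu>_def)
  have inv: "invertible (mat2 \<mu> 0 0 1)" "invertible (mat2 \<nu> 0 0 1)" using pos by (auto simp: invertible_mat2)
  have *: "mob (mat2 \<mu> 0 0 1 ** A) (affine_embed (exp (c1 * x))) = mob (A ** mat2 \<nu> 0 0 1) (affine_embed (exp (c1 * x)))" for x
  proof -
    have "mob (mat2 \<mu> 0 0 1 ** A) (affine_embed (exp (c1 * x))) = mob (mat2 \<mu> 0 0 1) (affine_embed (exp (c2 * \<Phi> x)))"
      by (simp add: mob_mob[symmetric] eq A)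
    also have "\<dots> = affine_embed (exp (c2 * \<Phi> (x + 1)))"
      using e(2)[of x 1] by (simp add: mob_affine_embed \<mu>_def distrib_left exp_add mult.commute)
    also have "\<dots> = mob A (affine_embed (exp (c1 * (x + 1))))" by (simp add: eq A)
    also have "\<dots> = mob (A ** mat2 \<nu> 0 0 1) (affine_embed (exp (c1 * x)))"
      by (simp add: mob_mob[symmetric] mob_affine_embed \<nu>_def distrib_left exp_add mult.commute)
    finally show ?thesis .
  qed
  have "exp (c1 * 0) \<noteq> exp (c1 * 1)" "exp (c1 * 1) \<noteq> exp (c1 * 2)" "exp (c1 * 0) \<noteq> exp (c1 * 2)" using c by auto
  from mat2_proportional[OF invertible_mult[OF inv(1) A(1)] invertible_mult[OF A(1) inv(2)] this * * *]
  obtain k where k: "k \<noteq> 0" "mat2 \<mu> 0 0 1 ** A = k *\<^sub>R (A ** mat2 \<nu> 0 0 1)" by blast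
  then have "\<mu> * a = k * (a * \<nu>)" "\<mu> * b = k * b" "c' = k * (c' * \<nu>)" "d = k * d"
    unfolding abcd mat2_mult by (auto simp: vec_eq_iff forall_2)
  moreover have "a * d - b * c' \<noteq> 0" using A by (simp add: abcd invertible_mat2)
  \<comment> \<open>An invertible matrix has a nonzero diagonal or a nonzero antidiagonal; the two
    cases give equal and inverse ratios.\<close>
  then have "a \<noteq> 0 \<and> d \<noteq> 0 \<or> b \<noteq> 0 \<and> c' \<noteq> 0" by auto
  ultimately have "\<mu> = \<nu> \<or> \<mu> * \<nu> = 1" by auto
  then show ?thesis
  proof
    assume "\<mu> = \<nu>"
    then have "c2 * e = c1" by (simp add: \<mu>_def \<nu>_def)
    then show ?thesis using e c by auto
  next
    assume "\<mu> * \<nu> = 1"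
    then have "c2 * e + c1 = 0" by (simp add: \<mu>_def \<nu>_def flip: exp_add)
    then show ?thesis using e c by auto
  qed
qed

text \<open>The rotation picked up in one turn sees r only modulo integers, so matrices do not
  suffice here. In the coordinate of the universal cover, \<Phi> becomes a lift of g: it respects
  integer translations and carries translation by r1 to translation by r2 up to sign.\<close>

lemma elliptic_rate_unique:
  assumes \<Phi>: "circle_lift \<Phi>" and r: "r1 > 0" "r2 > 0" and g: "g \<in> PGL2"
    and eq: "\<And>x. universal_cover (r2 * \<Phi> x) = g (universal_cover (r1 * x))"
  shows "r1 = r2"
proof -
  obtain e where e: "e \<in> {1, -1}" "\<And>x (n::int). \<Phi> (x + of_int n) = \<Phi> x + e * of_int n" by (rule circle_liftE[OF \<Phi>]) blast
  define \<Psi> where "\<Psi> y = r2 * \<Phi> (y / r1)" for y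
  have eq': "universal_cover (\<Psi> y) = g (universal_cover y)" for y
    using eq[of "y / r1"] r by (simp add: \<Psi>_def)
  have "circle_lift \<Psi>"
  proof (rule circle_liftI)
    show "continuous_on UNIV \<Psi>" unfolding \<Psi>_def
      by (intro continuous_intros continuous_on_compose2[OF circle_lift_continuous[OF \<Phi>, of UNIV]]) (use r in auto)
    show "\<Psi> x - \<Psi> y \<in> \<int> \<longleftrightarrow> x - y \<in> \<int>" for x y
      unfolding universal_cover_eq_iff[symmetric] eq' using PGL2_inj[OF g] by simp
    have "\<Psi> (r1 * inv_into UNIV \<Phi> (1 / r2)) - \<Psi> (r1 * inv_into UNIV \<Phi> 0) = 1"
      using r \<Phi> by (simp add: \<Psi>_def)
    then show "\<exists>x y. \<Psi> x - \<Psi> y = 1" by blast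
  qed
  moreover have "\<Psi> (y + r1) = \<Psi> y + e * r2" for y
    using e(2)[of "y / r1" 1] r by (simp add: \<Psi>_def add_divide_distrib algebra_simps)
  ultimately show ?thesis using translation_number_unique[OF _ r e(1)] by blast
qed

text \<open>The image of D separates the types: it is the projective line without exactly one point,
  without at least two points, or entire. Within the hyperbolic and the elliptic type the two
  preceding lemmas recover the rate.\<close>

lemma normal_dev_unique:
  assumes D1: "normal_dev D1" and D2: "normal_dev D2" and \<Phi>: "circle_lift \<Phi>" and g: "g \<in> PGL2"
    and eq: "\<And>x. D2 (\<Phi> x) = g (D1 x)"
  shows "D1 = D2"
proof -
  obtain h where h: "h \<in> PGL2" "\<forall>p. h (g p) = p" "\<forall>p. g (h p) = p" using PGL2_inv[OF g] by blast
  have rng: "p \<in> range D1 \<longleftrightarrow> g p \<in> range D2" for p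
  proof
    assume "p \<in> range D1"
    then obtain x where "p = D1 x" by blast
    then have "g p = D2 (\<Phi> x)" using eq by simp
    then show "g p \<in> range D2" by blast
  next
    assume "g p \<in> range D2"
    then obtain y where "g p = D2 y" by blast
    then have "g p = g (D1 (inv_into UNIV \<Phi> y))" using eq[of "inv_into UNIV \<Phi> y"] \<Phi> by simp
    then have "p = D1 (inv_into UNIV \<Phi> y)" using PGL2_inj[OF g] by blast
    then show "p \<in> range D1" by blast
  qed
  have inf: "point_at_infinity \<in> topspace proj_line" by (simp add: topspace_proj_line_eq)
  have ex: "affine_embed x \<in> range (\<lambda>x. affine_embed (exp (c * x))) \<longleftrightarrow> x > 0" if "c > 0" for x c
  proof
    assume "x > 0"
    then have "affine_embed x = affine_embed (exp (c * (ln x / c)))" using that by simp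
    then show "affine_embed x \<in> range (\<lambda>x. affine_embed (exp (c * x)))" by blast
  qed auto
  have miss_inf: "point_at_infinity \<notin> range affine_embed" "point_at_infinity \<notin> range (\<lambda>x. affine_embed (exp (c * x)))" for c
    by auto
  have onto: "p \<in> range (\<lambda>x. universal_cover (r * x))" if "p \<in> topspace proj_line" "r > 0" for p r
  proof -
    obtain y where "p = universal_cover y" using \<open>p \<in> topspace proj_line\<close> universal_cover_surj by blast
    then have "p = universal_cover (r * (y / r))" using that by simp
    then show ?thesis by blast
  qed
  have only_inf: "p = point_at_infinity" if "p \<in> topspace proj_line" "p \<notin> range affine_embed" for p
    using that by (auto simp: topspace_proj_line_eq)
  from D1 show ?thesis
  proof (cases rule: normal_dev_cases)
    case parabolic
    note 1 = this
    from D2 show ?thesis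
    proof (cases rule: normal_dev_cases)
      case parabolic then show ?thesis using 1 by simp
    next
      case (hyperbolic c)
      have "h point_at_infinity \<notin> range D1" "h (affine_embed 0) \<notin> range D1"
        unfolding rng using h(3) hyperbolic miss_inf(2) ex[OF hyperbolic(1), of 0] by auto
      then have "h point_at_infinity = point_at_infinity" "h (affine_embed 0) = point_at_infinity"
        using only_inf PGL2_topspace[OF h(1)] inf unfolding 1 by auto
      then have "g (h point_at_infinity) = g (h (affine_embed 0))" by simp
      then show ?thesis using h(3) by simp
    next
      case (elliptic r)
      have "g point_at_infinity \<in> range D2" unfolding elliptic
        using onto[OF PGL2_topspace[OF g inf] elliptic(1)] .
      then show ?thesis unfolding rng[symmetric] 1 using miss_inf by simp
    qed
  next
    case (hyperbolic c1)
    note 1 = this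
    from D2 show ?thesis
    proof (cases rule: normal_dev_cases)
      case parabolic
      have "point_at_infinity \<notin> range D1" "affine_embed 0 \<notin> range D1"
        using 1 miss_inf(2) ex[OF 1(1), of 0] by auto
      then have "g point_at_infinity = point_at_infinity" "g (affine_embed 0) = point_at_infinity"
        using only_inf PGL2_topspace[OF g] inf unfolding rng parabolic by auto
      then have "g point_at_infinity = g (affine_embed 0)" by simp
      then show ?thesis using PGL2_inj[OF g] by simp
    next
      case (hyperbolic c2)
      have "c1 = c2"
        by (rule hyperbolic_rate_unique[OF \<Phi> 1(1) hyperbolic(1) g]) (use eq 1(2) hyperbolic(2) in simp)
      then show ?thesis using 1 hyperbolic by simp
    next
      case (elliptic r)
      have "g point_at_infinity \<in> range D2" unfolding elliptic
        using onto[OF PGL2_topspace[OF g inf] elliptic(1)] .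
      then show ?thesis unfolding rng[symmetric] 1 using miss_inf by simp
    qed
  next
    case (elliptic r1)
    note 1 = this
    have all: "p \<in> range D2" if "p \<in> topspace proj_line" for p
      using rng[of "h p"] onto[OF PGL2_topspace[OF h(1) that] 1(1)] h(3) 1(2) by simp
    from D2 show ?thesis
    proof (cases rule: normal_dev_cases)
      case parabolic then show ?thesis using all[OF inf] miss_inf by simp
    next
      case (hyperbolic c) then show ?thesis using all[OF inf] miss_inf by simp
    next
      case (elliptic r2)
      have "r1 = r2"
        by (rule elliptic_rate_unique[OF \<Phi> 1(1) elliptic(1) g]) (use eq 1(2) elliptic(2) in simp)
      then show ?thesis using 1 elliptic by simp
    qed
  qed
qed

section \<open>Isomorphisms between the structures \<open>circle_structure F D\<close>\<close>

lemma proj_at_all_glue: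
  assumes "developing d" "\<And>x. proj_at d d' \<Phi> x"
  obtains g where "g \<in> PGL2" "\<And>x. d' (\<Phi> x) = g (d x)"
proof -
  have "\<exists>g\<in>PGL2. \<forall>y\<in>UNIV. d' (\<Phi> y) = g (d y)"
    by (rule developing_glue[OF assms(1)]) (use assms(2) in \<open>auto simp: proj_at_def\<close>)
  then show ?thesis using that by blast
qed

lemma curve_iso_circle_structure_unique:
  assumes F: "circle_lift F1" "circle_lift F2" and D: "normal_dev D1" "normal_dev D2"
    and f: "curve_iso proj_geom (circle, circle_structure F1 D1) (circle, circle_structure F2 D2) f"
  shows "D1 = D2"
proof -
  have hf: "homeomorphic_map circle circle f" using f by (simp add: curve_iso_def)
  \<comment> \<open>Outside the circle f may take arbitrary values; its restriction belongs to
    \<open>homeo_group\<close> and so has a lift.\<close>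
  then have "restrict f (topspace circle) \<in> carrier homeo_group"
    unfolding carrier_homeo_group using homeomorphic_map_eq[OF hf, of "restrict f (topspace circle)"] by simp
  then obtain \<Phi>0 where \<Phi>0: "circle_lift \<Phi>0" "restrict f (topspace circle) = circle_map \<Phi>0" by (rule homeo_group_lift)
  have f\<Phi>0: "f (circle_proj x) = circle_proj (\<Phi>0 x)" for x
    using \<Phi>0(2) circle_map_proj[OF \<Phi>0(1), of x] by (metis rangeI restrict_apply topspace_circle)
  define \<Phi> where "\<Phi> x = inv_into UNIV F2 (\<Phi>0 (F1 x))" for x
  have \<Phi>: "circle_lift \<Phi>" unfolding \<Phi>_def
    using circle_lift_comp[OF circle_lift_inv[OF F(2)] circle_lift_comp[OF \<Phi>0(1) F(1)]] .
  have f\<Phi>: "f (circle_proj (F1 x)) = circle_proj (F2 (\<Phi> x))" for x using F by (simp add: f\<Phi>0 \<Phi>_def)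
  have "proj_at D1 D2 \<Phi> x" for x
    using locally_modeled_circle[OF F D circle_lift_continuous[OF \<Phi>] f\<Phi>, of x] f
    by (simp add: curve_iso_def topspace_circle)
  then obtain g where "g \<in> PGL2" "\<And>x. D2 (\<Phi> x) = g (D1 x)"
    by (rule proj_at_all_glue[OF normal_dev_developing[OF D(1)]]) blast
  then show ?thesis using normal_dev_unique[OF D \<Phi>] by blast
qed

text \<open>In the parameters given by F1 and F2 the map is L, which D turns into a projective map.
  The choice \<open>uminus\<close> serves to reverse the orientation.\<close>

lemma curve_iso_circle_structureI:
  assumes F: "circle_lift F1" "circle_lift F2" and D: "normal_dev D"
    and L: "L = (\<lambda>x. x) \<or> L = uminus"
  shows "curve_iso proj_geom (circle, circle_structure F1 D) (circle, circle_structure F2 D)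
    (circle_map (\<lambda>x. F2 (L (inv_into UNIV F1 x))))"
  unfolding curve_iso_def fst_conv
proof (intro conjI ballI)
  have L': "circle_lift L" using L by auto
  have lift: "circle_lift (\<lambda>x. F2 (L (inv_into UNIV F1 x)))"
    using circle_lift_comp[OF F(2) circle_lift_comp[OF L' circle_lift_inv[OF F(1)]]] .
  then show "homeomorphic_map circle circle (circle_map (\<lambda>x. F2 (L (inv_into UNIV F1 x))))"
    by (rule circle_map_homeomorphic)
  fix p assume "p \<in> topspace circle"
  then obtain y where "p = circle_proj y" by (auto simp: topspace_circle)
  then obtain x where p: "p = circle_proj (F1 x)" using circle_lift_surj[OF F(1)] by (metis surjD)
  have "proj_at D D L x"
    using L normal_dev_reflect[OF D] PGL2_id unfolding proj_at_def by (auto intro!: exI[of _ 1])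
  moreover have "circle_map (\<lambda>x. F2 (L (inv_into UNIV F1 x))) (circle_proj (F1 x)) = circle_proj (F2 (L x))" for x
    using lift F by simp
  ultimately show "locally_modeled_at proj_geom (circle, circle_structure F1 D) (circle, circle_structure F2 D)
      (circle_map (\<lambda>x. F2 (L (inv_into UNIV F1 x)))) p"
    unfolding p using locally_modeled_circle[OF F D D circle_lift_continuous[OF L']] by blast
qed

lemma isomorphic_curves_sym:
  assumes "isomorphic_curves (T, A) (T', A')"
  shows "isomorphic_curves (T', A') (T, A)"
proof -
  obtain f where f: "curve_iso proj_geom (T, A) (T', A') f" using assms by (auto simp: isomorphic_curves_def)
  then obtain h where "homeomorphic_maps T T' f h" by (auto simp: curve_iso_def homeomorphic_map_maps)
  then have "\<And>y. y \<in> topspace T \<Longrightarrow> h (f y) = y" by (simp add: homeomorphic_maps_def)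
  then show ?thesis unfolding isomorphic_curves_def using proj.curve_iso_inv[OF f] by blast
qed

lemma isomorphic_curves_trans:
  assumes "is_atlas proj_geom T' A'" "isomorphic_curves (T, A) (T', A')" "isomorphic_curves (T', A') (T'', A'')"
  shows "isomorphic_curves (T, A) (T'', A'')"
  using assms proj.curve_iso_comp unfolding isomorphic_curves_def by blast

lemma isomorphic_circle_structure_iff:
  assumes "circle_lift F1" "circle_lift F2" "normal_dev D1" "normal_dev D2"
  shows "isomorphic_curves (circle, circle_structure F1 D1) (circle, circle_structure F2 D2) \<longleftrightarrow> D1 = D2"
  using curve_iso_circle_structure_unique[OF assms] curve_iso_circle_structureI[OF assms(1,2), of D1] assms(3)
  unfolding isomorphic_curves_def by blast

section \<open>Identification with the model curves\<close>

lemma isomorphic_model: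
  assumes D: "normal_dev D" and q: "quotient_data proj_geom S q d"
    and F: "homeomorphic_map euclideanreal (top_of_set S) F"
    and fib: "\<And>x y. q (F x) = q (F y) \<longleftrightarrow> x - y \<in> \<int>" and dF: "\<And>x. d (F x) = D x"
  shows "isomorphic_curves (circle, circle_structure (\<lambda>x. x) D) (quotient_curve proj_geom (top_of_set S) q d)"
    "is_atlas proj_geom (fst (quotient_curve proj_geom (top_of_set S) q d)) (snd (quotient_curve proj_geom (top_of_set S) q d))"
proof -
  interpret q1: quotient_data proj_geom UNIV "\<lambda>x. circle_proj x" D using quotient_data_circle[OF circle_lift_id D] .
  interpret q2: quotient_data proj_geom S q d by (rule q)
  define f where "f p = q (F (SOME x. circle_proj x = p))" for p
  have f: "f (circle_proj x) = q (F x)" for x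
  proof -
    have "circle_proj (SOME y. circle_proj y = circle_proj x) = circle_proj x" by (rule someI) simp
    then show ?thesis unfolding f_def fib circle_proj_eq_iff .
  qed
  have Fc: "continuous_on UNIV F" "F \<in> UNIV \<rightarrow> S"
    using homeomorphic_imp_continuous_map[OF F] by (auto simp: continuous_map_in_subtopology image_subset_iff)
  interpret quotient_pair proj_geom UNIV S "\<lambda>x. circle_proj x" q D d F f
    by unfold_locales (use Fc f in auto)
  have circ: "quotient_topology euclideanreal circle_proj = circle" by (simp add: circle_def)
  have "curve_iso proj_geom (q1.T, q1.struct) (q2.T, q2.struct) f"
    unfolding curve_iso_def fst_conv
  proof (intro conjI ballI)
    show "homeomorphic_map q1.T q2.T f"
      by (rule quotient_map_lift_homeomorphic[of _ _ F]) (use F f fib in \<open>auto simp: circle_proj_eq_iff\<close>)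
    fix p assume "p \<in> topspace q1.T"
    then obtain x where p: "p = circle_proj x" using q1.topspace_T by auto
    show "locally_modeled_at proj_geom (q1.T, q1.struct) (q2.T, q2.struct) f p"
      unfolding p using locally_modeled_at_lift[of x] PGL2_id dF by (auto intro!: exI[of _ 1])
  qed
  then show "isomorphic_curves (circle, circle_structure (\<lambda>x. x) D) (quotient_curve proj_geom (top_of_set S) q d)"
    unfolding isomorphic_curves_def q2.quotient_curve_eq circle_structure_def by (auto simp: circ)
  show "is_atlas proj_geom (fst (quotient_curve proj_geom (top_of_set S) q d)) (snd (quotient_curve proj_geom (top_of_set S) q d))"
    unfolding q2.quotient_curve_eq fst_conv snd_conv by (rule q2.is_atlas_struct)
qed

text \<open>Multiplication by r turns the translation by 1, which generates the deck group of the
  circle, into \<open>xi r\<close>.\<close>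

lemma isomorphic_Omega:
  assumes r: "r > 0"
  shows "isomorphic_curves (circle, circle_structure (\<lambda>x. x) (\<lambda>x. universal_cover (r * x))) (Omega r)"
    "is_atlas proj_geom (fst (Omega r)) (snd (Omega r))"
proof -
  have D: "normal_dev (\<lambda>x. universal_cover (r * x))" using r by (auto simp: normal_dev_def)
  have "normal_dev (\<lambda>x. universal_cover (1 * x))" unfolding normal_dev_def by (intro disjI2 exI[of _ 1]) simp
  then have "normal_dev universal_cover" by simp
  then have q: "quotient_data proj_geom UNIV (cyclic_orbit (xi r)) universal_cover"
    by (intro quotient_data_proj_translation[OF r]) (use r cyclic_orbit_xi_eq_iff in auto)
  have h: "homeomorphic_map euclideanreal (top_of_set UNIV) (\<lambda>x. r * x)"
    using r by (intro bijective_open_imp_homeomorphic_map)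
      (auto simp: open_map_def inj_def surj_def intro!: continuous_intros open_scaling[where 'a = real, simplified] exI[of _ "_ / r"])
  have fib: "cyclic_orbit (xi r) (r * x) = cyclic_orbit (xi r) (r * y) \<longleftrightarrow> x - y \<in> \<int>" for x y
    using r by (simp add: cyclic_orbit_xi_eq_iff right_diff_distrib[symmetric])
  from isomorphic_model[OF D q h fib refl]
  show "isomorphic_curves (circle, circle_structure (\<lambda>x. x) (\<lambda>x. universal_cover (r * x))) (Omega r)"
    "is_atlas proj_geom (fst (Omega r)) (snd (Omega r))"
    by (auto simp: Omega_def)
qed

lemma cyclic_orbit_scaling_eq_iff:
  fixes t :: real
  assumes "t > 1"
  shows "cyclic_orbit (\<lambda>x. t * x) x = cyclic_orbit (\<lambda>x. t * x) y \<longleftrightarrow> (\<exists>m n. t ^ m * x = t ^ n * y)"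
proof -
  have "((\<lambda>x. t * x) ^^ n) x = t ^ n * x" for n x by (induction n) auto
  moreover have "inj (\<lambda>x. t * x)" using assms by (simp add: inj_def)
  ultimately show ?thesis by (simp add: cyclic_orbit_eq_iff)
qed

lemma quotient_data_scaling:
  assumes t: "t > 1"
  shows "quotient_data proj_geom {0<..} (cyclic_orbit (\<lambda>x. t * x)) affine_embed"
proof
  show "continuous_map (top_of_set {0<..}) (fst proj_geom) affine_embed"
    using continuous_map_from_subtopology[OF continuous_affine_embed] by simp
  show "openin (fst proj_geom) (affine_embed ` U)" if "open U" for U using open_affine_embed[OF that] by simp
  show "\<exists>e>0. inj_on affine_embed (ball x e \<inter> {0<..})" for x by (intro exI[of _ 1]) (auto simp: inj_on_def)
next
  fix x :: real assume x: "x \<in> {0<..}"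
  \<comment> \<open>Chosen so that \<open>x + e = t * (x - e)\<close>: the ball is an open
    fundamental domain, and no nontrivial power of t maps one of its points to another.\<close>
  define e where "e = x * (t - 1) / (t + 1)"
  have e: "e > 0" "x + e = t * (x - e)" using x t by (auto simp: e_def field_simps)
  have lt: "False" if "y < x + e" "x - e < z" "z > 0" "y = t ^ Suc k * z" for y z k
  proof -
    have "t * (x - e) < t * z" using that t by simp
    also have "\<dots> = t * 1 * z" by simp
    also have "\<dots> \<le> t * t ^ k * z" using that t by (intro mult_mono mult_left_mono one_le_power) auto
    finally show False using that e(2) by simp
  qed
  have "y = z" if yz: "y \<in> ball x e" "z \<in> ball x e" "y > 0" "z > 0" "t ^ m * y = t ^ n * z" for y z m n
  proof -
    have b: "y < x + e" "x - e < y" "z < x + e" "x - e < z" using yz by (auto simp: dist_real_def)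
    consider "m = n" | k where "n = m + Suc k" | k where "m = n + Suc k"
      by (metis less_imp_Suc_add add_Suc_right linorder_neqE_nat)
    then show ?thesis
    proof cases
      case 1 then show ?thesis using yz t by simp
    next
      case (2 k)
      then have "t ^ m * y = t ^ m * (t ^ Suc k * z)" using yz(5) by (simp add: power_add mult.assoc)
      then have "y = t ^ Suc k * z" using t by (subst (asm) mult_left_cancel) auto
      then show ?thesis using lt b yz by blast
    next
      case (3 k)
      then have "t ^ n * (t ^ Suc k * y) = t ^ n * z" using yz(5) by (simp add: power_add mult.assoc)
      then have "z = t ^ Suc k * y" using t by (subst (asm) mult_left_cancel) auto
      then show ?thesis using lt b yz by blast
    qed
  qed
  then show "\<exists>e>0. inj_on (cyclic_orbit (\<lambda>x. t * x)) (ball x e \<inter> {0<..})"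
    using e(1) by (intro exI[of _ e] conjI inj_onI) (auto simp: cyclic_orbit_scaling_eq_iff[OF t])
next
  fix x y :: real assume xy: "x \<in> {0<..}" "y \<in> {0<..}" "cyclic_orbit (\<lambda>x. t * x) x = cyclic_orbit (\<lambda>x. t * x) y"
  then obtain m n where mn: "t ^ m * x = t ^ n * y" by (auto simp: cyclic_orbit_scaling_eq_iff[OF t])
  \<comment> \<open>The power of t with the possibly negative exponent m - n; multiplication by it
    is the deck transformation from x to y.\<close>
  define s where "s = t ^ m / t ^ n"
  have s: "s > 0" "s * x = y" "t ^ n * s = t ^ m" using t mn by (auto simp: s_def field_simps)
  have "cyclic_orbit (\<lambda>x. t * x) (s * z) = cyclic_orbit (\<lambda>x. t * x) z" for z
    unfolding cyclic_orbit_scaling_eq_iff[OF t] using s(3) by (intro exI[of _ n] exI[of _ m]) (simp add: mult.assoc[symmetric])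
  moreover have "mob (mat2 s 0 0 1) \<in> PGL2" by (intro mob_in_PGL2) (use s in \<open>simp add: invertible_mat2\<close>)
  moreover have "affine_embed (s * z) = mob (mat2 s 0 0 1) (affine_embed z)" for z by (simp add: mob_affine_embed)
  ultimately show "\<exists>\<sigma>. continuous_on {0<..} \<sigma> \<and> \<sigma> \<in> {0<..} \<rightarrow> {0<..} \<and> \<sigma> x = y \<and>
      (\<forall>z\<in>{0<..}. cyclic_orbit (\<lambda>x. t * x) (\<sigma> z) = cyclic_orbit (\<lambda>x. t * x) z) \<and>
      (\<exists>g\<in>snd proj_geom. \<forall>z\<in>{0<..}. affine_embed (\<sigma> z) = g (affine_embed z))"
    using s by (intro exI[of _ "\<lambda>z. s * z"]) (auto intro!: continuous_intros bexI[of _ "mob (mat2 s 0 0 1)"])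
qed simp

text \<open>The map x -> exp (ln t * x) turns translation by 1 into multiplication by t, so Theta t
  is the hyperbolic normal form of rate ln t.\<close>

lemma isomorphic_Theta:
  assumes t: "t > 1"
  shows "isomorphic_curves (circle, circle_structure (\<lambda>x. x) (\<lambda>x. affine_embed (exp (ln t * x)))) (Theta t)"
    "is_atlas proj_geom (fst (Theta t)) (snd (Theta t))"
proof -
  have c: "ln t > 0" using t by simp
  then have D: "normal_dev (\<lambda>x. affine_embed (exp (ln t * x)))" by (auto simp: normal_dev_def)
  have inj: "inj (\<lambda>x. exp (ln t * x))" using c by (simp add: inj_def)
  have cont: "continuous_on UNIV (\<lambda>x. exp (ln t * x))" by (intro continuous_intros)
  have h: "homeomorphic_map euclideanreal (top_of_set {0<..}) (\<lambda>x. exp (ln t * x))"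
  proof (rule bijective_open_imp_homeomorphic_map)
    show "open_map euclideanreal (top_of_set {0<..}) (\<lambda>x. exp (ln t * x))"
      unfolding open_map_def
    proof (intro allI impI)
      fix U :: "real set" assume "openin euclideanreal U"
      then have "open ((\<lambda>x. exp (ln t * x)) ` U)"
        by (intro injective_into_1d_imp_open_map_UNIV[of U UNIV]) (use cont inj in auto)
      then show "openin (top_of_set {0<..}) ((\<lambda>x. exp (ln t * x)) ` U)" by (auto simp: openin_open_eq)
    qed
    have "y \<in> range (\<lambda>x. exp (ln t * x))" if "y > 0" for y
      using that c by (intro image_eqI[of _ _ "ln y / ln t"]) auto
    then show "(\<lambda>x. exp (ln t * x)) ` topspace euclideanreal = topspace (top_of_set {0<..})" by auto
  qed (use cont inj in \<open>auto simp: continuous_map_in_subtopology\<close>)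
  have fib: "cyclic_orbit (\<lambda>x. t * x) (exp (ln t * x)) = cyclic_orbit (\<lambda>x. t * x) (exp (ln t * y)) \<longleftrightarrow> x - y \<in> \<int>" for x y
  proof -
    have "t ^ m * exp (ln t * x) = exp (ln t * (x + real m))" for m x
      using t by (simp add: distrib_left exp_add exp_of_nat_mult mult.commute)
    then have "t ^ m * exp (ln t * x) = t ^ n * exp (ln t * y) \<longleftrightarrow> x + real m = y + real n" for m n using c by simp
    then show ?thesis unfolding cyclic_orbit_scaling_eq_iff[OF t] by (simp add: nat_diff_Ints)
  qed
  from isomorphic_model[OF D quotient_data_scaling[OF t] h fib refl]
  show "isomorphic_curves (circle, circle_structure (\<lambda>x. x) (\<lambda>x. affine_embed (exp (ln t * x)))) (Theta t)"
    "is_atlas proj_geom (fst (Theta t)) (snd (Theta t))"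
    using t by (auto simp: Theta_def)
qed

lemma Theta_1: "Theta 1 = (circle, circle_structure (\<lambda>x. x) affine_embed)"
  by (simp add: Theta_def quotient_curve_def circle_def circle_structure_def)

lemma isomorphic_circle_structure_model_iff:
  assumes F: "circle_lift F" and D: "normal_dev D" and D': "normal_dev D'"
    and C: "isomorphic_curves (circle, circle_structure (\<lambda>x. x) D') C" "is_atlas proj_geom (fst C) (snd C)"
  shows "isomorphic_curves (circle, circle_structure F D) C \<longleftrightarrow> D = D'"
proof
  obtain T A where TA: "C = (T, A)" by (cases C) auto
  {
    assume "isomorphic_curves (circle, circle_structure F D) C"
    then have "isomorphic_curves (circle, circle_structure F D) (circle, circle_structure (\<lambda>x. x) D')"
      using isomorphic_curves_trans[of T A, OF _ _ isomorphic_curves_sym] C unfolding TA by simp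
    then show "D = D'" using isomorphic_circle_structure_iff[OF F circle_lift_id D D'] by simp
  next
    assume "D = D'"
    then have "isomorphic_curves (circle, circle_structure F D) (circle, circle_structure (\<lambda>x. x) D')"
      using isomorphic_circle_structure_iff[OF F circle_lift_id D D'] by simp
    then show "isomorphic_curves (circle, circle_structure F D) C"
      using isomorphic_curves_trans[OF is_atlas_circle_structure[OF circle_lift_id D']] C unfolding TA by blast
  }
qed

lemma isomorphic_Omega_iff:
  assumes "circle_lift F" "normal_dev D" "r > 0"
  shows "isomorphic_curves (circle, circle_structure F D) (Omega r) \<longleftrightarrow> D = (\<lambda>x. universal_cover (r * x))"
  by (rule isomorphic_circle_structure_model_iff[OF assms(1,2) _ isomorphic_Omega])
    (use assms(3) in \<open>auto simp: normal_dev_def\<close>)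

lemma isomorphic_Theta_iff:
  assumes "circle_lift F" "normal_dev D" "t > 1"
  shows "isomorphic_curves (circle, circle_structure F D) (Theta t) \<longleftrightarrow> D = (\<lambda>x. affine_embed (exp (ln t * x)))"
proof (rule isomorphic_circle_structure_model_iff[OF assms(1,2) _ isomorphic_Theta[OF assms(3)]])
  show "normal_dev (\<lambda>x. affine_embed (exp (ln t * x)))"
    unfolding normal_dev_def by (intro disjI2 disjI1 exI[of _ "ln t"]) (use assms(3) in simp)
qed

lemma isomorphic_Theta_1_iff:
  assumes "circle_lift F" "normal_dev D"
  shows "isomorphic_curves (circle, circle_structure F D) (Theta 1) \<longleftrightarrow> D = affine_embed"
  unfolding Theta_1 by (rule isomorphic_circle_structure_iff) (use assms in auto)

lemma isomorphic_to_some_model: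
  assumes "circle_lift F" "normal_dev D"
  shows "(\<exists>r>0. isomorphic_curves (circle, circle_structure F D) (Omega r)) \<or>
    (\<exists>t\<ge>1. isomorphic_curves (circle, circle_structure F D) (Theta t))"
  using assms(2)
proof (cases rule: normal_dev_cases)
  case parabolic
  then have "isomorphic_curves (circle, circle_structure F D) (Theta 1)" using isomorphic_Theta_1_iff[OF assms] by simp
  then show ?thesis by (intro disjI2 exI[of _ 1]) auto
next
  case (hyperbolic c)
  then have "isomorphic_curves (circle, circle_structure F D) (Theta (exp c))"
    using isomorphic_Theta_iff[OF assms, of "exp c"] by simp
  then show ?thesis using hyperbolic by (intro disjI2 exI[of _ "exp c"]) auto
next
  case (elliptic r)
  then show ?thesis using isomorphic_Omega_iff[OF assms, of r] by blast
qed

section \<open>Regularity\<close>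

text \<open>The flag adds a nonvanishing derivative: the inverse function theorem asks for it, while
  the charts of \<open>C1_map\<close> provide only differentiability.\<close>

definition c1_at :: "bool \<Rightarrow> (real \<Rightarrow> real) \<Rightarrow> real \<Rightarrow> bool" where
  "c1_at nz f x \<longleftrightarrow> (\<exists>e>0. \<exists>f'. continuous_on (ball x e) f' \<and>
     (\<forall>y\<in>ball x e. (f has_real_derivative f' y) (at y) \<and> (nz \<longrightarrow> f' y \<noteq> 0)))"

lemma c1_atE:
  assumes "c1_at nz f x"
  obtains e f' where "e > 0" "continuous_on (ball x e) f'" "\<And>y. y \<in> ball x e \<Longrightarrow> (f has_real_derivative f' y) (at y)"
    "\<And>y. y \<in> ball x e \<Longrightarrow> nz \<Longrightarrow> f' y \<noteq> 0" "continuous_on (ball x e) f"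
proof -
  obtain e f' where *: "e > 0" "continuous_on (ball x e) f'" "\<And>y. y \<in> ball x e \<Longrightarrow> (f has_real_derivative f' y) (at y)"
    "\<And>y. y \<in> ball x e \<Longrightarrow> nz \<Longrightarrow> f' y \<noteq> 0" using assms unfolding c1_at_def by blast
  have "continuous_on (ball x e) f" using *(3) by (meson DERIV_isCont continuous_at_imp_continuous_on)
  then show ?thesis using that * by blast
qed

lemma c1_atI:
  assumes "open S" "x \<in> S" "continuous_on S f'" "\<And>y. y \<in> S \<Longrightarrow> (f has_real_derivative f' y) (at y)"
    "\<And>y. y \<in> S \<Longrightarrow> nz \<Longrightarrow> f' y \<noteq> 0"
  shows "c1_at nz f x"
proof -
  obtain e where "e > 0" "ball x e \<subseteq> S" using assms(1,2) open_contains_ball by blast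
  then show ?thesis unfolding c1_at_def using assms continuous_on_subset
    by (intro exI[of _ e] conjI exI[of _ f']) auto
qed

lemma c1_at_weaken: "c1_at True f x \<Longrightarrow> c1_at nz f x"
  unfolding c1_at_def by blast

lemma c1_at_comp:
  assumes f: "c1_at nz f x" and g: "c1_at nz g (f x)"
  shows "c1_at nz (\<lambda>y. g (f y)) x"
proof -
  obtain e f' where 1: "e > 0" "continuous_on (ball x e) f'" "\<And>y. y \<in> ball x e \<Longrightarrow> (f has_real_derivative f' y) (at y)"
    "\<And>y. y \<in> ball x e \<Longrightarrow> nz \<Longrightarrow> f' y \<noteq> 0" "continuous_on (ball x e) f" using f by (rule c1_atE) blast
  obtain e2 g' where 2: "e2 > 0" "continuous_on (ball (f x) e2) g'" "\<And>y. y \<in> ball (f x) e2 \<Longrightarrow> (g has_real_derivative g' y) (at y)"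
    "\<And>y. y \<in> ball (f x) e2 \<Longrightarrow> nz \<Longrightarrow> g' y \<noteq> 0" using g by (rule c1_atE) blast
  let ?S = "ball x e \<inter> f -` ball (f x) e2"
  have "open ?S" using 1(5) continuous_on_open_vimage[of "ball x e" f] by (metis Int_commute open_ball)
  then show ?thesis
  proof (rule c1_atI)
    show "x \<in> ?S" using 1 2 by simp
    have "continuous_on ?S f'" "continuous_on ?S f" using 1 continuous_on_subset by blast+
    then show "continuous_on ?S (\<lambda>y. g' (f y) * f' y)"
      by (intro continuous_on_mult continuous_on_compose2[OF 2(2)]) auto
    fix y assume y: "y \<in> ?S"
    then show "((\<lambda>y. g (f y)) has_real_derivative g' (f y) * f' y) (at y)"
      using DERIV_chain2[of g "g' (f y)" f y "f' y" UNIV] 1(3) 2(3) by auto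
    show "g' (f y) * f' y \<noteq> 0" if nz using y that 1(4) 2(4) by auto
  qed
qed

lemma c1_at_cong:
  assumes "c1_at nz f x" "open S" "x \<in> S" "\<And>y. y \<in> S \<Longrightarrow> g y = f y"
  shows "c1_at nz g x"
proof -
  obtain e f' where 1: "e > 0" "continuous_on (ball x e) f'" "\<And>y. y \<in> ball x e \<Longrightarrow> (f has_real_derivative f' y) (at y)"
    "\<And>y. y \<in> ball x e \<Longrightarrow> nz \<Longrightarrow> f' y \<noteq> 0" "continuous_on (ball x e) f" using assms(1) by (rule c1_atE) blast
  show ?thesis
  proof (rule c1_atI)
    show op: "open (ball x e \<inter> S)" using assms by auto
    show "x \<in> ball x e \<inter> S" using 1 assms by auto
    show "continuous_on (ball x e \<inter> S) f'" using 1 continuous_on_subset by blast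
    fix y assume y: "y \<in> ball x e \<inter> S"
    show "(g has_real_derivative f' y) (at y)"
      by (rule has_field_derivative_transform_within_open[OF 1(3) op y]) (use y assms(4) in auto)
    show "f' y \<noteq> 0" if nz using y that 1(4) by auto
  qed
qed

lemma c1_at_translation: "c1_at nz (\<lambda>y. y + t) x"
  by (rule c1_atI[of UNIV _ "\<lambda>_. 1"]) (auto intro!: derivative_eq_intros)

lemma c1_at_uminus: "c1_at nz uminus x"
  by (rule c1_atI[of UNIV _ "\<lambda>_. -1"]) (auto intro!: derivative_eq_intros)

text \<open>The function u is fractional linear in v, and its denominator cannot vanish because the
  value is a finite point. Its derivative in v is the determinant over the squared denominator, so
  nonvanishing is inherited as well.\<close>

lemma c1_at_projective:
  assumes v: "c1_at nz v x" and g: "g \<in> PGL2" and e: "e > 0" "\<And>y. y \<in> ball x e \<Longrightarrow> affine_embed (u y) = g (affine_embed (v y))"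
  shows "c1_at nz u x"
proof -
  obtain A where A: "invertible A" "g = mob A" using g by (auto simp: PGL2_iff)
  obtain a b c d where abcd: "A = mat2 a b c d" using mat2_eta by blast
  have det: "a * d - b * c \<noteq> 0" using A by (simp add: abcd invertible_mat2)
  have m: "c * v y + d \<noteq> 0" "u y = (a * v y + b) / (c * v y + d)" if y: "y \<in> ball x e" for y
  proof -
    have "invertible (mat2 a b c d)" "mob (mat2 a b c d) (affine_embed (v y)) = affine_embed (u y)"
      using e(2)[OF y] A by (auto simp: abcd)
    from mob_affine_embed_eqD[OF this] show "c * v y + d \<noteq> 0" "u y = (a * v y + b) / (c * v y + d)"
      by (auto simp: field_simps)
  qed
  have "c1_at nz (\<lambda>s. (a * s + b) / (c * s + d)) (v x)"
  proof (rule c1_atI)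
    show "open {s. c * s + d \<noteq> 0}" by (intro open_Collect_neq continuous_intros)
    show "v x \<in> {s. c * s + d \<noteq> 0}" using m(1)[of x] e(1) by simp
    show "continuous_on {s. c * s + d \<noteq> 0} (\<lambda>s. (a * d - b * c) / (c * s + d)^2)"
      by (intro continuous_intros) auto
    fix s assume s: "s \<in> {s. c * s + d \<noteq> 0}"
    show "((\<lambda>s. (a * s + b) / (c * s + d)) has_real_derivative (a * d - b * c) / (c * s + d)^2) (at s)"
      using s by (auto intro!: derivative_eq_intros simp: power2_eq_square) (simp add: algebra_simps)
    show "(a * d - b * c) / (c * s + d)^2 \<noteq> 0" if nz using s det by simp
  qed
  from c1_at_comp[OF v this] show ?thesis
    by (rule c1_at_cong[of _ _ _ "ball x e"]) (use m(2) e(1) in auto)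
qed

lemma c1_at_inverse:
  assumes F: "circle_lift F" and c1: "c1_at True F x"
  shows "c1_at True (inv_into UNIV F) (F x)"
proof -
  obtain e f' where 1: "e > 0" "continuous_on (ball x e) f'" "\<And>y. y \<in> ball x e \<Longrightarrow> (F has_real_derivative f' y) (at y)"
    "\<And>y. y \<in> ball x e \<Longrightarrow> True \<Longrightarrow> f' y \<noteq> 0" "continuous_on (ball x e) F" using c1 by (rule c1_atE) blast
  have ci: "continuous_on S (inv_into UNIV F)" for S using circle_lift_continuous[OF circle_lift_inv[OF F]] .
  show ?thesis
  proof (rule c1_atI)
    show "open (F ` ball x e)" by (rule circle_lift_open[OF F]) simp
    show "F x \<in> F ` ball x e" using 1 by simp
    have im: "inv_into UNIV F ` F ` ball x e \<subseteq> ball x e" using F by auto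
    have nz: "f' (inv_into UNIV F u) \<noteq> 0" if "u \<in> F ` ball x e" for u
      using 1(4)[of "inv_into UNIV F u"] im that by blast
    show "continuous_on (F ` ball x e) (\<lambda>u. inverse (f' (inv_into UNIV F u)))"
      by (intro continuous_on_inverse continuous_on_compose2[OF 1(2) ci] im ballI nz)
    fix u assume u: "u \<in> F ` ball x e"
    have iu: "inv_into UNIV F u \<in> ball x e" using im u by blast
    show "(inv_into UNIV F has_real_derivative inverse (f' (inv_into UNIV F u))) (at u)"
      by (rule DERIV_inverse_function[where f = F and a = "u - 1" and b = "u + 1"])
        (use 1(3)[OF iu] 1(4)[OF iu] F ci[of UNIV] in \<open>auto simp: continuous_on_eq_continuous_at\<close>)
    show "inverse (f' (inv_into UNIV F u)) \<noteq> 0" using 1(4)[OF iu] by simp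
  qed
qed

section \<open>C1 maps between curves, compared with their lifts\<close>

lemma C1_differentiable_on_real:
  "f C1_differentiable_on S \<longleftrightarrow> (\<exists>f'. continuous_on S f' \<and> (\<forall>x\<in>S. (f has_real_derivative f' x) (at x)))"
  unfolding C1_differentiable_on_def by (auto simp: has_real_derivative_iff_has_vector_derivative)

text \<open>Each point brings its own local derivative; \<open>deriv f\<close> agrees with all of
  them and is therefore one continuous derivative on S.\<close>

lemma c1_at_C1_differentiable_on:
  assumes S: "open S" and c1: "\<And>x. x \<in> S \<Longrightarrow> c1_at nz f x"
  shows "f C1_differentiable_on S"
  unfolding C1_differentiable_on_real
proof (intro exI[of _ "deriv f"] conjI ballI)
  have *: "\<exists>e>0. continuous_on (ball x e) (deriv f) \<and> (f has_real_derivative deriv f x) (at x)" if x: "x \<in> S" for x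
  proof -
    obtain e f' where 1: "e > 0" "continuous_on (ball x e) f'" "\<And>y. y \<in> ball x e \<Longrightarrow> (f has_real_derivative f' y) (at y)"
      "\<And>y. y \<in> ball x e \<Longrightarrow> nz \<Longrightarrow> f' y \<noteq> 0" "continuous_on (ball x e) f" using c1[OF x] by (rule c1_atE) blast
    have eq: "f' y = deriv f y" if "y \<in> ball x e" for y using DERIV_imp_deriv[OF 1(3)[OF that]] by simp
    have "continuous_on (ball x e) (deriv f)" using continuous_on_eq[OF 1(2) eq] .
    moreover have "(f has_real_derivative deriv f x) (at x)" using 1(3)[of x] eq[of x] 1(1) by simp
    ultimately show ?thesis using 1(1) by blast
  qed
  show "continuous_on S (deriv f)"
  proof (rule continuous_at_imp_continuous_on, rule ballI)
    fix x assume "x \<in> S"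
    then obtain e where "e > 0" "continuous_on (ball x e) (deriv f)" using * by blast
    then show "isCont (deriv f) x" by (simp add: continuous_on_eq_continuous_at)
  qed
  show "(f has_real_derivative deriv f x) (at x)" if "x \<in> S" for x using *[OF that] by blast
qed

lemma C1_map_iff_pointwise:
  "C1_map (T, A) (T', A') f \<longleftrightarrow> (\<forall>x \<in> topspace T. \<exists>U \<phi> V \<psi>. (U, \<phi>) \<in> A \<and> (V, \<psi>) \<in> A' \<and>
     x \<in> U \<and> f ` U \<subseteq> V \<and> \<phi> ` U \<subseteq> range affine_embed \<and> \<psi> ` V \<subseteq> range affine_embed \<and>
     (\<lambda>s. the_inv affine_embed (\<psi> (f (the_inv_into U \<phi> (affine_embed s)))))
       C1_differentiable_on (affine_embed -` (\<phi> ` U)))"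
  unfolding C1_map_def prod.case by (intro ball_cong refl) auto

lemma PGL2_homeomorphic: "g \<in> PGL2 \<Longrightarrow> homeomorphic_map proj_line proj_line g"
proof -
  assume g: "g \<in> PGL2"
  then obtain h where h: "h \<in> PGL2" "\<forall>x. h (g x) = x" "\<forall>x. g (h x) = x" using PGL2_inv by blast
  then have "homeomorphic_maps proj_line proj_line g h"
    using PGL2_continuous g by (auto simp: homeomorphic_maps_def)
  then show ?thesis using homeomorphic_map_maps by blast
qed

lemma is_chart_compose:
  assumes c: "is_chart proj_geom T (U, \<phi>)" and g: "g \<in> PGL2"
  shows "is_chart proj_geom T (U, restrict (\<lambda>y. g (\<phi> y)) U)"
proof -
  have op: "openin T U" "openin proj_line (\<phi> ` U)"
    and h: "homeomorphic_map (subtopology T U) (subtopology proj_line (\<phi> ` U)) \<phi>"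
    and r: "subtopology proj_line (\<phi> ` U) homeomorphic_space euclideanreal"
    using c by (auto simp: is_chart_def open_interval_in_def)
  have im: "restrict (\<lambda>y. g (\<phi> y)) U ` U = g ` \<phi> ` U" by (simp add: image_image)
  have gh: "homeomorphic_map (subtopology proj_line (\<phi> ` U)) (subtopology proj_line (g ` \<phi> ` U)) g"
    by (rule homeomorphic_map_subtopologies_alt[OF PGL2_homeomorphic[OF g]])
      (use PGL2_inj[OF g] openin_subset[OF op(2)] in auto)
  have "homeomorphic_map (subtopology T U) (subtopology proj_line (g ` \<phi> ` U)) (restrict (\<lambda>y. g (\<phi> y)) U)"
    using homeomorphic_map_compose[OF h gh] by (rule homeomorphic_map_eq) auto
  moreover have "open_interval_in proj_line (g ` \<phi> ` U)"
    unfolding open_interval_in_def using PGL2_openin[OF g op(2)] r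
      homeomorphic_space_trans[OF homeomorphic_space_sym[THEN iffD1, OF homeomorphic_map_imp_homeomorphic_space[OF gh]]] by blast
  ultimately show ?thesis using op unfolding is_chart_def by (simp only: prod.case im proj_geom_sel) simp
qed

text \<open>A maximal atlas absorbs composition with projective maps, since these only alter the
  changes of charts. This provides the charts avoiding the point at infinity that
  \<open>C1_map\<close> demands.\<close>

lemma structure_compose:
  assumes A: "is_structure proj_geom T A" and c: "(U, \<phi>) \<in> A" and g: "g \<in> PGL2"
  shows "(U, restrict (\<lambda>y. g (\<phi> y)) U) \<in> A"
proof -
  have at: "is_atlas proj_geom T A" and eq: "structure_of proj_geom T A = A" using A by (auto simp: is_structure_def)
  have ch: "is_chart proj_geom T (U, \<phi>)" using at c by (auto simp: is_atlas_def)
  have "chart_change proj_geom T (U, restrict (\<lambda>y. g (\<phi> y)) U) c'" if c': "c' \<in> A" for c'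
    unfolding chart_change_iff
  proof
    fix x assume x: "x \<in> fst (U, restrict (\<lambda>y. g (\<phi> y)) U) \<inter> fst c'"
    have "change_at proj_geom T (U, restrict (\<lambda>y. g (\<phi> y)) U) (U, \<phi>) x"
    proof (rule proj.change_at_sym, rule change_atI)
      show "openin T U" using proj.chart_openin[OF ch] by simp
    qed (use x g in auto)
    moreover have "change_at proj_geom T (U, \<phi>) c' x"
      by (rule atlas_change_at[OF at c c']) (use x in auto)
    ultimately show "change_at proj_geom T (U, restrict (\<lambda>y. g (\<phi> y)) U) c' x" by (rule proj.change_at_trans)
  qed
  then have "(U, restrict (\<lambda>y. g (\<phi> y)) U) \<in> structure_of proj_geom T A"
    using is_chart_compose[OF ch g] by (simp add: structure_of_def)
  then show ?thesis using eq by simp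
qed

definition std_chart :: "(real \<Rightarrow> real) \<Rightarrow> (real \<Rightarrow> p1) \<Rightarrow> real set \<Rightarrow> (real set, p1) chart" where
  "std_chart F D J = ((\<lambda>x. circle_proj (F x)) ` J,
     restrict (\<lambda>y. D (the_inv_into J (\<lambda>x. circle_proj (F x)) y)) ((\<lambda>x. circle_proj (F x)) ` J))"

lemma fst_std_chart: "fst (std_chart F D J) = (\<lambda>x. circle_proj (F x)) ` J"
  by (simp add: std_chart_def)

lemma snd_std_chart:
  assumes "inj_on (\<lambda>x. circle_proj (F x)) J" "z \<in> J"
  shows "snd (std_chart F D J) (circle_proj (F z)) = D z"
  using the_inv_into_f_f[OF assms] assms(2) by (simp add: std_chart_def)

lemma circle_structure_small_chart:
  assumes F: "circle_lift F" and D: "normal_dev D" and U: "open U" "z \<in> U"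
  obtains e where "e > 0" "ball z e \<subseteq> U" "inj_on (\<lambda>x. circle_proj (F x)) (ball z e)"
    "std_chart F D (ball z e) \<in> circle_structure F D"
proof -
  interpret quotient_data proj_geom UNIV "\<lambda>x. circle_proj (F x)" D by (rule quotient_data_circle[OF F D])
  have T: "T = circle" by (simp add: circle_eq_quotient F)
  obtain e where e: "e > 0" "ball z e \<subseteq> UNIV \<inter> U" "inj_on (\<lambda>x. circle_proj (F x)) (ball z e)" "inj_on D (ball z e)"
    by (rule small_interval[of z U]) (use U in auto)
  have "std_chart F D (ball z e) \<in> struct"
    unfolding std_chart_def by (rule struct_chart) (use e in auto)
  then have "std_chart F D (ball z e) \<in> circle_structure F D" using T by (simp add: circle_structure_def)
  then show ?thesis using that[of e] e by auto
qed

lemma C1_mapI: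
  assumes F: "circle_lift F" and D: "normal_dev D" and \<Phi>: "circle_lift \<Phi>"
    and f: "\<And>x. f (circle_proj x) = circle_proj (F (\<Phi> x))" and c1: "\<And>x. c1_at nz \<Phi> x"
  shows "C1_map (circle, pi0) (circle, circle_structure F D) f"
  unfolding C1_map_iff_pointwise
proof
  fix p assume "p \<in> topspace circle"
  then obtain x where p: "p = circle_proj x" by (auto simp: topspace_circle)
  define z where "z = \<Phi> x"
  obtain k e \<theta> \<theta>' where dev: "k \<in> PGL2" "e > 0" "inj_on \<theta> (ball z e)" "continuous_on (ball z e) \<theta>'"
    "\<And>y. y \<in> ball z e \<Longrightarrow> D y = k (affine_embed (\<theta> y))"
    "\<And>y. y \<in> ball z e \<Longrightarrow> (\<theta> has_real_derivative \<theta>' y) (at y)" "\<And>y. y \<in> ball z e \<Longrightarrow> \<theta>' y \<noteq> 0"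
    "continuous_on (ball z e) \<theta>" by (rule developingE[OF normal_dev_developing[OF D], of z]) blast
  \<comment> \<open>Undoing k turns the target chart into the real coordinate \<theta>, away from
    infinity.\<close>
  obtain k' where k': "k' \<in> PGL2" "\<forall>x. k' (k x) = x" using PGL2_inv[OF dev(1)] by blast
  let ?q = "\<lambda>x. circle_proj (F x)"
  obtain e2 where e2: "e2 > 0" "ball z e2 \<subseteq> ball z e" "inj_on ?q (ball z e2)"
    "std_chart F D (ball z e2) \<in> circle_structure F D"
    by (rule circle_structure_small_chart[OF F D open_ball[of z e], of z]) (use dev(2) in auto)
  define J2 where "J2 = ball z e2"
  define V where "V = ?q ` J2"
  define \<psi>0 where "\<psi>0 = snd (std_chart F D J2)"
  define \<psi> where "\<psi> = restrict (\<lambda>y. k' (\<psi>0 y)) V"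
  have "(V, \<psi>0) \<in> circle_structure F D" using e2(4) by (simp add: V_def \<psi>0_def J2_def std_chart_def)
  then have V: "(V, \<psi>) \<in> circle_structure F D"
    unfolding \<psi>_def by (rule structure_compose[OF is_structure_circle_structure[OF F D] _ k'(1)])
  have \<psi>: "\<psi> (?q y) = affine_embed (\<theta> y)" if y: "y \<in> J2" for y
  proof -
    have "\<psi> (?q y) = k' (\<psi>0 (?q y))" using y by (simp add: \<psi>_def V_def)
    also have "\<dots> = k' (D y)" using snd_std_chart[of F J2 y D] e2(3) y by (simp add: \<psi>0_def J2_def)
    also have "\<dots> = affine_embed (\<theta> y)" using dev(5)[of y] k'(2) e2(2) y by (simp add: J2_def subset_iff)
    finally show ?thesis .
  qed
  have op: "open (\<Phi> -` J2)" unfolding J2_def by (rule open_vimage[OF open_ball circle_lift_continuous[OF \<Phi>]])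
  have xin: "x \<in> \<Phi> -` J2" using e2(1) by (simp add: J2_def z_def)
  obtain e1 where e1: "e1 > 0" "ball x e1 \<subseteq> \<Phi> -` J2" "inj_on (\<lambda>x. circle_proj x) (ball x e1)"
    "std_chart (\<lambda>x. x) affine_embed (ball x e1) \<in> pi0"
    unfolding pi0_eq by (rule circle_structure_small_chart[OF circle_lift_id normal_dev_affine op xin]) blast
  define J1 where "J1 = ball x e1"
  define U where "U = circle_proj ` J1"
  define \<phi> where "\<phi> = snd (std_chart (\<lambda>x. x) affine_embed J1)"
  have \<phi>: "\<phi> (circle_proj y) = affine_embed y" if "y \<in> J1" for y
    using snd_std_chart[of "\<lambda>x. x" J1 y affine_embed] that e1(3) by (simp add: \<phi>_def J1_def)
  have \<phi>U: "\<phi> ` U = affine_embed ` J1" using \<phi> by (force simp: U_def)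
  have inj\<phi>: "inj_on \<phi> U" unfolding U_def by (rule inj_onI) (auto simp: \<phi>)
  have pre: "affine_embed -` (\<phi> ` U) = J1" unfolding \<phi>U by auto
  have val: "the_inv affine_embed (\<psi> (f (the_inv_into U \<phi> (affine_embed s)))) = \<theta> (\<Phi> s)" if s: "s \<in> J1" for s
  proof -
    have "the_inv_into U \<phi> (affine_embed s) = circle_proj s"
      using the_inv_into_f_f[OF inj\<phi>, of "circle_proj s"] \<phi>[OF s] s by (simp add: U_def)
    moreover have "\<Phi> s \<in> J2" using e1(2) s by (auto simp: J1_def)
    ultimately show ?thesis using \<psi> by (simp add: f)
  qed
  have "(\<lambda>s. the_inv affine_embed (\<psi> (f (the_inv_into U \<phi> (affine_embed s))))) C1_differentiable_on J1"
  proof (rule c1_at_C1_differentiable_on[where nz = False])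
    show "open J1" by (simp add: J1_def)
    fix s assume s: "s \<in> J1"
    have "\<Phi> s \<in> J2" using e1(2) s by (auto simp: J1_def)
    then have "\<Phi> s \<in> ball z e" using e2(2) unfolding J2_def by blast
    then have t: "c1_at False \<theta> (\<Phi> s)" by (intro c1_atI[of "ball z e" _ \<theta>']) (use dev in auto)
    have "c1_at False \<Phi> s" using c1[of s] by (auto simp: c1_at_def)
    from c1_at_comp[OF this t] show "c1_at False (\<lambda>s. the_inv affine_embed (\<psi> (f (the_inv_into U \<phi> (affine_embed s))))) s"
      by (rule c1_at_cong[of _ _ _ J1]) (use s val in \<open>auto simp: J1_def\<close>)
  qed
  moreover have "(U, \<phi>) \<in> pi0" using e1(4) by (simp add: U_def \<phi>_def J1_def std_chart_def)
  moreover have "p \<in> U" using e1(1) by (simp add: p U_def J1_def)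
  moreover have "f ` U \<subseteq> V" using e1(2) by (auto simp: U_def V_def J1_def f)
  moreover have "\<phi> ` U \<subseteq> range affine_embed" unfolding \<phi>U by auto
  moreover have "\<psi> ` V \<subseteq> range affine_embed" using \<psi> by (auto simp: V_def)
  ultimately show "\<exists>U \<phi> V \<psi>. (U, \<phi>) \<in> pi0 \<and> (V, \<psi>) \<in> circle_structure F D \<and>
     p \<in> U \<and> f ` U \<subseteq> V \<and> \<phi> ` U \<subseteq> range affine_embed \<and> \<psi> ` V \<subseteq> range affine_embed \<and>
     (\<lambda>s. the_inv affine_embed (\<psi> (f (the_inv_into U \<phi> (affine_embed s)))))
       C1_differentiable_on (affine_embed -` (\<phi> ` U))" using V pre by metis
qed

text \<open>A chart of the maximal atlas is arbitrary, but its change from a standard chart at the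
  point is projective, so near x it reads as a projective map after D.\<close>

lemma circle_structure_chart_at:
  assumes F: "circle_lift F" and D: "normal_dev D" and c: "(U, \<phi>) \<in> circle_structure F D" "circle_proj (F x) \<in> U"
  obtains g e where "g \<in> PGL2" "e > 0" "\<And>y. y \<in> ball x e \<Longrightarrow> circle_proj (F y) \<in> U"
    "\<And>y. y \<in> ball x e \<Longrightarrow> \<phi> (circle_proj (F y)) = g (D y)"
proof -
  have at: "is_atlas proj_geom circle (circle_structure F D)" by (rule is_atlas_circle_structure[OF F D])
  obtain e1 where e1: "e1 > 0" "inj_on (\<lambda>x. circle_proj (F x)) (ball x e1)"
    "std_chart F D (ball x e1) \<in> circle_structure F D"
    by (rule circle_structure_small_chart[OF F D open_UNIV UNIV_I]) blast
  let ?c = "std_chart F D (ball x e1)"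
  have "change_at proj_geom circle ?c (U, \<phi>) (circle_proj (F x))"
    by (rule atlas_change_at[OF at e1(3) c(1)]) (use c e1 in \<open>auto simp: fst_std_chart\<close>)
  then obtain W g where W: "openin circle W" "circle_proj (F x) \<in> W" "W \<subseteq> fst ?c" "W \<subseteq> U" "g \<in> snd proj_geom"
    "\<And>y. y \<in> W \<Longrightarrow> \<phi> y = g (snd ?c y)"
    by (rule change_atE) simp
  have "open {y. circle_proj y \<in> W}" using openin_continuous_map_preimage[OF continuous_circle_proj W(1)] by simp
  from open_vimage[OF this circle_lift_continuous[OF F]]
  have "open (F -` {y. circle_proj y \<in> W} \<inter> ball x e1)" by auto
  moreover have "x \<in> F -` {y. circle_proj y \<in> W} \<inter> ball x e1" using W(2) e1(1) by simp
  ultimately obtain e where e: "e > 0" "ball x e \<subseteq> F -` {y. circle_proj y \<in> W} \<inter> ball x e1" using open_contains_ball by blast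
  show ?thesis
  proof (rule that[of g e])
    show "g \<in> PGL2" using W(5) by simp
    show "e > 0" by (rule e(1))
    fix y assume y: "y \<in> ball x e"
    then have yW: "circle_proj (F y) \<in> W" "y \<in> ball x e1" using e(2) by auto
    show "circle_proj (F y) \<in> U" using yW W(4) by blast
    show "\<phi> (circle_proj (F y)) = g (D y)"
      using W(6)[OF yW(1)] snd_std_chart[OF e1(2) yW(2)] by simp
  qed
qed

lemmas pi0_chart_at = circle_structure_chart_at[OF circle_lift_id normal_dev_affine, folded pi0_eq]

text \<open>The charts that witness \<open>C1_map\<close> are unknown. Since they avoid infinity, on
  both sides they differ from the standard coordinate by a fractional linear function with finite
  values, and being C1 passes through such functions.\<close>

lemma C1_map_lift:
  assumes \<Phi>: "circle_lift \<Phi>" and C: "C1_map (circle, pi0) (circle, pi0) (circle_map \<Phi>)"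
  shows "c1_at False \<Phi> x"
proof -
  have "circle_proj x \<in> topspace circle" by (simp add: topspace_circle)
  then obtain U \<phi> V \<psi> where UV: "(U, \<phi>) \<in> pi0" "(V, \<psi>) \<in> pi0" "circle_proj x \<in> U" "circle_map \<Phi> ` U \<subseteq> V"
    "\<phi> ` U \<subseteq> range affine_embed" "\<psi> ` V \<subseteq> range affine_embed"
    "(\<lambda>s. the_inv affine_embed (\<psi> (circle_map \<Phi> (the_inv_into U \<phi> (affine_embed s)))))
       C1_differentiable_on (affine_embed -` (\<phi> ` U))"
    using C unfolding C1_map_iff_pointwise by meson
  define \<kappa> where "\<kappa> = (\<lambda>s. the_inv affine_embed (\<psi> (circle_map \<Phi> (the_inv_into U \<phi> (affine_embed s)))))"
  have at: "is_atlas proj_geom circle pi0" unfolding pi0_eq by (rule is_atlas_circle_structure) auto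
  have ch: "is_chart proj_geom circle (U, \<phi>)" using at UV(1) by (auto simp: is_atlas_def)
  then have op\<phi>: "openin proj_line (\<phi> ` U)" and "inj_on \<phi> (topspace (subtopology circle U))"
    by (simp_all add: is_chart_def open_interval_in_def homeomorphic_map_def)
  then have inj\<phi>: "inj_on \<phi> U" using openin_subset[OF proj.chart_openin[OF ch]] by (simp add: Int_absorb1)
  have opS: "open (affine_embed -` (\<phi> ` U))"
    using openin_continuous_map_preimage[OF continuous_affine_embed op\<phi>] by (simp add: vimage_def)
  obtain g e where g: "g \<in> PGL2" "e > 0" "\<And>y. y \<in> ball x e \<Longrightarrow> circle_proj y \<in> U"
    "\<And>y. y \<in> ball x e \<Longrightarrow> \<phi> (circle_proj y) = g (affine_embed y)" using pi0_chart_at[OF UV(1,3)] by blast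
  have "circle_proj (\<Phi> x) \<in> V" using UV(3,4) \<Phi> by (metis circle_map_proj image_subset_iff)
  then obtain h e' where h: "h \<in> PGL2" "e' > 0" "\<And>y. y \<in> ball (\<Phi> x) e' \<Longrightarrow> circle_proj y \<in> V"
    "\<And>y. y \<in> ball (\<Phi> x) e' \<Longrightarrow> \<psi> (circle_proj y) = h (affine_embed y)" using pi0_chart_at[OF UV(2)] by blast
  obtain h' where h': "h' \<in> PGL2" "\<forall>p. h' (h p) = p" using PGL2_inv[OF h(1)] by blast
  \<comment> \<open>Real reading of the source chart along the lift; the function tested by
    \<open>C1_map\<close> is then evaluated at a y.\<close>
  define a where "a y = the_inv affine_embed (\<phi> (circle_proj y))" for y
  have a: "affine_embed (a y) = \<phi> (circle_proj y)" if y: "y \<in> ball x e" for y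
  proof -
    have "\<phi> (circle_proj y) \<in> range affine_embed" using UV(5) g(3)[OF y] by blast
    then obtain s where "\<phi> (circle_proj y) = affine_embed s" by blast
    then show ?thesis by (simp add: a_def)
  qed
  have c1a: "c1_at False a x"
    by (rule c1_at_projective[OF c1_at_translation[of _ 0] g(1,2)]) (use a g(4) in auto)
  have "a x \<in> affine_embed -` (\<phi> ` U)" using a[of x] g(2,3) by auto
  moreover obtain \<kappa>' where "continuous_on (affine_embed -` (\<phi> ` U)) \<kappa>'"
    "\<forall>x\<in>affine_embed -` (\<phi> ` U). (\<kappa> has_real_derivative \<kappa>' x) (at x)"
    using UV(7) unfolding C1_differentiable_on_real \<kappa>_def by blast
  ultimately have "c1_at False \<kappa> (a x)" using opS by (intro c1_atI[of "affine_embed -` (\<phi> ` U)" _ \<kappa>']) auto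
  then have c1\<kappa>: "c1_at False (\<lambda>y. \<kappa> (a y)) x" by (rule c1_at_comp[OF c1a])
  have "open (ball x e \<inter> \<Phi> -` ball (\<Phi> x) e')" using open_vimage[OF open_ball circle_lift_continuous[OF \<Phi>]] by auto
  moreover have "x \<in> ball x e \<inter> \<Phi> -` ball (\<Phi> x) e'" using g(2) h(2) by simp
  ultimately obtain e3 where e3: "e3 > 0" "ball x e3 \<subseteq> ball x e \<inter> \<Phi> -` ball (\<Phi> x) e'" using open_contains_ball by blast
  show ?thesis
  proof (rule c1_at_projective[OF c1\<kappa> h'(1) e3(1)])
    fix y assume "y \<in> ball x e3"
    then have y: "y \<in> ball x e" "\<Phi> y \<in> ball (\<Phi> x) e'" using e3(2) by auto
    have "the_inv_into U \<phi> (affine_embed (a y)) = circle_proj y"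
      unfolding a[OF y(1)] using the_inv_into_f_f[OF inj\<phi> g(3)[OF y(1)]] .
    then have "\<kappa> (a y) = the_inv affine_embed (\<psi> (circle_proj (\<Phi> y)))" using \<Phi> by (simp add: \<kappa>_def)
    moreover have "\<psi> (circle_proj (\<Phi> y)) \<in> range affine_embed" using UV(6) h(3)[OF y(2)] by blast
    then obtain s where "\<psi> (circle_proj (\<Phi> y)) = affine_embed s" by blast
    ultimately have "affine_embed (\<kappa> (a y)) = h (affine_embed (\<Phi> y))" using h(4)[OF y(2)] by simp
    then show "affine_embed (\<Phi> y) = h' (affine_embed (\<kappa> (a y)))" using h'(2) by simp
  qed
qed

lemma C1_diffeoI:
  assumes \<Phi>: "circle_lift \<Phi>" and c1: "\<And>x. c1_at nz \<Phi> x" "\<And>x. c1_at nz (inv_into UNIV \<Phi>) x"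
  shows "C1_diffeo (circle_map \<Phi>)"
proof -
  have *: "C1_map (circle, pi0) (circle, pi0) (circle_map \<Psi>)" if "circle_lift \<Psi>" "\<And>x. c1_at nz \<Psi> x" for \<Psi>
    unfolding pi0_eq[symmetric] using C1_mapI[OF circle_lift_id normal_dev_affine that(1) _ that(2), of "circle_map \<Psi>"] that(1)
    by (simp add: pi0_eq[symmetric])
  show ?thesis unfolding C1_diffeo_def circle_map_inv[OF \<Phi>]
    using * \<Phi> circle_lift_inv[OF \<Phi>] c1 by simp
qed

section \<open>Piecewise projective actions\<close>

lemma is_atlas_pi0: "is_atlas proj_geom circle pi0"
  unfolding pi0_eq by (rule is_atlas_circle_structure) auto

lemma homeomorphic_map_carrier: "f \<in> carrier homeo_group \<Longrightarrow> homeomorphic_map circle circle f"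
  by (simp add: carrier_homeo_group)

lemma homeomorphic_circle_id: "homeomorphic_map circle circle (\<lambda>x. x)"
  using homeomorphic_map_id[of circle circle] by (simp add: id_def)

text \<open>Failures come from three places: the identity towards \<pi>1, the map f for
  \<open>pi0\<close>, and the points that f sends to failures of the identity towards \<pi>2. The
  last set is finite because f is injective.\<close>

lemma compatible_piecewise:
  assumes c1: "compatible \<pi>1" and c2: "compatible \<pi>2" and f: "f \<in> PC0"
  shows "\<exists>E. finite E \<and> (\<forall>p\<in>topspace circle - E. locally_modeled_at proj_geom (circle, \<pi>1) (circle, \<pi>2) f p)"
proof -
  have hf: "homeomorphic_map circle circle f" using f homeomorphic_map_carrier by (simp add: PC0_def)
  then have fc: "continuous_map circle circle f" and finj: "inj_on f (topspace circle)" and ft: "f ` topspace circle = topspace circle"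
    by (auto simp: homeomorphic_eq_everything_map)
  obtain E0 where E0: "finite E0" "\<And>p. p \<in> topspace circle - E0 \<Longrightarrow> locally_modeled_at proj_geom (circle, pi0) (circle, pi0) f p"
    using f by (auto simp: PC0_def piecewise_iso_def)
  obtain E1 where E1: "finite E1" "\<And>p. p \<in> topspace circle - E1 \<Longrightarrow> locally_modeled_at proj_geom (circle, pi0) (circle, \<pi>1) (\<lambda>x. x) p"
    using c1 by (auto simp: compatible_def piecewise_iso_def)
  obtain E2 where E2: "finite E2" "\<And>p. p \<in> topspace circle - E2 \<Longrightarrow> locally_modeled_at proj_geom (circle, pi0) (circle, \<pi>2) (\<lambda>x. x) p"
    using c2 by (auto simp: compatible_def piecewise_iso_def)
  have "{p \<in> topspace circle. f p \<in> E2} = f -` E2 \<inter> topspace circle" by auto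
  then have "finite {p \<in> topspace circle. f p \<in> E2}" using finite_vimage_IntI[OF E2(1) finj] by simp
  moreover have "locally_modeled_at proj_geom (circle, \<pi>1) (circle, \<pi>2) f p"
    if p: "p \<in> topspace circle - (E1 \<union> E0 \<union> {p \<in> topspace circle. f p \<in> E2})" for p
  proof -
    have "locally_modeled_at proj_geom (circle, \<pi>1) (circle, pi0) (\<lambda>x. x) p"
      using proj.locally_modeled_at_inv[OF homeomorphic_circle_id, of "\<lambda>x. x" pi0 \<pi>1 p] E1(2)[of p] p by simp
    moreover have "locally_modeled_at proj_geom (circle, pi0) (circle, pi0) f p" using E0(2)[of p] p by simp
    ultimately have "locally_modeled_at proj_geom (circle, \<pi>1) (circle, pi0) (\<lambda>y. f y) p"
      using proj.locally_modeled_at_comp[OF is_atlas_pi0, of circle "\<lambda>x. x" \<pi>1 p circle pi0 f] by simp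
    moreover have "locally_modeled_at proj_geom (circle, pi0) (circle, \<pi>2) (\<lambda>x. x) (f p)"
      using E2(2)[of "f p"] p ft by auto
    ultimately show ?thesis
      using proj.locally_modeled_at_comp[OF is_atlas_pi0 fc, of \<pi>1 p circle \<pi>2 "\<lambda>x. x"] by simp
  qed
  ultimately show ?thesis using E0(1) E1(1) by (intro exI[of _ "E1 \<union> E0 \<union> {p \<in> topspace circle. f p \<in> E2}"]) auto
qed

text \<open>Read in \<open>pi0\<close>, the isomorphism stands between two identity maps that fail
  at finitely many points. This puts conjugators into \<open>PC0\<close> even when the straightening
  maps F1 and F2 are not in it.\<close>

lemma compatible_iso_PC0:
  assumes c1: "compatible \<pi>1" and c2: "compatible \<pi>2" and f: "f \<in> carrier homeo_group"
    and iso: "curve_iso proj_geom (circle, \<pi>1) (circle, \<pi>2) f"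
  shows "f \<in> PC0"
proof -
  have hf: "homeomorphic_map circle circle f" using f homeomorphic_map_carrier by simp
  then have fc: "continuous_map circle circle f" and finj: "inj_on f (topspace circle)" and ft: "f ` topspace circle = topspace circle"
    by (auto simp: homeomorphic_eq_everything_map)
  have at: "is_atlas proj_geom circle \<pi>1" "is_atlas proj_geom circle \<pi>2" using c1 c2 by (auto simp: compatible_def is_structure_def)
  obtain E1 where E1: "finite E1" "\<And>p. p \<in> topspace circle - E1 \<Longrightarrow> locally_modeled_at proj_geom (circle, pi0) (circle, \<pi>1) (\<lambda>x. x) p"
    using c1 by (auto simp: compatible_def piecewise_iso_def)
  obtain E2 where E2: "finite E2" "\<And>p. p \<in> topspace circle - E2 \<Longrightarrow> locally_modeled_at proj_geom (circle, pi0) (circle, \<pi>2) (\<lambda>x. x) p"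
    using c2 by (auto simp: compatible_def piecewise_iso_def)
  have "{p \<in> topspace circle. f p \<in> E2} = f -` E2 \<inter> topspace circle" by auto
  then have "finite {p \<in> topspace circle. f p \<in> E2}" using finite_vimage_IntI[OF E2(1) finj] by simp
  moreover have "locally_modeled_at proj_geom (circle, pi0) (circle, pi0) f p"
    if p: "p \<in> topspace circle - (E1 \<union> {p \<in> topspace circle. f p \<in> E2})" for p
  proof -
    have "locally_modeled_at proj_geom (circle, pi0) (circle, \<pi>1) (\<lambda>x. x) p" using E1(2)[of p] p by simp
    moreover have "locally_modeled_at proj_geom (circle, \<pi>1) (circle, \<pi>2) f p" using iso p by (simp add: curve_iso_def)
    ultimately have "locally_modeled_at proj_geom (circle, pi0) (circle, \<pi>2) (\<lambda>y. f y) p"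
      using proj.locally_modeled_at_comp[OF at(1), of circle "\<lambda>x. x" pi0 p circle \<pi>2 f] by simp
    moreover have "locally_modeled_at proj_geom (circle, pi0) (circle, \<pi>2) (\<lambda>x. x) (f p)"
      using E2(2)[of "f p"] p ft by auto
    then have "locally_modeled_at proj_geom (circle, \<pi>2) (circle, pi0) (\<lambda>x. x) (f p)"
      using proj.locally_modeled_at_inv[OF homeomorphic_circle_id, of "\<lambda>x. x" pi0 \<pi>2 "f p"] by simp
    ultimately show ?thesis
      using proj.locally_modeled_at_comp[OF at(2) fc, of pi0 p circle pi0 "\<lambda>x. x"] by simp
  qed
  ultimately show ?thesis using f hf E1(1) unfolding PC0_def piecewise_iso_def fst_conv
    by (intro CollectI conjI exI[of _ "E1 \<union> {p \<in> topspace circle. f p \<in> E2}"]) auto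
qed

lemma homeo_inv_apply:
  assumes "f \<in> carrier homeo_group"
  shows "(inv\<^bsub>homeo_group\<^esub> f) (f (circle_proj x)) = circle_proj x"
proof -
  obtain F where "circle_lift F" "f = circle_map F" by (rule homeo_group_lift[OF assms])
  then show ?thesis by (simp add: circle_map_inv circle_lift_inv)
qed

text \<open>\<open>fin\<close> says that F is piecewise projective from the parameter circle with
  developing map D to the standard circle, and \<open>conj\<close> that F straightens the action: F
  alone carries the dynamics, D the geometry.\<close>

locale uniformized_action = circle_action H \<rho> for H \<rho> +
  fixes F :: "real \<Rightarrow> real" and D :: "real \<Rightarrow> p1"
  assumes PC: "\<rho> ` H \<subseteq> PC0" and F: "circle_lift F" and D: "normal_dev D"
    and fin: "finite (circle_proj ` {x. \<not> proj_at D affine_embed F x})"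
    and conj: "\<And>h. h \<in> H \<Longrightarrow> \<rho> h = circle_map F \<otimes>\<^bsub>homeo_group\<^esub> h \<otimes>\<^bsub>homeo_group\<^esub> inv\<^bsub>homeo_group\<^esub> (circle_map F)"

lemma (in circle_action) uniformize:
  assumes PC: "\<rho> ` H \<subseteq> PC0"
  obtains F D where "uniformized_action H \<rho> F D"
proof -
  obtain F where F: "circle_lift F"
    "\<And>h. h \<in> H \<Longrightarrow> \<rho> h = circle_map F \<otimes>\<^bsub>homeo_group\<^esub> h \<otimes>\<^bsub>homeo_group\<^esub> inv\<^bsub>homeo_group\<^esub> (circle_map F)"
    by (rule conjugate_to_standard) blast
  have "circle_map (\<lambda>x. F (inv_into UNIV F x + t)) \<in> PC0" for t
  proof -
    have "circle_map (\<lambda>x. F (inv_into UNIV F x + t)) = \<rho> (rot t)"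
      using F(1) circle_lift_inv[OF F(1)] circle_lift_comp[OF F(1) circle_lift_translation]
      by (simp add: F(2)[OF rot_H] circle_map_inv circle_map_mult)
    then show ?thesis using PC rot_H by auto
  qed
  then obtain D where "normal_dev D" "finite (circle_proj ` {x. \<not> proj_at D affine_embed F x})"
    using normal_form_of_piecewise_projective[OF F(1)] by blast
  then have "uniformized_action H \<rho> F D"
    using F PC by unfold_locales auto
  then show ?thesis by (rule that)
qed

context uniformized_action
begin

abbreviation "inv_struct \<equiv> circle_structure F D"

lemma atlas_Pi: "is_atlas proj_geom circle inv_struct"
  by (rule is_atlas_circle_structure[OF F D])

lemma H_cases:
  assumes "h \<in> H"
  obtains (rot) t where "h = rot t" | (reflection) t where "h = circle_map (\<lambda>x. t - x)" "H = isometries"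
  using assms H isometries_eq isometries_plus_eq by blast

lemma rho_lift:
  assumes L: "circle_lift L" "circle_map L \<in> H"
  shows "\<rho> (circle_map L) = circle_map (\<lambda>x. F (L (inv_into UNIV F x)))"
  using F L circle_lift_inv[OF F] circle_lift_comp[OF F L(1)] by (simp add: conj circle_map_inv circle_map_mult)

lemma rho_apply:
  assumes L: "circle_lift L" "circle_map L \<in> H"
  shows "\<rho> (circle_map L) (circle_proj (F x)) = circle_proj (F (L x))"
  using circle_lift_comp[OF F circle_lift_comp[OF L(1) circle_lift_inv[OF F]]] F by (simp add: rho_lift[OF L])

lemma homogeneous:
  assumes L: "L = (\<lambda>x. x + t) \<or> L = (\<lambda>x. t - x)"
  shows "\<exists>g\<in>PGL2. \<forall>x. D (L x) = g (D x)"
  using L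
proof
  assume "L = (\<lambda>x. x + t)" then show ?thesis using normal_dev_translate[OF D] by simp
next
  assume L: "L = (\<lambda>x. t - x)"
  obtain g where g: "g \<in> PGL2" "\<And>x. D (x + t) = g (D x)" using normal_dev_translate[OF D] by blast
  obtain h where h: "h \<in> PGL2" "\<And>x. D (- x) = h (D x)" using normal_dev_reflect[OF D] by blast
  have "D (L x) = g (h (D x))" for x using g(2)[of "- x"] h(2) by (simp add: L)
  then show ?thesis using PGL2_comp[OF g(1) h(1)] by (intro bexI[of _ "\<lambda>p. g (h p)"]) auto
qed

text \<open>In the parameter of F the element h is a translation or a reflection, and
  \<open>homogeneous\<close> turns either into a projective map along D, with no exceptional
  point.\<close>

lemma curve_iso_H:
  assumes h: "h \<in> H"
  shows "curve_iso proj_geom (circle, inv_struct) (circle, inv_struct) (\<rho> h)"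
proof -
  obtain L t where L: "h = circle_map L" "L = (\<lambda>x. x + t) \<or> L = (\<lambda>x. t - x)" using h by (elim H_cases) auto
  have lift: "circle_lift L" using L(2) by auto
  show ?thesis unfolding curve_iso_def fst_conv
  proof (intro conjI ballI)
    show "homeomorphic_map circle circle (\<rho> h)" using rho_carrier[OF h] homeomorphic_map_carrier by blast
    fix p assume "p \<in> topspace circle"
    then obtain x where p: "p = circle_proj (F x)" using circle_lift_surj[OF F] by (metis imageE surjD topspace_circle)
    have "proj_at D D L x" unfolding proj_at_def using homogeneous[OF L(2)] by (auto intro!: exI[of _ 1])
    then show "locally_modeled_at proj_geom (circle, inv_struct) (circle, inv_struct) (\<rho> h) p"
      unfolding p using locally_modeled_circle[OF F F D D circle_lift_continuous[OF lift]] rho_apply[OF lift] h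
      unfolding L(1) by blast
  qed
qed

lemma compatible_Pi: "compatible inv_struct"
  unfolding compatible_def piecewise_iso_def fst_conv
proof (intro conjI)
  show "is_structure proj_geom circle inv_struct" by (rule is_structure_circle_structure[OF F D])
  show "homeomorphic_map circle circle (\<lambda>x. x)" by (rule homeomorphic_circle_id)
  let ?E = "circle_map F ` circle_proj ` {x. \<not> proj_at D affine_embed F x}"
  have "locally_modeled_at proj_geom (circle, pi0) (circle, inv_struct) (\<lambda>x. x) p" if p: "p \<in> topspace circle - ?E" for p
  proof -
    obtain x where x: "p = circle_proj (F x)" using p circle_lift_surj[OF F] by (metis DiffD1 imageE surjD topspace_circle)
    have "proj_at D affine_embed F x"
    proof (rule ccontr)
      assume "\<not> proj_at D affine_embed F x"
      then have "circle_map F (circle_proj x) \<in> ?E" by blast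
      then show False using p x F by simp
    qed
    then have "proj_at affine_embed D (inv_into UNIV F) (F x)" by (rule proj_at_inv[OF F])
    moreover have "locally_modeled_at proj_geom (circle, pi0) (circle, inv_struct) (\<lambda>x. x) (circle_proj (F x)) \<longleftrightarrow>
        proj_at affine_embed D (inv_into UNIV F) (F x)"
      unfolding pi0_eq
      by (rule locally_modeled_circle[OF circle_lift_id F normal_dev_affine D circle_lift_continuous[OF circle_lift_inv[OF F]]])
        (simp add: F)
    ultimately show ?thesis unfolding x by blast
  qed
  then show "\<exists>E. finite E \<and> (\<forall>p\<in>topspace circle - E. locally_modeled_at proj_geom (circle, pi0) (circle, inv_struct) (\<lambda>x. x) p)"
    using finite_imageI[OF fin] by blast
qed

lemma invariant_compatible_Pi: "invariant_compatible (\<rho> ` H) inv_struct"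
  using compatible_Pi curve_iso_H by (auto simp: invariant_compatible_def preserves_def)

text \<open>Rotations act freely on the circle, so the parameters t in (0,1) give infinitely many
  distinct points.\<close>

lemma orbit_avoids_finite:
  assumes "finite E" "p \<in> topspace circle"
  shows "\<exists>t. \<rho> (rot t) p \<notin> E"
proof -
  obtain x where x: "p = circle_proj (F x)" using assms(2) circle_lift_surj[OF F] by (metis imageE surjD topspace_circle)
  have "inj_on (\<lambda>t. \<rho> (rot t) p) {0<..<1}"
  proof (rule inj_onI)
    fix s t :: real assume st: "s \<in> {0<..<1}" "t \<in> {0<..<1}" "\<rho> (rot s) p = \<rho> (rot t) p"
    then have "circle_proj (F (x + s)) = circle_proj (F (x + t))" unfolding x by (simp add: rho_apply rot_H)
    then have "s - t \<in> \<int>" by (simp add: circle_proj_eq_iff circle_lift_Ints[OF F])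
    then show "s = t" using Ints_nonzero_abs_less1[of "s - t"] st by auto
  qed
  moreover have "infinite {0<..<1::real}" by (simp add: infinite_Ioo)
  ultimately have "infinite ((\<lambda>t. \<rho> (rot t) p) ` {0<..<1})" using finite_imageD by blast
  then have "\<not> (\<lambda>t. \<rho> (rot t) p) ` {0<..<1} \<subseteq> E" using finite_subset[OF _ assms(1)] by blast
  then show ?thesis by blast
qed

text \<open>Exceptional points are removable under equivariance: a rotation moves such a point off
  E, and the relation between f and g' brings the local form back.\<close>

lemma curve_iso_of_piecewise:
  assumes A: "is_atlas proj_geom circle A" "preserves proj_geom (\<rho> ` H) A" and A': "is_atlas proj_geom circle A'"
    and f: "homeomorphic_map circle circle f"
    and E: "finite E" "\<And>p. p \<in> topspace circle - E \<Longrightarrow> locally_modeled_at proj_geom (circle, A) (circle, A') f p"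
    and g: "\<And>t. \<exists>g'. curve_iso proj_geom (circle, A') (circle, A') g' \<and> (\<forall>y\<in>topspace circle. f y = g' (f (\<rho> (rot t) y)))"
  shows "curve_iso proj_geom (circle, A) (circle, A') f"
proof (rule proj.curve_iso_intertwining[OF A(1) A' f])
  fix p assume p: "p \<in> topspace circle"
  obtain t where t: "\<rho> (rot t) p \<notin> E" using orbit_avoids_finite[OF E(1) p] by blast
  obtain g' where g': "curve_iso proj_geom (circle, A') (circle, A') g'" "\<forall>y\<in>topspace circle. f y = g' (f (\<rho> (rot t) y))"
    using g by blast
  have iso: "curve_iso proj_geom (circle, A) (circle, A) (\<rho> (rot t))" using A(2) rot_H by (auto simp: preserves_def)
  then have "\<rho> (rot t) p \<in> topspace circle"
    using p homeomorphic_imp_surjective_map unfolding curve_iso_def fst_conv by blast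
  then have "locally_modeled_at proj_geom (circle, A) (circle, A') f (\<rho> (rot t) p)" using E(2) t by blast
  then show "\<exists>g g'. curve_iso proj_geom (circle, A) (circle, A) g \<and> curve_iso proj_geom (circle, A') (circle, A') g' \<and>
      locally_modeled_at proj_geom (circle, A) (circle, A') f (g p) \<and> (\<forall>y\<in>topspace circle. f y = g' (f (g y)))"
    using iso g' by blast
qed

lemma unique_structure:
  assumes "invariant_compatible (\<rho> ` H) \<pi>"
  shows "\<pi> = inv_struct"
proof -
  have c: "compatible \<pi>" "preserves proj_geom (\<rho> ` H) \<pi>" using assms by (auto simp: invariant_compatible_def)
  have st: "is_structure proj_geom circle \<pi>" using c(1) by (simp add: compatible_def)
  then have at: "is_atlas proj_geom circle \<pi>" by (simp add: is_structure_def)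
  \<comment> \<open>The identity as an element of \<open>PC0\<close>: group elements are
    extensional, so \<open>\<rho> (rot 0)\<close> takes its place and agrees with it on the
    circle.\<close>
  have "rot 0 \<in> H" by (rule rot_H)
  then have "\<rho> (rot 0) \<in> PC0" using PC by blast
  from compatible_piecewise[OF c(1) compatible_Pi this]
  obtain E where E: "finite E" "\<And>p. p \<in> topspace circle - E \<Longrightarrow> locally_modeled_at proj_geom (circle, \<pi>) (circle, inv_struct) (\<rho> (rot 0)) p"
    by blast
  have r0: "\<rho> (rot 0) p = p" if "p \<in> topspace circle" for p using that rho_rot_zero by (auto simp: topspace_circle)
  have "curve_iso proj_geom (circle, \<pi>) (circle, inv_struct) (\<lambda>x. x)"
  proof (rule curve_iso_of_piecewise[OF at c(2) atlas_Pi _ E(1)])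
    show "locally_modeled_at proj_geom (circle, \<pi>) (circle, inv_struct) (\<lambda>x. x) p" if "p \<in> topspace circle - E" for p
      using proj.locally_modeled_at_cong[OF r0 E(2)[OF that]] .
    show "\<exists>g'. curve_iso proj_geom (circle, inv_struct) (circle, inv_struct) g' \<and> (\<forall>y\<in>topspace circle. y = g' (\<rho> (rot t) y))" for t
    proof (intro exI[of _ "\<rho> (rot (- t))"] conjI ballI curve_iso_H rot_H)
      fix y assume "y \<in> topspace circle"
      then obtain x where "y = circle_proj x" by (auto simp: topspace_circle)
      then show "y = \<rho> (rot (- t)) (\<rho> (rot t) y)" using rho_rot_add[of "- t" t x] rho_rot_zero[of x] by simp
    qed
  qed (rule homeomorphic_circle_id)
  then show ?thesis
    using proj.structure_eqI[OF st is_structure_circle_structure[OF F D]] by (simp add: curve_iso_def)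
qed

text \<open>At one good point F is projective in the C1 coordinate of D, hence a local
  diffeomorphism. The identity F y = T s (F (y - s)), with T s the C1 map by which the rotation
  acts, carries this to every x; the inverse is treated through the same good point.\<close>

lemma F_c1:
  assumes C1: "\<And>g. g \<in> \<rho> ` H \<Longrightarrow> C1_diffeo g"
  shows "c1_at False F x" "c1_at False (inv_into UNIV F) u"
proof -
  have F': "circle_lift (inv_into UNIV F)" by (rule circle_lift_inv[OF F])
  define T where "T t u = F (inv_into UNIV F u + t)" for t u
  have T: "circle_lift (T t)" for t
    unfolding T_def using circle_lift_comp[OF F circle_lift_comp[OF circle_lift_translation F']] .
  have "circle_map (T t) = \<rho> (rot t)" for t
    unfolding T_def[abs_def] using rho_lift[OF circle_lift_translation rot_H] by simp
  then have cT: "c1_at False (T t) u" for t u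
    using C1[of "\<rho> (rot t)"] rot_H by (intro C1_map_lift[OF T]) (auto simp: C1_diffeo_def)
  obtain x1 e1 where x1: "e1 > 0" "ball x1 e1 \<inter> {x. \<not> proj_at D affine_embed F x} = {}"
    using circle_proj_finite_interval[OF fin] by blast
  have "proj_at D affine_embed F x1" using x1 by (metis (mono_tags, lifting) IntI centre_in_ball empty_iff mem_Collect_eq)
  then obtain g e2 where g: "g \<in> PGL2" "e2 > 0" "\<forall>y\<in>ball x1 e2. affine_embed (F y) = g (D y)" by (auto simp: proj_at_def)
  obtain k e \<theta> \<theta>' where dev: "k \<in> PGL2" "e > 0" "inj_on \<theta> (ball x1 e)" "continuous_on (ball x1 e) \<theta>'"
    "\<And>y. y \<in> ball x1 e \<Longrightarrow> D y = k (affine_embed (\<theta> y))"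
    "\<And>y. y \<in> ball x1 e \<Longrightarrow> (\<theta> has_real_derivative \<theta>' y) (at y)" "\<And>y. y \<in> ball x1 e \<Longrightarrow> \<theta>' y \<noteq> 0"
    "continuous_on (ball x1 e) \<theta>" by (rule developingE[OF normal_dev_developing[OF D], of x1]) blast
  have "c1_at True \<theta> x1" by (rule c1_atI[of "ball x1 e" _ \<theta>']) (use dev in auto)
  from c1_at_projective[OF this PGL2_comp[OF g(1) dev(1)], of "min e e2" F]
  have good: "c1_at True F x1" using dev(2,5) g(2,3) by simp
  show "c1_at False F x"
  proof -
    have "c1_at False (\<lambda>y. F (y + (x1 - x))) x"
      by (rule c1_at_comp[OF c1_at_translation]) (use good in \<open>simp add: c1_at_weaken\<close>)
    from c1_at_comp[OF this cT[of "x - x1"]]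
    show ?thesis using F by (simp add: T_def)
  qed
  show "c1_at False (inv_into UNIV F) u"
  proof -
    define x where "x = inv_into UNIV F u"
    have "T (x1 - x) u = F x1" using F by (simp add: T_def x_def)
    then have "c1_at False (inv_into UNIV F) (T (x1 - x) u)"
      using c1_at_inverse[OF F good] c1_at_weaken by simp
    from c1_at_comp[OF c1_at_comp[OF cT this] c1_at_translation[of _ "x - x1"]]
    show ?thesis using F by (simp add: T_def)
  qed
qed

lemma C1_compatible_Pi:
  assumes "\<And>g. g \<in> \<rho> ` H \<Longrightarrow> C1_diffeo g"
  shows "C1_compatible inv_struct"
  unfolding C1_compatible_def
  using compatible_Pi C1_mapI[OF F D circle_lift_inv[OF F] _ F_c1(2)[OF assms], of "\<lambda>x. x"] F by simp

end

section \<open>Conjugators between two actions\<close>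

lemma self_inverse_conjugator:
  assumes F: "circle_lift F1" "circle_lift F2" and L: "L = (\<lambda>x. x) \<or> L = uminus"
  shows "circle_lift (\<lambda>x. F2 (L (inv_into UNIV F1 x)))"
    "inv\<^bsub>homeo_group\<^esub> (circle_map (\<lambda>x. F2 (L (inv_into UNIV F1 x)))) = circle_map (\<lambda>x. F1 (L (inv_into UNIV F2 x)))"
    "inv_into UNIV (\<lambda>x. F2 (L (inv_into UNIV F1 x))) = (\<lambda>x. F1 (L (inv_into UNIV F2 x)))"
proof -
  have L': "circle_lift L" "L (L x) = x" for x using L by auto
  show 1: "circle_lift (\<lambda>x. F2 (L (inv_into UNIV F1 x)))"
    using circle_lift_comp[OF F(2) circle_lift_comp[OF L'(1) circle_lift_inv[OF F(1)]]] .
  show 3: "inv_into UNIV (\<lambda>x. F2 (L (inv_into UNIV F1 x))) = (\<lambda>x. F1 (L (inv_into UNIV F2 x)))"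
  proof
    fix x
    have "(\<lambda>x. F2 (L (inv_into UNIV F1 x))) (F1 (L (inv_into UNIV F2 x))) = x" using F L' by simp
    then show "inv_into UNIV (\<lambda>x. F2 (L (inv_into UNIV F1 x))) x = F1 (L (inv_into UNIV F2 x))"
      using circle_lift_inv_f(1)[OF 1, of "F1 (L (inv_into UNIV F2 x))"] by simp
  qed
  show "inv\<^bsub>homeo_group\<^esub> (circle_map (\<lambda>x. F2 (L (inv_into UNIV F1 x)))) = circle_map (\<lambda>x. F1 (L (inv_into UNIV F2 x)))"
    using circle_map_inv[OF 1] unfolding 3 .
qed

locale uniformized_pair = u1: uniformized_action H \<rho>1 F1 D1 + u2: uniformized_action H \<rho>2 F2 D2
  for H \<rho>1 \<rho>2 F1 F2 D1 D2
begin

text \<open>Compatibility makes f piecewise projective between the two invariant structures.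
  Conjugation by f carries rotations of the first action to automorphisms of the second structure,
  so the exceptional points are removable.\<close>

lemma conjugate_imp_isomorphic:
  assumes "conjugate_subsets PC0 (\<rho>1 ` H) (\<rho>2 ` H)"
  shows "isomorphic_curves (circle, u1.inv_struct) (circle, u2.inv_struct)"
proof -
  obtain f where f: "f \<in> PC0" and eq: "\<rho>2 ` H = (\<lambda>g. f \<otimes>\<^bsub>homeo_group\<^esub> g \<otimes>\<^bsub>homeo_group\<^esub> inv\<^bsub>homeo_group\<^esub> f) ` \<rho>1 ` H"
    using assms by (auto simp: conjugate_subsets_def)
  have fc: "f \<in> carrier homeo_group" using f by (simp add: PC0_def)
  obtain E where E: "finite E" "\<And>p. p \<in> topspace circle - E \<Longrightarrow> locally_modeled_at proj_geom (circle, u1.inv_struct) (circle, u2.inv_struct) f p"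
    using compatible_piecewise[OF u1.compatible_Pi u2.compatible_Pi f] by blast
  have pres: "preserves proj_geom (\<rho>1 ` H) u1.inv_struct" using u1.invariant_compatible_Pi by (simp add: invariant_compatible_def)
  have "curve_iso proj_geom (circle, u1.inv_struct) (circle, u2.inv_struct) f"
  proof (rule u1.curve_iso_of_piecewise[OF u1.atlas_Pi pres u2.atlas_Pi homeomorphic_map_carrier[OF fc] E])
    fix t
    \<comment> \<open>The inverse rotation transported by f: it lies in the second image and undoes
      \<open>\<rho>1 (rot t)\<close> after f.\<close>
    let ?g = "f \<otimes>\<^bsub>homeo_group\<^esub> \<rho>1 (rot (- t)) \<otimes>\<^bsub>homeo_group\<^esub> inv\<^bsub>homeo_group\<^esub> f"
    have "?g \<in> \<rho>2 ` H" unfolding eq by (intro imageI u1.rot_H)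
    then have "curve_iso proj_geom (circle, u2.inv_struct) (circle, u2.inv_struct) ?g"
      by (rule imageE) (simp only: u2.curve_iso_H)
    moreover have "f y = ?g (f (\<rho>1 (rot t) y))" if y: "y \<in> topspace circle" for y
    proof -
      obtain x where x: "y = circle_proj x" using y by (auto simp: topspace_circle)
      obtain z where z: "\<rho>1 (rot t) (circle_proj x) = circle_proj z"
        using homeo_carrierE(1)[OF u1.rho_carrier[OF u1.rot_H]] by blast
      obtain w where w: "f (circle_proj z) = circle_proj w" using homeo_carrierE(1)[OF fc] by blast
      have c: "\<rho>1 (rot (- t)) \<in> carrier homeo_group" by (rule u1.rho_carrier[OF u1.rot_H])
      obtain v where v: "(inv\<^bsub>homeo_group\<^esub> f) (circle_proj w) = circle_proj v"
        using homeo_carrierE(1)[OF homeo.inv_closed[OF fc]] by blast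
      have "?g (circle_proj w) = f (\<rho>1 (rot (- t)) ((inv\<^bsub>homeo_group\<^esub> f) (circle_proj w)))"
        using homeo_mult_apply[OF homeo.m_closed[OF fc c] homeo.inv_closed[OF fc], of w] homeo_mult_apply[OF fc c, of v] v by simp
      also have "(inv\<^bsub>homeo_group\<^esub> f) (circle_proj w) = circle_proj z" unfolding w[symmetric] by (rule homeo_inv_apply[OF fc])
      also have "\<rho>1 (rot (- t)) (circle_proj z) = circle_proj x"
        using u1.rho_rot_add[of "- t" t x] u1.rho_rot_zero[of x] z by simp
      finally show ?thesis by (simp add: x z w)
    qed
    ultimately show "\<exists>g'. curve_iso proj_geom (circle, u2.inv_struct) (circle, u2.inv_struct) g' \<and> (\<forall>y\<in>topspace circle. f y = g' (f (\<rho>1 (rot t) y)))"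
      by blast
  qed
  then show ?thesis by (auto simp: isomorphic_curves_def)
qed

lemma conjugator_PC0:
  assumes eq: "D1 = D2" and L: "L = (\<lambda>x. x) \<or> L = uminus"
  shows "circle_map (\<lambda>x. F2 (L (inv_into UNIV F1 x))) \<in> PC0"
  using curve_iso_circle_structureI[OF u1.F u2.F u1.D L] self_inverse_conjugator(1)[OF u1.F u2.F L] eq
  by (intro compatible_iso_PC0[OF u1.compatible_Pi u2.compatible_Pi]) auto

text \<open>In the parameters both actions are the standard one, so the conjugator replaces M by its
  conjugate under L. With the identity for L this matches the actions; with \<open>uminus\<close> it
  matches the images and twists the action by the reflection.\<close>

lemma conjugator_conjugates:
  assumes L: "L = (\<lambda>x. x) \<or> L = uminus" and M: "circle_lift M" "circle_map M \<in> H" "circle_map (\<lambda>x. L (M (L x))) \<in> H"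
  shows "circle_map (\<lambda>x. F2 (L (inv_into UNIV F1 x))) \<otimes>\<^bsub>homeo_group\<^esub> \<rho>1 (circle_map M) \<otimes>\<^bsub>homeo_group\<^esub>
      inv\<^bsub>homeo_group\<^esub> (circle_map (\<lambda>x. F2 (L (inv_into UNIV F1 x)))) = \<rho>2 (circle_map (\<lambda>x. L (M (L x))))"
proof -
  have L': "circle_lift L" using L by auto
  have LML: "circle_lift (\<lambda>x. L (M (L x)))" using circle_lift_comp[OF L' circle_lift_comp[OF M(1) L']] .
  have lifts: "circle_lift (\<lambda>x. F2 (L (inv_into UNIV F1 x)))" "circle_lift (\<lambda>x. F1 (L (inv_into UNIV F2 x)))"
    using self_inverse_conjugator(1) u1.F u2.F L by auto
  have l1: "circle_lift (\<lambda>x. F1 (M (inv_into UNIV F1 x)))"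
    using circle_lift_comp[OF u1.F circle_lift_comp[OF M(1) circle_lift_inv[OF u1.F]]] .
  show ?thesis
    unfolding u1.rho_lift[OF M(1,2)] u2.rho_lift[OF LML M(3)] self_inverse_conjugator(2)[OF u1.F u2.F L]
    using circle_lift_comp[OF lifts(1) l1] by (simp add: circle_map_mult lifts l1 u1.F)
qed

lemma reflect_H:
  assumes "h \<in> H" and L: "L = (\<lambda>x. x) \<or> L = uminus"
  shows "\<exists>M. circle_lift M \<and> h = circle_map M \<and> circle_map (\<lambda>x. L (M (L x))) \<in> H"
  using \<open>h \<in> H\<close>
proof (cases rule: u1.H_cases)
  case (rot t)
  have "circle_map (\<lambda>x. L (L x + t)) \<in> H" using L u1.rot_H[of t] u1.rot_H[of "- t"] by auto
  then show ?thesis using rot by (intro exI[of _ "\<lambda>x. x + t"]) auto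
next
  case (reflection t)
  have "circle_map (\<lambda>x. s - x) \<in> H" for s using reflection(2) isometries_eq by blast
  from this[of t] this[of "- t"] have "circle_map (\<lambda>x. L (t - L x)) \<in> H" using L by auto
  then show ?thesis using reflection by (intro exI[of _ "\<lambda>x. t - x"]) auto
qed

lemma conjugator_image:
  assumes L: "L = (\<lambda>x. x) \<or> L = uminus"
  defines "f \<equiv> circle_map (\<lambda>x. F2 (L (inv_into UNIV F1 x)))"
  shows "\<rho>2 ` H = (\<lambda>g. f \<otimes>\<^bsub>homeo_group\<^esub> g \<otimes>\<^bsub>homeo_group\<^esub> inv\<^bsub>homeo_group\<^esub> f) ` \<rho>1 ` H"
proof (rule antisym; rule subsetI)
  fix k assume "k \<in> \<rho>2 ` H"
  then obtain h where h: "h \<in> H" "k = \<rho>2 h" by blast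
  obtain M where M: "circle_lift M" "h = circle_map M" "circle_map (\<lambda>x. L (M (L x))) \<in> H" using reflect_H[OF h(1) L] by blast
  have LL: "L (L x) = x" "circle_lift L" for x using L by auto
  have LML: "circle_lift (\<lambda>x. L (M (L x)))" using circle_lift_comp[OF LL(2) circle_lift_comp[OF M(1) LL(2)]] .
  have e: "(\<lambda>x. L (L (M (L (L x))))) = M" using LL by simp
  have "f \<otimes>\<^bsub>homeo_group\<^esub> \<rho>1 (circle_map (\<lambda>x. L (M (L x)))) \<otimes>\<^bsub>homeo_group\<^esub> inv\<^bsub>homeo_group\<^esub> f = k"
    using conjugator_conjugates[OF L LML M(3)] h M(2) unfolding e f_def by simp
  then show "k \<in> (\<lambda>g. f \<otimes>\<^bsub>homeo_group\<^esub> g \<otimes>\<^bsub>homeo_group\<^esub> inv\<^bsub>homeo_group\<^esub> f) ` \<rho>1 ` H" using M(3) by blast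
next
  fix k assume "k \<in> (\<lambda>g. f \<otimes>\<^bsub>homeo_group\<^esub> g \<otimes>\<^bsub>homeo_group\<^esub> inv\<^bsub>homeo_group\<^esub> f) ` \<rho>1 ` H"
  then obtain h where h: "h \<in> H" "k = f \<otimes>\<^bsub>homeo_group\<^esub> \<rho>1 h \<otimes>\<^bsub>homeo_group\<^esub> inv\<^bsub>homeo_group\<^esub> f" by blast
  obtain M where M: "circle_lift M" "h = circle_map M" "circle_map (\<lambda>x. L (M (L x))) \<in> H" using reflect_H[OF h(1) L] by blast
  have "k = \<rho>2 (circle_map (\<lambda>x. L (M (L x))))"
    using conjugator_conjugates[OF L M(1) _ M(3)] h M(2) unfolding f_def by simp
  then show "k \<in> \<rho>2 ` H" using M(3) by blast
qed

text \<open>\<open>uminus\<close> is taken when one of F1 and F2 is increasing and the other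
  decreasing, the identity when they have the same direction.\<close>

lemma oriented_conjugator: "\<exists>L. (L = (\<lambda>x. x) \<or> L = uminus) \<and> strict_mono (\<lambda>x. F2 (L (inv_into UNIV F1 x)))"
proof -
  have *: "strict_mono G \<or> (\<forall>x y. x < y \<longrightarrow> G y < G x)" if "circle_lift G" for G
    using circle_lift_mono[OF that] unfolding strict_mono_def by (metis minus_minus neg_less_iff_less)
  from *[OF u2.F] *[OF circle_lift_inv[OF u1.F]]
  consider "strict_mono F2" "strict_mono (inv_into UNIV F1)"
    | "\<forall>x y. x < y \<longrightarrow> F2 y < F2 x" "\<forall>x y. x < y \<longrightarrow> inv_into UNIV F1 y < inv_into UNIV F1 x"
    | "strict_mono F2" "\<forall>x y. x < y \<longrightarrow> inv_into UNIV F1 y < inv_into UNIV F1 x"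
    | "\<forall>x y. x < y \<longrightarrow> F2 y < F2 x" "strict_mono (inv_into UNIV F1)" by blast
  then show ?thesis
  proof cases
    case 1 then show ?thesis by (intro exI[of _ "\<lambda>x. x"]) (simp add: strict_mono_def)
  next
    case 2 then show ?thesis by (intro exI[of _ "\<lambda>x. x"]) (simp add: strict_mono_def)
  next
    case 3 then show ?thesis by (intro exI[of _ uminus]) (simp add: strict_mono_def)
  next
    case 4 then show ?thesis by (intro exI[of _ uminus]) (simp add: strict_mono_def)
  qed
qed

text \<open>By \<open>F_c1\<close> the maps F1 and F2 and their inverses are C1, and the inverse of
  the conjugator is built from them in the same way.\<close>

lemma conjugator_PC1:
  assumes eq: "D1 = D2" and L: "L = (\<lambda>x. x) \<or> L = uminus" and P1: "\<rho>1 ` H \<subseteq> PC1" "\<rho>2 ` H \<subseteq> PC1"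
  shows "circle_map (\<lambda>x. F2 (L (inv_into UNIV F1 x))) \<in> PC1"
proof -
  have c: "C1_diffeo g" if "g \<in> \<rho>1 ` H \<or> g \<in> \<rho>2 ` H" for g using that P1 by (auto simp: PC1_def)
  have cL: "c1_at False L x" for x using L c1_at_uminus c1_at_translation[of _ 0] by auto
  have k1: "c1_at False F1 x" "c1_at False (inv_into UNIV F1) x" for x using u1.F_c1(1)[of x] u1.F_c1(2)[of x] c by auto
  have k2: "c1_at False F2 x" "c1_at False (inv_into UNIV F2) x" for x using u2.F_c1(1)[of x] u2.F_c1(2)[of x] c by auto
  have "c1_at False (\<lambda>x. F2 (L (inv_into UNIV F1 x))) x" for x
    using c1_at_comp[OF c1_at_comp[OF k1(2) cL] k2(1)] .
  moreover have "c1_at False (\<lambda>x. F1 (L (inv_into UNIV F2 x))) x" for x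
    using c1_at_comp[OF c1_at_comp[OF k2(2) cL] k1(1)] .
  ultimately have "C1_diffeo (circle_map (\<lambda>x. F2 (L (inv_into UNIV F1 x))))"
    using self_inverse_conjugator[OF u1.F u2.F L] by (intro C1_diffeoI) auto
  then show ?thesis using conjugator_PC0[OF eq L] by (simp add: PC1_def)
qed

lemma isomorphic_iff: "isomorphic_curves (circle, u1.inv_struct) (circle, u2.inv_struct) \<longleftrightarrow> D1 = D2"
  by (rule isomorphic_circle_structure_iff[OF u1.F u2.F u1.D u2.D])

lemma conjugate_actions_imp_subsets: "conjugate_actions P H \<rho>1 \<rho>2 \<Longrightarrow> conjugate_subsets P (\<rho>1 ` H) (\<rho>2 ` H)"
  unfolding conjugate_actions_def conjugate_subsets_def by (force simp: image_image)

lemma conjugate_subsets_mono: "conjugate_subsets P A B \<Longrightarrow> P \<subseteq> P' \<Longrightarrow> conjugate_subsets P' A B"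
  unfolding conjugate_subsets_def by blast

text \<open>One argument serves \<open>PC0\<close> and \<open>PC1\<close>: a conjugation in P is one
  in \<open>PC0\<close> and gives an isomorphism, and conversely P contains the conjugators. The
  oriented statement concerns images, since correcting the orientation may twist the action.\<close>

lemma conjugacy_iff:
  assumes P: "P \<subseteq> PC0" "\<And>L. L = (\<lambda>x. x) \<or> L = uminus \<Longrightarrow> D1 = D2 \<Longrightarrow> circle_map (\<lambda>x. F2 (L (inv_into UNIV F1 x))) \<in> P"
  shows "conjugate_subsets P (\<rho>1 ` H) (\<rho>2 ` H) \<longleftrightarrow> isomorphic_curves (circle, u1.inv_struct) (circle, u2.inv_struct)"
    "conjugate_subsets {f \<in> P. orientation_preserving f} (\<rho>1 ` H) (\<rho>2 ` H) \<longleftrightarrow> isomorphic_curves (circle, u1.inv_struct) (circle, u2.inv_struct)"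
    "conjugate_actions P H \<rho>1 \<rho>2 \<longleftrightarrow> isomorphic_curves (circle, u1.inv_struct) (circle, u2.inv_struct)"
proof -
  have fwd: "isomorphic_curves (circle, u1.inv_struct) (circle, u2.inv_struct)" if "conjugate_subsets Q (\<rho>1 ` H) (\<rho>2 ` H)" "Q \<subseteq> P" for Q
    using conjugate_imp_isomorphic conjugate_subsets_mono[OF that(1)] that(2) P(1) by blast
  have act: "conjugate_actions P H \<rho>1 \<rho>2" if eq: "D1 = D2"
    unfolding conjugate_actions_def
  proof (intro bexI[of _ "circle_map (\<lambda>x. F2 ((\<lambda>x. x) (inv_into UNIV F1 x)))"] ballI P(2) eq)
    fix h assume h: "h \<in> H"
    have L: "(\<lambda>x. x) = (\<lambda>x::real. x) \<or> (\<lambda>x::real. x) = uminus" by simp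
    obtain M where "circle_lift M" "h = circle_map M" using reflect_H[OF h L] by blast
    then show "\<rho>2 h = circle_map (\<lambda>x. F2 ((\<lambda>x. x) (inv_into UNIV F1 x))) \<otimes>\<^bsub>homeo_group\<^esub> \<rho>1 h \<otimes>\<^bsub>homeo_group\<^esub>
        inv\<^bsub>homeo_group\<^esub> (circle_map (\<lambda>x. F2 ((\<lambda>x. x) (inv_into UNIV F1 x))))"
      using conjugator_conjugates[OF L] h by simp
  qed simp
  have plus: "conjugate_subsets {f \<in> P. orientation_preserving f} (\<rho>1 ` H) (\<rho>2 ` H)" if eq: "D1 = D2"
  proof -
    obtain L where L: "L = (\<lambda>x. x) \<or> L = uminus" "strict_mono (\<lambda>x. F2 (L (inv_into UNIV F1 x)))" using oriented_conjugator by blast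
    have "orientation_preserving (circle_map (\<lambda>x. F2 (L (inv_into UNIV F1 x))))"
      using orientation_preserving_circle_map[OF self_inverse_conjugator(1)[OF u1.F u2.F L(1)]] L(2) by simp
    then show ?thesis unfolding conjugate_subsets_def using P(2)[OF L(1) eq] conjugator_image[OF L(1)] by blast
  qed
  show "conjugate_subsets {f \<in> P. orientation_preserving f} (\<rho>1 ` H) (\<rho>2 ` H) \<longleftrightarrow> isomorphic_curves (circle, u1.inv_struct) (circle, u2.inv_struct)"
    using fwd[of "{f \<in> P. orientation_preserving f}"] plus isomorphic_iff by blast
  show "conjugate_subsets P (\<rho>1 ` H) (\<rho>2 ` H) \<longleftrightarrow> isomorphic_curves (circle, u1.inv_struct) (circle, u2.inv_struct)"
    using fwd[of P] act conjugate_actions_imp_subsets isomorphic_iff by blast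
  show "conjugate_actions P H \<rho>1 \<rho>2 \<longleftrightarrow> isomorphic_curves (circle, u1.inv_struct) (circle, u2.inv_struct)"
    using fwd[of P] act conjugate_actions_imp_subsets isomorphic_iff by blast
qed

end

section \<open>Invariant affine structures\<close>

lemma affine_geom_sel: "fst affine_geom = euclideanreal" "g \<in> snd affine_geom \<longleftrightarrow> (\<exists>a b. a \<noteq> 0 \<and> g = (\<lambda>x. a * x + b))"
  by (auto simp: affine_geom_def)

lemma affine_geomI: "a \<noteq> 0 \<Longrightarrow> (\<And>x. g x = a * x + b) \<Longrightarrow> g \<in> snd affine_geom"
  by (auto simp: affine_geom_sel fun_eq_iff)

lemma geometry_group_affine: "geometry_group affine_geom"
proof
  show "(\<lambda>x. x) \<in> snd affine_geom" by (rule affine_geomI[of 1 _ 0]) auto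
next
  fix g h assume "g \<in> snd affine_geom" "h \<in> snd affine_geom"
  then obtain a b c d where "g = (\<lambda>x. a * x + b)" "a \<noteq> 0" "h = (\<lambda>x. c * x + d)" "c \<noteq> 0"
    by (auto simp: affine_geom_sel)
  then show "(\<lambda>x. g (h x)) \<in> snd affine_geom"
    by (intro affine_geomI[of "a * c" _ "a * d + b"]) (auto simp: algebra_simps)
next
  fix g assume "g \<in> snd affine_geom"
  then obtain a b where g: "g = (\<lambda>x. a * x + b)" "a \<noteq> 0" by (auto simp: affine_geom_sel)
  have "(\<lambda>x. (1 / a) * x + (- b / a)) \<in> snd affine_geom" using g(2) by (intro affine_geomI[of "1 / a" _ "- b / a"]) auto
  then show "\<exists>h\<in>snd affine_geom. (\<forall>x. h (g x) = x) \<and> (\<forall>x. g (h x) = x)"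
    using g by (intro bexI[of _ "\<lambda>x. (1 / a) * x + (- b / a)"]) (auto simp: field_simps)
qed

interpretation aff: geometry_group affine_geom by (rule geometry_group_affine)

text \<open>Affine maps act on the projective line and fix the point at infinity; this common fixed
  point later obstructs the elliptic type.\<close>

lemma affine_map_embed:
  assumes "a \<noteq> 0"
  shows "mob (mat2 a b 0 1) \<in> PGL2" "affine_embed (a * x + b) = mob (mat2 a b 0 1) (affine_embed x)"
    "mob (mat2 a b 0 1) point_at_infinity = point_at_infinity"
proof -
  show "mob (mat2 a b 0 1) \<in> PGL2" using assms by (intro mob_in_PGL2) (simp add: invertible_mat2)
  show "affine_embed (a * x + b) = mob (mat2 a b 0 1) (affine_embed x)" by (simp add: mob_affine_embed)
  have "mob (mat2 a b 0 1) point_at_infinity = span {vector [a, 0]}"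
    by (simp add: point_at_infinity_def mob_span mat2_mult_vector)
  then show "mob (mat2 a b 0 1) point_at_infinity = point_at_infinity" using assms by (simp add: span_vector_infinity)
qed

definition proj_charts :: "('a, real) chart set \<Rightarrow> ('a, p1) chart set" where
  "proj_charts \<alpha> = {(U, restrict (\<lambda>y. affine_embed (\<phi> y)) U) | U \<phi>. (U, \<phi>) \<in> \<alpha>}"

lemma proj_of_affine_eq: "proj_of_affine T \<alpha> = structure_of proj_geom T (proj_charts \<alpha>)"
  by (simp add: proj_of_affine_def proj_charts_def)

lemma is_chart_proj_of_affine:
  assumes c: "is_chart affine_geom T (U, \<phi>)"
  shows "is_chart proj_geom T (U, restrict (\<lambda>y. affine_embed (\<phi> y)) U)"
proof -
  have op: "openin T U" "open (\<phi> ` U)"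
    and h: "homeomorphic_map (subtopology T U) (top_of_set (\<phi> ` U)) \<phi>"
    and r: "top_of_set (\<phi> ` U) homeomorphic_space euclideanreal"
    using c by (auto simp: is_chart_def open_interval_in_def affine_geom_sel)
  have im: "restrict (\<lambda>y. affine_embed (\<phi> y)) U ` U = affine_embed ` \<phi> ` U" by (simp add: image_image)
  have gh: "homeomorphic_map (top_of_set (\<phi> ` U)) (subtopology proj_line (affine_embed ` \<phi> ` U)) affine_embed"
  proof (rule bijective_open_imp_homeomorphic_map)
    show "continuous_map (top_of_set (\<phi> ` U)) (subtopology proj_line (affine_embed ` \<phi> ` U)) affine_embed"
      using continuous_map_from_subtopology[OF continuous_affine_embed] by (auto simp: continuous_map_in_subtopology)
    show "open_map (top_of_set (\<phi> ` U)) (subtopology proj_line (affine_embed ` \<phi> ` U)) affine_embed"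
      unfolding open_map_def openin_open_eq[OF op(2)]
      by (auto simp: openin_open_subtopology[OF open_affine_embed[OF op(2)]] intro!: open_affine_embed)
    show "affine_embed ` topspace (top_of_set (\<phi> ` U)) = topspace (subtopology proj_line (affine_embed ` \<phi> ` U))"
      using openin_subset[OF open_affine_embed[OF op(2)]] by auto
  qed (simp add: inj_on_def)
  have "homeomorphic_map (subtopology T U) (subtopology proj_line (affine_embed ` \<phi> ` U)) (restrict (\<lambda>y. affine_embed (\<phi> y)) U)"
    using homeomorphic_map_compose[OF h gh] by (rule homeomorphic_map_eq) auto
  moreover have "open_interval_in proj_line (affine_embed ` \<phi> ` U)"
    unfolding open_interval_in_def using open_affine_embed[OF op(2)] r
      homeomorphic_space_trans[OF homeomorphic_space_sym[THEN iffD1, OF homeomorphic_map_imp_homeomorphic_space[OF gh]]] by blast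
  ultimately show ?thesis using op unfolding is_chart_def by (simp only: prod.case im proj_geom_sel) simp
qed

lemma is_atlas_proj_charts:
  assumes A: "is_atlas affine_geom T \<alpha>"
  shows "is_atlas proj_geom T (proj_charts \<alpha>)"
  unfolding is_atlas_def
proof (intro conjI ballI)
  fix c assume "c \<in> proj_charts \<alpha>"
  then show "is_chart proj_geom T c" using A is_chart_proj_of_affine by (auto simp: proj_charts_def is_atlas_def)
next
  have "fst ` proj_charts \<alpha> = fst ` \<alpha>" unfolding proj_charts_def by force
  then show "\<Union> (fst ` proj_charts \<alpha>) = topspace T" using A by (simp add: is_atlas_def)
next
  fix c c' assume "c \<in> proj_charts \<alpha>" "c' \<in> proj_charts \<alpha>"
  then obtain U \<phi> V \<psi> where c: "c = (U, restrict (\<lambda>y. affine_embed (\<phi> y)) U)" "(U, \<phi>) \<in> \<alpha>"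
    "c' = (V, restrict (\<lambda>y. affine_embed (\<psi> y)) V)" "(V, \<psi>) \<in> \<alpha>" by (auto simp: proj_charts_def)
  show "chart_change proj_geom T c c'"
    unfolding chart_change_iff
  proof
    fix x assume "x \<in> fst c \<inter> fst c'"
    then have "change_at affine_geom T (U, \<phi>) (V, \<psi>) x" by (intro atlas_change_at[OF A]) (auto simp: c)
    then obtain W g where W: "openin T W" "x \<in> W" "W \<subseteq> U" "W \<subseteq> V" "g \<in> snd affine_geom" "\<And>y. y \<in> W \<Longrightarrow> \<psi> y = g (\<phi> y)"
      by (rule change_atE) simp
    obtain a b where ab: "a \<noteq> 0" "g = (\<lambda>x. a * x + b)" using W(5) by (auto simp: affine_geom_sel)
    show "change_at proj_geom T c c' x"
      by (rule change_atI[OF W(1,2), of _ _ "mob (mat2 a b 0 1)"])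
        (use W affine_map_embed[OF ab(1)] in \<open>auto simp: c ab(2) subset_iff\<close>)
  qed
qed

lemma is_structure_proj_of_affine: "is_atlas affine_geom T \<alpha> \<Longrightarrow> is_structure proj_geom T (proj_of_affine T \<alpha>)"
  unfolding proj_of_affine_eq by (rule proj.is_structure_structure_of[OF is_atlas_proj_charts])

lemma proj_of_affine_mem:
  "is_atlas affine_geom T \<alpha> \<Longrightarrow> (U, \<phi>) \<in> \<alpha> \<Longrightarrow> (U, restrict (\<lambda>y. affine_embed (\<phi> y)) U) \<in> proj_of_affine T \<alpha>"
  using proj.atlas_subset_structure_of[OF is_atlas_proj_charts, of T \<alpha>] unfolding proj_of_affine_eq proj_charts_def by blast

lemma curve_iso_proj_of_affine:
  assumes A: "is_atlas affine_geom T \<alpha>" and g: "curve_iso affine_geom (T, \<alpha>) (T, \<alpha>) g"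
  shows "curve_iso proj_geom (T, proj_of_affine T \<alpha>) (T, proj_of_affine T \<alpha>) g"
  unfolding curve_iso_def fst_conv
proof (intro conjI ballI)
  show "homeomorphic_map T T g" using g by (simp add: curve_iso_def)
  fix x assume "x \<in> topspace T"
  then have "locally_modeled_at affine_geom (T, \<alpha>) (T, \<alpha>) g x" using g by (simp add: curve_iso_def)
  then obtain U \<phi> V \<psi> W m where W: "(U, \<phi>) \<in> \<alpha>" "(V, \<psi>) \<in> \<alpha>" "openin T W" "x \<in> W" "W \<subseteq> U" "g ` W \<subseteq> V"
    "m \<in> snd affine_geom" "\<And>y. y \<in> W \<Longrightarrow> \<psi> (g y) = m (\<phi> y)" by (rule locally_modeled_atE) blast
  obtain a b where ab: "a \<noteq> 0" "m = (\<lambda>x. a * x + b)" using W(7) by (auto simp: affine_geom_sel)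
  have Wg: "g y \<in> V" "y \<in> U" if "y \<in> W" for y using that W(5,6) by auto
  show "locally_modeled_at proj_geom (T, proj_of_affine T \<alpha>) (T, proj_of_affine T \<alpha>) g x"
    by (rule locally_modeled_atI[OF proj_of_affine_mem[OF A W(1)] proj_of_affine_mem[OF A W(2)] W(3-6), of "mob (mat2 a b 0 1)"])
      (use affine_map_embed[OF ab(1)] Wg W(8) in \<open>simp_all add: ab(2)\<close>)
qed

context uniformized_action
begin

text \<open>By uniqueness the projective structure of \<alpha> is the invariant one, so near F 0 an
  affine chart is g composed with D. In it the elements considered act affinely and fix infinity,
  whose preimage under g is Q. The bound e keeps the image of the base point in the same
  chart.\<close>

lemma affine_fixed_point:
  assumes "preserves_affine_structure (\<rho> ` H)"
  obtains Q e where "Q \<in> topspace proj_line" "e > 0"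
    "\<And>L t A. L = uminus \<or> L = (\<lambda>x. x + t) \<Longrightarrow> \<bar>t\<bar> < e \<Longrightarrow> circle_map L \<in> H \<Longrightarrow> A \<in> PGL2 \<Longrightarrow>
       (\<And>y. D (L y) = A (D y)) \<Longrightarrow> A Q = Q"
proof -
  obtain \<alpha> where \<alpha>: "is_structure affine_geom circle \<alpha>" "compatible (proj_of_affine circle \<alpha>)" "preserves affine_geom (\<rho> ` H) \<alpha>"
    using assms by (auto simp: preserves_affine_structure_def)
  have at: "is_atlas affine_geom circle \<alpha>" using \<alpha>(1) by (simp add: is_structure_def)
  have "invariant_compatible (\<rho> ` H) (proj_of_affine circle \<alpha>)"
    using \<alpha>(2,3) curve_iso_proj_of_affine[OF at] by (auto simp: invariant_compatible_def preserves_def)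
  then have eq: "proj_of_affine circle \<alpha> = inv_struct" by (rule unique_structure)
  have "circle_proj (F 0) \<in> topspace circle" by (simp add: topspace_circle)
  then obtain U \<phi> where U: "(U, \<phi>) \<in> \<alpha>" "circle_proj (F 0) \<in> U" by (rule aff.atlas_chart_at[OF at])
  have "(U, restrict (\<lambda>y. affine_embed (\<phi> y)) U) \<in> inv_struct" using proj_of_affine_mem[OF at U(1)] eq by simp
  then obtain g e where g: "g \<in> PGL2" "e > 0" "\<And>y. y \<in> ball 0 e \<Longrightarrow> circle_proj (F y) \<in> U"
    "\<And>y. y \<in> ball 0 e \<Longrightarrow> restrict (\<lambda>y. affine_embed (\<phi> y)) U (circle_proj (F y)) = g (D y)"
    using circle_structure_chart_at[OF F D _ U(2)] by blast
  define u where "u y = \<phi> (circle_proj (F y))" for y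
  have u: "affine_embed (u y) = g (D y)" if "y \<in> ball 0 e" for y using g(3,4)[OF that] by (simp add: u_def)
  obtain g' where g': "g' \<in> PGL2" "\<forall>p. g' (g p) = p" "\<forall>p. g (g' p) = p" using PGL2_inv[OF g(1)] by blast
  have inf: "point_at_infinity \<in> topspace proj_line" by (simp add: topspace_proj_line_eq)
  show ?thesis
  proof (rule that[of "g' point_at_infinity" e])
    show Q: "g' point_at_infinity \<in> topspace proj_line" by (rule PGL2_topspace[OF g'(1) inf])
    show "e > 0" by (rule g(2))
    fix L t A assume L: "L = uminus \<or> L = (\<lambda>x. x + t)" "\<bar>t\<bar> < e" "circle_map L \<in> H"
      and A: "A \<in> PGL2" "\<And>y. D (L y) = A (D y)"
    have lift: "circle_lift L" using L(1) by auto
    have L0: "L 0 \<in> ball 0 e" using L(1,2) g(2) by auto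
    let ?r = "\<rho> (circle_map L)"
    have iso: "curve_iso affine_geom (circle, \<alpha>) (circle, \<alpha>) ?r" using \<alpha>(3) L(3) by (auto simp: preserves_def)
    have "continuous_map circle circle ?r" "locally_modeled_at affine_geom (circle, \<alpha>) (circle, \<alpha>) ?r (circle_proj (F 0))"
      using iso by (auto simp: curve_iso_def homeomorphic_imp_continuous_map topspace_circle)
    moreover have "?r (circle_proj (F 0)) \<in> U" using g(3)[OF L0] by (simp add: rho_apply[OF lift L(3)])
    ultimately obtain W m where W: "openin circle W" "circle_proj (F 0) \<in> W" "W \<subseteq> U" "?r ` W \<subseteq> U" "m \<in> snd affine_geom"
      "\<And>y. y \<in> W \<Longrightarrow> \<phi> (?r y) = m (\<phi> y)"
      using aff.locally_modeled_at_any_chart[OF at at _ _ U U(1)] by blast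
    obtain a b where ab: "a \<noteq> 0" "m = (\<lambda>x. a * x + b)" using W(5) by (auto simp: affine_geom_sel)
    have "open {y. circle_proj y \<in> W}" using openin_continuous_map_preimage[OF continuous_circle_proj W(1)] by simp
    from open_vimage[OF this circle_lift_continuous[OF F]] open_vimage[OF open_ball circle_lift_continuous[OF lift], of 0 e]
    have "open (F -` {y. circle_proj y \<in> W} \<inter> L -` ball 0 e \<inter> ball 0 e)" by auto
    moreover have "0 \<in> F -` {y. circle_proj y \<in> W} \<inter> L -` ball 0 e \<inter> ball 0 e" using W(2) L0 g(2) by simp
    ultimately obtain e3 where e3: "e3 > 0" "ball 0 e3 \<subseteq> F -` {y. circle_proj y \<in> W} \<inter> L -` ball 0 e \<inter> ball 0 e"
      using open_contains_ball by blast
    let ?M = "mob (mat2 a b 0 1)"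
    have "g (A (D y)) = ?M (g (D y))" if "y \<in> ball 0 e3" for y
    proof -
      have y: "circle_proj (F y) \<in> W" "L y \<in> ball 0 e" "y \<in> ball 0 e" using that e3(2) by auto
      have "u (L y) = a * u y + b" using W(6)[OF y(1)] by (simp add: u_def ab(2) rho_apply[OF lift L(3)])
      then show ?thesis using u[OF y(2)] u[OF y(3)] affine_map_embed(2)[OF ab(1)] A(2)[of y] by metis
    qed
    from PGL2_eq_on_developing[OF normal_dev_developing[OF D] PGL2_comp[OF g(1) A(1)] PGL2_comp[OF affine_map_embed(1)[OF ab(1)] g(1)] e3(1) _ Q, of 0] this
    have "g (A (g' point_at_infinity)) = ?M (g (g' point_at_infinity))" by simp
    then have "g (A (g' point_at_infinity)) = point_at_infinity" using g'(3) affine_map_embed(3)[OF ab(1)] by simp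
    then show "A (g' point_at_infinity) = g' point_at_infinity" using g'(2) by metis
  qed
qed

text \<open>In the elliptic type a small translation acts as a rotation without fixed point. In the
  hyperbolic type translations fix only 0 and infinity, and a reflection exchanges these two, so H
  contains none.\<close>

lemma preserves_affine_imp:
  assumes "preserves_affine_structure (\<rho> ` H)"
  shows "D = affine_embed \<or> H = isometries_plus \<and> (\<exists>c>0. D = (\<lambda>x. affine_embed (exp (c * x))))"
proof -
  obtain Q e where Q: "Q \<in> topspace proj_line" "e > 0"
    "\<And>L t A. L = uminus \<or> L = (\<lambda>x. x + t) \<Longrightarrow> \<bar>t\<bar> < e \<Longrightarrow> circle_map L \<in> H \<Longrightarrow> A \<in> PGL2 \<Longrightarrow>
       (\<And>y. D (L y) = A (D y)) \<Longrightarrow> A Q = Q" by (rule affine_fixed_point[OF assms]) blast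
  from D show ?thesis
  proof (cases rule: normal_dev_cases)
    case parabolic then show ?thesis by simp
  next
    case (elliptic r)
    \<comment> \<open>Small enough for the common fixed point, and with \<open>r * t\<close>
      strictly between 0 and 1, hence not an integer.\<close>
    define t where "t = min (e / 2) (1 / (2 * r))"
    have t: "0 < t" "t < e" "r * t < 1"
    proof -
      show "0 < t" "t < e" using Q(2) elliptic(1) by (auto simp: t_def)
      have "r * t \<le> r * (1 / (2 * r))" using elliptic(1) by (intro mult_left_mono) (auto simp: t_def)
      then show "r * t < 1" using elliptic(1) by simp
    qed
    obtain A where A: "A \<in> PGL2" "\<forall>x. D (x + t) = A (D x)" using normal_dev_translate[OF D] by blast
    have "A Q = Q" using Q(3)[of "\<lambda>x. x + t" t A] A t rot_H by auto
    moreover obtain s where s: "Q = universal_cover s" using Q(1) universal_cover_surj by blast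
    moreover have "universal_cover (s + r * t) = A (universal_cover s)"
      using A(2)[rule_format, of "s / r"] elliptic by (simp add: distrib_left)
    ultimately have "universal_cover (s + r * t) = universal_cover s" by simp
    then have "r * t \<in> \<int>" by (simp add: universal_cover_eq_iff)
    then have "r * t = 0" using t elliptic(1) by (intro Ints_nonzero_abs_less1) (auto simp: abs_mult)
    then show ?thesis using t elliptic(1) by simp
  next
    case (hyperbolic c)
    have "H = isometries_plus"
    proof (rule ccontr)
      assume "H \<noteq> isometries_plus"
      then have "H = isometries" using H by blast
      moreover have "circle_map (\<lambda>x. 0 - x) \<in> isometries" unfolding isometries_eq by blast
      ultimately have refl: "circle_map uminus \<in> H" by simp
      let ?S = "mob (mat2 0 1 1 0)"
      have S: "?S \<in> PGL2" by (intro mob_in_PGL2) (simp add: invertible_mat2)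
      have "?S Q = Q"
        by (rule Q(3)[of uminus 0 ?S]) (use Q(2) refl S hyperbolic affine_exp_reflect in auto)
      define t where "t = e / 2"
      have t: "0 < t" "t < e" using Q(2) by (auto simp: t_def)
      let ?A = "mob (mat2 (exp (c * t)) 0 0 1)"
      have A: "?A \<in> PGL2" by (intro mob_in_PGL2) (simp add: invertible_mat2)
      have "?A Q = Q"
        by (rule Q(3)[of "\<lambda>x. x + t" t ?A])
          (use t rot_H A hyperbolic in \<open>auto simp: mob_affine_embed exp_add distrib_left mult.commute\<close>)
      have S0: "?S (affine_embed 0) = point_at_infinity"
        by (simp add: affine_embed_def mob_span mat2_mult_vector point_at_infinity_def)
      consider "Q = point_at_infinity" | s where "Q = affine_embed s" using Q(1) by (auto simp: topspace_proj_line_eq)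
      then show False
      proof cases
        case 1
        then have "?S (affine_embed 0) = ?S Q" using S0 \<open>?S Q = Q\<close> by simp
        then show False using PGL2_inj[OF S] 1 by simp
      next
        case (2 s)
        then have "exp (c * t) * s = s" using \<open>?A Q = Q\<close> by (simp add: mob_affine_embed)
        then have "s = 0" using hyperbolic(1) t by simp
        then show False using S0 \<open>?S Q = Q\<close> 2 by simp
      qed
    qed
    then show ?thesis using hyperbolic by blast
  qed
qed

text \<open>The quotient construction over the affine geometry, with developing map d, yields
  \<alpha>. Composed with \<open>affine_embed\<close>, its small charts are standard charts of the
  invariant projective structure, so the two projective structures agree.\<close>

lemma preserves_affine_of_affine_developing:
  assumes d: "continuous_on UNIV d" "inj d" and Dd: "D = (\<lambda>x. affine_embed (d x))"
    and aff: "\<And>L. circle_lift L \<Longrightarrow> circle_map L \<in> H \<Longrightarrow> (\<exists>t. L = (\<lambda>x. x + t) \<or> L = (\<lambda>x. t - x)) \<Longrightarrow>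
      \<exists>a b. a \<noteq> 0 \<and> (\<forall>x. d (L x) = a * d x + b)"
  shows "preserves_affine_structure (\<rho> ` H)"
proof -
  interpret qa: quotient_data affine_geom UNIV "\<lambda>x. circle_proj (F x)" d
  proof (rule quotient_data_translation[OF geometry_group_affine, of 1])
    show "continuous_map euclideanreal (fst affine_geom) d" using d by (simp add: affine_geom_sel)
    show "openin (fst affine_geom) (d ` U)" if "open U" for U
      using injective_into_1d_imp_open_map_UNIV[OF that d subset_UNIV] by (simp add: affine_geom_sel)
    show "\<exists>e>0. inj_on d (ball x e)" for x using d(2) by (intro exI[of _ 1]) (auto intro: inj_on_subset)
    show "\<exists>g\<in>snd affine_geom. \<forall>x. d (x + s) = g (d x)" for s
    proof -
      obtain a b where "a \<noteq> 0" "\<forall>x. d (x + s) = a * d x + b" using aff[of "\<lambda>x. x + s"] rot_H by auto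
      then show ?thesis by (intro bexI[of _ "\<lambda>x. a * x + b"]) (auto simp: affine_geom_sel)
    qed
  qed (auto simp: circle_proj_eq_iff circle_lift_Ints[OF F])
  have T: "qa.T = circle" by (simp add: circle_eq_quotient F)
  define \<alpha> where "\<alpha> = structure_of affine_geom circle (quotient_charts (top_of_set UNIV) (\<lambda>x. circle_proj (F x)) d)"
  have \<alpha>: "qa.struct = \<alpha>" unfolding \<alpha>_def T ..
  have st: "is_structure affine_geom circle \<alpha>" using qa.is_structure_struct unfolding \<alpha>_def T .
  then have at: "is_atlas affine_geom circle \<alpha>" by (simp add: is_structure_def)
  have pres: "preserves affine_geom (\<rho> ` H) \<alpha>"
    unfolding preserves_def
  proof
    fix k assume "k \<in> \<rho> ` H"
    then obtain h where h: "h \<in> H" "k = \<rho> h" by blast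
    obtain L t where L: "h = circle_map L" "L = (\<lambda>x. x + t) \<or> L = (\<lambda>x. t - x)" using h(1) by (elim H_cases) auto
    have lift: "circle_lift L" using L(2) by auto
    have LH: "circle_map L \<in> H" using h(1) L(1) by simp
    interpret pr: quotient_pair affine_geom UNIV UNIV "\<lambda>x. circle_proj (F x)" "\<lambda>x. circle_proj (F x)" d d L k
      by unfold_locales (use circle_lift_continuous[OF lift] rho_apply[OF lift LH] h L(1) in auto)
    obtain a b where ab: "a \<noteq> 0" "\<forall>x. d (L x) = a * d x + b" using aff[OF lift LH] L(2) by blast
    show "curve_iso affine_geom (circle, \<alpha>) (circle, \<alpha>) k"
      unfolding curve_iso_def fst_conv
    proof (intro conjI ballI)
      show "homeomorphic_map circle circle k" using rho_carrier[OF h(1)] homeomorphic_map_carrier h(2) by blast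
      fix p assume "p \<in> topspace circle"
      then obtain x where p: "p = circle_proj (F x)" using circle_lift_surj[OF F] by (metis imageE surjD topspace_circle)
      have "\<exists>g\<in>snd affine_geom. \<exists>e>0. \<forall>y\<in>ball x e \<inter> UNIV. d (L y) = g (d y)"
        using ab by (intro bexI[of _ "\<lambda>x. a * x + b"] exI[of _ 1]) (auto simp: affine_geom_sel)
      then show "locally_modeled_at affine_geom (circle, \<alpha>) (circle, \<alpha>) k p"
        using pr.locally_modeled_at_lift[of x] unfolding p \<alpha>_def T by blast
    qed
  qed
  have "proj_of_affine circle \<alpha> = inv_struct"
  proof (rule proj.structure_eqI[OF is_structure_proj_of_affine[OF at] is_structure_circle_structure[OF F D]])
    fix p assume "p \<in> topspace circle"
    then obtain x where p: "p = circle_proj (F x)" using circle_lift_surj[OF F] by (metis imageE surjD topspace_circle)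
    let ?q = "\<lambda>x. circle_proj (F x)"
    obtain e where e: "e > 0" "inj_on ?q (ball x e)" "std_chart F D (ball x e) \<in> inv_struct"
      by (rule circle_structure_small_chart[OF F D open_UNIV UNIV_I]) blast
    let ?U = "?q ` ball x e"
    let ?\<phi> = "restrict (\<lambda>y. d (the_inv_into (ball x e) ?q y)) ?U"
    have "(?U, ?\<phi>) \<in> \<alpha>" unfolding \<alpha>[symmetric]
      by (rule qa.struct_chart) (use e d(2) in \<open>auto intro: inj_on_subset\<close>)
    from proj_of_affine_mem[OF at this]
    have "(?U, restrict (\<lambda>y. affine_embed (?\<phi> y)) ?U) \<in> proj_of_affine circle \<alpha>" .
    moreover have "restrict (\<lambda>y. affine_embed (?\<phi> y)) ?U = snd (std_chart F D (ball x e))"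
      unfolding std_chart_def Dd by (simp add: restrict_def fun_eq_iff)
    ultimately have c: "(?U, snd (std_chart F D (ball x e))) \<in> proj_of_affine circle \<alpha>" by simp
    have c': "(?U, snd (std_chart F D (ball x e))) \<in> inv_struct" using e(3) by (simp add: std_chart_def)
    have "openin circle ?U" using qa.q_open[of "ball x e"] T by simp
    then show "locally_modeled_at proj_geom (circle, proj_of_affine circle \<alpha>) (circle, inv_struct) (\<lambda>x. x) p"
      by (intro locally_modeled_atI[OF c c', of _ ?U _ _ "\<lambda>x. x"]) (use e(1) p PGL2_id in auto)
  qed
  then show ?thesis
    unfolding preserves_affine_structure_def using st pres compatible_Pi by metis
qed

text \<open>In the coordinate x all isometries are affine. In the coordinate exp (c * x)
  translations are homotheties, but reflections are inversions; this is the origin of the condition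
  on H.\<close>

lemma preserves_affine_iff:
  "preserves_affine_structure (\<rho> ` H) \<longleftrightarrow>
    D = affine_embed \<or> H = isometries_plus \<and> (\<exists>c>0. D = (\<lambda>x. affine_embed (exp (c * x))))"
proof
  assume "D = affine_embed \<or> H = isometries_plus \<and> (\<exists>c>0. D = (\<lambda>x. affine_embed (exp (c * x))))"
  then show "preserves_affine_structure (\<rho> ` H)"
  proof (elim disjE conjE exE)
    assume "D = affine_embed"
    then show ?thesis
    proof (intro preserves_affine_of_affine_developing[of "\<lambda>x. x"])
      fix L :: "real \<Rightarrow> real" assume "\<exists>t. L = (\<lambda>x. x + t) \<or> L = (\<lambda>x. t - x)"
      then obtain t where "L = (\<lambda>x. 1 * x + t) \<or> L = (\<lambda>x. (- 1) * x + t)" by auto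
      then show "\<exists>a b. a \<noteq> 0 \<and> (\<forall>x. L x = a * x + b)"
        by (elim disjE) (rule exI[of _ 1], rule exI[of _ t], simp, rule exI[of _ "-1"], rule exI[of _ t], simp)
    qed auto
  next
    fix c assume c: "H = isometries_plus" "0 < c" "D = (\<lambda>x. affine_embed (exp (c * x)))"
    show ?thesis
    proof (rule preserves_affine_of_affine_developing[of "\<lambda>x. exp (c * x)"])
      show "continuous_on UNIV (\<lambda>x. exp (c * x))" by (intro continuous_intros)
      show "inj (\<lambda>x. exp (c * x))" using c by (simp add: inj_def)
      fix L assume L: "circle_lift L" "circle_map L \<in> H"
      then obtain t where "circle_map L = rot t" using c(1) isometries_plus_eq by auto
      \<comment> \<open>L is known only as some lift of a rotation, hence as a translation up to the
        integer n.\<close>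
      then obtain n where n: "\<And>x. L x = x + t + n" using circle_map_eq_iff[OF L(1) circle_lift_translation] by blast
      have "exp (c * L x) = exp (c * (t + n)) * exp (c * x) + 0" for x by (simp add: n distrib_left exp_add)
      then show "\<exists>a b. a \<noteq> 0 \<and> (\<forall>x. exp (c * L x) = a * exp (c * x) + b)" by (metis exp_not_eq_zero)
    qed (rule c(3))
  qed
qed (rule preserves_affine_imp)

lemma preserves_affine_iff_type:
  "preserves_affine_structure (\<rho> ` H) \<longleftrightarrow>
     isomorphic_curves (circle, inv_struct) (Theta 1) \<or>
     H = isometries_plus \<and> (\<exists>t > 1. isomorphic_curves (circle, inv_struct) (Theta t))"
proof -
  have "(\<exists>t>1. isomorphic_curves (circle, inv_struct) (Theta t)) \<longleftrightarrow> (\<exists>c>0. D = (\<lambda>x. affine_embed (exp (c * x))))"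
  proof
    assume "\<exists>t>1. isomorphic_curves (circle, inv_struct) (Theta t)"
    then obtain t where t: "t > 1" "D = (\<lambda>x. affine_embed (exp (ln t * x)))" using isomorphic_Theta_iff[OF F D] by blast
    then show "\<exists>c>0. D = (\<lambda>x. affine_embed (exp (c * x)))" by (intro exI[of _ "ln t"]) simp
  next
    assume "\<exists>c>0. D = (\<lambda>x. affine_embed (exp (c * x)))"
    then obtain c where c: "c > 0" "D = (\<lambda>x. affine_embed (exp (c * x)))" by blast
    then show "\<exists>t>1. isomorphic_curves (circle, inv_struct) (Theta t)"
      using isomorphic_Theta_iff[OF F D, of "exp c"] by (intro exI[of _ "exp c"]) simp
  qed
  then show ?thesis unfolding preserves_affine_iff isomorphic_Theta_1_iff[OF F D] by simp
qed

end

context uniformized_pair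
begin

text \<open>Both sides come down to D1 = D2, since each model curve stands for exactly one normal
  form.\<close>

lemma isomorphic_iff_same_type:
  "isomorphic_curves (circle, u1.inv_struct) (circle, u2.inv_struct) \<longleftrightarrow>
     (\<exists>r > 0. isomorphic_curves (circle, u1.inv_struct) (Omega r) \<and> isomorphic_curves (circle, u2.inv_struct) (Omega r)) \<or>
     (\<exists>t \<ge> 1. isomorphic_curves (circle, u1.inv_struct) (Theta t) \<and> isomorphic_curves (circle, u2.inv_struct) (Theta t))"
  (is "_ \<longleftrightarrow> ?R")
proof -
  have Th: "isomorphic_curves (circle, u1.inv_struct) (Theta t) \<longleftrightarrow> D1 = (if t = 1 then affine_embed else (\<lambda>x. affine_embed (exp (ln t * x))))"
    "isomorphic_curves (circle, u2.inv_struct) (Theta t) \<longleftrightarrow> D2 = (if t = 1 then affine_embed else (\<lambda>x. affine_embed (exp (ln t * x))))"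
    if "t \<ge> 1" for t
    using isomorphic_Theta_iff[OF u1.F u1.D, of t] isomorphic_Theta_1_iff[OF u1.F u1.D]
      isomorphic_Theta_iff[OF u2.F u2.D, of t] isomorphic_Theta_1_iff[OF u2.F u2.D] that by auto
  have "D1 = D2" if ?R
    using that isomorphic_Omega_iff[OF u1.F u1.D] isomorphic_Omega_iff[OF u2.F u2.D] Th by metis
  moreover have ?R if eq: "D1 = D2"
    using isomorphic_to_some_model[OF u1.F u1.D] isomorphic_Omega_iff[OF u1.F u1.D] isomorphic_Omega_iff[OF u2.F u2.D] Th eq by metis
  ultimately show ?thesis unfolding isomorphic_iff by blast
qed

end

section \<open>Assembly of the classification for both groups of isometries\<close>

theorem theorem7p8:
  fixes H :: "(real set \<Rightarrow> real set) set"
  assumes "H = isometries \<or> H = isometries_plus"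
  shows
    "(\<forall>\<rho> G. faithful_continuous_action H \<rho> \<and> G = \<rho> ` H \<and> G \<subseteq> PC0 \<longrightarrow>
        (\<exists>!\<pi>. invariant_compatible G \<pi>) \<and>
        (\<forall>\<pi>. invariant_compatible G \<pi> \<longrightarrow>
           ((\<forall>g \<in> G. C1_diffeo g) \<longrightarrow> C1_compatible \<pi>) \<and>
           ((\<exists>r > 0. isomorphic_curves (circle, \<pi>) (Omega r)) \<or>
            (\<exists>t \<ge> 1. isomorphic_curves (circle, \<pi>) (Theta t))) \<and>
           (preserves_affine_structure G \<longleftrightarrow>
              isomorphic_curves (circle, \<pi>) (Theta 1) \<or>
              H = isometries_plus \<and> (\<exists>t > 1. isomorphic_curves (circle, \<pi>) (Theta t))))) \<and>
     (\<forall>\<rho>1 \<rho>2 G1 G2 \<pi>1 \<pi>2.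
        faithful_continuous_action H \<rho>1 \<and> G1 = \<rho>1 ` H \<and> G1 \<subseteq> PC0 \<and> invariant_compatible G1 \<pi>1 \<and>
        faithful_continuous_action H \<rho>2 \<and> G2 = \<rho>2 ` H \<and> G2 \<subseteq> PC0 \<and> invariant_compatible G2 \<pi>2 \<longrightarrow>
        (isomorphic_curves (circle, \<pi>1) (circle, \<pi>2) \<longleftrightarrow>
           (\<exists>r > 0. isomorphic_curves (circle, \<pi>1) (Omega r) \<and>
                   isomorphic_curves (circle, \<pi>2) (Omega r)) \<or>
           (\<exists>t \<ge> 1. isomorphic_curves (circle, \<pi>1) (Theta t) \<and>
                   isomorphic_curves (circle, \<pi>2) (Theta t))) \<and>
        (conjugate_subsets PC0 G1 G2 \<longleftrightarrow> isomorphic_curves (circle, \<pi>1) (circle, \<pi>2)) \<and>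
        (conjugate_subsets PC0_plus G1 G2 \<longleftrightarrow> isomorphic_curves (circle, \<pi>1) (circle, \<pi>2)) \<and>
        (conjugate_actions PC0 H \<rho>1 \<rho>2 \<longleftrightarrow> isomorphic_curves (circle, \<pi>1) (circle, \<pi>2)) \<and>
        (G1 \<subseteq> PC1 \<and> G2 \<subseteq> PC1 \<longrightarrow>
           (conjugate_subsets PC1 G1 G2 \<longleftrightarrow> isomorphic_curves (circle, \<pi>1) (circle, \<pi>2)) \<and>
           (conjugate_subsets PC1_plus G1 G2 \<longleftrightarrow> isomorphic_curves (circle, \<pi>1) (circle, \<pi>2)) \<and>
           (conjugate_actions PC1 H \<rho>1 \<rho>2 \<longleftrightarrow> isomorphic_curves (circle, \<pi>1) (circle, \<pi>2))))"
proof (rule conjI)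
  have uni: "\<exists>F D. uniformized_action H \<rho> F D" if "faithful_continuous_action H \<rho>" "\<rho> ` H \<subseteq> PC0" for \<rho>
  proof -
    interpret circle_action H \<rho> using assms that(1) by unfold_locales
    show ?thesis using uniformize[OF that(2)] by blast
  qed
  show "\<forall>\<rho> G. faithful_continuous_action H \<rho> \<and> G = \<rho> ` H \<and> G \<subseteq> PC0 \<longrightarrow>
        (\<exists>!\<pi>. invariant_compatible G \<pi>) \<and>
        (\<forall>\<pi>. invariant_compatible G \<pi> \<longrightarrow>
           ((\<forall>g \<in> G. C1_diffeo g) \<longrightarrow> C1_compatible \<pi>) \<and>
           ((\<exists>r > 0. isomorphic_curves (circle, \<pi>) (Omega r)) \<or>
            (\<exists>t \<ge> 1. isomorphic_curves (circle, \<pi>) (Theta t))) \<and>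
           (preserves_affine_structure G \<longleftrightarrow>
              isomorphic_curves (circle, \<pi>) (Theta 1) \<or>
              H = isometries_plus \<and> (\<exists>t > 1. isomorphic_curves (circle, \<pi>) (Theta t))))"
  proof (intro allI impI)
    fix \<rho> G assume a: "faithful_continuous_action H \<rho> \<and> G = \<rho> ` H \<and> G \<subseteq> PC0"
    then obtain F D where "uniformized_action H \<rho> F D" using uni by blast
    then interpret uniformized_action H \<rho> F D .
    have G: "G = \<rho> ` H" using a by blast
    have ex: "\<exists>!\<pi>. invariant_compatible G \<pi>"
      unfolding G using invariant_compatible_Pi unique_structure by blast
    show "(\<exists>!\<pi>. invariant_compatible G \<pi>) \<and>
        (\<forall>\<pi>. invariant_compatible G \<pi> \<longrightarrow>
           ((\<forall>g \<in> G. C1_diffeo g) \<longrightarrow> C1_compatible \<pi>) \<and>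
           ((\<exists>r > 0. isomorphic_curves (circle, \<pi>) (Omega r)) \<or>
            (\<exists>t \<ge> 1. isomorphic_curves (circle, \<pi>) (Theta t))) \<and>
           (preserves_affine_structure G \<longleftrightarrow>
              isomorphic_curves (circle, \<pi>) (Theta 1) \<or>
              H = isometries_plus \<and> (\<exists>t > 1. isomorphic_curves (circle, \<pi>) (Theta t))))"
    proof (intro conjI ex allI impI)
      fix \<pi> assume "invariant_compatible G \<pi>"
      then have \<pi>: "\<pi> = inv_struct" unfolding G by (rule unique_structure)
      show "C1_compatible \<pi>" if "\<forall>g\<in>G. C1_diffeo g"
        unfolding \<pi> using that G by (intro C1_compatible_Pi) blast
      show "(\<exists>r > 0. isomorphic_curves (circle, \<pi>) (Omega r)) \<or> (\<exists>t \<ge> 1. isomorphic_curves (circle, \<pi>) (Theta t))"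
        unfolding \<pi> by (rule isomorphic_to_some_model[OF F D])
      show "preserves_affine_structure G \<longleftrightarrow> isomorphic_curves (circle, \<pi>) (Theta 1) \<or>
              H = isometries_plus \<and> (\<exists>t > 1. isomorphic_curves (circle, \<pi>) (Theta t))"
        unfolding \<pi> G by (rule preserves_affine_iff_type)
    qed
  qed
  show "\<forall>\<rho>1 \<rho>2 G1 G2 \<pi>1 \<pi>2.
        faithful_continuous_action H \<rho>1 \<and> G1 = \<rho>1 ` H \<and> G1 \<subseteq> PC0 \<and> invariant_compatible G1 \<pi>1 \<and>
        faithful_continuous_action H \<rho>2 \<and> G2 = \<rho>2 ` H \<and> G2 \<subseteq> PC0 \<and> invariant_compatible G2 \<pi>2 \<longrightarrow>
        (isomorphic_curves (circle, \<pi>1) (circle, \<pi>2) \<longleftrightarrow>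
           (\<exists>r > 0. isomorphic_curves (circle, \<pi>1) (Omega r) \<and>
                   isomorphic_curves (circle, \<pi>2) (Omega r)) \<or>
           (\<exists>t \<ge> 1. isomorphic_curves (circle, \<pi>1) (Theta t) \<and>
                   isomorphic_curves (circle, \<pi>2) (Theta t))) \<and>
        (conjugate_subsets PC0 G1 G2 \<longleftrightarrow> isomorphic_curves (circle, \<pi>1) (circle, \<pi>2)) \<and>
        (conjugate_subsets PC0_plus G1 G2 \<longleftrightarrow> isomorphic_curves (circle, \<pi>1) (circle, \<pi>2)) \<and>
        (conjugate_actions PC0 H \<rho>1 \<rho>2 \<longleftrightarrow> isomorphic_curves (circle, \<pi>1) (circle, \<pi>2)) \<and>
        (G1 \<subseteq> PC1 \<and> G2 \<subseteq> PC1 \<longrightarrow>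
           (conjugate_subsets PC1 G1 G2 \<longleftrightarrow> isomorphic_curves (circle, \<pi>1) (circle, \<pi>2)) \<and>
           (conjugate_subsets PC1_plus G1 G2 \<longleftrightarrow> isomorphic_curves (circle, \<pi>1) (circle, \<pi>2)) \<and>
           (conjugate_actions PC1 H \<rho>1 \<rho>2 \<longleftrightarrow> isomorphic_curves (circle, \<pi>1) (circle, \<pi>2)))"
  proof (intro allI impI, elim conjE)
    fix \<rho>1 \<rho>2 G1 G2 \<pi>1 \<pi>2
    assume 1: "faithful_continuous_action H \<rho>1" "G1 = \<rho>1 ` H" "G1 \<subseteq> PC0" "invariant_compatible G1 \<pi>1"
      and 2: "faithful_continuous_action H \<rho>2" "G2 = \<rho>2 ` H" "G2 \<subseteq> PC0" "invariant_compatible G2 \<pi>2"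
    obtain F1 D1 where u1: "uniformized_action H \<rho>1 F1 D1" using uni 1 by blast
    obtain F2 D2 where u2: "uniformized_action H \<rho>2 F2 D2" using uni 2 by blast
    interpret uniformized_pair H \<rho>1 \<rho>2 F1 F2 D1 D2
      using u1 u2 by (rule uniformized_pair.intro)
    \<comment> \<open>Uniqueness identifies the given invariant structures with the constructed
      ones, whose isomorphisms are already classified.\<close>
    have \<pi>: "\<pi>1 = u1.inv_struct" "\<pi>2 = u2.inv_struct"
      using 1 2 u1.unique_structure u2.unique_structure by blast+
    note c0 = conjugacy_iff[OF order_refl conjugator_PC0, folded PC0_plus_def]
    have c1: "conjugate_subsets PC1 G1 G2 \<longleftrightarrow> isomorphic_curves (circle, \<pi>1) (circle, \<pi>2)"
      "conjugate_subsets PC1_plus G1 G2 \<longleftrightarrow> isomorphic_curves (circle, \<pi>1) (circle, \<pi>2)"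
      "conjugate_actions PC1 H \<rho>1 \<rho>2 \<longleftrightarrow> isomorphic_curves (circle, \<pi>1) (circle, \<pi>2)" if "G1 \<subseteq> PC1" "G2 \<subseteq> PC1"
      unfolding PC1_plus_def \<pi> 1(2) 2(2)
      by (rule conjugacy_iff; use that 1(2) 2(2) conjugator_PC1 in \<open>auto simp: PC1_def\<close>)+
    show "(isomorphic_curves (circle, \<pi>1) (circle, \<pi>2) \<longleftrightarrow>
           (\<exists>r > 0. isomorphic_curves (circle, \<pi>1) (Omega r) \<and>
                   isomorphic_curves (circle, \<pi>2) (Omega r)) \<or>
           (\<exists>t \<ge> 1. isomorphic_curves (circle, \<pi>1) (Theta t) \<and>
                   isomorphic_curves (circle, \<pi>2) (Theta t))) \<and>
        (conjugate_subsets PC0 G1 G2 \<longleftrightarrow> isomorphic_curves (circle, \<pi>1) (circle, \<pi>2)) \<and>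
        (conjugate_subsets PC0_plus G1 G2 \<longleftrightarrow> isomorphic_curves (circle, \<pi>1) (circle, \<pi>2)) \<and>
        (conjugate_actions PC0 H \<rho>1 \<rho>2 \<longleftrightarrow> isomorphic_curves (circle, \<pi>1) (circle, \<pi>2)) \<and>
        (G1 \<subseteq> PC1 \<and> G2 \<subseteq> PC1 \<longrightarrow>
           (conjugate_subsets PC1 G1 G2 \<longleftrightarrow> isomorphic_curves (circle, \<pi>1) (circle, \<pi>2)) \<and>
           (conjugate_subsets PC1_plus G1 G2 \<longleftrightarrow> isomorphic_curves (circle, \<pi>1) (circle, \<pi>2)) \<and>
           (conjugate_actions PC1 H \<rho>1 \<rho>2 \<longleftrightarrow> isomorphic_curves (circle, \<pi>1) (circle, \<pi>2)))"
      using c1 c0 isomorphic_iff_same_type unfolding \<pi> 1(2) 2(2) by (intro conjI impI) simp_all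
  qed
qed

end
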